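(* Let $N\ge1$ be an integer and suppose $a>\max\{0,2-N\}$. Let $u\in C^\infty(\mathbb{R}^N\setminus\{0\})\cap C(\mathbb{R}^N)$ be of polynomial growth, and let $H_tu$ be its $a$-deformed heat flow. Then for every $x\in\mathbb{R}^N$ $$\lim_{t\to+0}H_tu(x)=u(x).$$
   Context: Normalized I-Bessel function: for $\mu\in\mathbb{R}$ and $w\in\mathbb{C}$, $\tilde I_\mu(w)=\sum_{j=0}^\infty\frac{(w/2)^{2j}}{j!\,\Gamma(\mu+j+1)}$ (with $1/\Gamma=0$ at the poles of $\Gamma$). Normalized Gegenbauer polynomials $\check C^\nu_m(t)$ are defined by the formal power series expansion $\frac{1-x^2}{(1-2tx+x^2)^{\nu+1}}=\sum_{m=0}^\infty\check C^\nu_m(t)x^m$. For $b>0$, $\nu\in\mathbb{R}$ with $1+b\nu>0$, $w\in\mathbb{C}$, $t\in[-1,1]$, $$\mathscr{I}(b,\nu,w,t):=\Gamma(b\nu+1)\sum_{m=0}^\infty\left(\frac w2\right)^{bm}\tilde I_{b(m+\nu)}(w)\,\check C^\nu_m(t),$$ where $(w/2)^s=(|w|/2)^se^{i\theta s}$ for $w=|w|e^{i\theta}$, $\theta\in(-\pi,\pi]$; the series converges absolutely and locally uniformly. For $a>\max\{0,2-N\}$ put $B_a(r\omega,s\mu)=\mathscr{I}\left(\frac2a,\frac{N-2}{2},\frac{2(rs)^{a/2}}{ai},\langle\omega,\mu\rangle\right)$ for $r,s\ge0$, $\omega,\mu\in S^{N-1}$, and $c_a=\left(\int_{\mathbb{R}^N}e^{-\frac1a|x|^a}\frac{dx}{|x|^{2-a}}\right)^{-1}$.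 The $a$-deformed heat kernel is $$h_a(x,y;t)=c_a\int_{\mathbb{R}^N}\overline{B_a(x,\xi)}\,B_a(y,\xi)\,e^{-\frac ta|\xi|^a}\frac{d\xi}{|\xi|^{2-a}}\qquad(x,y\in\mathbb{R}^N,\ t>0),$$ an absolutely convergent integral. For a continuous function $u$ on $\mathbb{R}^N$ of polynomial growth ($|u(y)|\le C(1+|y|)^k$ for some $C,k$), the $a$-deformed heat flow is $H_tu(x)=c_a\int_{\mathbb{R}^N}h_a(x,y;t)u(y)\frac{dy}{|y|^{2-a}}$ for $t>0$, $x\in\mathbb{R}^N$ (absolutely convergent). *)

theory Defs
  imports "HOL-Analysis.Analysis" "HOL-Computational_Algebra.Formal_Power_Series"
begin

(* rGamma is the entire function 1/Gamma, which vanishes at the poles of Gamma. *)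
definition normalized_I_Bessel :: "real \<Rightarrow> complex \<Rightarrow> complex" where
  "normalized_I_Bessel \<mu> w =
     (\<Sum>j. (w / 2) ^ (2 * j) * of_real (rGamma (\<mu> + real j + 1)) / fact j)"

(* (1 - 2 t x + x^2) powr (-(\<nu> + 1)) as a formal power series in x: the binomial series
   (1 + X) powr (-(\<nu> + 1)) composed with x^2 - 2 t x, which has no constant term. *)
definition normalized_Gegenbauer :: "real \<Rightarrow> nat \<Rightarrow> real \<Rightarrow> real" where
  "normalized_Gegenbauer \<nu> m t =
     fps_nth ((1 - fps_X ^ 2) *
       fps_compose (fps_binomial (- (\<nu> + 1))) (fps_X ^ 2 - fps_const (2 * t) * fps_X)) m"

(* The branch with argument in (-pi, pi] is that of the library's Arg.  The case s = 0 is
   separate because z^0 = 1 also at z = 0, whereas 0 powr 0 = 0. *)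
definition principal_power :: "complex \<Rightarrow> real \<Rightarrow> complex" where
  "principal_power z s =
     (if s = 0 then 1 else complex_of_real (norm z powr s) * cis (s * Arg z))"

definition script_I :: "real \<Rightarrow> real \<Rightarrow> complex \<Rightarrow> real \<Rightarrow> complex" where
  "script_I b \<nu> w t = of_real (Gamma (b * \<nu> + 1)) *
     (\<Sum>m. principal_power (w / 2) (b * real m) * normalized_I_Bessel (b * (real m + \<nu>)) w
            * of_real (normalized_Gegenbauer \<nu> m t))"

(* In polar coordinates x = r \<omega>, y = s \<mu> one has r = norm x and \<omega> = sgn x for x \<noteq> 0.  At the
   origin the unit vector is arbitrary and sgn 0 = 0 takes its place; the kernel does not depend
   on the choice, see deformed_B_polar below. *)
definition deformed_B :: "real \<Rightarrow> 'a::euclidean_space \<Rightarrow> 'a \<Rightarrow> complex" where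
  "deformed_B a x y =
     script_I (2 / a) ((real DIM('a) - 2) / 2)
       (of_real (2 * (norm x * norm y) powr (a / 2)) / (of_real a * \<i>))
       (sgn x \<bullet> sgn y)"

definition deformed_const :: "'a::euclidean_space itself \<Rightarrow> real \<Rightarrow> real" where
  "deformed_const _ a =
     inverse (LINT x::'a|lborel. exp (- (1 / a) * norm x powr a) / norm x powr (2 - a))"

definition deformed_heat_kernel ::
    "real \<Rightarrow> 'a::euclidean_space \<Rightarrow> 'a \<Rightarrow> real \<Rightarrow> complex" where
  "deformed_heat_kernel a x y t = of_real (deformed_const TYPE('a) a) *
     (LINT \<xi>|lborel. cnj (deformed_B a x \<xi>) * deformed_B a y \<xi>
        * of_real (exp (- (t / a) * norm \<xi> powr a)) / of_real (norm \<xi> powr (2 - a)))"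

definition deformed_heat_flow ::
    "real \<Rightarrow> ('a::euclidean_space \<Rightarrow> complex) \<Rightarrow> real \<Rightarrow> 'a \<Rightarrow> complex" where
  "deformed_heat_flow a u t x = of_real (deformed_const TYPE('a) a) *
     (LINT y|lborel. deformed_heat_kernel a x y t * u y / of_real (norm y powr (2 - a)))"

definition polynomial_growth :: "('a::real_normed_vector \<Rightarrow> complex) \<Rightarrow> bool" where
  "polynomial_growth u \<longleftrightarrow> (\<exists>(C::real) (k::nat). \<forall>y. norm (u y) \<le> C * (1 + norm y) ^ k)"

(* Class C^k on an open set S, by iterated directional derivatives. *)
primrec Ck_on ::
    "nat \<Rightarrow> ('a::real_normed_vector \<Rightarrow> 'b::real_normed_vector) \<Rightarrow> 'a set \<Rightarrow> bool" where
  "Ck_on 0 f S \<longleftrightarrow> continuous_on S f"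
| "Ck_on (Suc k) f S \<longleftrightarrow> (\<forall>x\<in>S. f differentiable (at x)) \<and>
     (\<forall>v. Ck_on k (\<lambda>x. frechet_derivative f (at x) v) S)"

definition Cinfinity_on ::
    "('a::real_normed_vector \<Rightarrow> 'b::real_normed_vector) \<Rightarrow> 'a set \<Rightarrow> bool" where
  "Cinfinity_on f S \<longleftrightarrow> (\<forall>k. Ck_on k f S)"

lemma script_I_zero:
  assumes "b > 0"
  shows "script_I b \<nu> 0 t = script_I b \<nu> 0 t'"
proof -
  have G0: "normalized_Gegenbauer \<nu> 0 s = 1" for s
    by (simp add: normalized_Gegenbauer_def fps_binomial_def)
  have "principal_power 0 (b * real m) * normalized_I_Bessel (b * (real m + \<nu>)) 0
            * of_real (normalized_Gegenbauer \<nu> m t)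
      = principal_power 0 (b * real m) * normalized_I_Bessel (b * (real m + \<nu>)) 0
            * of_real (normalized_Gegenbauer \<nu> m t')" for m
    using assms by (cases "m = 0") (auto simp: principal_power_def G0)
  then show ?thesis
    by (simp only: script_I_def div_0)
qed

lemma deformed_B_polar:
  fixes \<omega> \<mu> :: "'a::euclidean_space"
  assumes "a > 0" "r \<ge> 0" "s \<ge> 0" "norm \<omega> = 1" "norm \<mu> = 1"
  shows "deformed_B a (r *\<^sub>R \<omega>) (s *\<^sub>R \<mu>) =
     script_I (2 / a) ((real DIM('a) - 2) / 2)
       (of_real (2 * (r * s) powr (a / 2)) / (of_real a * \<i>)) (\<omega> \<bullet> \<mu>)"
proof (cases "r = 0 \<or> s = 0")
  case True
  then show ?thesis
    using assms script_I_zero[of "2 / a"] by (auto simp: deformed_B_def)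
next
  case False
  with assms have "sgn (r *\<^sub>R \<omega>) = \<omega>" "sgn (s *\<^sub>R \<mu>) = \<mu>"
    by (simp_all add: sgn_div_norm)
  then show ?thesis
    using assms by (simp add: deformed_B_def)
qed

end

theory Submission
  imports Defs
begin

text \<open>Put \<open>q = \<bar>x\<bar>\<^sup>a / a\<close>. In the coordinates \<open>(q, x / \<bar>x\<bar>)\<close> the weighted measure
  is, up to its normalization, the product of \<open>q\<^bsup>c-1\<^esup> dq / \<Gamma>(c)\<close>, \<open>c = (N + a - 2) / a\<close>, and
  the rotation invariant probability measure of the sphere. Weber's second exponential integral and the
  reproducing property of the Gegenbauer polynomials turn the integral defining the heat kernel into
  a series over the degree \<open>m\<close>, so that \<open>H\<^sub>t u(x)\<close> is the sum over \<open>m\<close> of the integrals of the zonal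
  coefficients of \<open>u\<close> against explicit densities in \<open>q\<close>. For \<open>x \<noteq> 0\<close> these densities concentrate at
  \<open>p = \<bar>x\<bar>\<^sup>a / a\<close> as \<open>t\<close> tends to 0, by a Korovkin argument: their moments of order \<open>\<beta> + n\<close>,
  \<open>\<beta> = m / a\<close>, are explicit polynomials in \<open>t / p\<close>. The limit and the sum commute because, uniformly in
  \<open>t\<close>, the part of the densities outside the annulus \<open>p / 2 \<le> q \<le> 2 p\<close> is exponentially small in \<open>m\<close>,
  while inside the annulus \<open>u\<close> is smooth and repeated integration by parts with the spherical Laplacian
  makes its zonal coefficients decay faster than any power of \<open>m\<close>. The series of the limits is the
  expansion of \<open>u\<close> on a sphere, whose sum is \<open>u(x)\<close> by the Poisson kernel. For \<open>x = 0\<close> only the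
  term \<open>m = 0\<close> is present and continuity of \<open>u\<close> suffices.\<close>

section \<open>Gegenbauer polynomials\<close>

text \<open>The argument uses no sign and no pointwise estimate of the heat kernel itself. For a
  fixed degree, however, the radial factor is a power series with nonnegative coefficients, hence
  the density of a positive measure in q. Its moment of order \<gamma> is a Poisson average of a
  quotient of Gamma values, and the orders \<beta> + n are those for which the quotient is a
  polynomial. For \<beta> > 0 the total mass (order 0) is therefore not explicit, only bounded by 1;
  the test function with integral exactly 1 is (q / p)^\<beta> instead of the constant. This
  asymmetry dictates the choice of test functions.

  The factor 1 - x^2 in the generating function makes the polynomials reproducing kernels on the
  sphere in every dimension, also for N = 2, where the classical polynomials of index 0 vanish in
  positive degree. For N = 1 the sphere consists of two points and all rotation fields vanish, yet
  the same formulas apply: only degrees 0 and 1 share an eigenvalue. Smoothness of \<open>u\<close>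
  enters only through compact annuli that avoid the origin.\<close>

definition gegenbauer_fps :: "real \<Rightarrow> real \<Rightarrow> real fps" where
  "gegenbauer_fps k t = fps_compose (fps_binomial (- k)) (fps_X ^ 2 - fps_const (2 * t) * fps_X)"

lemma normalized_Gegenbauer_fps:
  "normalized_Gegenbauer \<nu> m t = fps_nth ((1 - fps_X ^ 2) * gegenbauer_fps (\<nu> + 1) t) m"
  by (simp add: normalized_Gegenbauer_def gegenbauer_fps_def)

lemma fps_quadratic_nth_0: "fps_nth (fps_X ^ 2 - fps_const (2 * t) * fps_X) 0 = (0::real)"
  by (simp add: power2_eq_square)

text \<open>\<open>gegenbauer_fps k t\<close> is (1 - 2 t x + x^2)^(-k), the generating function of
  the classical Gegenbauer polynomials of index k. Raising the index costs only a polynomial factor,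
  so that several series can be written as multiples of the one of highest index.\<close>

lemma gegenbauer_fps_Suc:
  "gegenbauer_fps k t
     = (1 - 2 * fps_const t * fps_X + fps_X ^ 2) * gegenbauer_fps (k + 1) t"
proof -
  have "fps_binomial (- k) = fps_binomial 1 * fps_binomial (- (k + 1))"
    using fps_binomial_add_mult[of 1 "- (k + 1)"] by simp
  also have "fps_binomial (1::real) = 1 + fps_X"
    by (simp add: fps_binomial_1)
  finally have *: "fps_binomial (- k) = (1 + fps_X) * fps_binomial (- (k + 1))" .
  have "fps_compose (1 + fps_X) (fps_X ^ 2 - fps_const (2 * t) * fps_X)
      = 1 + (fps_X ^ 2 - fps_const (2 * t) * fps_X)"
    using fps_X_fps_compose_startby0[OF fps_quadratic_nth_0] by (simp add: fps_compose_add_distrib)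
  also have "\<dots> = 1 - 2 * fps_const t * fps_X + fps_X ^ 2"
    by (simp add: fps_const_mult[symmetric] numeral_fps_const del: fps_const_mult)
  finally show ?thesis
    unfolding gegenbauer_fps_def * fps_compose_mult_distrib[OF fps_quadratic_nth_0] by simp
qed

lemma fps_binomial_deriv_shift:
  "fps_deriv (fps_binomial (- k)) = fps_const (- k) * fps_binomial (- (k + 1) :: real)"
proof -
  have "fps_binomial (- k) = fps_binomial (- (k + 1)) * (1 + fps_X)"
    using fps_binomial_add_mult[of 1 "- (k + 1)"] by (simp add: fps_binomial_1 mult.commute)
  moreover have "(1 + fps_X :: real fps) \<noteq> 0"
    by (metis add.right_neutral fps_X_neq_zero fps_nonzeroI fps_add_nth fps_X_nth zero_neq_one fps_one_nth)
  ultimately show ?thesis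
    unfolding fps_binomial_deriv by (metis mult.assoc nonzero_mult_div_cancel_right)
qed

lemma fps_deriv_gegenbauer:
  "fps_deriv (gegenbauer_fps k t)
     = 2 * fps_const k * (fps_const t - fps_X) * gegenbauer_fps (k + 1) t"
proof -
  define q where "q = fps_X ^ 2 - fps_const (2 * t) * fps_X"
  have q0: "fps_nth q 0 = 0"
    by (simp add: q_def power2_eq_square)
  have "fps_deriv q = fps_X + fps_X - fps_const (2 * t)"
    by (simp add: q_def power2_eq_square)
  also have "\<dots> = 2 * (fps_X - fps_const t)"
    by (simp add: fps_eq_iff numeral_fps_const)
  finally have dq: "fps_deriv q = 2 * (fps_X - fps_const t)" .
  have "fps_deriv (gegenbauer_fps k t)
      = (fps_const (- k) oo q) * (fps_binomial (- (k + 1)) oo q) * (2 * (fps_X - fps_const t))"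
    unfolding gegenbauer_fps_def q_def[symmetric] fps_compose_deriv[OF q0] fps_binomial_deriv_shift dq
      fps_compose_mult_distrib[OF q0] ..
  also have "\<dots> = 2 * fps_const k * (fps_const t - fps_X) * gegenbauer_fps (k + 1) t"
    unfolding gegenbauer_fps_def q_def[symmetric] fps_const_compose unfolding fps_const_neg[symmetric]
    by (simp add: algebra_simps del: fps_const_neg)
  finally show ?thesis .
qed

section \<open>Differentiation in the parameter and the Gegenbauer equation\<close>

lemma has_field_derivative_fps_nth_mult:
  fixes F G :: "real \<Rightarrow> real fps"
  assumes "\<And>m. ((\<lambda>t. fps_nth (F t) m) has_real_derivative fps_nth F' m) (at t)"
    and "\<And>m. ((\<lambda>t. fps_nth (G t) m) has_real_derivative fps_nth G' m) (at t)"
  shows "((\<lambda>t. fps_nth (F t * G t) m) has_real_derivative fps_nth (F' * G t + F t * G') m) (at t)"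
proof -
  have "((\<lambda>t. \<Sum>i=0..m. fps_nth (F t) i * fps_nth (G t) (m - i)) has_real_derivative
      (\<Sum>i=0..m. fps_nth F' i * fps_nth (G t) (m - i) + fps_nth G' (m - i) * fps_nth (F t) i)) (at t)"
    by (intro DERIV_sum DERIV_mult assms)
  then show ?thesis
    by (simp add: fps_mult_nth sum.distrib mult.commute[of "fps_nth G' _"])
qed

text \<open>Since the inner series has no constant term, the coefficient of x^m in the composition
  involves only its powers i \<le> m. It is thus a polynomial in t, differentiated term by term
  without any question of convergence.\<close>

lemma has_field_derivative_gegenbauer_fps_nth:
  "((\<lambda>t. fps_nth (gegenbauer_fps k t) m) has_real_derivative
     fps_nth (2 * fps_const k * fps_X * gegenbauer_fps (k + 1) t) m) (at t)"
proof -
  let ?q = "\<lambda>t. fps_X ^ 2 - fps_const (2 * t) * fps_X :: real fps"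
  have q: "((\<lambda>t. fps_nth (?q t) m) has_real_derivative fps_nth (- 2 * fps_X) m) (at t)" for m
  proof -
    have "fps_nth (?q t) m = fps_nth (fps_X ^ 2) m - 2 * t * fps_nth fps_X m" for t
      by simp
    moreover have "fps_nth (- 2 * fps_X :: real fps) m = - 2 * fps_nth fps_X m"
      by (metis fps_const_neg fps_mult_left_const_nth numeral_fps_const)
    ultimately show ?thesis
      by (auto intro!: derivative_eq_intros)
  qed
  have pw: "((\<lambda>t. fps_nth (?q t ^ i) m) has_real_derivative
      fps_nth (of_nat i * (- 2 * fps_X) * ?q t ^ (i - 1)) m) (at t)" for i m
  proof (induction i arbitrary: m)
    case 0 then show ?case by simp
  next
    case (Suc i)
    have "(- 2 * fps_X) * ?q t ^ i + ?q t * (of_nat i * (- 2 * fps_X) * ?q t ^ (i - 1))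
      = of_nat (Suc i) * (- 2 * fps_X) * ?q t ^ (Suc i - 1)"
      by (cases i) (simp_all add: algebra_simps)
    then show ?case
      using has_field_derivative_fps_nth_mult[OF q Suc, of m] by simp
  qed
  have "((\<lambda>t. \<Sum>i=0..m. ((-k) gchoose i) * fps_nth (?q t ^ i) m) has_real_derivative
      (\<Sum>i=0..m. ((-k) gchoose i) * fps_nth (of_nat i * (- 2 * fps_X) * ?q t ^ (i - 1)) m)) (at t)"
    by (intro DERIV_sum DERIV_cmult pw)
  moreover have "(\<Sum>i=0..m. ((-k) gchoose i) * fps_nth (of_nat i * (- 2 * fps_X) * ?q t ^ (i - 1)) m)
      = fps_nth (2 * fps_const k * fps_X * gegenbauer_fps (k + 1) t) m"
  proof (cases m)
    case 0
    then show ?thesis by (simp add: mult.assoc)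
  next
    case (Suc n)
    \<comment> \<open>Comparing coefficients in \<open>fps_binomial_deriv_shift\<close>: the factor
      that the power rule produces is absorbed by passing from the exponent -k to -(k + 1).\<close>
    have b: "((-k) gchoose Suc i) * real (Suc i) = - k * ((-(k+1)) gchoose i)" for i
      using arg_cong[OF fps_binomial_deriv_shift[of k], of "\<lambda>F. fps_nth F i"] by (simp add: mult.commute)
    have X: "fps_nth (2 * (fps_X * F)) (Suc n) = 2 * fps_nth F n" for F :: "real fps"
      by (metis One_nat_def diff_Suc_1 fps_X_mult_nth fps_mult_left_const_nth nat.distinct(1) numeral_fps_const)
    have "(\<Sum>i=0..m. ((-k) gchoose i) * fps_nth (of_nat i * (- 2 * fps_X) * ?q t ^ (i - 1)) m)
       = (\<Sum>i=0..n. ((-k) gchoose Suc i) * fps_nth (of_nat (Suc i) * (- 2 * fps_X) * ?q t ^ i) m)"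
      unfolding Suc by (subst sum.atLeast0_atMost_Suc_shift) simp
    also have "\<dots> = (\<Sum>i=0..n. 2 * k * ((-(k+1)) gchoose i) * fps_nth (?q t ^ i) n)"
    proof (rule sum.cong[OF refl])
      fix i
      have "fps_nth (of_nat (Suc i) * (- 2 * fps_X) * ?q t ^ i) m
          = real (Suc i) * (- fps_nth (2 * (fps_X * ?q t ^ i)) (Suc n))"
        unfolding Suc by (simp only: fps_of_nat[symmetric] fps_mult_left_const_nth mult.assoc
            mult_minus_left fps_neg_nth minus_mult_commute)
      also have "\<dots> = - 2 * real (Suc i) * fps_nth (?q t ^ i) n"
        unfolding X by (simp add: ring_distribs)
      finally have e: "fps_nth (of_nat (Suc i) * (- 2 * fps_X) * ?q t ^ i) m
          = - 2 * real (Suc i) * fps_nth (?q t ^ i) n" .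
      have "A * (- 2 * S * f) = 2 * k * B * f" if "A * S = - k * B" for A S B f :: real
        using that by algebra
      from this[OF b[of i]] show "((-k) gchoose Suc i) * fps_nth (of_nat (Suc i) * (- 2 * fps_X) * ?q t ^ i) m
         = 2 * k * ((-(k+1)) gchoose i) * fps_nth (?q t ^ i) n"
        unfolding e .
    qed
    also have "\<dots> = 2 * k * fps_nth (gegenbauer_fps (k + 1) t) n"
      by (simp add: gegenbauer_fps_def fps_compose_nth sum_distrib_left mult.assoc)
    also have "\<dots> = fps_nth (2 * (fps_X * (fps_const k * gegenbauer_fps (k + 1) t))) (Suc n)"
      unfolding X by simp
    finally show ?thesis
      by (simp add: Suc algebra_simps)
  qed
  ultimately show ?thesis
    by (simp add: gegenbauer_fps_def fps_compose_nth)
qed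

text \<open>The first two derivatives in t are kept as coefficients of multiples of the generating
  function of higher index. This turns the Gegenbauer equation into one identity between formal
  power series.\<close>

definition gegenbauer_diff :: "real \<Rightarrow> nat \<Rightarrow> real \<Rightarrow> real" where
  "gegenbauer_diff \<nu> m t =
     fps_nth ((1 - fps_X ^ 2) * (2 * fps_const (\<nu> + 1) * fps_X * gegenbauer_fps (\<nu> + 2) t)) m"

definition gegenbauer_diff2 :: "real \<Rightarrow> nat \<Rightarrow> real \<Rightarrow> real" where
  "gegenbauer_diff2 \<nu> m t =
     fps_nth ((1 - fps_X ^ 2) * (2 * fps_const (\<nu> + 1) * fps_X *
       (2 * fps_const (\<nu> + 2) * fps_X * gegenbauer_fps (\<nu> + 3) t))) m"

lemma has_field_derivative_fps_nth_const_mult: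
  fixes G :: "real \<Rightarrow> real fps"
  assumes "\<And>m. ((\<lambda>t. fps_nth (G t) m) has_real_derivative fps_nth G' m) (at t)"
  shows "((\<lambda>t. fps_nth (F * G t) m) has_real_derivative fps_nth (F * G') m) (at t)"
  using has_field_derivative_fps_nth_mult[of "\<lambda>_. F" 0 t G G' m] assms by simp

lemma has_field_derivative_normalized_Gegenbauer:
  "(normalized_Gegenbauer \<nu> m has_real_derivative gegenbauer_diff \<nu> m t) (at t)"
proof -
  have "\<nu> + 1 + 1 = \<nu> + 2" by simp
  then show ?thesis
    unfolding normalized_Gegenbauer_fps[abs_def] gegenbauer_diff_def
    using has_field_derivative_fps_nth_const_mult[OF has_field_derivative_gegenbauer_fps_nth[of "\<nu> + 1"]]
    by metis
qed

lemma has_field_derivative_gegenbauer_diff: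
  "(gegenbauer_diff \<nu> m has_real_derivative gegenbauer_diff2 \<nu> m t) (at t)"
proof -
  have "\<nu> + 2 + 1 = \<nu> + 3" by simp
  then show ?thesis
    unfolding gegenbauer_diff_def[abs_def] gegenbauer_diff2_def
    using has_field_derivative_fps_nth_const_mult[OF
        has_field_derivative_fps_nth_const_mult[OF has_field_derivative_gegenbauer_fps_nth[of "\<nu> + 2"]]]
    by metis
qed

lemma continuous_gegenbauer_diff2: "continuous_on S (gegenbauer_diff2 \<nu> m)"
proof -
  have "((\<lambda>t. gegenbauer_diff2 \<nu> m t) has_real_derivative
    fps_nth ((1 - fps_X ^ 2) * (2 * fps_const (\<nu> + 1) * fps_X *
       (2 * fps_const (\<nu> + 2) * fps_X * (2 * fps_const (\<nu> + 3) * fps_X * gegenbauer_fps (\<nu> + 3 + 1) t)))) m) (at t)" for t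
    unfolding gegenbauer_diff2_def
    by (intro has_field_derivative_fps_nth_const_mult has_field_derivative_gegenbauer_fps_nth)
  then show ?thesis
    by (meson DERIV_isCont continuous_at_imp_continuous_on)
qed

lemma fps_nth_X_deriv: "fps_nth (fps_X * fps_deriv F) m = real m * fps_nth F m"
  by (cases m) simp_all

text \<open>The left side lies in the ideal generated by the relations (1 - T^2) + D^2 = Q, U - Q =
  2 X D and T - X = D. Keeping \<open>Q\<close>, \<open>U\<close> and \<open>D\<close> as letters
  exhibits the three cofactors and avoids a full expansion.\<close>

lemma gegenbauer_ODE_identity:
  fixes T K X A Q U D :: "'a::idom"
  assumes "Q = 1 - 2 * T * X + X * X" "U = 1 - X * X" "D = T - X"
  shows "(1 - T * T) * (U * (2 * (K + 1) * X * (2 * (K + 2) * X * A)))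
    - (2 * K + 1) * T * (U * (2 * (K + 1) * X * (Q * A)))
    + X * ((- 2 * X * (Q * (Q * A)) + U * (2 * (K + 1) * D * (Q * A)))
         + X * (- 2 * (Q * (Q * A)) - 4 * X * (2 * (K + 1) * D * (Q * A))
             - U * (2 * (K + 1) * (Q * A))
             + U * (2 * (K + 1) * D * (2 * (K + 2) * D * A))))
    + 2 * K * (X * (- 2 * X * (Q * (Q * A)) + U * (2 * (K + 1) * D * (Q * A)))) = 0" (is "?L = 0")
proof -
  have "?L = 4 * (K + 1) * (K + 2) * U * X * X * A * ((1 - T * T) + D * D - Q)
      + 4 * (K + 1) * X * X * Q * A * (U - Q - 2 * X * D)
      - 2 * (2 * K + 1) * (K + 1) * X * U * Q * A * (T - X - D)"
    by (simp add: algebra_simps)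
  moreover have "(1 - T * T) + D * D - Q = 0" "U - Q - 2 * X * D = 0" "T - X - D = 0"
    unfolding assms by (simp_all add: algebra_simps)
  ultimately show ?thesis by (simp only: mult_zero_right) simp
qed

text \<open>The Euler operator \<theta> = x d/dx multiplies the m-th coefficient by m, so m (m + 2
  \<nu>) corresponds to \<theta>^2 + 2 \<nu> \<theta>. The equation for all m at once is a
  differential identity for the generating function, in which every series is a multiple of the one
  of index \<nu> + 3.\<close>

lemma gegenbauer_ODE:
  "(1 - t\<^sup>2) * gegenbauer_diff2 \<nu> m t - (2 * \<nu> + 1) * t * gegenbauer_diff \<nu> m t
     + real m * (real m + 2 * \<nu>) * normalized_Gegenbauer \<nu> m t = 0"
proof -
  define T K X where "T = fps_const t" and "K = fps_const \<nu>" and "X = (fps_X :: real fps)"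
  define A where "A = gegenbauer_fps (\<nu> + 3) t"
  define Q where "Q = 1 - 2 * T * X + X * X"
  define G1 where "G1 = gegenbauer_fps (\<nu> + 1) t"
  define G2 where "G2 = gegenbauer_fps (\<nu> + 2) t"
  define F where "F = (1 - X * X) * G1"
  define F1 where "F1 = (1 - X * X) * (2 * (K + 1) * X * G2)"
  define F2 where "F2 = (1 - X * X) * (2 * (K + 1) * X * (2 * (K + 2) * X * A))"
  have K: "fps_const (\<nu> + 1) = K + 1" "fps_const (\<nu> + 2) = K + 2" "fps_const (\<nu> + 3) = K + 3"
    by (simp_all only: K_def fps_const_add[symmetric] numeral_fps_const fps_const_1_eq_1)
  have nu: "\<nu> + 1 + 1 = \<nu> + 2" "\<nu> + 2 + 1 = \<nu> + 3"
    by simp_all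
  have A2: "G2 = Q * A"
    using gegenbauer_fps_Suc[of "\<nu> + 2" t]
    unfolding Q_def T_def X_def A_def G2_def nu power2_eq_square by blast
  have A1: "G1 = Q * (Q * A)"
    using gegenbauer_fps_Suc[of "\<nu> + 1" t]
    unfolding nu A2[symmetric] unfolding G1_def G2_def Q_def T_def X_def power2_eq_square by blast
  have D1: "fps_deriv G1 = 2 * (K + 1) * (T - X) * G2"
    using fps_deriv_gegenbauer[of "\<nu> + 1" t] unfolding nu K T_def X_def G1_def G2_def by blast
  have D2: "fps_deriv G2 = 2 * (K + 2) * (T - X) * A"
    using fps_deriv_gegenbauer[of "\<nu> + 2" t] unfolding nu K T_def X_def A_def G2_def by blast
  have two: "fps_deriv (2 :: real fps) = 0"
    by (metis fps_deriv_const numeral_fps_const)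
  have dX: "fps_deriv X = 1" "fps_deriv T = 0" "fps_deriv K = 0"
    by (simp_all add: X_def T_def K_def)
  have dF: "fps_deriv F = - 2 * X * G1 + (1 - X * X) * (2 * (K + 1) * (T - X) * G2)"
    unfolding F_def fps_deriv_mult D1 fps_deriv_sub dX by (simp add: ring_distribs)
  have ddF: "fps_deriv (fps_deriv F) = - 2 * G1 - 4 * X * (2 * (K + 1) * (T - X) * G2)
      - (1 - X * X) * (2 * (K + 1) * G2)
      + (1 - X * X) * (2 * (K + 1) * (T - X) * (2 * (K + 2) * (T - X) * A))"
    unfolding dF fps_deriv_add fps_deriv_mult D1 D2 fps_deriv_sub dX two fps_deriv_neg fps_deriv_1
    by algebra
  have X1: "fps_deriv (X * fps_deriv F) = fps_deriv F + X * fps_deriv (fps_deriv F)"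
    unfolding fps_deriv_mult dX by simp
  have "(1 - T * T) * F2 - (2 * K + 1) * T * F1 + X * fps_deriv (X * fps_deriv F) + 2 * K * (X * fps_deriv F) = 0"
    unfolding X1 unfolding ddF unfolding dF F2_def F1_def A1 A2
    by (rule gegenbauer_ODE_identity) (simp_all add: Q_def)
  moreover have "(1 - T * T) = fps_const (1 - t\<^sup>2)" "(2 * K + 1) * T = fps_const ((2 * \<nu> + 1) * t)"
    "2 * K = fps_const (2 * \<nu>)"
    by (simp_all add: T_def K_def numeral_fps_const power2_eq_square flip: fps_const_1_eq_1)
  ultimately have "fps_const (1 - t\<^sup>2) * F2 - fps_const ((2 * \<nu> + 1) * t) * F1
      + X * fps_deriv (X * fps_deriv F) + fps_const (2 * \<nu>) * (X * fps_deriv F) = 0"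
    by simp
  then have "fps_nth (fps_const (1 - t\<^sup>2) * F2 - fps_const ((2 * \<nu> + 1) * t) * F1
      + X * fps_deriv (X * fps_deriv F) + fps_const (2 * \<nu>) * (X * fps_deriv F)) m = 0"
    by simp
  then have "(1 - t\<^sup>2) * fps_nth F2 m - (2 * \<nu> + 1) * t * fps_nth F1 m
      + real m * (real m * fps_nth F m) + 2 * \<nu> * (real m * fps_nth F m) = 0"
    unfolding fps_add_nth fps_sub_nth fps_mult_left_const_nth X_def fps_nth_X_deriv .
  moreover have "fps_nth F m = normalized_Gegenbauer \<nu> m t"
    "fps_nth F1 m = gegenbauer_diff \<nu> m t" "fps_nth F2 m = gegenbauer_diff2 \<nu> m t"
    unfolding F_def F1_def F2_def normalized_Gegenbauer_fps gegenbauer_diff_def gegenbauer_diff2_def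
      K X_def G1_def G2_def A_def power2_eq_square by (rule refl)+
  ultimately show ?thesis
    by (simp add: algebra_simps)
qed

section \<open>Polynomial bounds from the factorization over the unit circle\<close>

definition binomial_weight :: "real \<Rightarrow> nat \<Rightarrow> real" where
  "binomial_weight k n = pochhammer k n / fact n"

lemma binomial_weight_Suc: "real (Suc n) * binomial_weight k (Suc n) = (k + real n) * binomial_weight k n"
  by (simp add: binomial_weight_def pochhammer_Suc field_simps del: of_nat_Suc)

lemma binomial_weight_nonneg: "k > 0 \<Longrightarrow> 0 \<le> binomial_weight k n"
  by (simp add: binomial_weight_def pochhammer_nonneg)

text \<open>The ratio of consecutive weights is at most 1 + N / (n + 1), hence by Bernoulli at most
  ((n + 2) / (n + 1))^N, and these bounds telescope.\<close>

lemma binomial_weight_le: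
  assumes "0 < k" "k \<le> real N"
  shows "binomial_weight k n \<le> real (n + 1) ^ N"
proof (induction n)
  case 0
  then show ?case by (simp add: binomial_weight_def)
next
  case (Suc n)
  have "binomial_weight k (Suc n) = (k + real n) / real (Suc n) * binomial_weight k n"
    using binomial_weight_Suc[of n k] by (simp add: field_simps del: of_nat_Suc)
  also have "(k + real n) / real (Suc n) \<le> (real N + real (Suc n)) / real (Suc n)"
    using assms by (intro divide_right_mono) auto
  also have "\<dots> = 1 + real N * (1 / real (Suc n))"
    by (simp add: add_divide_distrib)
  also have "\<dots> \<le> (1 + 1 / real (Suc n)) ^ N"
    using Bernoulli_inequality[of "1 / real (Suc n)" N] by (simp add: field_simps)
  finally have "binomial_weight k (Suc n) \<le> (1 + 1 / real (Suc n)) ^ N * real (n + 1) ^ N"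
    using Suc binomial_weight_nonneg[OF assms(1)]
    by (smt (verit) mult_mono mult_right_mono zero_le_power divide_nonneg_nonneg of_nat_0_le_iff)
  also have "\<dots> = real (Suc n + 1) ^ N"
    by (simp add: power_mult_distrib[symmetric] field_simps)
  finally show ?case .
qed

text \<open>The Taylor series of (1 - z x)^(-k), with z inside the coefficients.\<close>

definition binomial_fps :: "real \<Rightarrow> complex \<Rightarrow> complex fps" where
  "binomial_fps k z = Abs_fps (\<lambda>n. of_real (binomial_weight k n) * z ^ n)"

lemma fps_deriv_binomial_fps:
  "(1 - fps_const z * fps_X) * fps_deriv (binomial_fps k z) = fps_const (of_real k * z) * binomial_fps k z"
proof (rule fps_ext)
  fix n
  have w: "of_nat (Suc n) * complex_of_real (binomial_weight k (Suc n)) =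
      (of_real k + of_nat n) * of_real (binomial_weight k n)" for n
    using arg_cong[OF binomial_weight_Suc[of n k], of complex_of_real] by simp
  show "fps_nth ((1 - fps_const z * fps_X) * fps_deriv (binomial_fps k z)) n
      = fps_nth (fps_const (of_real k * z) * binomial_fps k z) n"
  proof (cases n)
    case 0
    then show ?thesis using w[of 0] by (simp add: binomial_fps_def left_diff_distrib mult.assoc)
  next
    case (Suc m)
    have "fps_nth ((1 - fps_const z * fps_X) * fps_deriv (binomial_fps k z)) n
       = of_nat (Suc n) * of_real (binomial_weight k (Suc n)) * z ^ Suc n
         - z * (of_nat n * (of_real (binomial_weight k n) * z ^ n))"
      by (simp add: binomial_fps_def left_diff_distrib mult.assoc Suc)
    also have "\<dots> = (of_real k + of_nat n) * of_real (binomial_weight k n) * z ^ Suc n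
         - z * (of_nat n * (of_real (binomial_weight k n) * z ^ n))"
      unfolding w ..
    also have "\<dots> = of_real k * z * (of_real (binomial_weight k n) * z ^ n)"
      by (simp add: algebra_simps)
    finally show ?thesis by (simp add: binomial_fps_def)
  qed
qed

text \<open>A solution of this first order equation is determined by its constant coefficient. The
  recurrence serves to identify two solutions over different fields, one real and one
  complex.\<close>

lemma fps_quadratic_ODE_recurrence:
  fixes F :: "'a::field_char_0 fps"
  assumes "(1 - fps_const s * fps_X + fps_X ^ 2) * fps_deriv F = fps_const k * (fps_const s - 2 * fps_X) * F"
  shows "fps_nth F 1 = k * s * fps_nth F 0"
    and "of_nat (n + 2) * fps_nth F (n + 2)
      = s * (of_nat (n + 1) + k) * fps_nth F (n + 1) - (of_nat n + 2 * k) * fps_nth F n"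
proof -
  have e: "fps_deriv F - fps_const s * (fps_X * fps_deriv F) + fps_X * (fps_X * fps_deriv F)
      = fps_const (k * s) * F - fps_const (2 * k) * (fps_X * F)"
    using assms by (simp add: algebra_simps power2_eq_square numeral_fps_const flip: fps_const_mult)
  have E: "fps_nth (fps_deriv F) n - s * fps_nth (fps_X * fps_deriv F) n + fps_nth (fps_X * (fps_X * fps_deriv F)) n
      = k * s * fps_nth F n - 2 * k * fps_nth (fps_X * F) n" for n
    using arg_cong[OF e, of "\<lambda>F. fps_nth F n"]
    by (simp only: fps_add_nth fps_sub_nth fps_mult_left_const_nth)
  show "fps_nth F 1 = k * s * fps_nth F 0"
    using E[of 0] by simp
  show "of_nat (n + 2) * fps_nth F (n + 2)
      = s * (of_nat (n + 1) + k) * fps_nth F (n + 1) - (of_nat n + 2 * k) * fps_nth F n"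
    using E[of "Suc n"] by (cases n) (simp_all add: algebra_simps)
qed

text \<open>With t = cos \<theta> and z = exp(i \<theta>) one has 1 - 2 t x + x^2 = (1 - z x)(1 -
  cnj z x). Both sides solve the same first order equation with the same constant
  coefficient.\<close>

lemma gegenbauer_fps_nth_complex:
  assumes "\<bar>t\<bar> \<le> 1"
  defines "z \<equiv> cis (arccos t)"
  shows "complex_of_real (fps_nth (gegenbauer_fps k t) m)
      = fps_nth (binomial_fps k z * binomial_fps k (cnj z)) m"
proof -
  define P where "P = binomial_fps k z * binomial_fps k (cnj z)"
  have zz: "z * cnj z = 1" "z + cnj z = of_real (2 * t)"
    using assms complex_norm_square[of z] by (simp_all add: complex_add_cnj z_def cos_arccos_abs)
  have "(1 - fps_const z * fps_X) * (1 - fps_const (cnj z) * fps_X)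
     = 1 - fps_const (z + cnj z) * fps_X + fps_const (z * cnj z) * fps_X ^ 2"
    by (simp add: algebra_simps power2_eq_square flip: fps_const_add fps_const_mult)
  then have Q: "1 - fps_const (of_real (2 * t)) * fps_X + fps_X ^ 2
     = (1 - fps_const z * fps_X) * (1 - fps_const (cnj z) * fps_X)"
    unfolding zz by simp
  have "(1 - fps_const z * fps_X) * (1 - fps_const (cnj z) * fps_X) * fps_deriv P
     = ((1 - fps_const z * fps_X) * fps_deriv (binomial_fps k z)) * ((1 - fps_const (cnj z) * fps_X) * binomial_fps k (cnj z))
     + ((1 - fps_const (cnj z) * fps_X) * fps_deriv (binomial_fps k (cnj z))) * ((1 - fps_const z * fps_X) * binomial_fps k z)"
    unfolding P_def fps_deriv_mult by algebra
  also have "\<dots> = fps_const (of_real k) * (fps_const z + fps_const (cnj z) - 2 * fps_const (z * cnj z) * fps_X) * P"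
    unfolding fps_deriv_binomial_fps
    unfolding P_def fps_const_mult[symmetric] by algebra
  also have "fps_const z + fps_const (cnj z) = fps_const (of_real (2 * t))"
    unfolding zz(2)[symmetric] by (simp only: fps_const_add)
  finally have PO: "(1 - fps_const (of_real (2 * t)) * fps_X + fps_X ^ 2) * fps_deriv P
     = fps_const (of_real k) * (fps_const (of_real (2 * t)) - 2 * fps_X) * P"
    unfolding Q zz by simp
  have AO: "(1 - fps_const (2 * t) * fps_X + fps_X ^ 2) * fps_deriv (gegenbauer_fps k t)
     = fps_const k * (fps_const (2 * t) - 2 * fps_X) * gegenbauer_fps k t"
  proof -
    have c: "fps_const (2 * t) = 2 * fps_const t"
      by (simp add: numeral_fps_const)
    show ?thesis
      unfolding fps_deriv_gegenbauer c unfolding gegenbauer_fps_Suc[of k t] by algebra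
  qed
  note rP = fps_quadratic_ODE_recurrence[OF PO] and rA = fps_quadratic_ODE_recurrence[OF AO]
  have eq0: "complex_of_real (fps_nth (gegenbauer_fps k t) 0) = fps_nth P 0"
    by (simp add: P_def gegenbauer_fps_def binomial_fps_def binomial_weight_def)
  have "complex_of_real (fps_nth (gegenbauer_fps k t) m) = fps_nth P m \<and>
      complex_of_real (fps_nth (gegenbauer_fps k t) (Suc m)) = fps_nth P (Suc m)"
  proof (induction m)
    case 0
    then show ?case using eq0 rP(1) rA(1) by simp
  next
    case (Suc n)
    have "of_nat (n + 2) * fps_nth P (n + 2)
      = of_real (real (n + 2) * fps_nth (gegenbauer_fps k t) (n + 2))"
      unfolding rP(2) rA(2) using Suc by simp
    then have "of_nat (n + 2) * fps_nth P (n + 2)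
      = of_nat (n + 2) * complex_of_real (fps_nth (gegenbauer_fps k t) (n + 2))"
      by (simp only: of_real_mult of_real_of_nat_eq)
    then show ?case using Suc
      by (simp only: mult_cancel_left of_nat_eq_0_iff) simp
  qed
  then show ?thesis by (simp add: P_def)
qed

text \<open>As z has modulus 1, both factors have coefficients of size at most (m + 1)^N up to index
  m, and the convolution has m + 1 terms.\<close>

lemma gegenbauer_fps_nth_bound:
  assumes "\<bar>t\<bar> \<le> 1" "0 < k" "k \<le> real N"
  shows "\<bar>fps_nth (gegenbauer_fps k t) m\<bar> \<le> real (m + 1) ^ (2 * N + 1)"
proof -
  define z where "z = cis (arccos t)"
  have "\<bar>fps_nth (gegenbauer_fps k t) m\<bar> = norm (fps_nth (binomial_fps k z * binomial_fps k (cnj z)) m)"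
    using gegenbauer_fps_nth_complex[OF assms(1), of k m] unfolding z_def
    by (metis norm_of_real real_norm_def)
  also have "\<dots> \<le> (\<Sum>i=0..m. norm (fps_nth (binomial_fps k z) i * fps_nth (binomial_fps k (cnj z)) (m - i)))"
    unfolding fps_mult_nth by (rule norm_sum)
  also have "\<dots> \<le> (\<Sum>i=0..m. real (m + 1) ^ N * real (m + 1) ^ N)"
  proof (rule sum_mono)
    fix i assume "i \<in> {0..m}"
    then have *: "binomial_weight k j \<le> real (m + 1) ^ N" if "j \<le> m" for j
      using binomial_weight_le[OF assms(2,3), of j] that
      by (meson order_trans power_mono of_nat_0_le_iff of_nat_mono add_le_mono1)
    show "norm (fps_nth (binomial_fps k z) i * fps_nth (binomial_fps k (cnj z)) (m - i))
       \<le> real (m + 1) ^ N * real (m + 1) ^ N"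
      using *[of i] *[of "m - i"] \<open>i \<in> {0..m}\<close> binomial_weight_nonneg[OF assms(2)]
      by (auto simp: binomial_fps_def norm_mult norm_power z_def intro!: mult_mono)
  qed
  also have "\<dots> = real (m + 1) ^ (2 * N + 1)"
    by (simp add: power_add mult_2)
  finally show ?thesis .
qed

lemma normalized_Gegenbauer_nth:
  "normalized_Gegenbauer \<nu> m t = fps_nth (gegenbauer_fps (\<nu> + 1) t) m
     - (if m < 2 then 0 else fps_nth (gegenbauer_fps (\<nu> + 1) t) (m - 2))"
  by (simp add: normalized_Gegenbauer_fps left_diff_distrib fps_X_power_mult_nth)

text \<open>The exponent is that of \<open>gegenbauer_fps_nth_bound\<close>; the factor 2 accounts
  for the multiplication by 1 - x^2. What matters is polynomial growth in m.\<close>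

definition gegenbauer_bound :: "nat \<Rightarrow> nat \<Rightarrow> real" where
  "gegenbauer_bound N m = 2 * real (m + 1) ^ (2 * N + 1)"

lemma normalized_Gegenbauer_bound:
  assumes "\<bar>t\<bar> \<le> 1" "-1 < \<nu>" "\<nu> + 1 \<le> real N"
  shows "\<bar>normalized_Gegenbauer \<nu> m t\<bar> \<le> gegenbauer_bound N m"
proof -
  have *: "\<bar>fps_nth (gegenbauer_fps (\<nu> + 1) t) j\<bar> \<le> real (m + 1) ^ (2 * N + 1)" if "j \<le> m" for j
  proof -
    have "\<bar>fps_nth (gegenbauer_fps (\<nu> + 1) t) j\<bar> \<le> real (j + 1) ^ (2 * N + 1)"
      using gegenbauer_fps_nth_bound[of t "\<nu> + 1" N j] assms by simp
    also have "\<dots> \<le> real (m + 1) ^ (2 * N + 1)"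
      using that by (intro power_mono) auto
    finally show ?thesis .
  qed
  show ?thesis
    using *[of m] *[of "m - 2"] unfolding normalized_Gegenbauer_nth gegenbauer_bound_def by auto
qed

lemma gegenbauer_bound_pos: "0 < gegenbauer_bound N m"
  by (simp add: gegenbauer_bound_def)

lemma summable_gegenbauer_bound:
  assumes "\<bar>r\<bar> < 1"
  shows "summable (\<lambda>m. gegenbauer_bound N m * r ^ m)"
proof (cases "r = 0")
  case True
  then have "(\<lambda>m. gegenbauer_bound N m * r ^ m) = (\<lambda>m. if m = 0 then gegenbauer_bound N m else 0)"
    by (auto simp: fun_eq_iff)
  then show ?thesis by simp
next
  case False
  have "real (m + 2) / real (m + 1) = 1 + inverse (real (Suc m))" for m
    by (simp add: field_simps)
  then have "(\<lambda>m. real (m + 2) / real (m + 1)) \<longlonglongrightarrow> 1"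
    using LIMSEQ_inverse_real_of_nat_add[of 1] by (simp del: of_nat_add)
  then have "(\<lambda>m. (real (m + 2) / real (m + 1)) ^ (2 * N + 1) * \<bar>r\<bar>) \<longlonglongrightarrow> 1 ^ (2 * N + 1) * \<bar>r\<bar>"
    by (intro tendsto_intros)
  moreover obtain c where c: "\<bar>r\<bar> < c" "c < 1" using assms dense by blast
  ultimately have "\<forall>\<^sub>F m in sequentially. (real (m + 2) / real (m + 1)) ^ (2 * N + 1) * \<bar>r\<bar> < c"
    by (intro order_tendstoD) auto
  then obtain M where M: "\<And>m. m \<ge> M \<Longrightarrow> (real (m + 2) / real (m + 1)) ^ (2 * N + 1) * \<bar>r\<bar> < c"
    by (auto simp: eventually_sequentially)
  show ?thesis
  proof (rule summable_ratio_test[OF \<open>c < 1\<close>])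
    fix m assume "m \<ge> M"
    have "norm (gegenbauer_bound N (Suc m) * r ^ Suc m)
      = ((real (m + 2) / real (m + 1)) ^ (2 * N + 1) * \<bar>r\<bar>) * norm (gegenbauer_bound N m * r ^ m)"
      by (simp add: gegenbauer_bound_def norm_mult norm_power abs_mult power_divide power_abs add.commute)
    also have "\<dots> \<le> c * norm (gegenbauer_bound N m * r ^ m)"
      using M[OF \<open>m \<ge> M\<close>] by (intro mult_right_mono) auto
    finally show "norm (gegenbauer_bound N (Suc m) * r ^ Suc m) \<le> c * norm (gegenbauer_bound N m * r ^ m)" .
  qed
qed

section \<open>Convergence of the generating function and the Poisson kernel\<close>

lemma binomial_fps_sums:
  fixes w :: complex
  assumes "norm w < 1"
  shows "(\<lambda>n. of_real (binomial_weight k n) * w ^ n) sums ((1 - w) powr of_real (- k))"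
    and "summable (\<lambda>n. norm (of_real (binomial_weight k n) * w ^ n))"
proof -
  have "((of_real (- k) :: complex) gchoose n) * (- w) ^ n = of_real (binomial_weight k n) * w ^ n"
    for n and w :: complex
    by (simp add: gbinomial_pochhammer binomial_weight_def pochhammer_of_real power_minus[of w])
  then have *: "(\<lambda>n. of_real (binomial_weight k n) * w ^ n) sums ((1 - w) powr of_real (- k))"
    if "norm w < 1" for w :: complex
    using gen_binomial_complex[of "- w" "of_real (- k)"] that by simp
  then show "(\<lambda>n. of_real (binomial_weight k n) * w ^ n) sums ((1 - w) powr of_real (- k))"
    using assms by blast
  \<comment> \<open>Convergence at a radius strictly larger than |w| yields absolute convergence at
    w.\<close>
  obtain r where r: "norm w < r" "r < 1" using assms dense by blast
  then have "norm (complex_of_real r) < 1"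
    using order.strict_trans1[OF norm_ge_zero r(1)] by simp
  then have "summable (\<lambda>n. of_real (binomial_weight k n) * (complex_of_real r) ^ n)"
    using * sums_summable by blast
  then show "summable (\<lambda>n. norm (of_real (binomial_weight k n) * w ^ n))"
    using r order.strict_trans1[OF norm_ge_zero r(1)] by (intro powser_insidea) auto
qed

text \<open>The series is the Cauchy product of two conjugate binomial series, so its sum is |1 - z
  r|^(-2 k), and |1 - z r|^2 = 1 - 2 r t + r^2.\<close>

lemma gegenbauer_fps_sums:
  assumes "\<bar>t\<bar> \<le> 1" "\<bar>r\<bar> < 1"
  shows "(\<lambda>m. fps_nth (gegenbauer_fps k t) m * r ^ m) sums ((1 - 2 * r * t + r\<^sup>2) powr (- k))"
proof -
  define z where "z = cis (arccos t)"
  have n: "norm (z * of_real r) < 1" "norm (cnj z * of_real r) < 1"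
    using assms by (simp_all add: z_def norm_mult)
  define A where "A = (\<lambda>z n. of_real (binomial_weight k n) * (z * complex_of_real r) ^ n)"
  define w where "w = 1 - z * of_real r"
  have w: "w \<noteq> 0" "cnj w = 1 - cnj z * of_real r"
    using n(1) by (auto simp: w_def)
  have wn: "(norm w)\<^sup>2 = 1 - 2 * r * t + r\<^sup>2"
  proof -
    have "Re z = t"
      using assms by (simp add: z_def cos_arccos_abs)
    moreover have "(Re z)\<^sup>2 + (Im z)\<^sup>2 = 1"
      by (simp add: z_def)
    moreover have "(norm w)\<^sup>2 = (1 - Re z * r)\<^sup>2 + (Im z * r)\<^sup>2"
      by (simp add: w_def cmod_power2)
    moreover have "(1 - Re z * r)\<^sup>2 + (Im z * r)\<^sup>2 = 1 - 2 * r * Re z + ((Re z)\<^sup>2 + (Im z)\<^sup>2) * r\<^sup>2"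
      by (simp add: power2_eq_square algebra_simps)
    ultimately show ?thesis by simp
  qed
  \<comment> \<open>The real part of w is positive, which keeps w off the branch cut and lets
    conjugation commute with the power.\<close>
  have Rew: "w \<notin> \<real>\<^sub>\<le>\<^sub>0"
  proof -
    have "\<bar>Re (z * of_real r)\<bar> < 1" using n(1) abs_Re_le_cmod order.strict_trans1 by blast
    then have "Re w > 0" by (simp add: w_def abs_less_iff)
    then show ?thesis by (auto simp: complex_nonpos_Reals_iff)
  qed
  have "(\<lambda>m. \<Sum>i\<le>m. A z i * A (cnj z) (m - i)) sums ((\<Sum>m. A z m) * (\<Sum>m. A (cnj z) m))"
    unfolding A_def using binomial_fps_sums(2)[OF n(1)] binomial_fps_sums(2)[OF n(2)]
    by (rule Cauchy_product_sums)
  moreover have "(\<Sum>m. A z m) = w powr of_real (- k)"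
    unfolding A_def w_def using binomial_fps_sums(1)[OF n(1)] by (rule sums_unique[symmetric])
  moreover have "(\<Sum>m. A (cnj z) m) = cnj w powr of_real (- k)"
    unfolding A_def w using binomial_fps_sums(1)[OF n(2)] by (rule sums_unique[symmetric])
  moreover have "w powr of_real (- k) * cnj w powr of_real (- k) = of_real ((1 - 2 * r * t + r\<^sup>2) powr (- k))"
  proof -
    have "cnj w powr of_real (- k) = cnj (w powr of_real (- k))"
      using Rew by (subst cnj_powr) (auto simp: complex_nonpos_Reals_iff)
    then have "w powr of_real (- k) * cnj w powr of_real (- k) = of_real ((norm (w powr of_real (- k)))\<^sup>2)"
      by (simp only: complex_norm_square)
    also have "norm (w powr of_real (- k)) = norm w powr (- k)"
      using norm_powr_real_powr' by (metis Reals_of_real Re_complex_of_real)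
    also have "(norm w powr (- k))\<^sup>2 = ((norm w)\<^sup>2) powr (- k)"
      using w(1) by (simp add: power2_eq_square powr_mult)
    finally show ?thesis unfolding wn .
  qed
  moreover have "(\<Sum>i\<le>m. A z i * A (cnj z) (m - i))
      = complex_of_real (fps_nth (gegenbauer_fps k t) m * r ^ m)" for m
  proof -
    have "(\<Sum>i\<le>m. A z i * A (cnj z) (m - i)) =
      (\<Sum>i=0..m. fps_nth (binomial_fps k z) i * fps_nth (binomial_fps k (cnj z)) (m - i) * of_real r ^ m)"
      unfolding atMost_atLeast0
    proof (intro sum.cong refl)
      fix i assume "i \<in> {0..m}"
      then have "complex_of_real r ^ m = of_real r ^ i * of_real r ^ (m - i)"
        by (simp add: power_add[symmetric])
      then show "A z i * A (cnj z) (m - i)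
        = fps_nth (binomial_fps k z) i * fps_nth (binomial_fps k (cnj z)) (m - i) * of_real r ^ m"
        by (simp add: A_def binomial_fps_def power_mult_distrib)
    qed
    then show ?thesis
      using gegenbauer_fps_nth_complex[OF assms(1), of k m]
      by (simp add: z_def fps_mult_nth sum_distrib_right)
  qed
  ultimately show ?thesis
    by (simp only: sums_of_real_iff)
qed

text \<open>For \<nu> = (N - 2) / 2 and t the inner product of unit vectors \<omega> and \<eta>,
  this is the Poisson kernel (1 - r^2) / |\<eta> - r \<omega>|^N of the unit ball.\<close>

definition poisson_kernel :: "real \<Rightarrow> real \<Rightarrow> real \<Rightarrow> real" where
  "poisson_kernel \<nu> r t = (1 - r\<^sup>2) * (1 - 2 * r * t + r\<^sup>2) powr (- (\<nu> + 1))"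

lemma normalized_Gegenbauer_sums:
  assumes "\<bar>t\<bar> \<le> 1" "\<bar>r\<bar> < 1"
  shows "(\<lambda>m. normalized_Gegenbauer \<nu> m t * r ^ m) sums poisson_kernel \<nu> r t"
proof -
  define S where "S = (1 - 2 * r * t + r\<^sup>2) powr (- (\<nu> + 1))"
  define A where "A = (\<lambda>m. fps_nth (gegenbauer_fps (\<nu> + 1) t) m * r ^ m)"
  have A: "A sums S"
    unfolding A_def S_def using gegenbauer_fps_sums[OF assms, of "\<nu> + 1"] .
  \<comment> \<open>Multiplication by r^2 shifts the power series by two indices; subtracting it
    realizes the factor 1 - x^2.\<close>
  define B where "B = (\<lambda>m. if m < 2 then 0 else r\<^sup>2 * A (m - 2))"
  have "(\<lambda>m. B (m + 2)) sums (r\<^sup>2 * S)"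
    unfolding B_def using sums_mult[OF A] by simp
  then have "B sums (r\<^sup>2 * S + (\<Sum>i<2. B i))"
    using sums_iff_shift[of B 2 "r\<^sup>2 * S"] by simp
  then have "B sums (r\<^sup>2 * S)"
    by (simp add: B_def)
  with A have "(\<lambda>m. A m - B m) sums (S - r\<^sup>2 * S)"
    by (rule sums_diff)
  moreover have "A m - B m = normalized_Gegenbauer \<nu> m t * r ^ m" for m
  proof (cases "m < 2")
    case False
    then have "r ^ m = r\<^sup>2 * r ^ (m - 2)" by (metis add_diff_inverse_nat power_add)
    then show ?thesis using False
      by (simp add: A_def B_def normalized_Gegenbauer_nth algebra_simps)
  qed (simp add: A_def B_def normalized_Gegenbauer_nth)
  ultimately show ?thesis
    by (simp add: poisson_kernel_def S_def algebra_simps)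
qed

section \<open>Polar coordinates\<close>

lemma measure_eqI_real_atMost:
  fixes M N :: "real measure"
  assumes sets: "sets M = sets borel" "sets N = sets borel"
    and fin: "\<And>x. emeasure M {..x} < \<infinity>"
    and eq: "\<And>x. emeasure M {..x} = emeasure N {..x}"
  shows "M = N"
proof (rule measure_eqI_generator_eq[where \<Omega> = UNIV and E = "range atMost" and A = "\<lambda>i. {..real i}"])
  show "Int_stable (range (atMost :: real \<Rightarrow> _))"
    by (auto simp: Int_stable_def)
  show "sets M = sigma_sets UNIV (range atMost)" "sets N = sigma_sets UNIV (range atMost)"
    unfolding sets borel_eq_atMost by simp_all
  show "(\<Union>i. {..real i}) = UNIV"
    by (auto intro: real_arch_simple)
qed (use fin eq in \<open>auto simp: less_top\<close>)

lemma nn_integral_lborel_scaleR: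
  fixes f :: "'a::euclidean_space \<Rightarrow> ennreal"
  assumes "f \<in> borel_measurable borel" "R > 0"
  shows "(\<integral>\<^sup>+x. f x \<partial>lborel) = ennreal (R ^ DIM('a)) * (\<integral>\<^sup>+x. f (R *\<^sub>R x) \<partial>lborel)"
proof -
  have "(\<integral>\<^sup>+x. f x \<partial>lborel) =
      (\<integral>\<^sup>+x. f x \<partial>(density (distr lborel borel (\<lambda>x. 0 + R *\<^sub>R x)) (\<lambda>_. \<bar>R\<bar> ^ DIM('a))))"
    using lborel_affine[of R "0::'a"] assms by simp
  also have "\<dots> = ennreal (R ^ DIM('a)) * (\<integral>\<^sup>+x. f (R *\<^sub>R x) \<partial>lborel)"
    using assms by (simp add: nn_integral_density nn_integral_distr nn_integral_cmult)
  finally show ?thesis .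
qed

lemma nn_integral_Gamma:
  assumes "z > 0" "k > 0"
  shows "(\<integral>\<^sup>+q. ennreal (indicator {0<..} q * (q powr (z - 1) * exp (- (k * q)))) \<partial>lborel) = ennreal (Gamma z / k powr z)"
proof -
  have "(\<integral>\<^sup>+q. ennreal (indicator {0<..} q * (q powr (z - 1) * exp (- (k * q)))) \<partial>lborel)
     = ennreal (1 / k) * (\<integral>\<^sup>+q. ennreal (indicator {0<..} (q / k) * ((q / k) powr (z - 1) * exp (- q))) \<partial>lborel)"
    using nn_integral_lborel_scaleR[of "\<lambda>q. ennreal (indicator {0<..} q * (q powr (z - 1) * exp (- (k * q))))" "1 / k"] assms
    by (simp add: field_simps)
  also have "(\<integral>\<^sup>+q. ennreal (indicator {0<..} (q / k) * ((q / k) powr (z - 1) * exp (- q))) \<partial>lborel)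
     = (\<integral>\<^sup>+q. ennreal (1 / k powr (z - 1)) * ennreal (indicator {0..} q * q powr (z - 1) / exp q) \<partial>lborel)"
    using assms
    by (intro nn_integral_cong)
       (auto simp: indicator_def powr_divide exp_minus field_simps zero_less_divide_iff ennreal_mult'[symmetric])
  also have "\<dots> = ennreal (1 / k powr (z - 1)) * (\<integral>\<^sup>+q. ennreal (indicator {0..} q * q powr (z - 1) / exp q) \<partial>lborel)"
    by (intro nn_integral_cmult) measurable
  also have "(\<integral>\<^sup>+q. ennreal (indicator {0..} q * q powr (z - 1) / exp q) \<partial>lborel) = Gamma z"
    using Gamma_conv_nn_integral_real[OF assms(1)] by simp
  also have "ennreal (1 / k) * (ennreal (1 / k powr (z - 1)) * ennreal (Gamma z)) = ennreal (Gamma z / k powr z)"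
    using assms by (simp add: ennreal_mult'[symmetric] powr_diff field_simps)
  finally show ?thesis .
qed

section \<open>The homogeneous weight and the measure on the sphere\<close>

definition weighted_lborel :: "real \<Rightarrow> 'a::euclidean_space measure" where
  "weighted_lborel a = density lborel (\<lambda>x. ennreal (norm x powr (a - 2)))"

lemma sets_weighted_lborel [measurable_cong, simp]: "sets (weighted_lborel a) = sets borel"
  by (simp add: weighted_lborel_def)

lemma space_weighted_lborel [simp]: "space (weighted_lborel a) = UNIV"
  by (simp add: weighted_lborel_def)

lemma emeasure_weighted_lborel_scaleR:
  fixes A :: "'a::euclidean_space set"
  assumes [measurable]: "A \<in> sets borel" and R: "R > 0"
  shows "emeasure (weighted_lborel a) A
    = ennreal (R powr (real DIM('a) + a - 2)) * emeasure (weighted_lborel a) {x. R *\<^sub>R x \<in> A}"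
proof -
  have [measurable]: "{x. R *\<^sub>R x \<in> A} \<in> sets borel" by measurable
  have "emeasure (weighted_lborel a) A = (\<integral>\<^sup>+x. ennreal (norm x powr (a - 2)) * indicator A x \<partial>lborel)"
    by (simp add: weighted_lborel_def emeasure_density)
  also have "\<dots> = ennreal (R ^ DIM('a)) *
      (\<integral>\<^sup>+x. ennreal (norm (R *\<^sub>R x) powr (a - 2)) * indicator A (R *\<^sub>R x) \<partial>lborel)"
    by (rule nn_integral_lborel_scaleR) (use R in measurable)
  also have "(\<integral>\<^sup>+x. ennreal (norm (R *\<^sub>R x) powr (a - 2)) * indicator A (R *\<^sub>R x) \<partial>lborel)
     = (\<integral>\<^sup>+x. ennreal (R powr (a - 2)) * (ennreal (norm x powr (a - 2)) * indicator {x. R *\<^sub>R x \<in> A} x) \<partial>lborel)"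
    using R by (intro nn_integral_cong) (auto simp: powr_mult ennreal_mult' indicator_def)
  also have "\<dots> = ennreal (R powr (a - 2)) * emeasure (weighted_lborel a) {x. R *\<^sub>R x \<in> A}"
    by (simp add: weighted_lborel_def emeasure_density nn_integral_cmult)
  also have "ennreal (R ^ DIM('a)) * (ennreal (R powr (a - 2)) * emeasure (weighted_lborel a) {x. R *\<^sub>R x \<in> A})
     = ennreal (R powr (real DIM('a) + a - 2)) * emeasure (weighted_lborel a) {x. R *\<^sub>R x \<in> A}"
    using R by (simp add: mult.assoc[symmetric] ennreal_mult'[symmetric] powr_realpow[symmetric] powr_add[symmetric])
       (simp add: algebra_simps)
  finally show ?thesis .
qed

definition punctured_ball :: "'a::euclidean_space set" where
  "punctured_ball = {x. 0 < norm x \<and> norm x \<le> 1}"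

lemma punctured_ball_borel [measurable]: "punctured_ball \<in> sets borel"
  unfolding punctured_ball_def by measurable

text \<open>Dyadic shells are scaled copies of one shell, so their measures form a geometric series
  of ratio 2^(-(N + a - 2)). Its convergence is exactly the condition a > 2 - N.\<close>

lemma emeasure_weighted_punctured_ball_finite:
  assumes "2 - real DIM('a) < a"
  shows "emeasure (weighted_lborel a) (punctured_ball :: 'a::euclidean_space set) < \<infinity>"
proof -
  define d where "d = real DIM('a) + a - 2"
  have d: "d > 0" using assms by (simp add: d_def)
  define s where "s = (1/2::real) powr d"
  have s: "0 < s" "s < 1"
    using d by (simp_all add: s_def powr01_less_one)
  define S where "S = (\<lambda>k::nat. {x::'a. (1/2) ^ Suc k < norm x \<and> norm x \<le> (1/2) ^ k})"
  have [measurable]: "S k \<in> sets borel" for k unfolding S_def by measurable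
  have S0: "emeasure (weighted_lborel a) (S 0) < \<infinity>"
  proof -
    have "emeasure (weighted_lborel a) (S 0) = (\<integral>\<^sup>+x. ennreal (norm x powr (a - 2)) * indicator (S 0) x \<partial>lborel)"
      by (simp add: weighted_lborel_def emeasure_density)
    also have "\<dots> \<le> (\<integral>\<^sup>+x. ennreal (max 1 ((1/2) powr (a - 2))) * indicator (cball (0::'a) 1) x \<partial>lborel)"
    proof (intro nn_integral_mono)
      fix x :: 'a
      have "norm x powr (a - 2) \<le> max 1 ((1/2) powr (a - 2))" if "1/2 < norm x" "norm x \<le> 1"
      proof (cases "a \<ge> 2")
        case True
        then have "norm x powr (a - 2) \<le> 1 powr (a - 2)" using that by (intro powr_mono2) auto
        then show ?thesis by simp
      next
        case False
        then have "norm x powr (a - 2) \<le> (1/2) powr (a - 2)" using that by (intro powr_mono2') auto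
        then show ?thesis by simp
      qed
      then show "ennreal (norm x powr (a - 2)) * indicator (S 0) x
          \<le> ennreal (max 1 ((1/2) powr (a - 2))) * indicator (cball (0::'a) 1) x"
        by (auto simp: S_def indicator_def intro!: ennreal_leI)
    qed
    also have "\<dots> < \<infinity>"
      using emeasure_compact_finite[of "cball (0::'a) 1"]
      by (subst nn_integral_cmult_indicator) (simp_all add: ennreal_mult_less_top)
    finally show ?thesis .
  qed
  have Sk: "emeasure (weighted_lborel a) (S k) = ennreal (s ^ k) * emeasure (weighted_lborel a) (S 0)" for k
  proof -
    have "{x. (1/2::real) ^ k *\<^sub>R x \<in> S k} = S 0"
      by (auto simp: S_def field_simps)
    moreover have "((1/2::real) ^ k) powr d = s ^ k"
      by (simp add: s_def powr_realpow[symmetric] powr_powr mult.commute)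
    ultimately show ?thesis
      using emeasure_weighted_lborel_scaleR[of "S k" "(1/2) ^ k" a] by (simp add: d_def)
  qed
  have "punctured_ball \<subseteq> (\<Union>k. S k)"
  proof
    fix x :: 'a assume "x \<in> punctured_ball"
    then have x: "0 < norm x" "norm x \<le> 1" by (auto simp: punctured_ball_def)
    obtain n where n: "(1/2::real) ^ n < norm x"
      using real_arch_pow_inv[of "norm x" "1/2"] x by auto
    \<comment> \<open>The least m with 2^(-m) < |x| is positive, and x lies in the shell of index m
      - 1.\<close>
    define m where "m = (LEAST n. (1/2::real) ^ n < norm x)"
    have m: "(1/2::real) ^ m < norm x" unfolding m_def using n by (rule LeastI)
    with x have "m \<noteq> 0" by (intro notI) simp
    then obtain k where k: "m = Suc k" by (cases m) auto
    then have "\<not> (1/2::real) ^ k < norm x"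
      using not_less_Least[of k "\<lambda>n. (1/2::real) ^ n < norm x"] m_def by simp
    then show "x \<in> (\<Union>k. S k)" using m k by (auto simp: S_def)
  qed
  then have "emeasure (weighted_lborel a) (punctured_ball :: 'a set) \<le> emeasure (weighted_lborel a) (\<Union>k. S k)"
    by (intro emeasure_mono) auto
  also have "\<dots> \<le> (\<Sum>k. emeasure (weighted_lborel a) (S k))"
    by (intro emeasure_subadditive_countably) auto
  also have "\<dots> = (\<Sum>k. ennreal (s ^ k)) * emeasure (weighted_lborel a) (S 0)"
  proof -
    have "(\<lambda>k. emeasure (weighted_lborel a) (S k)) = (\<lambda>k. ennreal (s ^ k) * emeasure (weighted_lborel a) (S 0))"
      using Sk by blast
    then show ?thesis by simp
  qed
  also have "(\<Sum>k. ennreal (s ^ k)) = ennreal (\<Sum>k. s ^ k)"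
    using s by (intro suminf_ennreal2) auto
  also have "\<dots> * emeasure (weighted_lborel a) (S 0) < \<infinity>"
    using S0 by (simp add: ennreal_mult_less_top)
  finally show ?thesis .
qed

lemma emeasure_weighted_punctured_ball_pos:
  "emeasure (weighted_lborel a) (punctured_ball :: 'a::euclidean_space set) > 0"
proof (rule ccontr)
  assume "\<not> ?thesis"
  then have "(\<integral>\<^sup>+x. ennreal (norm x powr (a - 2)) * indicator (punctured_ball :: 'a set) x \<partial>lborel) = 0"
    by (simp add: weighted_lborel_def emeasure_density)
  then have "AE x in lborel. ennreal (norm x powr (a - 2)) * indicator (punctured_ball :: 'a set) x = 0"
    by (subst (asm) nn_integral_0_iff_AE) auto
  moreover have "AE x in lborel. x \<noteq> (0::'a)"
    by (rule AE_lborel_singleton)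
  ultimately have "AE x in lborel. x \<notin> ball (0::'a) 1"
    by eventually_elim (auto simp: punctured_ball_def indicator_def split: if_splits)
  then have "emeasure lborel (ball (0::'a) 1) = 0"
    by (subst (asm) AE_iff_measurable[OF _ refl]) (auto simp: ball_def)
  then show False
    using content_ball_pos[of 1 "0::'a"] by (simp add: measure_def)
qed

text \<open>Radial projection of the normalized weighted measure of the punctured unit ball: the
  uniform probability measure on the unit sphere, carried by the whole space. In this form the polar
  decomposition reduces to the homogeneity of the weight, and rotation invariance to that of
  Lebesgue measure.\<close>

definition sphere_measure :: "real \<Rightarrow> 'a::euclidean_space measure" where
  "sphere_measure a = distr (uniform_measure (weighted_lborel a) punctured_ball) borel sgn"

lemma sgn_borel [measurable]: "(sgn :: 'a::euclidean_space \<Rightarrow> 'a) \<in> borel_measurable borel"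
  unfolding sgn_div_norm[abs_def] by measurable

lemma sets_sphere_measure [measurable_cong, simp]: "sets (sphere_measure a) = sets borel"
  by (simp add: sphere_measure_def)

lemma space_sphere_measure [simp]: "space (sphere_measure a) = UNIV"
  by (simp add: sphere_measure_def)

lemma emeasure_sphere_measure:
  fixes B :: "'a::euclidean_space set"
  assumes [measurable]: "B \<in> sets borel"
  shows "emeasure (sphere_measure a) B =
    emeasure (weighted_lborel a) (punctured_ball \<inter> sgn -` B) / emeasure (weighted_lborel a) (punctured_ball :: 'a::euclidean_space set)"
proof -
  have [measurable]: "sgn -` B \<in> sets borel"
    using measurable_sets[OF sgn_borel assms] by simp
  show ?thesis
    by (simp add: sphere_measure_def emeasure_distr)
qed

lemma emeasure_sphere_measure_space:
  assumes "2 - real DIM('a) < a"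
  shows "emeasure (sphere_measure a :: 'a::euclidean_space measure) UNIV = 1"
  using emeasure_weighted_punctured_ball_finite[OF assms] emeasure_weighted_punctured_ball_pos[of a, where 'a = 'a]
  by (simp add: emeasure_sphere_measure ennreal_divide_self)

lemma AE_sphere_measure: "AE x in sphere_measure a. norm (x :: 'a::euclidean_space) = 1"
proof -
  have "AE x in uniform_measure (weighted_lborel a) punctured_ball. norm (sgn x :: 'a) = 1"
    by (rule AE_uniform_measureI) (auto simp: punctured_ball_def norm_sgn)
  then show ?thesis
    unfolding sphere_measure_def by (subst AE_distr_iff) auto
qed

lemma nn_integral_powr_atMost:
  assumes "c > 0" "Q \<ge> 0"
  shows "(\<integral>\<^sup>+q. ennreal (indicator {0<..} q * q powr (c - 1)) * indicator {..Q} q \<partial>lborel) = ennreal (Q powr c / c)"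
proof -
  have *: "((\<lambda>x. x powr (c - 1)) has_integral (Q powr (c - 1 + 1) / (c - 1 + 1))) {0..Q}"
    using assms by (intro has_integral_powr_from_0) auto
  have "(\<integral>\<^sup>+q. ennreal (indicator {0<..} q * q powr (c - 1)) * indicator {..Q} q \<partial>lborel)
      = (\<integral>\<^sup>+q. ennreal (q powr (c - 1)) * indicator {0..Q} q \<partial>lborel)"
    by (intro nn_integral_cong) (auto simp: indicator_def)
  also have "\<dots> = ennreal (Q powr c / c)"
    using nn_integral_has_integral_lebesgue'[OF _ *] by simp
  finally show ?thesis .
qed

section \<open>The decomposition into radial and spherical parts\<close>

definition radial_measure :: "real \<Rightarrow> real measure" where
  "radial_measure c = density lborel (\<lambda>q. ennreal (indicator {0<..} q * q powr (c - 1)))"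

lemma sets_radial_measure [measurable_cong, simp]: "sets (radial_measure c) = sets borel"
  by (simp add: radial_measure_def)

lemma space_radial_measure [simp]: "space (radial_measure c) = UNIV"
  by (simp add: radial_measure_def)

lemma emeasure_radial_measure_atMost:
  assumes "c > 0" "Q \<ge> 0"
  shows "emeasure (radial_measure c) {..Q} = ennreal (Q powr c / c)"
  using nn_integral_powr_atMost[OF assms] by (simp add: radial_measure_def emeasure_density)

text \<open>For fixed \<open>B\<close> both sides are measures in \<open>A\<close>, so half-lines
  suffice. For a half-line the set on the left is, up to the null set of the origin, a dilate of the
  part of the unit ball lying over \<open>B\<close>.\<close>

lemma weighted_lborel_polar_emeasure:
  fixes B :: "'a::euclidean_space set"
  assumes a: "a > 0" "2 - real DIM('a) < a" and [measurable]: "A \<in> sets borel" "B \<in> sets borel"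
  defines "c \<equiv> (real DIM('a) + a - 2) / a"
  defines "K \<equiv> ennreal (c * a powr c) * emeasure (weighted_lborel a) (punctured_ball :: 'a set)"
  shows "emeasure (weighted_lborel a) {x. norm x powr a / a \<in> A \<and> sgn x \<in> B}
     = K * emeasure (radial_measure c) A * emeasure (sphere_measure a) B"
proof -
  have c: "c > 0" using a by (simp add: c_def)
  let ?M = "weighted_lborel a :: 'a measure"
  have [measurable]: "sgn -` B \<in> sets borel"
    using measurable_sets[OF sgn_borel \<open>B \<in> sets borel\<close>] by simp
  define N1 where "N1 = distr (density ?M (indicator (sgn -` B))) borel (\<lambda>x. norm x powr a / a)"
  define N2 where "N2 = scale_measure (K * emeasure (sphere_measure a) B) (radial_measure c)"
  have [measurable]: "(\<lambda>x::'a. norm x powr a / a) -` A \<in> sets borel" if [measurable]: "A \<in> sets borel" for A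
    unfolding vimage_def by measurable
  have N1: "emeasure N1 A = emeasure ?M {x. norm x powr a / a \<in> A \<and> sgn x \<in> B}" if [measurable]: "A \<in> sets borel" for A
  proof -
    have "emeasure N1 A = (\<integral>\<^sup>+x. indicator (sgn -` B) x * indicator ((\<lambda>x. norm x powr a / a) -` A) x \<partial>?M)"
      unfolding N1_def by (subst emeasure_distr) (auto simp: emeasure_density)
    also have "\<dots> = (\<integral>\<^sup>+x. indicator {x. norm x powr a / a \<in> A \<and> sgn x \<in> B} x \<partial>?M)"
      by (intro nn_integral_cong) (auto simp: indicator_def)
    also have "\<dots> = emeasure ?M {x. norm x powr a / a \<in> A \<and> sgn x \<in> B}"
      by (rule nn_integral_indicator) measurable
    finally show ?thesis .
  qed
  have N2: "emeasure N2 A = K * emeasure (radial_measure c) A * emeasure (sphere_measure a) B" for A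
    by (simp add: N2_def mult_ac)
  have zero: "emeasure ?M {0} = 0"
    by (simp add: weighted_lborel_def emeasure_density)
  have eq: "emeasure N1 {..Q} = emeasure N2 {..Q}" for Q
  proof (cases "Q > 0")
    case False
    have "{x::'a. norm x powr a / a \<in> {..Q} \<and> sgn x \<in> B} \<subseteq> {0}"
    proof (rule subsetI)
      fix x :: 'a assume "x \<in> {x. norm x powr a / a \<in> {..Q} \<and> sgn x \<in> B}"
      then have "\<not> 0 < norm x powr a / a" using False by auto
      then show "x \<in> {0}" using a by (cases "x = 0") auto
    qed
    from emeasure_eq_0[OF _ zero this] have "emeasure N1 {..Q} = 0"
      by (subst N1) simp_all
    moreover have "emeasure (radial_measure c) {..Q} \<le> emeasure (radial_measure c) {..0}"
      using False by (intro emeasure_mono) auto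
    then have "emeasure (radial_measure c) {..Q} = 0"
      using emeasure_radial_measure_atMost[OF c, of 0] by simp
    ultimately show ?thesis by (simp add: N2)
  next
    case True
    \<comment> \<open>The radius for which |x|^a / a \<le> Q means |x| \<le> R. Since N + a - 2 = a
      c, homogeneity contributes R^(a c) = (a Q)^c.\<close>
    define R where "R = (a * Q) powr (1 / a)"
    have R: "R > 0" using True a by (simp add: R_def)
    have Ra: "norm x powr a / a \<le> Q \<longleftrightarrow> norm x \<le> R" for x :: 'a
    proof -
      have "R powr a = a * Q" using a True by (simp add: R_def powr_powr)
      then have "norm x powr a / a \<le> Q \<longleftrightarrow> norm x powr a \<le> R powr a" using a by (simp add: field_simps)
      also have "\<dots> \<longleftrightarrow> norm x \<le> R"
        using a R powr_mono2[of a "norm x" R] powr_less_mono2[of a R "norm x"] by (cases "norm x \<le> R") auto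
      finally show ?thesis .
    qed
    have "emeasure N1 {..Q} = emeasure ?M {x. norm x \<le> R \<and> sgn x \<in> B}"
      by (simp add: N1 Ra)
    also have "\<dots> = emeasure ?M {x. x \<noteq> 0 \<and> norm x \<le> R \<and> sgn x \<in> B}"
    proof (rule emeasure_eq_AE)
      have "AE x in ?M. x \<noteq> 0"
        unfolding weighted_lborel_def by (subst AE_density) auto
      then show "AE x in ?M. (x \<in> {x. norm x \<le> R \<and> sgn x \<in> B}) = (x \<in> {x. x \<noteq> 0 \<and> norm x \<le> R \<and> sgn x \<in> B})"
        by eventually_elim auto
    qed measurable
    also have "\<dots> = ennreal (R powr (real DIM('a) + a - 2)) *
        emeasure ?M {x. R *\<^sub>R x \<in> {x. x \<noteq> 0 \<and> norm x \<le> R \<and> sgn x \<in> B}}"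
      by (rule emeasure_weighted_lborel_scaleR) (use R in measurable)
    also have "{x. R *\<^sub>R x \<in> {x. x \<noteq> 0 \<and> norm x \<le> R \<and> sgn x \<in> B}} = punctured_ball \<inter> sgn -` B"
      using R by (auto simp: punctured_ball_def sgn_scaleR)
    also have "R powr (real DIM('a) + a - 2) = (a * Q) powr c"
      by (simp add: R_def powr_powr c_def)
    also have "emeasure ?M (punctured_ball \<inter> sgn -` B) = emeasure ?M punctured_ball * emeasure (sphere_measure a) B"
    proof -
      have "m * (y / m) = y" if "m < \<infinity>" "0 < m" for m y :: ennreal
        using that ennreal_mult_divide_eq[of m y] by (simp add: ennreal_times_divide mult.commute)
      then show ?thesis
        using emeasure_weighted_punctured_ball_finite[OF a(2)] emeasure_weighted_punctured_ball_pos[of a, where 'a = 'a]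
        by (simp add: emeasure_sphere_measure)
    qed
    also have "ennreal ((a * Q) powr c) * (emeasure ?M punctured_ball * emeasure (sphere_measure a) B)
        = K * ennreal (Q powr c / c) * emeasure (sphere_measure a) B"
    proof -
      have "(a * Q) powr c = c * a powr c * (Q powr c / c)"
        using a True c by (simp add: powr_mult)
      then have "ennreal ((a * Q) powr c) = ennreal (c * a powr c) * ennreal (Q powr c / c)"
        using c by (simp add: ennreal_mult'[symmetric])
      then show ?thesis by (simp add: K_def mult_ac)
    qed
    finally show ?thesis
      using True by (simp add: N2 emeasure_radial_measure_atMost[OF c])
  qed
  have "N1 = N2"
  proof (rule measure_eqI_real_atMost)
    fix Q
    have "K < \<infinity>" "emeasure (sphere_measure a) B \<le> emeasure (sphere_measure a :: 'a measure) UNIV"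
      using emeasure_weighted_punctured_ball_finite[OF a(2)]
      by (auto simp: K_def ennreal_mult_less_top intro!: emeasure_mono)
    moreover have "emeasure (radial_measure c) {..Q} \<le> emeasure (radial_measure c) {..max 0 Q}"
      by (intro emeasure_mono) auto
    then have "emeasure (radial_measure c) {..Q} < \<infinity>"
      by (rule order.strict_trans1) (simp add: emeasure_radial_measure_atMost[OF c])
    ultimately show "emeasure N1 {..Q} < \<infinity>"
      unfolding eq N2 using emeasure_sphere_measure_space[OF a(2)] 
      by (auto simp: ennreal_mult_less_top intro: order.strict_trans1)
  qed (simp_all add: eq, simp_all add: N1_def N2_def)
  then show ?thesis
    using N1[of A] N2[of A] by simp
qed

text \<open>Normalized so that exp(-q) has integral 1, in agreement with the normalization of
  \<open>deformed_const\<close>.\<close>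

definition gamma_radial :: "real \<Rightarrow> real measure" where
  "gamma_radial c = density lborel (\<lambda>q. ennreal (indicator {0<..} q * q powr (c - 1) / Gamma c))"

lemma sets_gamma_radial [measurable_cong, simp]: "sets (gamma_radial c) = sets borel"
  by (simp add: gamma_radial_def)

lemma space_gamma_radial [simp]: "space (gamma_radial c) = UNIV"
  by (simp add: gamma_radial_def)

lemma emeasure_gamma_radial:
  assumes "c > 0" "A \<in> sets borel"
  shows "emeasure (gamma_radial c) A = ennreal (1 / Gamma c) * emeasure (radial_measure c) A"
proof -
  have "emeasure (gamma_radial c) A
      = (\<integral>\<^sup>+q. ennreal (1 / Gamma c) * (ennreal (indicator {0<..} q * q powr (c - 1)) * indicator A q) \<partial>lborel)"
    unfolding gamma_radial_def using assms
    by (subst emeasure_density)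
       (auto intro!: nn_integral_cong simp: mult.assoc[symmetric] ennreal_mult'[symmetric] Gamma_real_pos less_imp_le)
  also have "\<dots> = ennreal (1 / Gamma c) * emeasure (radial_measure c) A"
    using assms by (subst nn_integral_cmult) (auto simp: radial_measure_def emeasure_density)
  finally show ?thesis .
qed

lemma sigma_finite_gamma_radial:
  assumes "c > 0" shows "sigma_finite_measure (gamma_radial c)"
proof
  show "\<exists>A. countable A \<and> A \<subseteq> sets (gamma_radial c) \<and> \<Union>A = space (gamma_radial c) \<and>
        (\<forall>a\<in>A. emeasure (gamma_radial c) a \<noteq> \<infinity>)"
  proof (intro exI[of _ "range (\<lambda>n::nat. {..real n})"] conjI)
    show "\<Union>(range (\<lambda>n::nat. {..real n})) = space (gamma_radial c)"
      by (auto intro: real_arch_simple)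
  qed (use emeasure_radial_measure_atMost[OF assms] in
      \<open>auto simp: emeasure_gamma_radial[OF assms] ennreal_mult_eq_top_iff\<close>)
qed

definition polar_measure :: "real \<Rightarrow> 'a::euclidean_space measure" where
  "polar_measure a = density lborel (\<lambda>x. ennreal (deformed_const TYPE('a) a * norm x powr (a - 2)))"

text \<open>The radial law of the weighted measure is K q^(c - 1) dq, with \<open>K\<close> the
  product in parentheses. Integrating exp(-q) against it gives K \<Gamma>(c), whose reciprocal is
  \<open>deformed_const\<close>.\<close>

lemma deformed_const_conv:
  fixes a :: real
  assumes a: "a > 0" "2 - real DIM('a::euclidean_space) < a"
  defines "c \<equiv> (real DIM('a) + a - 2) / a"
  shows "ennreal (deformed_const TYPE('a) a) * (ennreal (c * a powr c) *
     emeasure (weighted_lborel a) (punctured_ball :: 'a set)) = ennreal (1 / Gamma c)"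
proof -
  have c: "c > 0" using a by (simp add: c_def)
  define K where "K = enn2real (ennreal (c * a powr c) * emeasure (weighted_lborel a) (punctured_ball :: 'a set))"
  have K: "ennreal (c * a powr c) * emeasure (weighted_lborel a) (punctured_ball :: 'a set) = ennreal K"
    unfolding K_def using emeasure_weighted_punctured_ball_finite[OF a(2)]
    by (intro ennreal_enn2real[symmetric]) (simp add: ennreal_mult_less_top)
  have Kpos: "K > 0"
    unfolding K_def using emeasure_weighted_punctured_ball_finite[OF a(2)] emeasure_weighted_punctured_ball_pos[of a, where 'a = 'a] c a
    by (intro enn2real_positive_iff[THEN iffD2]) (auto simp: ennreal_mult_less_top ennreal_zero_less_mult_iff)
  have rad: "distr (weighted_lborel a :: 'a measure) borel (\<lambda>x. norm x powr a / a) = density lborel (\<lambda>q. ennreal (K * (indicator {0<..} q * q powr (c - 1))))"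
  proof (rule measure_eqI)
    fix A :: "real set" assume "A \<in> sets (distr (weighted_lborel a :: 'a measure) borel (\<lambda>x. norm x powr a / a))"
    then have [measurable]: "A \<in> sets borel" by simp
    have "emeasure (distr (weighted_lborel a :: 'a measure) borel (\<lambda>x. norm x powr a / a)) A
      = emeasure (weighted_lborel a) {x::'a. norm x powr a / a \<in> A \<and> sgn x \<in> UNIV}"
      by (subst emeasure_distr) (auto simp: vimage_def)
    also have "\<dots> = ennreal K * emeasure (radial_measure c) A"
      by (subst weighted_lborel_polar_emeasure[OF a]) (simp_all add: emeasure_sphere_measure_space[OF a(2)] K flip: c_def)
    also have "\<dots> = emeasure (density lborel (\<lambda>q. ennreal (K * (indicator {0<..} q * q powr (c - 1))))) A"
      using Kpos
      by (simp add: emeasure_density radial_measure_def ennreal_mult' mult.assoc nn_integral_cmult)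
    finally show "emeasure (distr (weighted_lborel a :: 'a measure) borel (\<lambda>x. norm x powr a / a)) A
       = emeasure (density lborel (\<lambda>q. ennreal (K * (indicator {0<..} q * q powr (c - 1))))) A" .
  qed simp
  have "(\<integral>\<^sup>+x. ennreal (exp (- (1 / a) * norm x powr a) / norm x powr (2 - a)) \<partial>(lborel :: 'a measure))
     = (\<integral>\<^sup>+x. ennreal (norm x powr (a - 2)) * ennreal (exp (- (norm x powr a / a))) \<partial>(lborel :: 'a measure))"
  proof (intro nn_integral_cong)
    fix x :: 'a
    have "1 / norm x powr (2 - a) = norm x powr (a - 2)"
      using powr_minus_divide[of "norm x" "2 - a"] by simp
    then show "ennreal (exp (- (1 / a) * norm x powr a) / norm x powr (2 - a))
       = ennreal (norm x powr (a - 2)) * ennreal (exp (- (norm x powr a / a)))"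
      by (simp add: ennreal_mult'[symmetric] divide_inverse mult.commute)
  qed
  also have "\<dots> = (\<integral>\<^sup>+x. ennreal (exp (- (norm x powr a / a))) \<partial>(weighted_lborel a :: 'a measure))"
    unfolding weighted_lborel_def by (subst nn_integral_density) auto
  also have "\<dots> = (\<integral>\<^sup>+q. ennreal (exp (- q)) \<partial>(distr (weighted_lborel a :: 'a measure) borel (\<lambda>x. norm x powr a / a)))"
    by (subst nn_integral_distr) auto
  also have "\<dots> = (\<integral>\<^sup>+q. ennreal K * ennreal (indicator {0<..} q * (q powr (c - 1) * exp (- (1 * q)))) \<partial>lborel)"
    unfolding rad using Kpos
    by (subst nn_integral_density) (auto intro!: nn_integral_cong simp: ennreal_mult'[symmetric] mult.assoc)
  also have "\<dots> = ennreal K * ennreal (Gamma c)"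
    using nn_integral_Gamma[OF c zero_less_one] by (subst nn_integral_cmult) auto
  also have "\<dots> = ennreal (K * Gamma c)"
    using Kpos by (simp add: ennreal_mult')
  finally have "(LINT x::'a|lborel. exp (- (1 / a) * norm x powr a) / norm x powr (2 - a)) = K * Gamma c"
    using Kpos Gamma_real_pos[OF c] by (subst integral_eq_nn_integral) auto
  then have "deformed_const TYPE('a) a = 1 / (K * Gamma c)"
    by (simp add: deformed_const_def divide_inverse)
  then show ?thesis
    unfolding K using Kpos Gamma_real_pos[OF c] by (simp add: ennreal_mult'[symmetric])
qed

lemma polar_coordinates:
  fixes a :: real
  assumes a: "a > 0" "2 - real DIM('a::euclidean_space) < a"
  defines "c \<equiv> (real DIM('a) + a - 2) / a"
  shows "distr (polar_measure a :: 'a measure) (borel \<Otimes>\<^sub>M borel) (\<lambda>x. (norm x powr a / a, sgn x))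
    = gamma_radial c \<Otimes>\<^sub>M sphere_measure a"
proof (rule pair_measure_eqI[symmetric])
  have c: "c > 0" using a by (simp add: c_def)
  show "sigma_finite_measure (gamma_radial c)"
    by (rule sigma_finite_gamma_radial[OF c])
  show "sigma_finite_measure (sphere_measure a :: 'a measure)"
    by (intro finite_measure.axioms(1) finite_measureI) (simp add: emeasure_sphere_measure_space[OF a(2)])
  show "sets (gamma_radial c \<Otimes>\<^sub>M (sphere_measure a :: 'a measure)) =
      sets (distr (polar_measure a :: 'a measure) (borel \<Otimes>\<^sub>M borel) (\<lambda>x. (norm x powr a / a, sgn x)))"
    by (simp cong: sets_pair_measure_cong)
  fix A :: "real set" and B :: "'a set"
  assume "A \<in> sets (gamma_radial c)" "B \<in> sets (sphere_measure a)"
  then have [measurable]: "A \<in> sets borel" "B \<in> sets borel" by simp_all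
  have C: "deformed_const TYPE('a) a \<ge> 0"
    unfolding deformed_const_def by (intro inverse_nonnegative_iff_nonnegative[THEN iffD2] integral_nonneg_AE) auto
  have "emeasure (distr (polar_measure a :: 'a measure) (borel \<Otimes>\<^sub>M borel) (\<lambda>x. (norm x powr a / a, sgn x))) (A \<times> B)
     = emeasure (polar_measure a :: 'a measure) {x. norm x powr a / a \<in> A \<and> sgn x \<in> B}"
    by (subst emeasure_distr) (auto simp: polar_measure_def vimage_def)
  also have "\<dots> = (\<integral>\<^sup>+x. ennreal (deformed_const TYPE('a) a) *
      (ennreal (norm x powr (a - 2)) * indicator {x. norm x powr a / a \<in> A \<and> sgn x \<in> B} x) \<partial>(lborel :: 'a measure))"
    unfolding polar_measure_def using C
    by (subst emeasure_density) (auto intro!: nn_integral_cong simp: ennreal_mult' mult.assoc)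
  also have "\<dots> = ennreal (deformed_const TYPE('a) a) *
      emeasure (weighted_lborel a :: 'a measure) {x. norm x powr a / a \<in> A \<and> sgn x \<in> B}"
    by (subst nn_integral_cmult) (auto simp: weighted_lborel_def emeasure_density)
  also have "\<dots> = ennreal (1 / Gamma c) * emeasure (radial_measure c) A * emeasure (sphere_measure a) B"
    by (subst weighted_lborel_polar_emeasure[OF a])
       (simp_all only: c_def[symmetric] deformed_const_conv[OF a, folded c_def, symmetric] mult.assoc
         \<open>A \<in> sets borel\<close> \<open>B \<in> sets borel\<close>)
  also have "\<dots> = emeasure (gamma_radial c) A * emeasure (sphere_measure a) B"
    by (simp add: emeasure_gamma_radial[OF c])
  finally show "emeasure (gamma_radial c) A * emeasure (sphere_measure a) B =
    emeasure (distr (polar_measure a :: 'a measure) (borel \<Otimes>\<^sub>M borel) (\<lambda>x. (norm x powr a / a, sgn x))) (A \<times> B)"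
    by simp
qed

text \<open>Uniqueness of Haar measure: the image measure is translation invariant, and comparing both
  measures through the unit ball, which the map preserves, fixes the constant.\<close>

lemma distr_lborel_orthogonal:
  fixes f :: "'a::euclidean_space \<Rightarrow> 'a"
  assumes f: "orthogonal_transformation f"
  shows "distr lborel borel f = lborel"
proof (rule measure_eqI)
  have lin: "linear f" by (rule orthogonal_transformation_linear[OF f])
  have [measurable]: "f \<in> borel_measurable borel"
    using lin by (intro borel_measurable_continuous_onI linear_continuous_on) (simp add: linear_conv_bounded_linear[symmetric])
  define M where "M = distr lborel borel f"
  have [measurable_cong, simp]: "sets M = sets borel" and [simp]: "space M = UNIV" by (simp_all add: M_def)
  have M_plus: "distr M borel ((+) c) = M" for c
  proof -
    obtain z where z: "f z = c" using orthogonal_transformation_surj[OF f] by (metis surjD)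
    have "distr M borel ((+) c) = distr lborel borel (\<lambda>x. c + f x)"
      unfolding M_def by (subst distr_distr) (auto simp: comp_def)
    also have "(\<lambda>x. c + f x) = f \<circ> (+) z"
      using lin by (auto simp: z[symmetric] linear_add)
    also have "distr lborel borel \<dots> = distr (distr lborel borel ((+) z)) borel f"
      by (subst distr_distr) auto
    finally show ?thesis by (simp add: lborel_distr_plus M_def)
  qed
  define A where "A = ball (0::'a) 1"
  have [measurable]: "A \<in> sets borel" by (simp add: A_def)
  have MA: "emeasure M A = emeasure lborel A"
  proof -
    have "f -` A = A" using f by (auto simp: A_def orthogonal_transformation)
    then show ?thesis by (simp add: M_def emeasure_distr)
  qed
  have A: "emeasure lborel A \<noteq> 0" "emeasure lborel A \<noteq> \<infinity>"
    using content_ball_pos[of 1 "0::'a"] emeasure_lborel_ball_finite[of "0::'a" 1]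
    by (auto simp: A_def measure_def)
  interpret M: sigma_finite_measure M
  proof
    show "\<exists>\<A>. countable \<A> \<and> \<A> \<subseteq> sets M \<and> \<Union>\<A> = space M \<and> (\<forall>a\<in>\<A>. emeasure M a \<noteq> \<infinity>)"
    proof (intro exI[of _ "range (\<lambda>n::nat. ball (0::'a) (real n))"] conjI)
      show "\<Union>(range (\<lambda>n::nat. ball (0::'a) (real n))) = space M"
        by (auto intro: reals_Archimedean2)
      have "f -` ball 0 (real n) = ball 0 (real n)" for n
        using f by (auto simp: orthogonal_transformation)
      then show "\<forall>a\<in>range (\<lambda>n::nat. ball (0::'a) (real n)). emeasure M a \<noteq> \<infinity>"
        using emeasure_lborel_ball_finite[of "0::'a"] by (auto simp: M_def emeasure_distr less_top[symmetric])
    qed auto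
  qed
  interpret pair_sigma_finite lborel M ..
  fix B assume "B \<in> sets (distr lborel borel f)"
  then have [measurable]: "B \<in> sets borel" by simp
  have "emeasure lborel A * emeasure M B = (\<integral>\<^sup>+x. indicator A x * (\<integral>\<^sup>+y. indicator B y \<partial>M) \<partial>lborel)"
    by (subst nn_integral_multc) auto
  also have "\<dots> = (\<integral>\<^sup>+x. (\<integral>\<^sup>+y. indicator A x * indicator B (x + y) \<partial>M) \<partial>lborel)"
  proof (intro nn_integral_cong)
    fix x :: 'a
    have "(\<integral>\<^sup>+y. indicator B y \<partial>M) = (\<integral>\<^sup>+y. indicator B y \<partial>(distr M borel ((+) x)))"
      by (simp only: M_plus)
    also have "\<dots> = (\<integral>\<^sup>+y. indicator B (x + y) \<partial>M)"
      by (subst nn_integral_distr) auto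
    finally show "indicator A x * (\<integral>\<^sup>+y. indicator B y \<partial>M) = (\<integral>\<^sup>+y. indicator A x * indicator B (x + y) \<partial>M)"
      by (simp add: nn_integral_cmult)
  qed
  also have "\<dots> = (\<integral>\<^sup>+y. (\<integral>\<^sup>+x. indicator A x * indicator B (x + y) \<partial>lborel) \<partial>M)"
    by (rule Fubini'[symmetric]) measurable
  also have "\<dots> = (\<integral>\<^sup>+y. (\<integral>\<^sup>+x. indicator A (x - y) * indicator B x \<partial>lborel) \<partial>M)"
  proof (rule nn_integral_cong)
    fix y :: 'a
    have "(\<integral>\<^sup>+x. indicator A (x - y) * indicator B x \<partial>lborel)
        = (\<integral>\<^sup>+x. indicator A (x - y) * indicator B x \<partial>(distr lborel borel ((+) y)))"
      by (simp only: lborel_distr_plus)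
    also have "\<dots> = (\<integral>\<^sup>+x. indicator A x * indicator B (x + y) \<partial>lborel)"
      by (subst nn_integral_distr) (auto simp: add.commute)
    finally show "(\<integral>\<^sup>+x. indicator A x * indicator B (x + y) \<partial>lborel) = (\<integral>\<^sup>+x. indicator A (x - y) * indicator B x \<partial>lborel)" ..
  qed
  also have "\<dots> = (\<integral>\<^sup>+x. (\<integral>\<^sup>+y. indicator A (x - y) * indicator B x \<partial>M) \<partial>lborel)"
    by (rule Fubini') measurable
  also have "\<dots> = (\<integral>\<^sup>+x. emeasure M A * indicator B x \<partial>lborel)"
  proof (intro nn_integral_cong)
    fix x :: 'a
    have "(\<integral>\<^sup>+y. indicator A (x - y) \<partial>M) = (\<integral>\<^sup>+y. indicator A (x - y) \<partial>(distr M borel ((+) x)))"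
      by (simp only: M_plus)
    also have "\<dots> = (\<integral>\<^sup>+y. indicator A y \<partial>M)"
    proof -
      have "indicator A (x - (x + y)) = (indicator A y :: ennreal)" for y
        by (simp add: A_def indicator_def)
      then show ?thesis by (subst nn_integral_distr) simp_all
    qed
    also have "\<dots> = emeasure M A"
      by (rule nn_integral_indicator) simp
    finally show "(\<integral>\<^sup>+y. indicator A (x - y) * indicator B x \<partial>M) = emeasure M A * indicator B x"
      by (simp add: nn_integral_multc)
  qed
  also have "\<dots> = emeasure M A * emeasure lborel B"
    by (subst nn_integral_cmult) auto
  finally have "emeasure lborel A * emeasure M B = emeasure lborel A * emeasure lborel B"
    by (simp add: MA)
  then show "emeasure (distr lborel borel f) B = emeasure lborel B"
    using A by (simp add: M_def[symmetric] ennreal_mult_cancel_left)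
qed simp

text \<open>An orthogonal map commutes with \<open>sgn\<close> and preserves the norm, so the
  invariance of Lebesgue measure passes to the weighted ball and to its projection.\<close>

lemma distr_sphere_measure_orthogonal:
  fixes f :: "'a::euclidean_space \<Rightarrow> 'a"
  assumes f: "orthogonal_transformation f"
  shows "distr (sphere_measure a) borel f = sphere_measure a"
proof (rule measure_eqI)
  have [measurable]: "f \<in> borel_measurable borel"
    using f by (intro borel_measurable_continuous_onI linear_continuous_on) (simp add: orthogonal_transformation_linear linear_conv_bounded_linear[symmetric])
  have nf: "norm (f x) = norm x" for x
    using f by (simp add: orthogonal_transformation)
  have sf: "sgn (f x) = f (sgn x)" for x
    using orthogonal_transformation_linear[OF f] by (simp add: sgn_div_norm nf linear_scale)
  fix B assume "B \<in> sets (distr (sphere_measure a) borel f)"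
  then have [measurable]: "B \<in> sets borel" by simp
  have [measurable]: "f -` B \<in> sets borel" "sgn -` B \<in> sets borel" if "B \<in> sets borel"
    for B :: "'a set"
    using measurable_sets[of f borel borel B] measurable_sets[of sgn borel borel B] that by simp_all
  have "emeasure (weighted_lborel a) (punctured_ball \<inter> sgn -` (f -` B))
     = (\<integral>\<^sup>+x. ennreal (norm x powr (a - 2)) * indicator (punctured_ball \<inter> sgn -` (f -` B)) x \<partial>lborel)"
    by (simp add: weighted_lborel_def emeasure_density)
  also have "\<dots> = (\<integral>\<^sup>+x. ennreal (norm (f x) powr (a - 2)) * indicator (punctured_ball \<inter> sgn -` B) (f x) \<partial>lborel)"
  proof -
    have "f x = 0 \<longleftrightarrow> x = 0" for x using nf[of x] by (metis norm_eq_zero)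
    then show ?thesis
      by (intro nn_integral_cong) (auto simp: nf indicator_def punctured_ball_def sf)
  qed
  also have "\<dots> = (\<integral>\<^sup>+x. ennreal (norm x powr (a - 2)) * indicator (punctured_ball \<inter> sgn -` B) x \<partial>(distr lborel borel f))"
    by (subst nn_integral_distr) auto
  also have "\<dots> = emeasure (weighted_lborel a) (punctured_ball \<inter> sgn -` B)"
    by (simp add: distr_lborel_orthogonal[OF f] weighted_lborel_def emeasure_density)
  finally show "emeasure (distr (sphere_measure a) borel f) B = emeasure (sphere_measure a) B"
    by (subst emeasure_distr) (auto simp: emeasure_sphere_measure)
qed simp

section \<open>Rotations and the spherical Laplacian\<close>

lemma Ck_on_cong:
  assumes "open S" "\<And>x. x \<in> S \<Longrightarrow> f x = g x" "Ck_on k f S"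
  shows "Ck_on k g S"
  using assms(2,3)
proof (induction k arbitrary: f g)
  case 0
  then show ?case by (simp cong: continuous_on_cong)
next
  case (Suc k)
  \<comment> \<open>On an open set the derivative depends only on nearby values, so the one of f
    serves for g. This is what later allows explicit product rule formulas to stand for
    \<open>frechet_derivative\<close>.\<close>
  have D: "(g has_derivative frechet_derivative f (at x)) (at x)" if "x \<in> S" for x
  proof (rule has_derivative_transform_within_open[OF _ \<open>open S\<close> that])
    show "(f has_derivative frechet_derivative f (at x)) (at x)"
      using Suc.prems(2) that by (simp add: frechet_derivative_works)
  qed (use Suc.prems in auto)
  have "g differentiable (at x)" if "x \<in> S" for x
    using D[OF that] by (auto simp: differentiable_def)
  moreover have "Ck_on k (\<lambda>x. frechet_derivative g (at x) v) S" for v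
  proof (rule Suc.IH)
    show "Ck_on k (\<lambda>x. frechet_derivative f (at x) v) S" using Suc.prems by simp
    show "frechet_derivative f (at x) v = frechet_derivative g (at x) v" if "x \<in> S" for x
      using frechet_derivative_at[OF D[OF that]] by simp
  qed
  ultimately show ?case by simp
qed

lemma Ck_on_Suc_imp: "Ck_on (Suc k) f S \<Longrightarrow> Ck_on k f S"
proof (induction k arbitrary: f)
  case 0
  then show ?case
    by (auto intro!: continuous_at_imp_continuous_on differentiable_imp_continuous_within)
next
  case (Suc k)
  then show ?case by (metis Ck_on.simps(2))
qed

lemma Ck_on_add:
  assumes "open S" "Ck_on k f S" "Ck_on k g S"
  shows "Ck_on k (\<lambda>x. f x + g x) S"
  using assms(2,3)
proof (induction k arbitrary: f g)
  case 0
  then show ?case by (auto intro: continuous_on_add)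
next
  case (Suc k)
  have "Ck_on k (\<lambda>x. frechet_derivative (\<lambda>x. f x + g x) (at x) v) S" for v
  proof (rule Ck_on_cong[OF \<open>open S\<close>])
    show "Ck_on k (\<lambda>x. frechet_derivative f (at x) v + frechet_derivative g (at x) v) S"
      using Suc by simp
    fix x assume "x \<in> S"
    then have "((\<lambda>x. f x + g x) has_derivative (\<lambda>v. frechet_derivative f (at x) v + frechet_derivative g (at x) v)) (at x)"
      using Suc.prems by (intro has_derivative_add) (simp_all add: frechet_derivative_works)
    then show "frechet_derivative f (at x) v + frechet_derivative g (at x) v = frechet_derivative (\<lambda>x. f x + g x) (at x) v"
      using frechet_derivative_at by metis
  qed
  then show ?case using Suc.prems by auto
qed

lemma Ck_on_scaleR:
  assumes "open S" "Ck_on k f S"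
  shows "Ck_on k (\<lambda>x. c *\<^sub>R f x) S"
  using assms(2)
proof (induction k arbitrary: f)
  case 0
  then show ?case by (auto intro: continuous_intros)
next
  case (Suc k)
  have D: "((\<lambda>x. c *\<^sub>R f x) has_derivative (\<lambda>v. c *\<^sub>R frechet_derivative f (at x) v)) (at x)" if "x \<in> S" for x
    using Suc.prems that by (intro has_derivative_scaleR_right) (simp_all add: frechet_derivative_works)
  have "Ck_on k (\<lambda>x. frechet_derivative (\<lambda>x. c *\<^sub>R f x) (at x) v) S" for v
  proof (rule Ck_on_cong[OF \<open>open S\<close>])
    show "Ck_on k (\<lambda>x. c *\<^sub>R frechet_derivative f (at x) v) S"
      using Suc by simp
    show "c *\<^sub>R frechet_derivative f (at x) v = frechet_derivative (\<lambda>x. c *\<^sub>R f x) (at x) v" if "x \<in> S" for x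
      using frechet_derivative_at[OF D[OF that]] by metis
  qed
  then show ?case using D by (auto simp: differentiable_def)
qed

text \<open>Rotation fields have linear coefficients, so products with linear functions are the ones
  that occur. The product rule leaves a term with f itself, which needs one degree of smoothness
  less.\<close>

lemma Ck_on_inner_scaleR:
  fixes f :: "'a::euclidean_space \<Rightarrow> 'b::real_normed_vector"
  assumes "open S" "Ck_on k f S"
  shows "Ck_on k (\<lambda>x. (x \<bullet> c) *\<^sub>R f x) S"
  using assms(2)
proof (induction k arbitrary: f)
  case 0
  then show ?case by (simp, intro continuous_intros)
next
  case (Suc k)
  have D: "((\<lambda>x. (x \<bullet> c) *\<^sub>R f x) has_derivative
      (\<lambda>v. (x \<bullet> c) *\<^sub>R frechet_derivative f (at x) v + (v \<bullet> c) *\<^sub>R f x)) (at x)" if "x \<in> S" for x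
    using Suc.prems that
    by (intro has_derivative_scaleR has_derivative_inner_left has_derivative_ident) (simp_all add: frechet_derivative_works)
  have "Ck_on k (\<lambda>x. frechet_derivative (\<lambda>x. (x \<bullet> c) *\<^sub>R f x) (at x) v) S" for v
  proof (rule Ck_on_cong[OF \<open>open S\<close>])
    show "Ck_on k (\<lambda>x. (x \<bullet> c) *\<^sub>R frechet_derivative f (at x) v + (v \<bullet> c) *\<^sub>R f x) S"
      using Suc Ck_on_Suc_imp[OF Suc.prems] by (intro Ck_on_add Ck_on_scaleR assms(1)) simp_all
    show "(x \<bullet> c) *\<^sub>R frechet_derivative f (at x) v + (v \<bullet> c) *\<^sub>R f x
        = frechet_derivative (\<lambda>x. (x \<bullet> c) *\<^sub>R f x) (at x) v" if "x \<in> S" for x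
      using frechet_derivative_at[OF D[OF that]] by metis
  qed
  then show ?case using D by (auto simp: differentiable_def)
qed

text \<open>The infinitesimal rotation in the plane of the coordinates i and j.\<close>

definition rot_field :: "'n \<Rightarrow> 'n \<Rightarrow> real ^ 'n \<Rightarrow> real ^ 'n" where
  "rot_field i j x = (x $ i) *\<^sub>R axis j 1 - (x $ j) *\<^sub>R axis i 1"

definition rot_deriv :: "'n \<Rightarrow> 'n \<Rightarrow> (real ^ 'n \<Rightarrow> 'b::real_normed_vector) \<Rightarrow> real ^ 'n \<Rightarrow> 'b" where
  "rot_deriv i j f x = frechet_derivative f (at x) (rot_field i j x)"

text \<open>The sum runs over ordered pairs and counts every coordinate plane twice. It is therefore
  twice the Laplace-Beltrami operator of the unit sphere, acting on each sphere about the origin,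
  with eigenvalues -2 m (m + N - 2).\<close>

definition sphere_laplacian :: "(real ^ 'n \<Rightarrow> 'b::real_normed_vector) \<Rightarrow> real ^ 'n \<Rightarrow> 'b" where
  "sphere_laplacian f x = (\<Sum>i\<in>UNIV. \<Sum>j\<in>UNIV. rot_deriv i j (rot_deriv i j f) x)"

lemma Ck_on_zero: "Ck_on k (\<lambda>x. 0) S"
proof (induction k)
  case (Suc k)
  have "frechet_derivative (\<lambda>x. 0) (at x) = (\<lambda>v. 0)" for x
    by (metis frechet_derivative_const)
  then show ?case using Suc by simp
qed simp

lemma Ck_on_sum:
  assumes "open S" "finite I" "\<And>i. i \<in> I \<Longrightarrow> Ck_on k (f i) S"
  shows "Ck_on k (\<lambda>x. \<Sum>i\<in>I. f i x) S"
  using assms(2,3) by (induction I rule: finite_induct) (auto intro: Ck_on_add[OF assms(1)] Ck_on_zero)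

lemma Cinfinity_on_imp:
  assumes "Cinfinity_on f S"
  shows "x \<in> S \<Longrightarrow> (f has_derivative frechet_derivative f (at x)) (at x)"
    and "Cinfinity_on (\<lambda>x. frechet_derivative f (at x) v) S"
    and "continuous_on S f"
proof -
  have *: "Ck_on (Suc k) f S" and 0: "Ck_on 0 f S" for k
    using assms unfolding Cinfinity_on_def by blast+
  show "x \<in> S \<Longrightarrow> (f has_derivative frechet_derivative f (at x)) (at x)"
    using *[of 0] by (auto simp: frechet_derivative_works)
  show "Cinfinity_on (\<lambda>x. frechet_derivative f (at x) v) S"
    unfolding Cinfinity_on_def using * by simp
  show "continuous_on S f"
    using 0 by simp
qed

lemma Cinfinity_on_rot_deriv:
  fixes f :: "real ^ 'n \<Rightarrow> 'b::real_normed_vector"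
  assumes "open S" "Cinfinity_on f S"
  shows "Cinfinity_on (rot_deriv i j f) S"
  unfolding Cinfinity_on_def
proof
  fix k
  show "Ck_on k (rot_deriv i j f) S"
  proof (rule Ck_on_cong[OF assms(1)])
    show "Ck_on k (\<lambda>x. (x \<bullet> axis i 1) *\<^sub>R frechet_derivative f (at x) (axis j 1)
        + (-1) *\<^sub>R ((x \<bullet> axis j 1) *\<^sub>R frechet_derivative f (at x) (axis i 1))) S"
      using Cinfinity_on_imp(2)[OF assms(2)] unfolding Cinfinity_on_def
      by (intro Ck_on_add Ck_on_scaleR Ck_on_inner_scaleR assms(1)) auto
    fix x assume "x \<in> S"
    then have "linear (frechet_derivative f (at x))"
      using Cinfinity_on_imp(1)[OF assms(2)] has_derivative_linear by blast
    then show "(x \<bullet> axis i 1) *\<^sub>R frechet_derivative f (at x) (axis j 1)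
        + (-1) *\<^sub>R ((x \<bullet> axis j 1) *\<^sub>R frechet_derivative f (at x) (axis i 1)) = rot_deriv i j f x"
      by (simp add: rot_deriv_def rot_field_def linear_diff linear_scale inner_axis)
  qed
qed

lemma Cinfinity_on_sphere_laplacian:
  fixes f :: "real ^ 'n \<Rightarrow> 'b::real_normed_vector"
  assumes "open S" "Cinfinity_on f S"
  shows "Cinfinity_on (sphere_laplacian f) S"
proof -
  have "Ck_on k (rot_deriv i j (rot_deriv i j f)) S" for k i j
    using Cinfinity_on_rot_deriv[OF assms(1) Cinfinity_on_rot_deriv[OF assms]] by (simp add: Cinfinity_on_def)
  then have "Ck_on k (\<lambda>x. \<Sum>i\<in>UNIV. \<Sum>j\<in>UNIV. rot_deriv i j (rot_deriv i j f) x) S" for k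
    by (intro Ck_on_sum assms(1)) simp_all
  then show ?thesis by (simp add: Cinfinity_on_def sphere_laplacian_def[abs_def])
qed

text \<open>For i \<noteq> j this is the flow of \<open>rot_field\<close>, the rotation by \<theta>.
  Writing it as the identity plus a correction along two axes avoids a case distinction over
  coordinates.\<close>

definition plane_rot :: "'n \<Rightarrow> 'n \<Rightarrow> real \<Rightarrow> real ^ 'n \<Rightarrow> real ^ 'n" where
  "plane_rot i j \<theta> x = x + ((cos \<theta> - 1) * x $ i - sin \<theta> * x $ j) *\<^sub>R axis i 1
     + ((cos \<theta> - 1) * x $ j + sin \<theta> * x $ i) *\<^sub>R axis j 1"

lemma plane_rot_0: "plane_rot i j 0 x = x"
  by (simp add: plane_rot_def)

lemma orthogonal_transformation_plane_rot:
  fixes i j :: "'n::finite"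
  assumes "i \<noteq> j"
  shows "orthogonal_transformation (plane_rot i j \<theta>)"
proof -
  have "linear (plane_rot i j \<theta>)"
    by (rule linearI) (simp_all add: plane_rot_def algebra_simps vec_eq_iff)
  moreover have "norm (plane_rot i j \<theta> x) = norm x" for x :: "real ^ 'n"
  proof -
    have sc: "(sin \<theta>)\<^sup>2 = 1 - (cos \<theta>)\<^sup>2" by (simp add: sin_squared_eq)
    have e: "axis i (1::real) \<bullet> axis i 1 = 1" "axis j (1::real) \<bullet> axis j 1 = 1"
      "axis i (1::real) \<bullet> axis j 1 = 0" "axis j (1::real) \<bullet> axis i 1 = 0"
      using assms by (simp_all add: inner_axis_axis)
    define p where "p = (cos \<theta> - 1) * x $ i - sin \<theta> * x $ j"
    define q where "q = (cos \<theta> - 1) * x $ j + sin \<theta> * x $ i"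
    have "plane_rot i j \<theta> x \<bullet> plane_rot i j \<theta> x = x \<bullet> x + 2 * p * x $ i + 2 * q * x $ j + p\<^sup>2 + q\<^sup>2"
      unfolding plane_rot_def p_def[symmetric] q_def[symmetric]
      using assms
      by (simp add: inner_add_left inner_add_right e inner_axis inner_commute[of "axis _ _"] power2_eq_square)
         (simp add: axis_def algebra_simps)
    moreover have "2 * p * x $ i + 2 * q * x $ j + p\<^sup>2 + q\<^sup>2
        = ((x $ i)\<^sup>2 + (x $ j)\<^sup>2) * ((cos \<theta>)\<^sup>2 + (sin \<theta>)\<^sup>2 - 1)"
    proof -
      have "2 * ((C - 1) * X - S * Y) * X + 2 * ((C - 1) * Y + S * X) * Y
          + ((C - 1) * X - S * Y)\<^sup>2 + ((C - 1) * Y + S * X)\<^sup>2 = (X\<^sup>2 + Y\<^sup>2) * (C\<^sup>2 + S\<^sup>2 - 1)"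
        for C S X Y :: real
        by (simp add: power2_eq_square algebra_simps)
      then show ?thesis unfolding p_def q_def .
    qed
    ultimately have "plane_rot i j \<theta> x \<bullet> plane_rot i j \<theta> x = x \<bullet> x"
      using sc by simp
    then show ?thesis
      by (simp add: norm_eq_sqrt_inner)
  qed
  ultimately show ?thesis by (simp add: orthogonal_transformation)
qed

lemma has_vector_derivative_plane_rot:
  fixes i j :: "'n::finite"
  assumes "i \<noteq> j"
  shows "((\<lambda>\<theta>. plane_rot i j \<theta> x) has_vector_derivative rot_field i j (plane_rot i j \<theta> x)) (at \<theta>)"
proof -
  have "((\<lambda>\<theta>. plane_rot i j \<theta> x) has_vector_derivative
     (- sin \<theta> * x $ i - cos \<theta> * x $ j) *\<^sub>R axis i 1 + (- sin \<theta> * x $ j + cos \<theta> * x $ i) *\<^sub>R axis j 1) (at \<theta>)"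
    unfolding plane_rot_def
    by (auto intro!: derivative_eq_intros simp: has_real_derivative_iff_has_vector_derivative[symmetric])
  moreover have "(- sin \<theta> * x $ i - cos \<theta> * x $ j) *\<^sub>R axis i 1 + (- sin \<theta> * x $ j + cos \<theta> * x $ i) *\<^sub>R axis j 1
     = rot_field i j (plane_rot i j \<theta> x)"
    using assms by (simp add: rot_field_def plane_rot_def axis_def vec_eq_iff algebra_simps)
  ultimately show ?thesis by simp
qed

section \<open>Integration by parts on the sphere\<close>

lemma borel_measurable_punctured:
  fixes f :: "'a::euclidean_space \<Rightarrow> complex"
  assumes "continuous_on (- {0}) f"
  shows "f \<in> borel_measurable borel"
  using assms by (intro borel_measurable_continuous_countable_exceptions[of "{0}"]) auto

lemma finite_measure_sphere_measure:
  assumes "2 - real DIM('a::euclidean_space) < a"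
  shows "finite_measure (sphere_measure a :: 'a measure)"
  by (intro finite_measureI) (simp add: emeasure_sphere_measure_space[OF assms])

lemma bounded_on_sphere:
  fixes f :: "'a::euclidean_space \<Rightarrow> complex"
  assumes "continuous_on (- {0}) f" "r > 0"
  obtains C where "\<And>x. norm x = r \<Longrightarrow> norm (f x) \<le> C" "C \<ge> 0"
proof -
  have "compact (f ` sphere 0 r)"
    using assms by (intro compact_continuous_image compact_sphere continuous_on_subset[OF assms(1)]) auto
  then have "bounded (f ` sphere 0 r)" by (rule compact_imp_bounded)
  then obtain C where "\<forall>y\<in>f ` sphere 0 r. norm y \<le> C" unfolding bounded_iff by blast
  then have "norm (f x) \<le> max C 0" if "norm x = r" for x using that by (simp add: le_max_iff_disj)
  then show thesis using that[of "max C 0"] by simp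
qed

lemma integrable_sphere_bounded:
  fixes f :: "'a::euclidean_space \<Rightarrow> 'b::{banach, second_countable_topology}"
  assumes "2 - real DIM('a) < a" "f \<in> borel_measurable borel" "\<And>x. norm x = 1 \<Longrightarrow> norm (f x) \<le> C"
  shows "integrable (sphere_measure a) f"
proof -
  interpret finite_measure "sphere_measure a :: 'a measure"
    by (rule finite_measure_sphere_measure[OF assms(1)])
  have "AE x in sphere_measure a. norm (f x) \<le> C"
    using AE_sphere_measure by eventually_elim (rule assms(3))
  then show ?thesis
    using assms(2) by (intro integrable_const_bound[of _ C]) auto
qed

lemma integrable_sphere:
  fixes f :: "'a::euclidean_space \<Rightarrow> complex"
  assumes "2 - real DIM('a) < a" "continuous_on (- {0}) f" "r > 0"
  shows "integrable (sphere_measure a) (\<lambda>\<eta>. f (r *\<^sub>R \<eta>))"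
proof -
  obtain C where C: "\<And>x. norm x = r \<Longrightarrow> norm (f x) \<le> C" using bounded_on_sphere[OF assms(2,3)] by blast
  have [measurable]: "f \<in> borel_measurable borel" by (rule borel_measurable_punctured[OF assms(2)])
  show ?thesis
    by (rule integrable_sphere_bounded[OF assms(1), of _ C]) (use C assms(3) in auto)
qed

lemma sphere_integral_orthogonal:
  fixes f :: "'a::euclidean_space \<Rightarrow> complex" and R :: "'a \<Rightarrow> 'a"
  assumes "orthogonal_transformation R" "f \<in> borel_measurable borel"
  shows "(LINT \<eta>|sphere_measure a. f (R \<eta>)) = (LINT \<eta>|sphere_measure a. f \<eta>)"
proof -
  have [measurable]: "R \<in> borel_measurable borel"
    using orthogonal_transformation_linear[OF assms(1)]
    by (intro borel_measurable_continuous_onI linear_continuous_on) (simp add: linear_conv_bounded_linear[symmetric])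
  have "(LINT \<eta>|sphere_measure a. f \<eta>) = (LINT \<eta>|distr (sphere_measure a) borel R. f \<eta>)"
    by (simp only: distr_sphere_measure_orthogonal[OF assms(1)])
  also have "\<dots> = (LINT \<eta>|sphere_measure a. f (R \<eta>))"
    using assms(2) by (intro integral_distr) auto
  finally show ?thesis ..
qed

text \<open>By rotation invariance the integral of F over the sphere does not change when F is
  rotated, so all difference quotients along the rotation integrate to 0. Dominated convergence
  carries this over to the derivative.\<close>

lemma sphere_integral_rot_field:
  fixes F :: "real ^ 'n \<Rightarrow> complex"
  assumes a: "2 - real CARD('n) < a" and r: "r > 0"
    and F: "\<And>x. x \<noteq> 0 \<Longrightarrow> (F has_derivative F' x) (at x)"
    and G: "continuous_on (- {0}) (\<lambda>x. F' x (rot_field i j x))"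
  shows "(LINT \<eta>|sphere_measure a. F' (r *\<^sub>R \<eta>) (rot_field i j (r *\<^sub>R \<eta>))) = 0"
\<comment> \<open>For i = j the field vanishes identically, while \<open>plane_rot\<close> is no
  longer a rotation.\<close>
proof (cases "i = j")
  case True
  have "AE \<eta> in sphere_measure a. F' (r *\<^sub>R \<eta>) (rot_field i j (r *\<^sub>R \<eta>)) = 0"
    using AE_sphere_measure
  proof eventually_elim
    case (elim \<eta>)
    then have "r *\<^sub>R \<eta> \<noteq> 0" using r by auto
    then have "linear (F' (r *\<^sub>R \<eta>))" using F has_derivative_linear by blast
    then show ?case using True by (simp add: rot_field_def linear_0)
  qed
  then show ?thesis by (rule integral_eq_zero_AE)
next
  case False
  define G0 where "G0 = (\<lambda>x. F' x (rot_field i j x))"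
  have aD: "2 - real DIM(real ^ 'n) < a" using a by simp
  have Fcont: "continuous_on (- {0}) F"
    using F by (intro continuous_at_imp_continuous_on ballI has_derivative_continuous) auto
  have [measurable]: "F \<in> borel_measurable borel" "G0 \<in> borel_measurable borel"
    unfolding G0_def by (intro borel_measurable_punctured Fcont G)+
  obtain C where C: "\<And>x. norm x = r \<Longrightarrow> norm (G0 x) \<le> C" "C \<ge> 0"
    using bounded_on_sphere[OF G r] unfolding G0_def by blast
  define \<tau> where "\<tau> n = inverse (real (Suc n))" for n
  have \<tau>: "\<tau> n > 0" for n by (simp add: \<tau>_def)
  have \<tau>0: "\<tau> \<longlonglongrightarrow> 0" unfolding \<tau>_def by (rule LIMSEQ_inverse_real_of_nat)
  define R where "R = plane_rot i j"
  have R: "orthogonal_transformation (R \<theta>)" for \<theta>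
    unfolding R_def by (rule orthogonal_transformation_plane_rot[OF False])
  have Rr: "R \<theta> (r *\<^sub>R x) = r *\<^sub>R R \<theta> x" for \<theta> x
    using orthogonal_transformation_linear[OF R] by (simp add: linear_scale)
  have Rn: "norm (R \<theta> x) = norm x" for \<theta> x
    using R[of \<theta>] by (simp add: orthogonal_transformation)
  have D: "((\<lambda>\<theta>. F (R \<theta> x)) has_vector_derivative G0 (R \<theta> x)) (at \<theta>)" if "x \<noteq> 0" for x \<theta>
  proof -
    have "R \<theta> x \<noteq> 0" using Rn[of \<theta> x] that by (metis norm_eq_zero)
    then have "((F \<circ> (\<lambda>\<theta>. R \<theta> x)) has_vector_derivative F' (R \<theta> x) (rot_field i j (R \<theta> x))) (at \<theta>)"
      using has_vector_derivative_plane_rot[OF False, of x \<theta>]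
      by (intro vector_derivative_diff_chain_within) (auto simp: R_def intro: has_derivative_at_withinI F)
    then show ?thesis by (simp add: G0_def comp_def)
  qed
  define h where "h n \<eta> = (F (r *\<^sub>R R (\<tau> n) \<eta>) - F (r *\<^sub>R \<eta>)) /\<^sub>R \<tau> n" for n \<eta>
  have Rm [measurable]: "R \<theta> \<in> borel_measurable borel" for \<theta>
    using orthogonal_transformation_linear[OF R]
    by (intro borel_measurable_continuous_onI linear_continuous_on) (simp add: linear_conv_bounded_linear[symmetric])
  have hint: "(LINT \<eta>|sphere_measure a. h n \<eta>) = 0" for n
  proof -
    have "(LINT \<eta>|sphere_measure a. F (r *\<^sub>R R (\<tau> n) \<eta>)) = (LINT \<eta>|sphere_measure a. F (r *\<^sub>R \<eta>))"
      by (rule sphere_integral_orthogonal[OF R, of "\<lambda>\<eta>. F (r *\<^sub>R \<eta>)"]) measurable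
    moreover have "integrable (sphere_measure a) (\<lambda>\<eta>. F (r *\<^sub>R \<eta>))"
      by (rule integrable_sphere[OF aD Fcont r])
    moreover have "integrable (sphere_measure a) (\<lambda>\<eta>. F (r *\<^sub>R R (\<tau> n) \<eta>))"
    proof -
      obtain B where B: "\<And>x. norm x = r \<Longrightarrow> norm (F x) \<le> B" using bounded_on_sphere[OF Fcont r] by blast
      show ?thesis by (rule integrable_sphere_bounded[OF aD, of _ B]) (use B Rn r in auto)
    qed
    ultimately show ?thesis unfolding h_def by simp
  qed
  have lim: "(\<lambda>n. LINT \<eta>|sphere_measure a. h n \<eta>) \<longlonglongrightarrow> (LINT \<eta>|sphere_measure a. G0 (r *\<^sub>R \<eta>))"
  proof (rule integral_dominated_convergence[where w = "\<lambda>_. C"])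
    show "integrable (sphere_measure a) (\<lambda>_::real ^ 'n. C)"
      by (rule integrable_sphere_bounded[OF aD]) auto
    show "(\<lambda>\<eta>. h n \<eta>) \<in> borel_measurable (sphere_measure a)" for n
      unfolding h_def by measurable
    show "(\<lambda>\<eta>. G0 (r *\<^sub>R \<eta>)) \<in> borel_measurable (sphere_measure a)" by measurable
    show "AE \<eta> in sphere_measure a. (\<lambda>n. h n \<eta>) \<longlonglongrightarrow> G0 (r *\<^sub>R \<eta>)"
      using AE_sphere_measure
    proof eventually_elim
      case (elim \<eta>)
      then have ne: "r *\<^sub>R \<eta> \<noteq> 0" using r by auto
      have "((\<lambda>\<theta>. F (R \<theta> (r *\<^sub>R \<eta>))) has_vector_derivative G0 (r *\<^sub>R \<eta>)) (at 0)"
        using D[OF ne, of 0] by (simp add: R_def plane_rot_0)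
      then have "((\<lambda>\<theta>. norm (F (R \<theta> (r *\<^sub>R \<eta>)) - F (r *\<^sub>R \<eta>) - \<theta> *\<^sub>R G0 (r *\<^sub>R \<eta>)) / norm \<theta>) \<longlongrightarrow> 0) (at 0)"
        by (simp add: has_vector_derivative_def has_derivative_at R_def plane_rot_0)
      moreover have "filterlim \<tau> (at 0) sequentially"
        using \<tau>0 \<tau> by (auto simp: filterlim_at less_imp_neq[symmetric])
      ultimately have *: "(\<lambda>n. norm (F (R (\<tau> n) (r *\<^sub>R \<eta>)) - F (r *\<^sub>R \<eta>) - \<tau> n *\<^sub>R G0 (r *\<^sub>R \<eta>)) / norm (\<tau> n)) \<longlonglongrightarrow> 0"
        by (rule filterlim_compose)
      have "norm (F (R (\<tau> n) (r *\<^sub>R \<eta>)) - F (r *\<^sub>R \<eta>) - \<tau> n *\<^sub>R G0 (r *\<^sub>R \<eta>)) / norm (\<tau> n)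
          = norm (h n \<eta> - G0 (r *\<^sub>R \<eta>))" for n
      proof -
        have "h n \<eta> - G0 (r *\<^sub>R \<eta>) = (F (R (\<tau> n) (r *\<^sub>R \<eta>)) - F (r *\<^sub>R \<eta>) - \<tau> n *\<^sub>R G0 (r *\<^sub>R \<eta>)) /\<^sub>R \<tau> n"
          using \<tau>[of n] by (simp add: h_def Rr scaleR_diff_right)
        then show ?thesis by (simp add: divide_inverse mult.commute)
      qed
      with * have "(\<lambda>n. norm (h n \<eta> - G0 (r *\<^sub>R \<eta>))) \<longlonglongrightarrow> 0" by simp
      then show ?case
        by (rule LIM_zero_cancel[OF tendsto_norm_zero_cancel])
    qed
    show "AE \<eta> in sphere_measure a. norm (h n \<eta>) \<le> C" for n
      using AE_sphere_measure
    proof eventually_elim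
      case (elim \<eta>)
      then have ne: "r *\<^sub>R \<eta> \<noteq> 0" using r by auto
      \<comment> \<open>The orbit of the rotation stays on the sphere of radius r, where the
        derivative is bounded by \<open>C\<close>. The mean value inequality makes the difference
        quotients uniformly bounded.\<close>
      have "norm (F (R (\<tau> n) (r *\<^sub>R \<eta>)) - F (R 0 (r *\<^sub>R \<eta>))) \<le> C * norm (\<tau> n - 0)"
      proof (rule differentiable_bound[where S = UNIV and f' = "\<lambda>\<theta> h. h *\<^sub>R G0 (R \<theta> (r *\<^sub>R \<eta>))"])
        show "((\<lambda>\<theta>. F (R \<theta> (r *\<^sub>R \<eta>))) has_derivative (\<lambda>h. h *\<^sub>R G0 (R \<theta> (r *\<^sub>R \<eta>)))) (at \<theta> within UNIV)" for \<theta>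
          using D[OF ne, of \<theta>] by (simp add: has_vector_derivative_def)
        have "norm (G0 (R \<theta> (r *\<^sub>R \<eta>))) \<le> C" for \<theta>
          using C(1)[of "R \<theta> (r *\<^sub>R \<eta>)"] elim r by (simp add: Rn)
        then show "onorm (\<lambda>h. h *\<^sub>R G0 (R \<theta> (r *\<^sub>R \<eta>))) \<le> C" for \<theta>
          by (intro onorm_le) (simp add: mult.commute[of C] mult_left_mono)
      qed auto
      then have "norm (F (r *\<^sub>R R (\<tau> n) \<eta>) - F (r *\<^sub>R \<eta>)) \<le> C * \<tau> n"
        using \<tau>[of n] Rr[of "\<tau> n" \<eta>] by (simp add: R_def plane_rot_0)
      moreover have "norm (h n \<eta>) = norm (F (r *\<^sub>R R (\<tau> n) \<eta>) - F (r *\<^sub>R \<eta>)) / \<tau> n"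
        using \<tau>[of n] by (simp add: h_def divide_inverse mult.commute)
      ultimately show ?case
        using \<tau>[of n] by (simp add: divide_le_eq)
    qed
  qed
  then show ?thesis
    unfolding hint G0_def by (metis LIMSEQ_const_iff)
qed


lemma sphere_integral_by_parts:
  fixes f g :: "real ^ 'n \<Rightarrow> complex"
  assumes a: "2 - real CARD('n) < a" and r: "r > 0"
    and f: "\<And>x. x \<noteq> 0 \<Longrightarrow> (f has_derivative f' x) (at x)"
    and g: "\<And>x. x \<noteq> 0 \<Longrightarrow> (g has_derivative g' x) (at x)"
    and cf: "continuous_on (- {0}) (\<lambda>x. f' x (rot_field i j x))"
    and cg: "continuous_on (- {0}) (\<lambda>x. g' x (rot_field i j x))"
  shows "(LINT \<eta>|sphere_measure a. f' (r *\<^sub>R \<eta>) (rot_field i j (r *\<^sub>R \<eta>)) * g (r *\<^sub>R \<eta>))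
     = - (LINT \<eta>|sphere_measure a. f (r *\<^sub>R \<eta>) * g' (r *\<^sub>R \<eta>) (rot_field i j (r *\<^sub>R \<eta>)))"
proof -
  have aD: "2 - real DIM(real ^ 'n) < a" using a by simp
  have c: "continuous_on (- {0}) f" "continuous_on (- {0}) g"
    using f g by (auto intro!: continuous_at_imp_continuous_on has_derivative_continuous)
  have "(LINT \<eta>|sphere_measure a. f (r *\<^sub>R \<eta>) * g' (r *\<^sub>R \<eta>) (rot_field i j (r *\<^sub>R \<eta>))
      + f' (r *\<^sub>R \<eta>) (rot_field i j (r *\<^sub>R \<eta>)) * g (r *\<^sub>R \<eta>)) = 0"
    using sphere_integral_rot_field[OF a r, of "\<lambda>x. f x * g x" "\<lambda>x v. f x * g' x v + f' x v * g x" i j]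
    by (simp add: has_derivative_mult f g continuous_on_add continuous_on_mult c cf cg)
  moreover have "integrable (sphere_measure a) (\<lambda>\<eta>. f (r *\<^sub>R \<eta>) * g' (r *\<^sub>R \<eta>) (rot_field i j (r *\<^sub>R \<eta>)))"
    by (rule integrable_sphere[OF aD _ r, of "\<lambda>x. f x * g' x (rot_field i j x)"]) (intro continuous_on_mult c cg)
  moreover have "integrable (sphere_measure a) (\<lambda>\<eta>. f' (r *\<^sub>R \<eta>) (rot_field i j (r *\<^sub>R \<eta>)) * g (r *\<^sub>R \<eta>))"
    by (rule integrable_sphere[OF aD _ r, of "\<lambda>x. f' x (rot_field i j x) * g x"]) (intro continuous_on_mult c cf)
  ultimately show ?thesis
    by (simp add: add_eq_0_iff)
qed

lemma continuous_on_rot_field [continuous_intros]: "continuous_on S (rot_field i j)"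
  unfolding rot_field_def[abs_def] by (intro continuous_intros)

lemma linear_rot_field: "linear (rot_field i j)"
  by (rule linearI) (simp_all add: rot_field_def algebra_simps)

lemma has_derivative_rot_field: "(rot_field i j has_derivative rot_field i j) (at x)"
  by (rule linear_imp_has_derivative[OF linear_rot_field])

text \<open>Lagrange's identity and its first order companion. For unit vectors with inner product t
  they supply the coefficients 2 (1 - t^2) and -2 (N - 1) t of the operator on zonal
  functions.\<close>

lemma rot_field_sums:
  fixes \<omega> x :: "real ^ 'n"
  shows "(\<Sum>i\<in>UNIV. \<Sum>j\<in>UNIV. (\<omega> \<bullet> rot_field i j x)\<^sup>2) = 2 * ((\<omega> \<bullet> \<omega>) * (x \<bullet> x) - (\<omega> \<bullet> x)\<^sup>2)"
    and "(\<Sum>i\<in>UNIV. \<Sum>j\<in>UNIV. \<omega> \<bullet> rot_field i j (rot_field i j x)) = - 2 * (real CARD('n) - 1) * (\<omega> \<bullet> x)"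
proof -
  have w: "\<omega> \<bullet> rot_field i j x = x $ i * \<omega> $ j - x $ j * \<omega> $ i" for i j and x :: "real ^ 'n"
    by (simp add: rot_field_def inner_diff_right inner_axis)
  have s: "v \<bullet> w = (\<Sum>i\<in>UNIV. v $ i * w $ i)" for v w :: "real ^ 'n"
    by (simp add: inner_vec_def)
  have "(\<omega> \<bullet> rot_field i j x)\<^sup>2 = (x $ i * x $ i) * (\<omega> $ j * \<omega> $ j) + (\<omega> $ i * \<omega> $ i) * (x $ j * x $ j)
     - 2 * ((\<omega> $ i * x $ i) * (\<omega> $ j * x $ j))" for i j
    unfolding w by (simp add: power2_eq_square algebra_simps)
  then have "(\<Sum>i\<in>UNIV. \<Sum>j\<in>UNIV. (\<omega> \<bullet> rot_field i j x)\<^sup>2)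
     = (x \<bullet> x) * (\<omega> \<bullet> \<omega>) + (\<omega> \<bullet> \<omega>) * (x \<bullet> x) - 2 * ((\<omega> \<bullet> x) * (\<omega> \<bullet> x))"
    by (simp only: s sum.distrib sum_subtractf sum_distrib_left[symmetric] sum_distrib_right[symmetric])
  then show "(\<Sum>i\<in>UNIV. \<Sum>j\<in>UNIV. (\<omega> \<bullet> rot_field i j x)\<^sup>2) = 2 * ((\<omega> \<bullet> \<omega>) * (x \<bullet> x) - (\<omega> \<bullet> x)\<^sup>2)"
    by (simp add: power2_eq_square)
  have "\<omega> \<bullet> rot_field i j (rot_field i j x)
      = (if i = j then 2 * (\<omega> $ i * x $ i) else 0) - (\<omega> $ j * x $ j) - \<omega> $ i * x $ i" for i j
    unfolding w by (simp add: rot_field_def axis_def algebra_simps)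
  then have "(\<Sum>i\<in>UNIV. \<Sum>j\<in>UNIV. \<omega> \<bullet> rot_field i j (rot_field i j x))
      = 2 * (\<omega> \<bullet> x) - real CARD('n) * (\<omega> \<bullet> x) - real CARD('n) * (\<omega> \<bullet> x)"
    by (simp add: s sum.distrib sum_subtractf sum_distrib_left)
  then show "(\<Sum>i\<in>UNIV. \<Sum>j\<in>UNIV. \<omega> \<bullet> rot_field i j (rot_field i j x)) = - 2 * (real CARD('n) - 1) * (\<omega> \<bullet> x)"
    by (simp add: algebra_simps)
qed

text \<open>A zonal function is taken as a function of \<open>\<omega> \<bullet> x / r\<close> with \<open>r\<close> constant instead of
  \<open>\<omega> \<bullet> x / norm x\<close>; the two agree on the sphere of radius \<open>r\<close>, and only tangential derivatives are
  used.\<close>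

definition zonal :: "(real \<Rightarrow> real) \<Rightarrow> real \<Rightarrow> real ^ 'n \<Rightarrow> real ^ 'n \<Rightarrow> complex" where
  "zonal h r \<omega> x = of_real (h ((\<omega> \<bullet> x) / r))"

definition zonal_diff :: "(real \<Rightarrow> real) \<Rightarrow> real \<Rightarrow> real ^ 'n \<Rightarrow> real ^ 'n \<Rightarrow> real ^ 'n \<Rightarrow> complex" where
  "zonal_diff h' r \<omega> x v = of_real (h' ((\<omega> \<bullet> x) / r) * ((\<omega> \<bullet> v) / r))"

definition zonal_diff2 :: "(real \<Rightarrow> real) \<Rightarrow> (real \<Rightarrow> real) \<Rightarrow> real \<Rightarrow> real ^ 'n \<Rightarrow> 'n \<Rightarrow> 'n
    \<Rightarrow> real ^ 'n \<Rightarrow> real ^ 'n \<Rightarrow> complex" where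
  "zonal_diff2 h' h'' r \<omega> i j x v = of_real (h'' ((\<omega> \<bullet> x) / r) * ((\<omega> \<bullet> v) / r) * ((\<omega> \<bullet> rot_field i j x) / r)
     + h' ((\<omega> \<bullet> x) / r) * ((\<omega> \<bullet> rot_field i j v) / r))"

lemma has_derivative_inner_quotient: "((\<lambda>x. (\<omega> \<bullet> x) / r) has_derivative (\<lambda>v. (\<omega> \<bullet> v) / r)) (at x)" if "r > 0" for r :: real
  using that by (auto intro!: derivative_eq_intros)

lemma has_derivative_zonal:
  assumes r: "r > 0" and h: "\<And>t. (h has_real_derivative h' t) (at t)"
  shows "(zonal h r \<omega> has_derivative zonal_diff h' r \<omega> x) (at x)"
  unfolding zonal_def[abs_def] zonal_diff_def[abs_def]
  using bounded_linear.has_derivative[OF bounded_linear_of_real[where ?'a = complex]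
      DERIV_compose_FDERIV[OF h has_derivative_inner_quotient[OF r]]]
  by (simp add: mult.commute)

lemma has_derivative_zonal_diff:
  assumes r: "r > 0" and h': "\<And>t. (h' has_real_derivative h'' t) (at t)"
  shows "((\<lambda>x. zonal_diff h' r \<omega> x (rot_field i j x)) has_derivative zonal_diff2 h' h'' r \<omega> i j x) (at x)"
proof -
  have lin': "((\<lambda>x. (\<omega> \<bullet> rot_field i j x) / r) has_derivative (\<lambda>v. (\<omega> \<bullet> rot_field i j v) / r)) (at x)" for x i j
    using r by (auto intro!: derivative_eq_intros has_derivative_rot_field)
  have "((\<lambda>x. h' ((\<omega> \<bullet> x) / r) * ((\<omega> \<bullet> rot_field i j x) / r)) has_derivative
    (\<lambda>v. h' ((\<omega> \<bullet> x) / r) * ((\<omega> \<bullet> rot_field i j v) / r) + ((\<omega> \<bullet> v) / r * h'' ((\<omega> \<bullet> x) / r)) * ((\<omega> \<bullet> rot_field i j x) / r))) (at x)"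
    by (intro has_derivative_mult lin' DERIV_compose_FDERIV[OF h' has_derivative_inner_quotient[OF r]])
  from bounded_linear.has_derivative[OF bounded_linear_of_real[where ?'a = complex] this]
  show ?thesis
    unfolding zonal_diff_def zonal_diff2_def[abs_def] by (simp add: algebra_simps)
qed

lemma continuous_on_zonal_diff2:
  assumes r: "r > 0" and "continuous_on UNIV h'" "continuous_on UNIV h''"
  shows "continuous_on S (\<lambda>x. zonal_diff2 h' h'' r \<omega> i j x (rot_field i j x))"
proof -
  have comp: "continuous_on S (\<lambda>x. g ((\<omega> \<bullet> x) / r))" if "continuous_on UNIV g" for g :: "real \<Rightarrow> real"
    using r by (intro continuous_on_compose2[OF that]) (auto intro!: continuous_intros)
  show ?thesis
    unfolding zonal_diff2_def using r
    by (intro continuous_intros comp assms continuous_on_compose2[OF continuous_on_rot_field[of UNIV] continuous_on_rot_field]) auto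
qed

lemma zonal_laplacian:
  fixes \<omega> \<eta> :: "real ^ 'n"
  assumes r: "r > 0" and "norm \<omega> = 1" "norm \<eta> = 1"
  shows "(\<Sum>i\<in>UNIV. \<Sum>j\<in>UNIV. zonal_diff2 h' h'' r \<omega> i j (r *\<^sub>R \<eta>) (rot_field i j (r *\<^sub>R \<eta>)))
    = of_real (2 * ((1 - (\<omega> \<bullet> \<eta>)\<^sup>2) * h'' (\<omega> \<bullet> \<eta>) - (real CARD('n) - 1) * (\<omega> \<bullet> \<eta>) * h' (\<omega> \<bullet> \<eta>)))"
proof -
  have one: "\<omega> \<bullet> \<omega> = 1" "\<eta> \<bullet> \<eta> = 1"
    using assms by (simp_all add: dot_square_norm)
  have sc: "rot_field i j (r *\<^sub>R x) = r *\<^sub>R rot_field i j x" for x i j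
    using linear_rot_field by (rule linear_scale)
  have "zonal_diff2 h' h'' r \<omega> i j (r *\<^sub>R \<eta>) (rot_field i j (r *\<^sub>R \<eta>))
      = of_real (h'' (\<omega> \<bullet> \<eta>) * (\<omega> \<bullet> rot_field i j \<eta>)\<^sup>2
     + h' (\<omega> \<bullet> \<eta>) * (\<omega> \<bullet> rot_field i j (rot_field i j \<eta>)))" for i j
    using r by (simp add: zonal_diff2_def sc power2_eq_square mult.assoc)
  then have "(\<Sum>i\<in>UNIV. \<Sum>j\<in>UNIV. zonal_diff2 h' h'' r \<omega> i j (r *\<^sub>R \<eta>) (rot_field i j (r *\<^sub>R \<eta>)))
     = of_real (h'' (\<omega> \<bullet> \<eta>) * (\<Sum>i\<in>UNIV. \<Sum>j\<in>UNIV. (\<omega> \<bullet> rot_field i j \<eta>)\<^sup>2)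
       + h' (\<omega> \<bullet> \<eta>) * (\<Sum>i\<in>UNIV. \<Sum>j\<in>UNIV. \<omega> \<bullet> rot_field i j (rot_field i j \<eta>)))"
    by (simp add: sum_distrib_left sum.distrib distrib_left)
  also have "h'' (\<omega> \<bullet> \<eta>) * (\<Sum>i\<in>UNIV. \<Sum>j\<in>UNIV. (\<omega> \<bullet> rot_field i j \<eta>)\<^sup>2)
       + h' (\<omega> \<bullet> \<eta>) * (\<Sum>i\<in>UNIV. \<Sum>j\<in>UNIV. \<omega> \<bullet> rot_field i j (rot_field i j \<eta>))
     = 2 * ((1 - (\<omega> \<bullet> \<eta>)\<^sup>2) * h'' (\<omega> \<bullet> \<eta>) - (real CARD('n) - 1) * (\<omega> \<bullet> \<eta>) * h' (\<omega> \<bullet> \<eta>))"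
    unfolding rot_field_sums one by (simp add: algebra_simps)
  finally show ?thesis .
qed

text \<open>Two integrations by parts move both rotation derivatives onto the zonal function. The
  derivatives of f are abstract parameters, so that the lemma serves both a smooth f, with
  \<open>frechet_derivative\<close>, and a zonal f, with explicit formulas.\<close>

lemma sphere_laplacian_zonal_self_adjoint:
  fixes f :: "real ^ 'n \<Rightarrow> complex"
  assumes a: "2 - real CARD('n) < a" and r: "r > 0" and \<omega>: "norm \<omega> = 1"
    and f: "\<And>x. x \<noteq> 0 \<Longrightarrow> (f has_derivative f' x) (at x)"
    and f1: "\<And>i j x. x \<noteq> 0 \<Longrightarrow> ((\<lambda>x. f' x (rot_field i j x)) has_derivative f'' i j x) (at x)"
    and cf: "\<And>i j. continuous_on (- {0}) (\<lambda>x. f'' i j x (rot_field i j x))"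
    and h: "\<And>t. (h has_real_derivative h' t) (at t)"
    and h': "\<And>t. (h' has_real_derivative h'' t) (at t)"
    and ch: "continuous_on UNIV h''"
  shows "(LINT \<eta>|sphere_measure a. (\<Sum>i\<in>UNIV. \<Sum>j\<in>UNIV. f'' i j (r *\<^sub>R \<eta>) (rot_field i j (r *\<^sub>R \<eta>))) * of_real (h (\<omega> \<bullet> \<eta>)))
    = (LINT \<eta>|sphere_measure a. f (r *\<^sub>R \<eta>) *
        of_real (2 * ((1 - (\<omega> \<bullet> \<eta>)\<^sup>2) * h'' (\<omega> \<bullet> \<eta>) - (real CARD('n) - 1) * (\<omega> \<bullet> \<eta>) * h' (\<omega> \<bullet> \<eta>))))"
proof -
  have aD: "2 - real DIM(real ^ 'n) < a" using a by simp
  define Z Z' Z'' where "Z = zonal h r \<omega>" and "Z' = zonal_diff h' r \<omega>" and "Z'' = zonal_diff2 h' h'' r \<omega>"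
  have Z: "(Z has_derivative Z' x) (at x)" for x
    unfolding Z_def Z'_def by (rule has_derivative_zonal[OF r h])
  have Z1: "((\<lambda>x. Z' x (rot_field i j x)) has_derivative Z'' i j x) (at x)" for i j x
    unfolding Z'_def Z''_def by (rule has_derivative_zonal_diff[OF r h'])
  have ch': "continuous_on UNIV h'"
    using h' by (meson DERIV_isCont continuous_at_imp_continuous_on)
  have cZ: "continuous_on (- {0}) Z"
    using Z by (auto intro!: continuous_at_imp_continuous_on has_derivative_continuous)
  have cZ1: "continuous_on (- {0}) (\<lambda>x. Z' x (rot_field i j x))" for i j
    using Z1 by (auto intro!: continuous_at_imp_continuous_on has_derivative_continuous)
  have cZ2: "continuous_on (- {0}) (\<lambda>x. Z'' i j x (rot_field i j x))" for i j
    unfolding Z''_def by (rule continuous_on_zonal_diff2[OF r ch' ch])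
  have cf1: "continuous_on (- {0}) (\<lambda>x. f' x (rot_field i j x))" for i j
    using f1 by (auto intro!: continuous_at_imp_continuous_on has_derivative_continuous)
  have cf0: "continuous_on (- {0}) f"
    using f by (auto intro!: continuous_at_imp_continuous_on has_derivative_continuous)
  have Zr: "complex_of_real (h (\<omega> \<bullet> \<eta>)) = Z (r *\<^sub>R \<eta>)" for \<eta>
    using r by (simp add: Z_def zonal_def)
  have "(LINT \<eta>|sphere_measure a. (\<Sum>i\<in>UNIV. \<Sum>j\<in>UNIV. f'' i j (r *\<^sub>R \<eta>) (rot_field i j (r *\<^sub>R \<eta>))) * of_real (h (\<omega> \<bullet> \<eta>)))
    = (LINT \<eta>|sphere_measure a. (\<Sum>i\<in>UNIV. \<Sum>j\<in>UNIV. f'' i j (r *\<^sub>R \<eta>) (rot_field i j (r *\<^sub>R \<eta>)) * Z (r *\<^sub>R \<eta>)))"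
    unfolding Zr by (simp add: sum_distrib_right)
  also have "\<dots> = (\<Sum>i\<in>UNIV. \<Sum>j\<in>UNIV. (LINT \<eta>|sphere_measure a. f'' i j (r *\<^sub>R \<eta>) (rot_field i j (r *\<^sub>R \<eta>)) * Z (r *\<^sub>R \<eta>)))"
  proof -
    have "integrable (sphere_measure a) (\<lambda>\<eta>. f'' i j (r *\<^sub>R \<eta>) (rot_field i j (r *\<^sub>R \<eta>)) * Z (r *\<^sub>R \<eta>))" for i j
      by (rule integrable_sphere[OF aD _ r, of "\<lambda>x. f'' i j x (rot_field i j x) * Z x"]) (intro continuous_on_mult cf cZ)
    then show ?thesis by (subst Bochner_Integration.integral_sum, simp, subst Bochner_Integration.integral_sum) simp_all
  qed
  also have "\<dots> = (\<Sum>i\<in>UNIV. \<Sum>j\<in>UNIV. (LINT \<eta>|sphere_measure a. f (r *\<^sub>R \<eta>) * Z'' i j (r *\<^sub>R \<eta>) (rot_field i j (r *\<^sub>R \<eta>))))"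
  proof (intro sum.cong refl)
    fix i j
    show "(LINT \<eta>|sphere_measure a. f'' i j (r *\<^sub>R \<eta>) (rot_field i j (r *\<^sub>R \<eta>)) * Z (r *\<^sub>R \<eta>))
       = (LINT \<eta>|sphere_measure a. f (r *\<^sub>R \<eta>) * Z'' i j (r *\<^sub>R \<eta>) (rot_field i j (r *\<^sub>R \<eta>)))"
      using sphere_integral_by_parts[OF a r f1 Z cf cZ1]
        sphere_integral_by_parts[OF a r f Z1 cf1 cZ2] by simp
  qed
  also have "\<dots> = (LINT \<eta>|sphere_measure a. (\<Sum>i\<in>UNIV. \<Sum>j\<in>UNIV. f (r *\<^sub>R \<eta>) * Z'' i j (r *\<^sub>R \<eta>) (rot_field i j (r *\<^sub>R \<eta>))))"
  proof -
    have "integrable (sphere_measure a) (\<lambda>\<eta>. f (r *\<^sub>R \<eta>) * Z'' i j (r *\<^sub>R \<eta>) (rot_field i j (r *\<^sub>R \<eta>)))" for i j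
      by (rule integrable_sphere[OF aD _ r, of "\<lambda>x. f x * Z'' i j x (rot_field i j x)"]) (intro continuous_on_mult cf0 cZ2)
    then show ?thesis by (subst Bochner_Integration.integral_sum, simp, subst Bochner_Integration.integral_sum) simp_all
  qed
  also have "\<dots> = (LINT \<eta>|sphere_measure a. f (r *\<^sub>R \<eta>) *
        of_real (2 * ((1 - (\<omega> \<bullet> \<eta>)\<^sup>2) * h'' (\<omega> \<bullet> \<eta>) - (real CARD('n) - 1) * (\<omega> \<bullet> \<eta>) * h' (\<omega> \<bullet> \<eta>))))"
  proof (rule integral_cong_AE)
    have [measurable]: "f \<in> borel_measurable borel" "(\<lambda>x. Z'' i j x (rot_field i j x)) \<in> borel_measurable borel" for i j
      by (intro borel_measurable_punctured cf0 cZ2)+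
    have [measurable]: "h' \<in> borel_measurable borel" "h'' \<in> borel_measurable borel"
      by (intro borel_measurable_continuous_onI ch ch')+
    have "(\<lambda>\<eta>. Z'' i j (r *\<^sub>R \<eta>) (rot_field i j (r *\<^sub>R \<eta>))) \<in> borel_measurable (sphere_measure a)" for i j
      by (rule measurable_compose[of "\<lambda>\<eta>. r *\<^sub>R \<eta>" _ borel "\<lambda>x. Z'' i j x (rot_field i j x)"]) measurable
    then show "(\<lambda>\<eta>. \<Sum>i\<in>UNIV. \<Sum>j\<in>UNIV. f (r *\<^sub>R \<eta>) * Z'' i j (r *\<^sub>R \<eta>) (rot_field i j (r *\<^sub>R \<eta>)))
       \<in> borel_measurable (sphere_measure a)"
      by (intro borel_measurable_sum borel_measurable_times) measurable
    show "(\<lambda>\<eta>. f (r *\<^sub>R \<eta>) *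
        of_real (2 * ((1 - (\<omega> \<bullet> \<eta>)\<^sup>2) * h'' (\<omega> \<bullet> \<eta>) - (real CARD('n) - 1) * (\<omega> \<bullet> \<eta>) * h' (\<omega> \<bullet> \<eta>))))
       \<in> borel_measurable (sphere_measure a)"
      by measurable
    show "AE \<eta> in sphere_measure a. (\<Sum>i\<in>UNIV. \<Sum>j\<in>UNIV. f (r *\<^sub>R \<eta>) * Z'' i j (r *\<^sub>R \<eta>) (rot_field i j (r *\<^sub>R \<eta>)))
       = f (r *\<^sub>R \<eta>) * of_real (2 * ((1 - (\<omega> \<bullet> \<eta>)\<^sup>2) * h'' (\<omega> \<bullet> \<eta>) - (real CARD('n) - 1) * (\<omega> \<bullet> \<eta>) * h' (\<omega> \<bullet> \<eta>)))"
      using AE_sphere_measure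
    proof eventually_elim
      case (elim \<eta>)
      have "(\<Sum>i\<in>UNIV. \<Sum>j\<in>UNIV. f (r *\<^sub>R \<eta>) * Z'' i j (r *\<^sub>R \<eta>) (rot_field i j (r *\<^sub>R \<eta>)))
          = f (r *\<^sub>R \<eta>) * (\<Sum>i\<in>UNIV. \<Sum>j\<in>UNIV. Z'' i j (r *\<^sub>R \<eta>) (rot_field i j (r *\<^sub>R \<eta>)))"
        by (simp add: sum_distrib_left)
      then show ?case
        unfolding Z''_def zonal_laplacian[OF r \<omega> elim] .
    qed
  qed
  finally show ?thesis .
qed

section \<open>Zonal expansions\<close>

text \<open>The form in which all later exchanges of series and integral are made: an integrable
  majorant of the absolute partial sums.\<close>

lemma sums_integral_dominated:
  fixes f :: "nat \<Rightarrow> 'a \<Rightarrow> 'b::{banach, second_countable_topology}"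
  assumes [measurable]: "\<And>m. f m \<in> borel_measurable M"
    and w: "integrable M w"
    and sums: "AE x in M. (\<lambda>m. f m x) sums g x"
    and bound: "AE x in M. \<forall>n. (\<Sum>m<n. norm (f m x)) \<le> w x"
    and [measurable]: "g \<in> borel_measurable M"
  shows "(\<lambda>m. integral\<^sup>L M (f m)) sums integral\<^sup>L M g" "integrable M g" "integrable M (f m)"
proof -
  have f: "integrable M (f m)" for m
  proof (rule Bochner_Integration.integrable_bound[OF w])
    show "AE x in M. norm (f m x) \<le> norm (w x)"
      using bound
    proof eventually_elim
      case (elim x)
      have "norm (f m x) \<le> (\<Sum>k<Suc m. norm (f k x))"
        by (simp add: sum_nonneg)
      also have "\<dots> \<le> w x" using elim by blast
      finally show ?case by simp
    qed
  qed measurable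
  then show "integrable M (f m)" .
  have dom: "AE x in M. norm (\<Sum>m<n. f m x) \<le> w x" for n
    using bound by eventually_elim (rule order_trans[OF norm_sum], blast)
  have lim: "AE x in M. (\<lambda>n. \<Sum>m<n. f m x) \<longlonglongrightarrow> g x"
    using sums by (simp add: sums_def)
  have "(\<lambda>n. LINT x|M. (\<Sum>m<n. f m x)) \<longlonglongrightarrow> integral\<^sup>L M g"
    by (rule integral_dominated_convergence[OF _ _ w lim dom]) measurable
  then show "(\<lambda>m. integral\<^sup>L M (f m)) sums integral\<^sup>L M g"
    using f by (simp add: sums_def)
  show "integrable M g"
    by (rule integrable_dominated_convergence[OF _ _ w lim dom]) measurable
qed

lemma sum_norm_le_suminf:
  assumes "summable b" "\<And>m. norm (f m) \<le> b m"
  shows "(\<Sum>m<n. norm (f m)) \<le> (\<Sum>m. b m)"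
proof -
  have "b m \<ge> 0" for m using assms(2)[of m] norm_ge_zero order_trans by blast
  then have "(\<Sum>m<n. b m) \<le> (\<Sum>m. b m)" using assms(1) by (intro sum_le_suminf) auto
  moreover have "(\<Sum>m<n. norm (f m)) \<le> (\<Sum>m<n. b m)" by (intro sum_mono assms(2))
  ultimately show ?thesis by simp
qed

text \<open>The majorant is required from some index on, because the decay estimates for
  coefficients of degree m hold for large m only.\<close>

lemma tannery_eventually:
  fixes f :: "nat \<Rightarrow> 'a \<Rightarrow> 'b::{real_normed_algebra, banach}"
  assumes "\<And>k. ((\<lambda>x. f k x) \<longlongrightarrow> b k) F" "\<forall>\<^sub>F x in F. \<forall>k\<ge>k0. norm (f k x) \<le> M k" "summable M" "F \<noteq> bot"
  shows "((\<lambda>x. \<Sum>k. f k x) \<longlongrightarrow> (\<Sum>k. b k)) F"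
proof -
  have "\<forall>\<^sub>F (k, x) in sequentially \<times>\<^sub>F F. norm (f k x) \<le> M k"
    unfolding eventually_prod_filter
    by (rule exI[of _ "\<lambda>k. k \<ge> k0"], rule exI[of _ "\<lambda>x. \<forall>k\<ge>k0. norm (f k x) \<le> M k"])
       (use assms(2) in \<open>auto simp: eventually_ge_at_top\<close>)
  from tannerys_theorem[OF assms(1) this assms(3,4)] show ?thesis by simp
qed

text \<open>\<open>N\<close>, \<open>\<nu>\<close> and \<open>\<sigma>\<close> are names fixed by
  their equations; the actual data are \<open>a\<close> and the dimension.\<close>

locale deformed =
  fixes a :: real and N :: nat and \<nu> :: real and \<sigma> :: "(real ^ 'n) measure"
  assumes a_gt: "max 0 (2 - real CARD('n)) < a"
    and N_def: "N = CARD('n)"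
    and \<nu>_def: "\<nu> = (real N - 2) / 2"
    and \<sigma>_def: "\<sigma> = sphere_measure a"
begin

abbreviation C :: "nat \<Rightarrow> real \<Rightarrow> real" where "C \<equiv> normalized_Gegenbauer \<nu>"

abbreviation D :: "nat \<Rightarrow> real" where "D \<equiv> gegenbauer_bound N"

lemma a_pos: "a > 0" and a_gt': "2 - real N < a" and a_gt_DIM: "2 - real DIM(real ^ 'n) < a"
  using a_gt by (simp_all add: N_def)

lemma sets_\<sigma> [measurable_cong, simp]: "sets \<sigma> = sets borel" and space_\<sigma> [simp]: "space \<sigma> = UNIV"
  by (simp_all add: \<sigma>_def)

lemma AE_\<sigma>: "AE x in \<sigma>. norm x = 1"
  unfolding \<sigma>_def by (rule AE_sphere_measure)

lemma N_pos: "N \<ge> 1"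
  by (simp add: N_def Suc_le_eq)

lemma \<nu>_bounds: "-1 < \<nu>" "\<nu> + 1 \<le> real N" "2 * \<nu> + 1 = real N - 1" "2 * \<nu> = real N - 2"
  using N_pos by (simp_all add: \<nu>_def field_simps)

lemma C_bound: "\<bar>t\<bar> \<le> 1 \<Longrightarrow> \<bar>C m t\<bar> \<le> D m"
  by (rule normalized_Gegenbauer_bound[OF _ \<nu>_bounds(1,2)])

lemma C_cont: "continuous_on S (C m)"
  using has_field_derivative_normalized_Gegenbauer by (meson DERIV_isCont continuous_at_imp_continuous_on)

lemma C_borel [measurable]: "C m \<in> borel_measurable borel"
  by (intro borel_measurable_continuous_onI C_cont)

lemma C_0: "C 0 t = 1"
  by (simp add: normalized_Gegenbauer_nth gegenbauer_fps_def)

lemma inner_le: "norm \<omega> \<le> 1 \<Longrightarrow> norm \<eta> = 1 \<Longrightarrow> \<bar>\<omega> \<bullet> \<eta>\<bar> \<le> 1"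
  for \<omega> \<eta> :: "real ^ 'n"
  using Cauchy_Schwarz_ineq2[of \<omega> \<eta>] by simp

sublocale S: finite_measure \<sigma>
  unfolding \<sigma>_def by (rule finite_measure_sphere_measure[OF a_gt_DIM])

lemma measure_\<sigma>: "measure \<sigma> UNIV = 1"
  using emeasure_sphere_measure_space[OF a_gt_DIM] by (simp add: measure_def \<sigma>_def)

lemma integrable_\<sigma>:
  fixes f :: "real ^ 'n \<Rightarrow> 'b::{banach, second_countable_topology}"
  assumes "f \<in> borel_measurable borel" "\<And>x. norm x = 1 \<Longrightarrow> norm (f x) \<le> B"
  shows "integrable \<sigma> f"
  unfolding \<sigma>_def by (rule integrable_sphere_bounded[OF a_gt_DIM assms])

lemma integral_\<sigma>_bound:
  fixes f :: "real ^ 'n \<Rightarrow> 'b::{banach, second_countable_topology}"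
  assumes "f \<in> borel_measurable borel" "\<And>x. norm x = 1 \<Longrightarrow> norm (f x) \<le> B"
  shows "norm (integral\<^sup>L \<sigma> f) \<le> B"
proof -
  have "norm (integral\<^sup>L \<sigma> f) \<le> (LINT x|\<sigma>. norm (f x))"
    by (rule integral_norm_bound)
  also have "\<dots> \<le> (LINT x|\<sigma>. B)"
  proof (rule integral_mono_AE)
    show "AE x in \<sigma>. norm (f x) \<le> B"
      using AE_\<sigma> by eventually_elim (rule assms(2))
  qed (use integrable_\<sigma>[OF assms] in auto)
  also have "\<dots> = B" by (simp add: measure_\<sigma>)
  finally show ?thesis .
qed

lemma C_ode:
  "2 * ((1 - t\<^sup>2) * gegenbauer_diff2 \<nu> m t - (real N - 1) * t * gegenbauer_diff \<nu> m t)
     = - 2 * real m * (real m + real N - 2) * C m t"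
  using gegenbauer_ODE[of t \<nu> m] unfolding \<nu>_bounds(3,4) by (simp add: algebra_simps)

lemma cont_gegenbauer_diff: "continuous_on S (gegenbauer_diff \<nu> m)"
  using has_field_derivative_gegenbauer_diff by (meson DERIV_isCont continuous_at_imp_continuous_on)

lemma sphere_laplacian_gegenbauer:
  fixes f :: "real ^ 'n \<Rightarrow> complex"
  assumes r: "r > 0" and \<omega>: "norm \<omega> = 1" and f: "Cinfinity_on f (UNIV - {0})"
  shows "(LINT \<eta>|\<sigma>. sphere_laplacian f (r *\<^sub>R \<eta>) * of_real (C m (\<omega> \<bullet> \<eta>)))
     = - of_real (2 * real m * (real m + real N - 2)) * (LINT \<eta>|\<sigma>. f (r *\<^sub>R \<eta>) * of_real (C m (\<omega> \<bullet> \<eta>)))"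
proof -
  have o: "open (UNIV - {0 :: real ^ 'n})" by auto
  note f1 = Cinfinity_on_rot_deriv[OF o f] and f2 = Cinfinity_on_rot_deriv[OF o Cinfinity_on_rot_deriv[OF o f]]
  have rd: "(\<lambda>x. frechet_derivative g (at x) (rot_field i j x)) = rot_deriv i j g"
    for g :: "real ^ 'n \<Rightarrow> complex" and i j
    by (simp add: rot_deriv_def fun_eq_iff)
  have "(LINT \<eta>|\<sigma>. sphere_laplacian f (r *\<^sub>R \<eta>) * of_real (C m (\<omega> \<bullet> \<eta>)))
    = (LINT \<eta>|\<sigma>. (\<Sum>i\<in>UNIV. \<Sum>j\<in>UNIV. frechet_derivative (rot_deriv i j f) (at (r *\<^sub>R \<eta>)) (rot_field i j (r *\<^sub>R \<eta>))) * of_real (C m (\<omega> \<bullet> \<eta>)))"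
    by (simp add: sphere_laplacian_def rot_deriv_def[of _ _ "rot_deriv _ _ _"])
  also have "\<dots> = (LINT \<eta>|\<sigma>. f (r *\<^sub>R \<eta>) *
        of_real (2 * ((1 - (\<omega> \<bullet> \<eta>)\<^sup>2) * gegenbauer_diff2 \<nu> m (\<omega> \<bullet> \<eta>) - (real N - 1) * (\<omega> \<bullet> \<eta>) * gegenbauer_diff \<nu> m (\<omega> \<bullet> \<eta>))))"
  unfolding \<sigma>_def N_def
  proof (rule sphere_laplacian_zonal_self_adjoint[OF a_gt'[unfolded N_def] r \<omega>])
    show "(f has_derivative frechet_derivative f (at x)) (at x)" if "x \<noteq> 0" for x
      using Cinfinity_on_imp(1)[OF f] that by simp
    show "((\<lambda>x. frechet_derivative f (at x) (rot_field i j x)) has_derivative frechet_derivative (rot_deriv i j f) (at x)) (at x)"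
      if "x \<noteq> 0" for i j x
      using Cinfinity_on_imp(1)[OF f1] that unfolding rd by simp
    show "continuous_on (- {0}) (\<lambda>x. frechet_derivative (rot_deriv i j f) (at x) (rot_field i j x))" for i j
      using Cinfinity_on_imp(3)[OF f2] unfolding rd by (simp add: Compl_eq_Diff_UNIV)
  qed (rule has_field_derivative_normalized_Gegenbauer has_field_derivative_gegenbauer_diff continuous_gegenbauer_diff2)+
  also have "\<dots> = (LINT \<eta>|\<sigma>. - of_real (2 * real m * (real m + real N - 2)) * (f (r *\<^sub>R \<eta>) * of_real (C m (\<omega> \<bullet> \<eta>))))"
    unfolding C_ode by (simp add: algebra_simps)
  finally show ?thesis by simp
qed

lemma gegenbauer_orthogonal:
  assumes "norm \<omega> = 1" "norm y = 1" "m \<noteq> l"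
  shows "(LINT \<eta>|\<sigma>. C m (\<omega> \<bullet> \<eta>) * C l (y \<bullet> \<eta>)) = 0"
\<comment> \<open>Eigenvalues of distinct degrees coincide exactly when m + l + N = 2, that is, for
  N = 1 and degrees 0 and 1. There the oddness of the polynomial of degree 1 takes the place of the
  Laplacian.\<close>
proof (cases "m + l + N = 2")
  case True
  then have ml: "{m, l} = {0, 1}" using assms(3) N_pos by auto
  have C1: "C 1 (- t) = - C 1 t" for t
  proof -
    have "fps_nth (gegenbauer_fps (\<nu> + 1) t) 1 = 2 * (\<nu> + 1) * t" for t
      using fps_deriv_gegenbauer[of "\<nu> + 1" t, THEN arg_cong, of "\<lambda>F. fps_nth F 0"]
      by (simp add: gegenbauer_fps_def numeral_fps_const)
    then show ?thesis by (simp add: normalized_Gegenbauer_nth)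
  qed
  have *: "(LINT \<eta>|\<sigma>. C 1 (x \<bullet> \<eta>)) = 0" for x
  proof -
    have "(LINT \<eta>|\<sigma>. complex_of_real (C 1 (x \<bullet> - \<eta>))) = (LINT \<eta>|\<sigma>. complex_of_real (C 1 (x \<bullet> \<eta>)))"
      unfolding \<sigma>_def by (rule sphere_integral_orthogonal) (auto simp: orthogonal_transformation_neg orthogonal_transformation_id)
    then have "- (LINT \<eta>|\<sigma>. C 1 (x \<bullet> \<eta>)) = (LINT \<eta>|\<sigma>. C 1 (x \<bullet> \<eta>))"
      by (simp add: C1 del: One_nat_def flip: of_real_minus)
    then show ?thesis by simp
  qed
  show ?thesis
    using ml *[of \<omega>] *[of y] by (auto simp: doubleton_eq_iff C_0)
next
  case False
  let ?h = "C l" and ?h' = "gegenbauer_diff \<nu> l" and ?h'' = "gegenbauer_diff2 \<nu> l"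
  let ?e = "\<lambda>k. - 2 * real k * (real k + real N - 2)"
  \<comment> \<open>Self-adjointness with the zonal function of degree l about \<open>y\<close> in
    the role of f; the two sides then produce the two eigenvalues.\<close>
  have "(LINT \<eta>|\<sigma>. (\<Sum>i\<in>UNIV. \<Sum>j\<in>UNIV. zonal_diff2 ?h' ?h'' 1 y i j (1 *\<^sub>R \<eta>) (rot_field i j (1 *\<^sub>R \<eta>))) * of_real (C m (\<omega> \<bullet> \<eta>)))
    = (LINT \<eta>|\<sigma>. zonal ?h 1 y (1 *\<^sub>R \<eta>) *
        of_real (2 * ((1 - (\<omega> \<bullet> \<eta>)\<^sup>2) * gegenbauer_diff2 \<nu> m (\<omega> \<bullet> \<eta>) - (real N - 1) * (\<omega> \<bullet> \<eta>) * gegenbauer_diff \<nu> m (\<omega> \<bullet> \<eta>))))"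
    unfolding \<sigma>_def N_def
    by (rule sphere_laplacian_zonal_self_adjoint[OF a_gt'[unfolded N_def] zero_less_one assms(1)
          has_derivative_zonal[OF zero_less_one has_field_derivative_normalized_Gegenbauer]
          has_derivative_zonal_diff[OF zero_less_one has_field_derivative_gegenbauer_diff]
          continuous_on_zonal_diff2[OF zero_less_one cont_gegenbauer_diff continuous_gegenbauer_diff2]
          has_field_derivative_normalized_Gegenbauer has_field_derivative_gegenbauer_diff continuous_gegenbauer_diff2])
  also have "\<dots> = complex_of_real (?e m * (LINT \<eta>|\<sigma>. C m (\<omega> \<bullet> \<eta>) * C l (y \<bullet> \<eta>)))"
  proof -
    have "zonal ?h 1 y (1 *\<^sub>R \<eta>) * of_real (?e m * C m (\<omega> \<bullet> \<eta>))
        = complex_of_real (?e m * (C m (\<omega> \<bullet> \<eta>) * C l (y \<bullet> \<eta>)))" for \<eta>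
      by (simp add: zonal_def)
    then show ?thesis
      unfolding C_ode by (simp flip: of_real_mult of_real_minus)
  qed
  also have "(LINT \<eta>|\<sigma>. (\<Sum>i\<in>UNIV. \<Sum>j\<in>UNIV. zonal_diff2 ?h' ?h'' 1 y i j (1 *\<^sub>R \<eta>) (rot_field i j (1 *\<^sub>R \<eta>))) * of_real (C m (\<omega> \<bullet> \<eta>)))
     = (LINT \<eta>|\<sigma>. complex_of_real (?e l * (C m (\<omega> \<bullet> \<eta>) * C l (y \<bullet> \<eta>))))"
  proof (rule integral_cong_AE)
    have [measurable]: "(\<lambda>x. zonal_diff2 ?h' ?h'' 1 y i j x (rot_field i j x)) \<in> borel_measurable borel" for i j
      by (intro borel_measurable_continuous_onI continuous_on_zonal_diff2 zero_less_one
          cont_gegenbauer_diff continuous_gegenbauer_diff2)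
    show "(\<lambda>\<eta>. (\<Sum>i\<in>UNIV. \<Sum>j\<in>UNIV. zonal_diff2 ?h' ?h'' 1 y i j (1 *\<^sub>R \<eta>) (rot_field i j (1 *\<^sub>R \<eta>))) * of_real (C m (\<omega> \<bullet> \<eta>)))
       \<in> borel_measurable \<sigma>"
      unfolding scaleR_one by measurable
    show "AE \<eta> in \<sigma>. (\<Sum>i\<in>UNIV. \<Sum>j\<in>UNIV. zonal_diff2 ?h' ?h'' 1 y i j (1 *\<^sub>R \<eta>) (rot_field i j (1 *\<^sub>R \<eta>))) * of_real (C m (\<omega> \<bullet> \<eta>))
        = complex_of_real (?e l * (C m (\<omega> \<bullet> \<eta>) * C l (y \<bullet> \<eta>)))"
      using AE_\<sigma>
    proof eventually_elim
      case (elim \<eta>)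
      show ?case
        unfolding zonal_laplacian[OF zero_less_one assms(2) elim, folded N_def] C_ode by simp
    qed
  qed measurable
  also have "\<dots> = complex_of_real (?e l * (LINT \<eta>|\<sigma>. C m (\<omega> \<bullet> \<eta>) * C l (y \<bullet> \<eta>)))"
    by (simp flip: of_real_mult of_real_minus)
  finally have "(?e m - ?e l) * (LINT \<eta>|\<sigma>. C m (\<omega> \<bullet> \<eta>) * C l (y \<bullet> \<eta>)) = 0"
    unfolding of_real_eq_iff by (simp add: algebra_simps)
  moreover have "?e m - ?e l = - 2 * (real m - real l) * (real (m + l + N) - 2)"
    by (simp add: algebra_simps)
  moreover have "real (m + l + N) \<noteq> 2"
    using False by (metis of_nat_eq_iff of_nat_numeral)
  ultimately have "?e m - ?e l \<noteq> 0" and "(?e m - ?e l) * (LINT \<eta>|\<sigma>. C m (\<omega> \<bullet> \<eta>) * C l (y \<bullet> \<eta>)) = 0"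
    using assms(3) by (simp_all only: mult_eq_0_iff) simp
  then show ?thesis
    by (simp only: mult_eq_0_iff) blast
qed


section \<open>The Poisson integral and the reproducing property\<close>

lemma poisson_kernel_nonneg: "0 \<le> r \<Longrightarrow> r < 1 \<Longrightarrow> poisson_kernel \<nu> r t \<ge> 0"
  unfolding poisson_kernel_def by (intro mult_nonneg_nonneg) (auto simp: power_le_one)

lemma poisson_kernel_borel [measurable]: "poisson_kernel \<nu> r \<in> borel_measurable borel"
  unfolding poisson_kernel_def[abs_def] by measurable

lemma poisson_expansion:
  fixes f :: "real ^ 'n \<Rightarrow> complex"
  assumes \<omega>: "norm \<omega> = 1" and r: "\<bar>r\<bar> < 1" and [measurable]: "f \<in> borel_measurable borel"
    and f: "\<And>x. norm x = 1 \<Longrightarrow> norm (f x) \<le> B"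
  shows "(\<lambda>m. of_real (r ^ m) * (LINT \<eta>|\<sigma>. of_real (C m (\<omega> \<bullet> \<eta>)) * f \<eta>)) sums
      (LINT \<eta>|\<sigma>. of_real (poisson_kernel \<nu> r (\<omega> \<bullet> \<eta>)) * f \<eta>)"
    and "integrable \<sigma> (\<lambda>\<eta>. of_real (poisson_kernel \<nu> r (\<omega> \<bullet> \<eta>)) * f \<eta>)"
proof -
  define b where "b m = D m * \<bar>r\<bar> ^ m" for m
  have b: "summable b" unfolding b_def by (rule summable_gegenbauer_bound) (use r in simp)
  have bb: "norm (complex_of_real (C m (\<omega> \<bullet> \<eta>) * r ^ m) * f \<eta>) \<le> b m * B" if "norm \<eta> = 1" for m \<eta>
    using C_bound[OF inner_le[of \<omega> \<eta>]] \<omega> that f[OF that]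
    by (auto simp: b_def norm_mult norm_power abs_mult power_abs less_imp_le[OF gegenbauer_bound_pos] intro!: mult_mono mult_nonneg_nonneg)
  note * = sums_integral_dominated[of "\<lambda>m \<eta>. of_real (C m (\<omega> \<bullet> \<eta>) * r ^ m) * f \<eta>" \<sigma> "\<lambda>_. \<Sum>m. b m * B"
      "\<lambda>\<eta>. of_real (poisson_kernel \<nu> r (\<omega> \<bullet> \<eta>)) * f \<eta>"]
  have 1: "AE x in \<sigma>. (\<lambda>m. of_real (C m (\<omega> \<bullet> x) * r ^ m) * f x) sums (of_real (poisson_kernel \<nu> r (\<omega> \<bullet> x)) * f x)"
    using AE_\<sigma>
  proof eventually_elim
    case (elim x)
    then have "\<bar>\<omega> \<bullet> x\<bar> \<le> 1" using \<omega> by (intro inner_le) auto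
    from normalized_Gegenbauer_sums[OF this r, of \<nu>] show ?case
      by (intro sums_mult2 sums_of_real)
  qed
  have 2: "AE x in \<sigma>. \<forall>n. (\<Sum>m<n. norm (complex_of_real (C m (\<omega> \<bullet> x) * r ^ m) * f x)) \<le> (\<Sum>m. b m * B)"
    using AE_\<sigma>
  proof eventually_elim
    case (elim x)
    show ?case
      using sum_norm_le_suminf[OF summable_mult2[OF b] bb[OF elim]] by blast
  qed
  have 3: "integrable \<sigma> (\<lambda>_. \<Sum>m. b m * B)" by simp
  have "(\<lambda>m. LINT \<eta>|\<sigma>. of_real (C m (\<omega> \<bullet> \<eta>) * r ^ m) * f \<eta>) sums
      (LINT \<eta>|\<sigma>. of_real (poisson_kernel \<nu> r (\<omega> \<bullet> \<eta>)) * f \<eta>)"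
    by (rule *(1)[OF _ 3 1 2]) measurable
  moreover have "(LINT \<eta>|\<sigma>. of_real (C m (\<omega> \<bullet> \<eta>) * r ^ m) * f \<eta>)
      = of_real (r ^ m) * (LINT \<eta>|\<sigma>. of_real (C m (\<omega> \<bullet> \<eta>)) * f \<eta>)" for m
    by (subst integral_mult_right_zero[symmetric]) (simp add: mult_ac)
  ultimately show "(\<lambda>m. of_real (r ^ m) * (LINT \<eta>|\<sigma>. of_real (C m (\<omega> \<bullet> \<eta>)) * f \<eta>)) sums
      (LINT \<eta>|\<sigma>. of_real (poisson_kernel \<nu> r (\<omega> \<bullet> \<eta>)) * f \<eta>)"
    by simp
  show "integrable \<sigma> (\<lambda>\<eta>. of_real (poisson_kernel \<nu> r (\<omega> \<bullet> \<eta>)) * f \<eta>)"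
    by (rule *(2)[OF _ 3 1 2]) measurable
qed

lemma integral_gegenbauer_pos:
  assumes "norm \<omega> = 1" "m > 0"
  shows "(LINT \<eta>|\<sigma>. C m (\<omega> \<bullet> \<eta>)) = 0"
  using gegenbauer_orthogonal[OF assms(1,1), of m 0] assms(2) by (simp add: C_0)

text \<open>In the expansion of the kernel every degree m > 0 is orthogonal to C_0 = 1.\<close>

lemma poisson_integral:
  assumes \<omega>: "norm \<omega> = 1" and r: "\<bar>r\<bar> < 1"
  shows "(LINT \<eta>|\<sigma>. poisson_kernel \<nu> r (\<omega> \<bullet> \<eta>)) = 1"
proof -
  have s1: "(\<lambda>m. of_real (r ^ m) * (LINT \<eta>|\<sigma>. of_real (C m (\<omega> \<bullet> \<eta>)) * 1)) sums
      (LINT \<eta>|\<sigma>. complex_of_real (poisson_kernel \<nu> r (\<omega> \<bullet> \<eta>)) * 1)"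
    by (rule poisson_expansion[OF assms, of _ 1]) auto
  have eq: "of_real (r ^ m) * (LINT \<eta>|\<sigma>. complex_of_real (C m (\<omega> \<bullet> \<eta>)) * 1) = (if m = 0 then 1 else 0)" for m
    using integral_gegenbauer_pos[OF \<omega>, of m] by (cases "m = 0") (simp_all add: C_0 measure_\<sigma>)
  have "(LINT \<eta>|\<sigma>. complex_of_real (poisson_kernel \<nu> r (\<omega> \<bullet> \<eta>)) * 1) = 1"
    using sums_unique2[OF s1[unfolded eq] sums_single[of 0 "\<lambda>_. 1 :: complex"]] .
  then show ?thesis by (simp only: mult_1_right integral_complex_of_real of_real_eq_1_iff)
qed

lemma poisson_limit:
  fixes f :: "real ^ 'n \<Rightarrow> complex"
  assumes \<omega>: "norm \<omega> = 1" and [measurable]: "f \<in> borel_measurable borel"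
    and f: "\<And>x. norm x = 1 \<Longrightarrow> norm (f x) \<le> B" and c: "isCont f \<omega>"
  shows "((\<lambda>r. LINT \<eta>|\<sigma>. of_real (poisson_kernel \<nu> r (\<omega> \<bullet> \<eta>)) * f \<eta>) \<longlongrightarrow> f \<omega>) (at_left 1)"
proof (rule tendstoI)
  fix e :: real assume e: "e > 0"
  obtain d where d: "d > 0" "\<And>x. norm (x - \<omega>) < d \<Longrightarrow> norm (f x - f \<omega>) < e / 2"
    using c e unfolding continuous_at_eps_delta dist_norm by (meson half_gt_zero)
  have B: "B \<ge> 0" using f[OF \<omega>] norm_ge_zero order_trans by blast
  \<comment> \<open>If |\<eta> - \<omega>| \<ge> d then 1 - t \<ge> d^2 / 2, and 1 - 2 r t + r^2 =
    (1 - r)^2 + 2 r (1 - t) \<ge> d^2 / 2 as soon as r > 1 / 2. So \<open>K\<close> bounds the power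
    in the kernel away from \<omega>, and the factor 1 - r^2 tends to 0.\<close>
  define K where "K = (d\<^sup>2 / 2) powr (- (\<nu> + 1))"
  have est: "norm ((LINT \<eta>|\<sigma>. of_real (poisson_kernel \<nu> r (\<omega> \<bullet> \<eta>)) * f \<eta>) - f \<omega>) \<le> e / 2 + 2 * B * (1 - r\<^sup>2) * K"
    if r: "1 / 2 < r" "r < 1" for r
  proof -
    have r': "\<bar>r\<bar> < 1" "0 \<le> r" using r by auto
    have r2: "1 - r\<^sup>2 \<ge> 0" using r by (simp add: power_le_one)
    have P: "complex_of_real (LINT \<eta>|\<sigma>. poisson_kernel \<nu> r (\<omega> \<bullet> \<eta>)) = 1"
      by (simp add: poisson_integral[OF \<omega> r'(1)])
    have i1: "integrable \<sigma> (\<lambda>\<eta>. of_real (poisson_kernel \<nu> r (\<omega> \<bullet> \<eta>)) * f \<eta>)"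
      by (rule poisson_expansion(2)[OF \<omega> r'(1) _ f]) auto
    have i2: "integrable \<sigma> (\<lambda>\<eta>. complex_of_real (poisson_kernel \<nu> r (\<omega> \<bullet> \<eta>)) * 1)"
      by (rule poisson_expansion(2)[OF \<omega> r'(1), of _ 1]) auto
    then have i2': "integrable \<sigma> (\<lambda>\<eta>. poisson_kernel \<nu> r (\<omega> \<bullet> \<eta>))"
      using integrable_Re[OF i2] by simp
    have "(LINT \<eta>|\<sigma>. of_real (poisson_kernel \<nu> r (\<omega> \<bullet> \<eta>)) * f \<eta>) - f \<omega>
      = (LINT \<eta>|\<sigma>. of_real (poisson_kernel \<nu> r (\<omega> \<bullet> \<eta>)) * f \<eta>) - (LINT \<eta>|\<sigma>. of_real (poisson_kernel \<nu> r (\<omega> \<bullet> \<eta>)) * f \<omega>)"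
      using P by simp
    also have "\<dots> = (LINT \<eta>|\<sigma>. of_real (poisson_kernel \<nu> r (\<omega> \<bullet> \<eta>)) * (f \<eta> - f \<omega>))"
      using i1 i2 by (subst Bochner_Integration.integral_diff[symmetric]) (auto simp: algebra_simps)
    also have "norm \<dots> \<le> (LINT \<eta>|\<sigma>. norm (of_real (poisson_kernel \<nu> r (\<omega> \<bullet> \<eta>)) * (f \<eta> - f \<omega>)))"
      by (rule integral_norm_bound)
    also have "\<dots> \<le> (LINT \<eta>|\<sigma>. e / 2 * poisson_kernel \<nu> r (\<omega> \<bullet> \<eta>) + 2 * B * (1 - r\<^sup>2) * K)"
    proof (rule integral_mono_AE)
      have "integrable \<sigma> (\<lambda>\<eta>. of_real (poisson_kernel \<nu> r (\<omega> \<bullet> \<eta>)) * f \<eta> - of_real (poisson_kernel \<nu> r (\<omega> \<bullet> \<eta>)) * f \<omega>)"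
        using i1 i2 by (intro Bochner_Integration.integrable_diff) auto
      then show "integrable \<sigma> (\<lambda>\<eta>. norm (of_real (poisson_kernel \<nu> r (\<omega> \<bullet> \<eta>)) * (f \<eta> - f \<omega>)))"
        by (intro integrable_norm) (simp add: algebra_simps)
      show "integrable \<sigma> (\<lambda>\<eta>. e / 2 * poisson_kernel \<nu> r (\<omega> \<bullet> \<eta>) + 2 * B * (1 - r\<^sup>2) * K)"
        using i2' by auto
      show "AE \<eta> in \<sigma>. norm (of_real (poisson_kernel \<nu> r (\<omega> \<bullet> \<eta>)) * (f \<eta> - f \<omega>))
          \<le> e / 2 * poisson_kernel \<nu> r (\<omega> \<bullet> \<eta>) + 2 * B * (1 - r\<^sup>2) * K"
        using AE_\<sigma>
      proof eventually_elim
        case (elim \<eta>)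
        have p: "poisson_kernel \<nu> r (\<omega> \<bullet> \<eta>) \<ge> 0" using poisson_kernel_nonneg r' r by blast
        have n: "norm (of_real (poisson_kernel \<nu> r (\<omega> \<bullet> \<eta>)) * (f \<eta> - f \<omega>))
            = poisson_kernel \<nu> r (\<omega> \<bullet> \<eta>) * norm (f \<eta> - f \<omega>)"
          using p by (simp add: norm_mult)
        have K0: "2 * B * (1 - r\<^sup>2) * K \<ge> 0" using B r2 by (simp add: K_def)
        show ?case
        proof (cases "norm (\<eta> - \<omega>) < d")
          case True
          have "poisson_kernel \<nu> r (\<omega> \<bullet> \<eta>) * norm (f \<eta> - f \<omega>) \<le> poisson_kernel \<nu> r (\<omega> \<bullet> \<eta>) * (e / 2)"
            using p d(2)[OF True] by (intro mult_left_mono) auto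
          also have "\<dots> = e / 2 * poisson_kernel \<nu> r (\<omega> \<bullet> \<eta>)" by (rule mult.commute)
          finally show ?thesis unfolding n using K0 by linarith
        next
          case False
          have "(norm (\<eta> - \<omega>))\<^sup>2 = 2 - 2 * (\<omega> \<bullet> \<eta>)"
          proof -
            have "(norm (\<eta> - \<omega>))\<^sup>2 = (norm \<eta>)\<^sup>2 - 2 * (\<eta> \<bullet> \<omega>) + (norm \<omega>)\<^sup>2"
              by (simp add: power2_norm_eq_inner inner_diff_left inner_diff_right inner_commute)
            then show ?thesis using elim \<omega> by (simp add: inner_commute)
          qed
          moreover have "d\<^sup>2 \<le> (norm (\<eta> - \<omega>))\<^sup>2"
            using False d(1) by (intro power_mono) auto
          ultimately have t: "1 - \<omega> \<bullet> \<eta> \<ge> d\<^sup>2 / 2" by simp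
          have "1 - 2 * r * (\<omega> \<bullet> \<eta>) + r\<^sup>2 = (1 - r)\<^sup>2 + 2 * r * (1 - \<omega> \<bullet> \<eta>)"
            by (simp add: power2_eq_square algebra_simps)
          also have "\<dots> \<ge> 0 + 1 * (d\<^sup>2 / 2)"
            using r t d by (intro add_mono mult_mono) auto
          finally have q: "d\<^sup>2 / 2 \<le> 1 - 2 * r * (\<omega> \<bullet> \<eta>) + r\<^sup>2" by simp
          have "(1 - 2 * r * (\<omega> \<bullet> \<eta>) + r\<^sup>2) powr (- (\<nu> + 1)) \<le> K"
            unfolding K_def using q d \<nu>_bounds by (intro powr_mono2') auto
          then have pk: "poisson_kernel \<nu> r (\<omega> \<bullet> \<eta>) \<le> (1 - r\<^sup>2) * K"
            unfolding poisson_kernel_def using r2 by (intro mult_left_mono)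
          have "norm (f \<eta> - f \<omega>) \<le> B + B"
            using f[OF elim] f[OF \<omega>] norm_triangle_ineq4[of "f \<eta>" "f \<omega>"] by simp
          then have "poisson_kernel \<nu> r (\<omega> \<bullet> \<eta>) * norm (f \<eta> - f \<omega>) \<le> (1 - r\<^sup>2) * K * (B + B)"
            using pk p by (intro mult_mono) (auto intro: order_trans)
          moreover have "e / 2 * poisson_kernel \<nu> r (\<omega> \<bullet> \<eta>) \<ge> 0" using e p by simp
          ultimately show ?thesis unfolding n by (simp add: algebra_simps)
        qed
      qed
    qed
    also have "\<dots> = e / 2 + 2 * B * (1 - r\<^sup>2) * K"
      using i2' by (simp add: poisson_integral[OF \<omega> r'(1)] measure_\<sigma>)
    finally show ?thesis .
  qed
  have "((\<lambda>r. e / 2 + 2 * B * (1 - r\<^sup>2) * K) \<longlongrightarrow> e / 2 + 2 * B * (1 - 1\<^sup>2) * K) (at_left 1)"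
    by (intro tendsto_intros)
  from order_tendstoD(2)[OF this, of e] have "\<forall>\<^sub>F r in at_left 1. e / 2 + 2 * B * (1 - r\<^sup>2) * K < e"
    using e by simp
  moreover have "\<forall>\<^sub>F r in at_left (1::real). 1 / 2 < r \<and> r < 1"
    by (rule eventually_at_leftI[of "1/2"]) auto
  ultimately show "\<forall>\<^sub>F r in at_left 1. dist (LINT \<eta>|\<sigma>. of_real (poisson_kernel \<nu> r (\<omega> \<bullet> \<eta>)) * f \<eta>) (f \<omega>) < e"
  proof eventually_elim
    case (elim r)
    then show ?case using est[of r] by (auto simp: dist_norm)
  qed
qed

text \<open>Orthogonality reduces the Poisson integral of C_m(\<omega> . \<eta>) at y to r^m times
  the diagonal integral \<open>G\<close>. Letting r tend to 1 evaluates \<open>G\<close>, without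
  computing any norm of a Gegenbauer polynomial.\<close>

lemma gegenbauer_reproducing:
  assumes "norm \<omega> = 1" "norm y = 1"
  shows "(LINT \<eta>|\<sigma>. C m (\<omega> \<bullet> \<eta>) * C l (y \<bullet> \<eta>)) = (if m = l then C m (\<omega> \<bullet> y) else 0)"
proof (cases "m = l")
  case False
  then show ?thesis using gegenbauer_orthogonal[OF assms] by simp
next
  case True
  define G where "G = (LINT \<eta>|\<sigma>. C m (\<omega> \<bullet> \<eta>) * C m (y \<bullet> \<eta>))"
  have bd: "norm (complex_of_real (C m (\<omega> \<bullet> x))) \<le> D m" if "norm x = 1" for x
    using C_bound[OF inner_le[OF _ that]] assms by simp
  have eq: "(LINT \<eta>|\<sigma>. of_real (poisson_kernel \<nu> r (y \<bullet> \<eta>)) * of_real (C m (\<omega> \<bullet> \<eta>))) = complex_of_real (r ^ m * G)"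
    if r: "\<bar>r\<bar> < 1" for r
  proof -
    have s1: "(\<lambda>l. of_real (r ^ l) * (LINT \<eta>|\<sigma>. of_real (C l (y \<bullet> \<eta>)) * complex_of_real (C m (\<omega> \<bullet> \<eta>)))) sums
      (LINT \<eta>|\<sigma>. of_real (poisson_kernel \<nu> r (y \<bullet> \<eta>)) * of_real (C m (\<omega> \<bullet> \<eta>)))"
      by (rule poisson_expansion(1)[OF assms(2) r _ bd]) measurable
    have eq: "of_real (r ^ l) * (LINT \<eta>|\<sigma>. of_real (C l (y \<bullet> \<eta>)) * complex_of_real (C m (\<omega> \<bullet> \<eta>)))
       = (if l = m then complex_of_real (r ^ m * G) else 0)" for l
    proof -
      have "(LINT \<eta>|\<sigma>. of_real (C l (y \<bullet> \<eta>)) * complex_of_real (C m (\<omega> \<bullet> \<eta>)))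
         = complex_of_real (LINT \<eta>|\<sigma>. C m (\<omega> \<bullet> \<eta>) * C l (y \<bullet> \<eta>))"
        by (simp add: mult.commute flip: of_real_mult)
      then show ?thesis
        using gegenbauer_orthogonal[OF assms, of m l] by (auto simp: G_def)
    qed
    show ?thesis
      using sums_unique2[OF s1[unfolded eq] sums_single[of m "\<lambda>_. complex_of_real (r ^ m * G)"]] .
  qed
  have "isCont (\<lambda>x. complex_of_real (C m (\<omega> \<bullet> x))) y"
  proof -
    have "continuous_on UNIV (\<lambda>x. complex_of_real (C m (\<omega> \<bullet> x)))"
      by (intro continuous_on_of_real continuous_on_compose2[OF C_cont[of UNIV]] continuous_intros) auto
    then show ?thesis by (simp add: continuous_on_eq_continuous_at)
  qed
  then have "((\<lambda>r. LINT \<eta>|\<sigma>. of_real (poisson_kernel \<nu> r (y \<bullet> \<eta>)) * of_real (C m (\<omega> \<bullet> \<eta>)))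
      \<longlongrightarrow> complex_of_real (C m (\<omega> \<bullet> y))) (at_left 1)"
    by (intro poisson_limit[OF assms(2) _ bd]) auto
  moreover have "\<forall>\<^sub>F r in at_left (1::real). 0 < r \<and> r < 1"
    by (rule eventually_at_leftI[of 0]) auto
  then have "\<forall>\<^sub>F r in at_left 1. (LINT \<eta>|\<sigma>. of_real (poisson_kernel \<nu> r (y \<bullet> \<eta>)) * of_real (C m (\<omega> \<bullet> \<eta>)))
      = complex_of_real (r ^ m * G)"
    by eventually_elim (rule eq, auto)
  ultimately have "((\<lambda>r. complex_of_real (r ^ m * G)) \<longlongrightarrow> complex_of_real (C m (\<omega> \<bullet> y))) (at_left 1)"
    by (rule Lim_transform_eventually)
  moreover have "((\<lambda>r. complex_of_real (r ^ m * G)) \<longlongrightarrow> complex_of_real (1 ^ m * G)) (at_left 1)"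
    by (intro tendsto_intros)
  ultimately have "complex_of_real (1 ^ m * G) = complex_of_real (C m (\<omega> \<bullet> y))"
    using tendsto_unique trivial_limit_at_left_real by blast
  then show ?thesis using True by (simp add: G_def)
qed


text \<open>By the reproducing property this is, for unit \<omega>, the value in direction \<omega>
  of the degree m part of f on the sphere of radius r.\<close>

definition zonal_coeff :: "(real ^ 'n \<Rightarrow> complex) \<Rightarrow> real ^ 'n \<Rightarrow> nat \<Rightarrow> real \<Rightarrow> complex" where
  "zonal_coeff f \<omega> m r = (LINT \<eta>|\<sigma>. f (r *\<^sub>R \<eta>) * of_real (C m (\<omega> \<bullet> \<eta>)))"

lemma zonal_coeff_bound:
  assumes "norm \<omega> \<le> 1" "f \<in> borel_measurable borel" "\<And>\<eta>. norm \<eta> = 1 \<Longrightarrow> norm (f (r *\<^sub>R \<eta>)) \<le> B"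
  shows "norm (zonal_coeff f \<omega> m r) \<le> B * D m"
  unfolding zonal_coeff_def
proof (rule integral_\<sigma>_bound)
  fix \<eta> :: "real ^ 'n" assume \<eta>: "norm \<eta> = 1"
  have "norm (f (r *\<^sub>R \<eta>) * of_real (C m (\<omega> \<bullet> \<eta>))) = norm (f (r *\<^sub>R \<eta>)) * \<bar>C m (\<omega> \<bullet> \<eta>)\<bar>"
    by (simp add: norm_mult)
  also have "\<dots> \<le> B * D m"
    using assms(3)[OF \<eta>] C_bound[OF inner_le[OF assms(1) \<eta>], of m] gegenbauer_bound_pos[of N m]
    by (intro mult_mono) (auto intro: order_trans[OF norm_ge_zero])
  finally show "norm (f (r *\<^sub>R \<eta>) * of_real (C m (\<omega> \<bullet> \<eta>))) \<le> B * D m" .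
qed (use assms(2) in measurable)

lemma zonal_coeff_laplacian:
  assumes "r > 0" "norm \<omega> = 1" "Cinfinity_on f (UNIV - {0})"
  shows "Cinfinity_on ((sphere_laplacian ^^ K) f) (UNIV - {0})"
    and "zonal_coeff ((sphere_laplacian ^^ K) f) \<omega> m r
      = (- of_real (2 * real m * (real m + real N - 2))) ^ K * zonal_coeff f \<omega> m r"
proof -
  show *: "Cinfinity_on ((sphere_laplacian ^^ K) f) (UNIV - {0})" for K
    by (induction K) (auto intro!: assms Cinfinity_on_sphere_laplacian)
  show "zonal_coeff ((sphere_laplacian ^^ K) f) \<omega> m r
      = (- of_real (2 * real m * (real m + real N - 2))) ^ K * zonal_coeff f \<omega> m r"
  proof (induction K)
    case (Suc K)
    have "zonal_coeff ((sphere_laplacian ^^ Suc K) f) \<omega> m r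
       = - of_real (2 * real m * (real m + real N - 2)) * zonal_coeff ((sphere_laplacian ^^ K) f) \<omega> m r"
      using sphere_laplacian_gegenbauer[OF assms(1,2) *[of K], of m] by (simp add: zonal_coeff_def)
    then show ?case by (simp add: Suc)
  qed simp
qed

text \<open>Moving \<open>K\<close> Laplacians onto f divides by the K-th power of 2 m (m + N - 2),
  which is at least m^2. The condition m \<ge> 2 is due to N = 1, where the eigenvalue of degree 1
  is 0.\<close>

lemma zonal_coeff_decay:
  assumes \<omega>: "norm \<omega> = 1" and f: "Cinfinity_on f (UNIV - {0})" and r1: "0 < r1"
  obtains B where "B \<ge> 0"
    "\<And>m r. m \<ge> 2 \<Longrightarrow> r1 \<le> r \<Longrightarrow> r \<le> r2 \<Longrightarrow> norm (zonal_coeff f \<omega> m r) \<le> B * D m / real m ^ (2 * K)"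
proof -
  define g where "g = (sphere_laplacian ^^ K) f"
  have cg: "continuous_on (- {0}) g"
    using Cinfinity_on_imp(3)[OF zonal_coeff_laplacian(1)[OF r1 \<omega> f, of K]]
    by (simp add: g_def Compl_eq_Diff_UNIV)
  \<comment> \<open>The iterated Laplacian of f is continuous off the origin, so one bound on this
    closed shell serves all radii between r1 and r2.\<close>
  have "compact (cball 0 r2 - ball (0 :: real ^ 'n) r1)"
    by (intro compact_diff) auto
  moreover have "continuous_on (cball 0 r2 - ball 0 r1) g"
    by (rule continuous_on_subset[OF cg]) (use r1 in auto)
  ultimately have "bounded (g ` (cball 0 r2 - ball 0 r1))"
    by (intro compact_imp_bounded compact_continuous_image)
  then obtain B where B: "\<And>x. r1 \<le> norm x \<Longrightarrow> norm x \<le> r2 \<Longrightarrow> norm (g x) \<le> B"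
    unfolding bounded_iff by force
  show thesis
  proof (rule that[of "max B 0"])
    fix m :: nat and r assume m: "m \<ge> 2" and r: "r1 \<le> r" "r \<le> r2"
    have "norm (zonal_coeff g \<omega> m r) \<le> max B 0 * D m"
      using B r r1 \<omega> by (intro zonal_coeff_bound borel_measurable_punctured[OF cg]) (auto intro!: max.coboundedI1)
    moreover have "real m ^ (2 * K) * norm (zonal_coeff f \<omega> m r) \<le> norm (zonal_coeff g \<omega> m r)"
    proof -
      have "real m * 1 \<le> real m * (2 * (real m + real N - 2))"
        using m N_pos by (intro mult_left_mono) auto
      have "real m * real m \<le> real m * (2 * (real m + real N - 2))"
        using m N_pos by (intro mult_left_mono) auto
      then have "(real m * real m) ^ K \<le> \<bar>2 * real m * (real m + real N - 2)\<bar> ^ K"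
        by (intro power_mono) (auto simp: algebra_simps)
      then have "real m ^ (2 * K) \<le> norm ((- complex_of_real (2 * real m * (real m + real N - 2))) ^ K)"
        unfolding norm_power norm_minus_cancel norm_of_real by (simp add: power_mult power2_eq_square)
      then show ?thesis
        unfolding g_def zonal_coeff_laplacian(2)[OF order.strict_trans2[OF r1 r(1)] \<omega> f] norm_mult
        by (rule mult_right_mono) simp
    qed
    ultimately show "norm (zonal_coeff f \<omega> m r) \<le> max B 0 * D m / real m ^ (2 * K)"
      using m by (simp add: pos_le_divide_eq mult.commute)
  qed simp
qed

text \<open>\<open>D m\<close> grows like m^(2 N + 1), and 2 (N + 2) = (2 N + 1) + 3 leaves the
  summable m^(-3). This is where the number N + 2 of Laplacians comes from.\<close>

lemma summable_gegenbauer_bound_decay: "summable (\<lambda>m. B * D m / real m ^ (2 * (N + 2)))"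
proof (rule summable_comparison_test_ev)
  show "summable (\<lambda>m. \<bar>B\<bar> * 2 * 2 ^ (2 * N + 1) * inverse (real m ^ 3))"
    by (intro summable_mult inverse_power_summable) simp
  show "\<forall>\<^sub>F m in sequentially. norm (B * D m / real m ^ (2 * (N + 2))) \<le> \<bar>B\<bar> * 2 * 2 ^ (2 * N + 1) * inverse (real m ^ 3)"
  proof (rule eventually_sequentiallyI)
    fix m :: nat assume m: "1 \<le> m"
    have "real (m + 1) ^ (2 * N + 1) \<le> (2 * real m) ^ (2 * N + 1)"
      using m by (intro power_mono) auto
    then have Dm: "D m \<le> 2 * (2 ^ (2 * N + 1) * real m ^ (2 * N + 1))"
      unfolding gegenbauer_bound_def power_mult_distrib by linarith
    have "norm (B * D m / real m ^ (2 * (N + 2))) = \<bar>B\<bar> * D m / real m ^ (2 * (N + 2))"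
      using gegenbauer_bound_pos[of N m] by (simp add: abs_mult)
    also have "\<dots> \<le> \<bar>B\<bar> * (2 * (2 ^ (2 * N + 1) * real m ^ (2 * N + 1))) / real m ^ (2 * (N + 2))"
      by (intro divide_right_mono mult_left_mono Dm) auto
    also have "\<dots> = \<bar>B\<bar> * 2 * 2 ^ (2 * N + 1) * inverse (real m ^ 3)"
    proof -
      have "2 * (N + 2) = (2 * N + 1) + 3" by simp
      then have "real m ^ (2 * (N + 2)) = real m ^ (2 * N + 1) * real m ^ 3"
        by (simp only: power_add)
      then show ?thesis
        using m by (simp only:) (simp, simp add: divide_inverse mult_ac)
    qed
    finally show "norm (B * D m / real m ^ (2 * (N + 2))) \<le> \<bar>B\<bar> * 2 * 2 ^ (2 * N + 1) * inverse (real m ^ 3)" .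
  qed
qed

text \<open>Abel summation: the Poisson integral of f on the sphere is the series with factors
  \<rho>^m, and it tends to f(r \<omega>) as \<rho> tends to 1. The decay of the coefficients lets
  the limit be taken inside the series.\<close>

lemma zonal_coeff_sums:
  assumes \<omega>: "norm \<omega> = 1" and f: "Cinfinity_on f (UNIV - {0})" and r: "r > 0"
  shows "(\<lambda>m. zonal_coeff f \<omega> m r) sums f (r *\<^sub>R \<omega>)"
proof -
  define p where "p m = zonal_coeff f \<omega> m r" for m
  obtain B where "B \<ge> 0" and B': "\<And>m s. m \<ge> 2 \<Longrightarrow> r \<le> s \<Longrightarrow> s \<le> r \<Longrightarrow> norm (zonal_coeff f \<omega> m s) \<le> B * D m / real m ^ (2 * (N + 2))"
  proof (rule zonal_coeff_decay[OF \<omega> f r, where K = "N + 2" and ?r2.0 = r])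
    fix B
    assume "0 \<le> B" "\<And>m s. m \<ge> 2 \<Longrightarrow> r \<le> s \<Longrightarrow> s \<le> r \<Longrightarrow> norm (zonal_coeff f \<omega> m s) \<le> B * D m / real m ^ (2 * (N + 2))"
    then show thesis by (rule that)
  qed
  have B: "norm (p m) \<le> B * D m / real m ^ (2 * (N + 2))" if "m \<ge> 2" for m
    unfolding p_def using B'[OF that, of r] by simp
  have cf: "continuous_on (- {0}) f"
    using Cinfinity_on_imp(3)[OF f] by (simp add: Compl_eq_Diff_UNIV)
  obtain B0 where B0: "\<And>x. norm x = r \<Longrightarrow> norm (f x) \<le> B0"
    using bounded_on_sphere[OF cf r] by blast
  have [measurable]: "f \<in> borel_measurable borel" by (rule borel_measurable_punctured[OF cf])
  have near: "\<forall>\<^sub>F \<rho> in at_left (1::real). 0 < \<rho> \<and> \<rho> < 1"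
    by (rule eventually_at_leftI[of 0]) auto
  have T: "((\<lambda>\<rho>. \<Sum>k. of_real (\<rho> ^ k) * p k) \<longlongrightarrow> (\<Sum>k. p k)) (at_left (1::real))"
  proof (rule tannery_eventually[OF _ _ summable_gegenbauer_bound_decay[of B], of _ _ _ 2])
    fix k
    have "((\<lambda>\<rho>. of_real (\<rho> ^ k) * p k) \<longlongrightarrow> of_real (1 ^ k) * p k) (at_left 1)"
      by (intro tendsto_intros)
    then show "((\<lambda>\<rho>. of_real (\<rho> ^ k) * p k) \<longlongrightarrow> p k) (at_left 1)" by simp
  next
    show "\<forall>\<^sub>F \<rho> in at_left 1. \<forall>k\<ge>2. norm (of_real (\<rho> ^ k) * p k) \<le> B * D k / real k ^ (2 * (N + 2))"
      using near
    proof eventually_elim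
      case (elim \<rho>)
      show ?case
      proof (intro allI impI)
        fix k :: nat assume k: "2 \<le> k"
        have "norm (of_real (\<rho> ^ k) * p k) \<le> 1 * norm (p k)"
          using elim unfolding norm_mult by (intro mult_right_mono) (auto simp: power_le_one norm_power)
        then show "norm (of_real (\<rho> ^ k) * p k) \<le> B * D k / real k ^ (2 * (N + 2))"
          using B[OF k] by simp
      qed
    qed
  qed simp
  have lim: "((\<lambda>\<rho>. LINT \<eta>|\<sigma>. of_real (poisson_kernel \<nu> \<rho> (\<omega> \<bullet> \<eta>)) * f (r *\<^sub>R \<eta>)) \<longlongrightarrow> f (r *\<^sub>R \<omega>)) (at_left 1)"
  proof (rule poisson_limit[OF \<omega>])
    have "continuous_on (- {0}) (\<lambda>\<eta>. f (r *\<^sub>R \<eta>))"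
      by (rule continuous_on_compose2[OF cf]) (use r in \<open>auto intro!: continuous_intros\<close>)
    then show "isCont (\<lambda>\<eta>. f (r *\<^sub>R \<eta>)) \<omega>"
      using \<omega> by (subst (asm) continuous_on_eq_continuous_at) auto
    show "norm (f (r *\<^sub>R x)) \<le> B0" if "norm x = 1" for x
      using B0[of "r *\<^sub>R x"] that r by simp
  qed measurable
  from near have "\<forall>\<^sub>F \<rho> in at_left 1. (LINT \<eta>|\<sigma>. of_real (poisson_kernel \<nu> \<rho> (\<omega> \<bullet> \<eta>)) * f (r *\<^sub>R \<eta>)) = (\<Sum>k. of_real (\<rho> ^ k) * p k)"
  proof eventually_elim
    case (elim \<rho>)
    have "(\<lambda>m. of_real (\<rho> ^ m) * (LINT \<eta>|\<sigma>. of_real (C m (\<omega> \<bullet> \<eta>)) * f (r *\<^sub>R \<eta>))) sums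
      (LINT \<eta>|\<sigma>. of_real (poisson_kernel \<nu> \<rho> (\<omega> \<bullet> \<eta>)) * f (r *\<^sub>R \<eta>))"
      by (rule poisson_expansion(1)[OF \<omega>, of _ _ B0]) (use elim B0 r in auto)
    then show ?case
      unfolding p_def zonal_coeff_def by (simp add: mult.commute sums_unique)
  qed
  from Lim_transform_eventually[OF lim this]
  have "(\<Sum>k. p k) = f (r *\<^sub>R \<omega>)"
    using T tendsto_unique[OF trivial_limit_at_left_real] by blast
  moreover have "summable p"
    by (rule summable_comparison_test[OF _ summable_gegenbauer_bound_decay[of B]]) (use B in blast)
  ultimately show ?thesis
    unfolding p_def by (simp add: sums_iff)
qed

end

section \<open>The radial kernels\<close>

definition bessel_term :: "real \<Rightarrow> real \<Rightarrow> nat \<Rightarrow> real" where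
  "bessel_term c z j = z ^ j / (fact j * Gamma (c + real j))"

text \<open>The entire function behind the Bessel functions: for z > 0 it equals z^((1 - c) / 2)
  times the modified Bessel function I of order c - 1 at 2 sqrt z. Negative arguments give J in the
  same way.\<close>

definition bessel_series :: "real \<Rightarrow> real \<Rightarrow> real" where
  "bessel_series c z = (\<Sum>j. bessel_term c z j)"

text \<open>Only the first factor of the product can be smaller than 1.\<close>

lemma pochhammer_ge:
  assumes "c > (0::real)"
  shows "pochhammer c j \<ge> min c 1"
proof (induction j)
  case (Suc j)
  show ?case
  proof (cases "j = 0")
    case False
    have "min c 1 * 1 \<le> pochhammer c j * (c + real j)"
      using Suc assms False by (intro mult_mono) (auto intro: less_imp_le[OF pochhammer_pos])
    then show ?thesis by (simp add: pochhammer_Suc)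
  qed simp
qed simp

lemma Gamma_add_nat:
  assumes "c > (0::real)"
  shows "Gamma (c + real j) = pochhammer c j * Gamma c"
proof -
  have "c \<notin> \<int>\<^sub>\<le>\<^sub>0" using assms nonpos_Ints_nonpos by force
  then show ?thesis using pochhammer_Gamma[of c j] Gamma_real_pos[OF assms] by simp
qed

lemma summable_norm_bessel:
  assumes "c > 0"
  shows "summable (\<lambda>j. norm (bessel_term c z j))"
proof (rule summable_comparison_test)
  define K where "K = inverse (min c 1 * Gamma c)"
  show "summable (\<lambda>j. K * (inverse (fact j) * \<bar>z\<bar> ^ j))"
    by (intro summable_mult summable_exp)
  have "norm (norm (bessel_term c z j)) \<le> K * (inverse (fact j) * \<bar>z\<bar> ^ j)" for j
  proof -
    have G: "Gamma c > 0" using assms by (rule Gamma_real_pos)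
    have "min c 1 * Gamma c \<le> Gamma (c + real j)"
      unfolding Gamma_add_nat[OF assms] using pochhammer_ge[OF assms, of j] G by (intro mult_right_mono) auto
    then have "inverse (Gamma (c + real j)) \<le> K"
      unfolding K_def using G assms by (intro le_imp_inverse_le) auto
    then have "inverse (Gamma (c + real j)) * (inverse (fact j) * \<bar>z\<bar> ^ j) \<le> K * (inverse (fact j) * \<bar>z\<bar> ^ j)"
      by (intro mult_right_mono) auto
    moreover have "Gamma (c + real j) > 0" using assms by (intro Gamma_real_pos) auto
    ultimately show ?thesis
      by (simp add: bessel_term_def abs_mult power_abs divide_inverse mult_ac)
  qed
  then show "\<exists>N. \<forall>j\<ge>N. norm (norm (bessel_term c z j)) \<le> K * (inverse (fact j) * \<bar>z\<bar> ^ j)" by blast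
qed

lemma bessel_sums: "c > 0 \<Longrightarrow> bessel_term c z sums bessel_series c z"
  unfolding bessel_series_def using summable_norm_bessel summable_norm_cancel by (blast intro: summable_sums)

lemma bessel_term_nonneg: "c > 0 \<Longrightarrow> z \<ge> 0 \<Longrightarrow> bessel_term c z j \<ge> 0"
  by (simp add: bessel_term_def Gamma_real_pos less_imp_le)

lemma bessel_series_nonneg: "c > 0 \<Longrightarrow> z \<ge> 0 \<Longrightarrow> bessel_series c z \<ge> 0"
  using bessel_sums bessel_term_nonneg by (metis sums_le sums_zero)

lemma bessel_series_borel [measurable]: "bessel_series c \<in> borel_measurable borel"
  unfolding bessel_series_def[abs_def] bessel_term_def by measurable

text \<open>The moments of a Poisson variable in the rising-factorial basis.\<close>

lemma poisson_pochhammer_sums: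
  "(\<lambda>i. l ^ i / fact i * pochhammer (A + real i) n) sums
     (exp l * (\<Sum>k\<le>n. real (n choose k) * l ^ k * pochhammer (A + real k) (n - k)))"
proof (induction n arbitrary: A)
  case 0
  show ?case using exp_converges[of l] by (simp add: divide_inverse mult.commute)
next
  case (Suc n)
  define S where "S A = (\<Sum>k\<le>n. real (n choose k) * l ^ k * pochhammer (A + real k) (n - k))" for A
  have 1: "(\<lambda>i. (A + real n) * (l ^ i / fact i * pochhammer (A + real i) n)) sums ((A + real n) * (exp l * S A))"
    unfolding S_def by (intro sums_mult Suc.IH)
  have "(\<lambda>i. l * (l ^ i / fact i * pochhammer (A + 1 + real i) n)) sums (l * (exp l * S (A + 1)))"
    unfolding S_def by (intro sums_mult Suc.IH)
  moreover have "(\<lambda>i. l * (l ^ i / fact i * pochhammer (A + 1 + real i) n))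
      = (\<lambda>i. real (Suc i) * (l ^ Suc i / fact (Suc i) * pochhammer (A + real (Suc i)) n))"
  proof
    fix i
    have arg: "A + 1 + real i = A + real (Suc i)" by simp
    show "l * (l ^ i / fact i * pochhammer (A + 1 + real i) n)
      = real (Suc i) * (l ^ Suc i / fact (Suc i) * pochhammer (A + real (Suc i)) n)"
      unfolding arg by (simp add: divide_simps del: of_nat_Suc)
  qed
  ultimately have "(\<lambda>i. real (Suc i) * (l ^ Suc i / fact (Suc i) * pochhammer (A + real (Suc i)) n)) sums (l * (exp l * S (A + 1)))"
    by (simp only:)
  then have 2: "(\<lambda>i. real i * (l ^ i / fact i * pochhammer (A + real i) n)) sums (l * (exp l * S (A + 1)))"
    using sums_Suc_iff[of "\<lambda>i. real i * (l ^ i / fact i * pochhammer (A + real i) n)"] by simp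
  have "(\<lambda>i. l ^ i / fact i * pochhammer (A + real i) (Suc n)) sums
     ((A + real n) * (exp l * S A) + l * (exp l * S (A + 1)))"
  proof -
    have "(A + real n) * (f * P) + j * (f * P) = f * (P * (A + j + real n))" for f P j :: real
      by (simp add: algebra_simps)
    then have "(A + real n) * (l ^ i / fact i * pochhammer (A + real i) n) + real i * (l ^ i / fact i * pochhammer (A + real i) n)
        = l ^ i / fact i * pochhammer (A + real i) (Suc n)" for i
      unfolding pochhammer_Suc .
    then show ?thesis using sums_add[OF 1 2] by (simp only:)
  qed
  also have "(A + real n) * (exp l * S A) + l * (exp l * S (A + 1)) = exp l * ((A + real n) * S A + l * S (A + 1))"
    by (simp add: algebra_simps)
  also have "(A + real n) * S A + l * S (A + 1)
     = (\<Sum>k\<le>Suc n. real (Suc n choose k) * l ^ k * pochhammer (A + real k) (Suc n - k))"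
  proof -
    define P where "P k = l ^ k * pochhammer (A + real k) (Suc n - k)" for k
    have "(A + real n) * S A = (\<Sum>k\<le>n. real (n choose k) * P k)"
      unfolding S_def sum_distrib_left
    proof (intro sum.cong refl)
      fix k assume "k \<in> {..n}"
      then have "Suc n - k = Suc (n - k)" "real n = real k + real (n - k)" by auto
      then show "(A + real n) * (real (n choose k) * l ^ k * pochhammer (A + real k) (n - k)) = real (n choose k) * P k"
        by (simp add: P_def pochhammer_Suc algebra_simps)
    qed
    moreover have "l * S (A + 1) = (\<Sum>k\<le>n. real (n choose k) * P (Suc k))"
      unfolding S_def sum_distrib_left by (intro sum.cong refl) (simp add: P_def add_ac mult_ac)
    moreover have "(\<Sum>k\<le>Suc n. real (Suc n choose k) * P k)
       = (\<Sum>k\<le>n. real (n choose k) * P k) + (\<Sum>k\<le>n. real (n choose k) * P (Suc k))"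
    proof -
      have "(\<Sum>k\<le>Suc n. real (Suc n choose k) * P k) = P 0 + (\<Sum>k\<le>n. real (Suc n choose Suc k) * P (Suc k))"
        by (subst sum.atMost_Suc_shift) simp
      also have "\<dots> = P 0 + (\<Sum>k\<le>n. real (n choose Suc k) * P (Suc k)) + (\<Sum>k\<le>n. real (n choose k) * P (Suc k))"
        by (simp add: sum.distrib algebra_simps)
      also have "P 0 + (\<Sum>k\<le>n. real (n choose Suc k) * P (Suc k)) = (\<Sum>k\<le>Suc n. real (n choose k) * P k)"
        by (subst sum.atMost_Suc_shift) simp
      also have "\<dots> = (\<Sum>k\<le>n. real (n choose k) * P k)" by simp
      finally show ?thesis .
    qed
    ultimately show ?thesis by (simp add: P_def mult.assoc)
  qed
  finally show ?case .
qed

text \<open>With \<open>q = \<bar>y\<bar>\<^sup>a / a\<close>, \<open>p = \<bar>x\<bar>\<^sup>a / a\<close>, \<open>c = (N + a - 2) / a\<close> and \<open>\<beta> = m / a\<close> this is the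
  coefficient of the Gegenbauer polynomial of degree \<open>m\<close> in the heat kernel, including the weight
  \<open>q powr (c - 1)\<close> of the measure in polar coordinates.\<close>

definition radial_density :: "real \<Rightarrow> real \<Rightarrow> real \<Rightarrow> real \<Rightarrow> real \<Rightarrow> real" where
  "radial_density c \<beta> p t q = indicator {0<..} q * (exp (- ((p + q) / t)) / t * (p / t) powr \<beta> *
     (q / t) powr (\<beta> + c - 1) * bessel_series (c + 2 * \<beta>) (p * q / t\<^sup>2))"

definition radial_kernel :: "real \<Rightarrow> real \<Rightarrow> real \<Rightarrow> real \<Rightarrow> real measure" where
  "radial_kernel c \<beta> p t = density lborel (\<lambda>q. ennreal (radial_density c \<beta> p t q))"

lemma radial_density_borel [measurable]: "radial_density c \<beta> p t \<in> borel_measurable borel"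
  unfolding radial_density_def[abs_def] by measurable

lemma sets_radial_kernel [measurable_cong, simp]: "sets (radial_kernel c \<beta> p t) = sets borel"
  and space_radial_kernel [simp]: "space (radial_kernel c \<beta> p t) = UNIV"
  by (simp_all add: radial_kernel_def)

lemma AE_radial_kernel: "AE q in radial_kernel c \<beta> p t. q > 0"
  unfolding radial_kernel_def by (subst AE_density) (auto simp: radial_density_def indicator_def intro!: AE_I2)

text \<open>A Poisson weight of mean l = p / t times a Gamma quotient: integrating the i-th term of
  the Bessel series against a power of q gives a Gamma integral. For \<gamma> = \<beta> + n the
  quotient is a Pochhammer polynomial in i.\<close>

definition moment_term :: "real \<Rightarrow> real \<Rightarrow> real \<Rightarrow> real \<Rightarrow> nat \<Rightarrow> real" where
  "moment_term c \<beta> \<gamma> l i = exp (- l) * (l ^ i / fact i) *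
     (l powr (\<beta> - \<gamma>) * Gamma (c + \<beta> + \<gamma> + real i) / Gamma (c + 2 * \<beta> + real i))"

lemma radial_kernel_moment:
  assumes "c > 0" "\<beta> \<ge> 0" "c + \<beta> + \<gamma> > 0" and p: "p > 0" and t: "t > 0"
  shows "(\<integral>\<^sup>+q. ennreal ((q / p) powr \<gamma>) \<partial>radial_kernel c \<beta> p t) = (\<Sum>i. ennreal (moment_term c \<beta> \<gamma> (p / t) i))"
proof -
  define l where "l = p / t"
  have l: "l > 0" using p t by (simp add: l_def)
  define z where "z = c + \<beta> + \<gamma>"
  define K where "K i = exp (- l) * (l ^ i / fact i) * l powr (\<beta> - \<gamma>) / (Gamma (c + 2 * \<beta> + real i) * t powr (z + real i))" for i
  have G: "Gamma (c + 2 * \<beta> + real i) > 0" for i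
    using assms by (intro Gamma_real_pos) auto
  have K: "K i \<ge> 0" for i using l G[of i] by (simp add: K_def less_imp_le)
  have dens: "ennreal (radial_density c \<beta> p t q) * ennreal ((q / p) powr \<gamma>)
     = (\<Sum>i. ennreal (K i) * ennreal (indicator {0<..} q * (q powr (z + real i - 1) * exp (- (1 / t * q)))))" for q
  proof (cases "q > 0")
    case True
    have *: "exp (- ((p + q) / t)) / t * (p / t) powr \<beta> * (q / t) powr (\<beta> + c - 1) *
         bessel_term (c + 2 * \<beta>) (p * q / t\<^sup>2) i * (q / p) powr \<gamma>
       = K i * (q powr (z + real i - 1) * exp (- (1 / t * q)))" for i
    proof -
      have e: "exp (- ((p + q) / t)) = exp (- l) * exp (- (1 / t * q))"
        by (simp add: l_def add_divide_distrib exp_add[symmetric])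
      have pz: "(p * q / t\<^sup>2) ^ i = l ^ i * (q / t) powr real i"
        using True t by (simp add: l_def powr_realpow power_mult_distrib[symmetric] power2_eq_square)
      have qp: "(q / p) powr \<gamma> = (q / t) powr \<gamma> * l powr (- \<gamma>)"
      proof -
        have "q / p = (q / t) / l" using p t by (simp add: l_def)
        then have "(q / p) powr \<gamma> = (q / t / l) powr \<gamma>" by (simp only:)
        also have "\<dots> = (q / t) powr \<gamma> / l powr \<gamma>"
          by (rule powr_divide)
        finally show ?thesis by (simp add: powr_minus_divide)
      qed
      have qq: "(q / t) powr (\<beta> + c - 1) * (q / t) powr real i * (q / t) powr \<gamma> = q powr (z + real i - 1) / t powr (z + real i - 1)"
        using True t by (simp add: powr_add[symmetric] z_def powr_divide[symmetric] algebra_simps)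
      have tt: "t powr (z + real i) = t * t powr (z + real i - 1)"
        using t by (simp add: powr_mult_base)
      have ll: "l powr (\<beta> - \<gamma>) = l powr \<beta> * l powr (- \<gamma>)"
        using l by (simp add: powr_add[symmetric])
      have "exp (- ((p + q) / t)) / t * (p / t) powr \<beta> * (q / t) powr (\<beta> + c - 1) *
         bessel_term (c + 2 * \<beta>) (p * q / t\<^sup>2) i * (q / p) powr \<gamma>
         = exp (- l) * exp (- (1 / t * q)) / t * (l powr \<beta> * l powr (- \<gamma>)) * (l ^ i / fact i) / Gamma (c + 2 * \<beta> + real i) *
           ((q / t) powr (\<beta> + c - 1) * (q / t) powr real i * (q / t) powr \<gamma>)"
        unfolding e bessel_term_def pz qp l_def[symmetric] by (simp add: mult_ac)
      also have "\<dots> = K i * (q powr (z + real i - 1) * exp (- (1 / t * q)))"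
        unfolding qq ll[symmetric] K_def tt by (simp add: mult_ac)
      finally show ?thesis .
    qed
    have pos: "p * q / t\<^sup>2 \<ge> 0" using p True by simp
    have "(\<lambda>i. exp (- ((p + q) / t)) / t * (p / t) powr \<beta> * (q / t) powr (\<beta> + c - 1) *
         bessel_term (c + 2 * \<beta>) (p * q / t\<^sup>2) i * (q / p) powr \<gamma>) sums
       (exp (- ((p + q) / t)) / t * (p / t) powr \<beta> * (q / t) powr (\<beta> + c - 1) *
         bessel_series (c + 2 * \<beta>) (p * q / t\<^sup>2) * (q / p) powr \<gamma>)"
      using assms by (intro sums_mult sums_mult2 bessel_sums) auto
    then have "(\<lambda>i. K i * (q powr (z + real i - 1) * exp (- (1 / t * q)))) sums (radial_density c \<beta> p t q * (q / p) powr \<gamma>)"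
      unfolding * using True by (simp add: radial_density_def)
    then have "ennreal (radial_density c \<beta> p t q * (q / p) powr \<gamma>) = (\<Sum>i. ennreal (K i * (q powr (z + real i - 1) * exp (- (1 / t * q)))))"
      using K by (intro suminf_ennreal_eq[symmetric]) auto
    then show ?thesis
      using True K by (simp add: ennreal_mult'' ennreal_mult')
  qed (simp add: radial_density_def)
  have "(\<integral>\<^sup>+q. ennreal ((q / p) powr \<gamma>) \<partial>radial_kernel c \<beta> p t)
     = (\<integral>\<^sup>+q. (\<Sum>i. ennreal (K i) * ennreal (indicator {0<..} q * (q powr (z + real i - 1) * exp (- (1 / t * q))))) \<partial>lborel)"
    unfolding radial_kernel_def by (subst nn_integral_density) (auto simp: dens)
  also have "\<dots> = (\<Sum>i. ennreal (K i) * (\<integral>\<^sup>+q. ennreal (indicator {0<..} q * (q powr (z + real i - 1) * exp (- (1 / t * q)))) \<partial>lborel))"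
    by (subst nn_integral_suminf) (auto simp: nn_integral_cmult)
  also have "\<dots> = (\<Sum>i. ennreal (moment_term c \<beta> \<gamma> (p / t) i))"
  proof (intro suminf_cong)
    fix i
    have z: "z + real i > 0" using assms by (simp add: z_def)
    have "ennreal (K i) * (\<integral>\<^sup>+q. ennreal (indicator {0<..} q * (q powr (z + real i - 1) * exp (- (1 / t * q)))) \<partial>lborel)
       = ennreal (K i * (Gamma (z + real i) / (1 / t) powr (z + real i)))"
    proof -
      have t': "1 / t > 0" using t by simp
      show ?thesis unfolding nn_integral_Gamma[OF z t'] by (rule ennreal_mult'[OF K, symmetric])
    qed
    also have "K i * (Gamma (z + real i) / (1 / t) powr (z + real i)) = moment_term c \<beta> \<gamma> (p / t) i"
      using t by (simp add: K_def moment_term_def z_def l_def[symmetric] powr_divide)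
    finally show "ennreal (K i) * (\<integral>\<^sup>+q. ennreal (indicator {0<..} q * (q powr (z + real i - 1) * exp (- (1 / t * q)))) \<partial>lborel)
       = ennreal (moment_term c \<beta> \<gamma> (p / t) i)" .
  qed
  finally show ?thesis .
qed

lemma nn_integral_Beta:
  assumes "z > 0" "d > (0::real)"
  shows "(\<integral>\<^sup>+y. ennreal (y powr (z - 1) * (1 - y) powr (d - 1)) * indicator {0..1} y \<partial>lborel) = ennreal (Gamma z * Gamma d / Gamma (z + d))"
  using nn_integral_has_integral_lebesgue'[OF _ has_integral_Beta_real[OF assms]] by (simp add: Beta_def)

text \<open>For \<gamma> < \<beta> the Gamma quotient is a Beta integral over y with exponents z = c
  + \<beta> + \<gamma> and d = \<beta> - \<gamma>. Summing the Poisson weights inside it produces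
  exp(-l (1 - y)); after y^(z - 1) is bounded by 1, a Gamma integral remains that cancels the
  constant exactly.\<close>

lemma radial_kernel_moment_le_1:
  assumes c: "c > 0" and \<beta>: "\<beta> \<ge> 0" and \<gamma>: "\<gamma> < \<beta>" "c + \<beta> + \<gamma> \<ge> 1" and p: "p > 0" and t: "t > 0"
  shows "(\<integral>\<^sup>+q. ennreal ((q / p) powr \<gamma>) \<partial>radial_kernel c \<beta> p t) \<le> 1"
proof -
  define l where "l = p / t"
  have l: "l > 0" using p t by (simp add: l_def)
  define z d where "z = c + \<beta> + \<gamma>" and "d = \<beta> - \<gamma>"
  have z: "z \<ge> 1" and d: "d > 0" using \<gamma> by (simp_all add: z_def d_def)
  have Gd: "Gamma d > 0" using d by (rule Gamma_real_pos)
  define f where "f i y = exp (- l) * l powr d / Gamma d * ((l * y) ^ i / fact i) * (y powr (z - 1) * (1 - y) powr (d - 1))" for i and y :: real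
  have tm: "ennreal (moment_term c \<beta> \<gamma> l i) = (\<integral>\<^sup>+y. ennreal (f i y) * indicator {0..1} y \<partial>lborel)" for i
  proof -
    define w where "w = exp (- l) * (l ^ i / fact i) * l powr d / Gamma d"
    have w: "w \<ge> 0" using l Gd by (simp add: w_def)
    have mt: "moment_term c \<beta> \<gamma> l i = w * (Gamma (z + real i) * Gamma d / Gamma (z + real i + d))"
      using Gd by (simp add: moment_term_def w_def z_def d_def algebra_simps)
    have "ennreal (moment_term c \<beta> \<gamma> l i) = ennreal w *
        (\<integral>\<^sup>+y. ennreal (y powr (z + real i - 1) * (1 - y) powr (d - 1)) * indicator {0..1} y \<partial>lborel)"
    proof -
      have zp: "z + real i > 0" using z by simp
      show ?thesis
        by (simp only: mt ennreal_mult'[OF w] nn_integral_Beta[OF zp d])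
    qed
    also have "\<dots> = (\<integral>\<^sup>+y. ennreal w * (ennreal (y powr (z + real i - 1) * (1 - y) powr (d - 1)) * indicator {0..1} y) \<partial>lborel)"
      by (subst nn_integral_cmult) auto
    also have "\<dots> = (\<integral>\<^sup>+y. ennreal (f i y) * indicator {0..1} y \<partial>lborel)"
    proof (rule nn_integral_cong_AE)
      have "AE y in lborel. y \<noteq> (0::real)" by (rule AE_lborel_singleton)
      then show "AE y in lborel. ennreal w * (ennreal (y powr (z + real i - 1) * (1 - y) powr (d - 1)) * indicator {0..1} y)
         = ennreal (f i y) * indicator {0..1} y"
      proof eventually_elim
        case (elim y)
        show ?case
        proof (cases "y \<in> {0..1}")
          case True
          then have "y powr (z + real i - 1) = y ^ i * y powr (z - 1)"
            using elim by (simp add: powr_realpow[symmetric] powr_add[symmetric] algebra_simps)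
          then have "w * (y powr (z + real i - 1) * (1 - y) powr (d - 1)) = f i y"
            by (simp add: w_def f_def power_mult_distrib mult_ac)
          then show ?thesis using w by (simp add: mult.assoc[symmetric] ennreal_mult'[symmetric])
        qed simp
      qed
    qed
    finally show ?thesis .
  qed
  have "(\<integral>\<^sup>+q. ennreal ((q / p) powr \<gamma>) \<partial>radial_kernel c \<beta> p t) = (\<Sum>i. ennreal (moment_term c \<beta> \<gamma> l i))"
    unfolding l_def using c \<beta> \<gamma> p t by (intro radial_kernel_moment) auto
  also have "\<dots> = (\<integral>\<^sup>+y. (\<Sum>i. ennreal (f i y) * indicator {0..1} y) \<partial>lborel)"
    unfolding tm by (subst nn_integral_suminf) (auto simp: f_def)
  also have "\<dots> \<le> (\<integral>\<^sup>+y. ennreal (l powr d / Gamma d) * (ennreal (indicator {0<..} (1 - y) * ((1 - y) powr (d - 1) * exp (- (l * (1 - y)))))) \<partial>lborel)"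
  proof (rule nn_integral_mono_AE)
    have "AE y in lborel. y \<noteq> (1::real)" by (rule AE_lborel_singleton)
    then show "AE y in lborel. (\<Sum>i. ennreal (f i y) * indicator {0..1} y)
      \<le> ennreal (l powr d / Gamma d) * (ennreal (indicator {0<..} (1 - y) * ((1 - y) powr (d - 1) * exp (- (l * (1 - y))))))"
    proof eventually_elim
      case (elim y)
      show ?case
      proof (cases "y \<in> {0..1}")
        case True
        then have y: "0 \<le> y" "y < 1" using elim by auto
        have "(\<lambda>i. exp (- l) * l powr d / Gamma d * ((l * y) ^ i / fact i) * (y powr (z - 1) * (1 - y) powr (d - 1))) sums
           (exp (- l) * l powr d / Gamma d * exp (l * y) * (y powr (z - 1) * (1 - y) powr (d - 1)))"
          using exp_converges[of "l * y"] by (intro sums_mult sums_mult2) (simp add: divide_inverse mult.commute)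
        moreover have "f i y \<ge> 0" for i using l y Gd by (simp add: f_def)
        ultimately have "(\<Sum>i. ennreal (f i y)) = ennreal (exp (- l) * l powr d / Gamma d * exp (l * y) * (y powr (z - 1) * (1 - y) powr (d - 1)))"
          unfolding f_def by (intro suminf_ennreal_eq) auto
        \<comment> \<open>Here y^(z - 1) \<le> 1, which is the use of c + \<beta> + \<gamma> \<ge>
          1.\<close>
        also have "\<dots> \<le> ennreal (exp (- l) * l powr d / Gamma d * exp (l * y) * (1 * (1 - y) powr (d - 1)))"
          using y z Gd by (intro ennreal_leI mult_left_mono mult_right_mono powr_le1) auto
        also have "exp (- l) * l powr d / Gamma d * exp (l * y) * (1 * (1 - y) powr (d - 1))
           = l powr d / Gamma d * ((1 - y) powr (d - 1) * exp (- (l * (1 - y))))"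
          by (simp add: exp_add[symmetric] algebra_simps exp_diff exp_minus divide_simps)
        finally have A: "(\<Sum>i. ennreal (f i y)) \<le> ennreal (l powr d / Gamma d * ((1 - y) powr (d - 1) * exp (- (l * (1 - y)))))" .
        have ind: "indicator {0<..} (1 - y) = (1 :: real)" using y by simp
        have "ennreal (l powr d / Gamma d * ((1 - y) powr (d - 1) * exp (- (l * (1 - y)))))
          = ennreal (l powr d / Gamma d) * ennreal (indicator {0<..} (1 - y) * ((1 - y) powr (d - 1) * exp (- (l * (1 - y)))))"
          unfolding ind mult_1 by (rule ennreal_mult') (use Gd in simp)
        moreover have "(\<Sum>i. ennreal (f i y) * indicator {0..1} y) = (\<Sum>i. ennreal (f i y))"
          using True by simp
        ultimately show ?thesis using A by (simp only:)
      qed simp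
    qed
  qed
  also have "\<dots> = ennreal (l powr d / Gamma d) * (\<integral>\<^sup>+y. ennreal (indicator {0<..} (1 - y) * ((1 - y) powr (d - 1) * exp (- (l * (1 - y))))) \<partial>lborel)"
    by (subst nn_integral_cmult) auto
  also have "(\<integral>\<^sup>+y. ennreal (indicator {0<..} (1 - y) * ((1 - y) powr (d - 1) * exp (- (l * (1 - y))))) \<partial>lborel)
     = (\<integral>\<^sup>+y. ennreal (indicator {0<..} y * (y powr (d - 1) * exp (- (l * y)))) \<partial>lborel)"
    by (subst (2) nn_integral_real_affine[of _ "-1" 1]) auto
  also have "\<dots> = ennreal (Gamma d / l powr d)"
    by (rule nn_integral_Gamma[OF d l])
  also have "ennreal (l powr d / Gamma d) * ennreal (Gamma d / l powr d) = 1"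
    using Gd l by (simp add: ennreal_mult'[symmetric])
  finally show ?thesis .
qed

text \<open>The Gamma quotient becomes a Pochhammer symbol, and its Poisson average is
  \<open>poisson_pochhammer_sums\<close>. For n = 0 the value is 1 for every t.\<close>

lemma radial_kernel_moment_nat:
  assumes c: "c > 0" and \<beta>: "\<beta> \<ge> 0" and p: "p > 0" and t: "t > 0"
  shows "(\<integral>\<^sup>+q. ennreal ((q / p) powr (\<beta> + real n)) \<partial>radial_kernel c \<beta> p t)
    = ennreal (\<Sum>k\<le>n. real (n choose k) * pochhammer (c + 2 * \<beta> + real k) (n - k) * (t / p) ^ (n - k))"
proof -
  define l where "l = p / t"
  have l: "l > 0" using p t by (simp add: l_def)
  define A where "A = c + 2 * \<beta>"
  have A: "A > 0" using c \<beta> by (simp add: A_def)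
  have "moment_term c \<beta> (\<beta> + real n) l i = exp (- l) / l ^ n * (l ^ i / fact i * pochhammer (A + real i) n)" for i
  proof -
    have "Gamma (c + \<beta> + (\<beta> + real n) + real i) = pochhammer (A + real i) n * Gamma (A + real i)"
      using Gamma_add_nat[of "A + real i" n] A by (simp add: A_def algebra_simps)
    moreover have "l powr (\<beta> - (\<beta> + real n)) = 1 / l ^ n"
      using l by (simp add: powr_minus powr_realpow divide_inverse)
    moreover have "Gamma (A + real i) > 0" using A by (intro Gamma_real_pos) auto
    ultimately show ?thesis by (simp add: moment_term_def A_def mult_ac)
  qed
  moreover have "(\<lambda>i. exp (- l) / l ^ n * (l ^ i / fact i * pochhammer (A + real i) n)) sums
     (exp (- l) / l ^ n * (exp l * (\<Sum>k\<le>n. real (n choose k) * l ^ k * pochhammer (A + real k) (n - k))))"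
    by (intro sums_mult poisson_pochhammer_sums)
  moreover have "exp (- l) / l ^ n * (exp l * (\<Sum>k\<le>n. real (n choose k) * l ^ k * pochhammer (A + real k) (n - k)))
     = (\<Sum>k\<le>n. real (n choose k) * pochhammer (A + real k) (n - k) * (t / p) ^ (n - k))"
  proof -
    have "exp (- l) / l ^ n * (exp l * (\<Sum>k\<le>n. real (n choose k) * l ^ k * pochhammer (A + real k) (n - k)))
       = (\<Sum>k\<le>n. real (n choose k) * pochhammer (A + real k) (n - k) * (l ^ k / l ^ n))"
    proof -
      have "exp (- l) * exp l = 1" by (simp add: exp_minus)
      moreover have "exp (- l) / l ^ n * (exp l * S) = (exp (- l) * exp l) * S / l ^ n" for S
        by simp
      ultimately have "exp (- l) / l ^ n * (exp l * S) = S / l ^ n" for S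
        by simp
      then show ?thesis by (simp only:) (simp add: sum_divide_distrib mult_ac)
    qed
    also have "\<dots> = (\<Sum>k\<le>n. real (n choose k) * pochhammer (A + real k) (n - k) * (t / p) ^ (n - k))"
    proof (intro sum.cong refl)
      fix k assume "k \<in> {..n}"
      then have "l ^ n = l ^ k * l ^ (n - k)" by (simp add: power_add[symmetric])
      then have "l ^ k / l ^ n = inverse l ^ (n - k)" using l by (simp add: field_simps)
      moreover have "inverse l = t / p" by (simp add: l_def)
      ultimately have "l ^ k / l ^ n = (t / p) ^ (n - k)" by (simp only:)
      then show "real (n choose k) * pochhammer (A + real k) (n - k) * (l ^ k / l ^ n) = real (n choose k) * pochhammer (A + real k) (n - k) * (t / p) ^ (n - k)"
        by simp
    qed
    finally show ?thesis .
  qed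
  moreover have "moment_term c \<beta> (\<beta> + real n) l i \<ge> 0" for i
    using l c \<beta> by (auto simp: moment_term_def intro!: mult_nonneg_nonneg divide_nonneg_nonneg less_imp_le[OF Gamma_real_pos])
  ultimately have "(\<Sum>i. ennreal (moment_term c \<beta> (\<beta> + real n) l i))
     = ennreal (\<Sum>k\<le>n. real (n choose k) * pochhammer (A + real k) (n - k) * (t / p) ^ (n - k))"
    by (intro suminf_ennreal_eq) auto
  then show ?thesis
    using radial_kernel_moment[of c \<beta> "\<beta> + real n" p t] c \<beta> p t by (simp add: l_def A_def)
qed


section \<open>Concentration of the radial densities by a Korovkin argument\<close>

definition moment_poly :: "real \<Rightarrow> real \<Rightarrow> nat \<Rightarrow> real \<Rightarrow> real" where
  "moment_poly A p n t = (\<Sum>k\<le>n. real (n choose k) * pochhammer (A + real k) (n - k) * (t / p) ^ (n - k))"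

lemma moment_poly_0: "moment_poly A p 0 t = 1"
  by (simp add: moment_poly_def)

lemma moment_poly_tendsto: "(moment_poly A p n \<longlongrightarrow> 1) (at_right 0)"
proof -
  have "((\<lambda>t. \<Sum>k\<le>n. real (n choose k) * pochhammer (A + real k) (n - k) * (t * inverse p) ^ (n - k)) \<longlongrightarrow>
      (\<Sum>k\<le>n. real (n choose k) * pochhammer (A + real k) (n - k) * (0 * inverse p) ^ (n - k))) (at_right 0)"
    by (intro tendsto_intros)
  moreover have "(\<Sum>k\<le>n. real (n choose k) * pochhammer (A + real k) (n - k) * (0 * inverse p) ^ (n - k))
     = (\<Sum>k\<in>{n}. real (n choose k) * pochhammer (A + real k) (n - k) * (0 * inverse p) ^ (n - k))"
    by (rule sum.mono_neutral_right) (auto simp: power_0_left)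
  ultimately show ?thesis
    unfolding moment_poly_def[abs_def] by (simp add: divide_inverse)
qed

text \<open>\<open>mass_cond\<close> ensures that the total mass is at most 1: for \<beta> = 0 the
  mass is the explicit moment of order \<beta> + 0, for \<beta> > 0 it is the moment of order 0 <
  \<beta>, which needs c + \<beta> \<ge> 1. With \<beta> = m / a and m > 0 this amounts to N + m
  \<ge> 2.\<close>

locale radial =
  fixes c \<beta> p :: real
  assumes c: "c > 0" and \<beta>: "\<beta> \<ge> 0" and mass_cond: "\<beta> = 0 \<or> 1 \<le> c + \<beta>" and p: "p > 0"
begin

abbreviation K :: "real \<Rightarrow> real measure" where "K \<equiv> radial_kernel c \<beta> p"

abbreviation I :: "nat \<Rightarrow> real \<Rightarrow> real" where "I \<equiv> moment_poly (c + 2 * \<beta>) p"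

lemma moment_nat:
  assumes t: "t > 0"
  shows "integrable (K t) (\<lambda>q. (q / p) powr (\<beta> + real n))" "(LINT q|K t. (q / p) powr (\<beta> + real n)) = I n t"
proof -
  have *: "(\<integral>\<^sup>+q. ennreal ((q / p) powr (\<beta> + real n)) \<partial>K t) = ennreal (I n t)"
    using radial_kernel_moment_nat[OF c \<beta> p t] by (simp add: moment_poly_def)
  show "integrable (K t) (\<lambda>q. (q / p) powr (\<beta> + real n))"
    by (rule integrableI_nonneg) (use * in auto)
  have "I n t \<ge> 0"
    using c \<beta> p t unfolding moment_poly_def
    by (auto intro!: sum_nonneg mult_nonneg_nonneg pochhammer_nonneg)
  then show "(LINT q|K t. (q / p) powr (\<beta> + real n)) = I n t"
    using * by (subst integral_eq_nn_integral) auto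
qed

lemma mass_le_1:
  assumes t: "t > 0"
  shows "emeasure (K t) UNIV \<le> 1"
proof -
  have "emeasure (K t) UNIV = (\<integral>\<^sup>+q. 1 \<partial>K t)" by simp
  also have "\<dots> = (\<integral>\<^sup>+q. ennreal ((q / p) powr 0) \<partial>K t)"
    using p by (intro nn_integral_cong_AE, use AE_radial_kernel[of c \<beta> p t] in eventually_elim) auto
  also have "\<dots> \<le> 1"
  proof (cases "\<beta> = 0")
    case True
    then show ?thesis using radial_kernel_moment_nat[OF c \<beta> p t, of 0] by simp
  next
    case False
    then show ?thesis using radial_kernel_moment_le_1[OF c \<beta> _ _ p t, of 0] \<beta> mass_cond by simp
  qed
  finally show ?thesis .
qed

lemma finite_K: "t > 0 \<Longrightarrow> finite_measure (K t)"
  using mass_le_1[of t] by (intro finite_measureI) (auto simp: top_unique)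

lemma measure_K_le: "t > 0 \<Longrightarrow> measure (K t) UNIV \<le> 1"
  using mass_le_1[of t] by (simp add: measure_def enn2real_leI)

text \<open>Both \<open>bump\<close> and \<open>\<Psi>\<close> are combinations of powers \<open>s powr (\<beta> + j)\<close>, whose integrals are explicit.
  For \<open>\<beta> > 0\<close> the maximum of \<open>bump\<close> is attained at \<open>s = 1\<close> only, so that \<open>\<Psi>\<close> is a nonnegative test
  function vanishing at \<open>1\<close> only; its second summand covers \<open>\<beta> = 0\<close> and dominates the growth at infinity.\<close>

definition bump :: "real \<Rightarrow> real" where "bump s = s powr \<beta> * (1 + \<beta> * (1 - s))"

lemma bump_deriv:
  assumes "s > 0"
  shows "(bump has_real_derivative \<beta> * (\<beta> + 1) * s powr (\<beta> - 1) * (1 - s)) (at s)"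
proof -
  have "s powr \<beta> = s * s powr (\<beta> - 1)" using assms by (simp add: powr_mult_base)
  then show ?thesis
    unfolding bump_def[abs_def] using assms
    by (auto intro!: derivative_eq_intros simp: algebra_simps)
qed

lemma bump_mono:
  assumes "0 < s" "s < s'" "s' \<le> 1" "\<beta> > 0"
  shows "bump s < bump s'"
proof (rule DERIV_pos_imp_increasing_open[OF assms(2)])
  fix x assume x: "s < x" "x < s'"
  then have "\<beta> * (\<beta> + 1) * x powr (\<beta> - 1) * (1 - x) > 0" using assms by auto
  then show "\<exists>y. DERIV bump x :> y \<and> 0 < y" using bump_deriv[of x] x assms by auto
next
  show "continuous_on {s..s'} bump"
    using assms by (intro continuous_at_imp_continuous_on ballI) (auto intro: DERIV_isCont[OF bump_deriv])
qed

lemma bump_le_1: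
  assumes "s > 0"
  shows "bump s \<le> 1"
proof (cases "\<beta> = 0")
  case True
  then show ?thesis unfolding bump_def using assms by simp
next
  case False
  then have b: "\<beta> > 0" using \<beta> by simp
  have h1: "bump 1 = 1" by (simp add: bump_def)
  consider "s < 1" | "s = 1" | "s > 1" by linarith
  then show ?thesis
  proof cases
    case 1 then show ?thesis using bump_mono[OF assms, of 1] b h1 by simp
  next
    case 2 then show ?thesis using h1 by simp
  next
    case 3
    have "bump s \<le> bump 1"
    proof (rule DERIV_nonpos_imp_nonincreasing[where f = bump and a = 1 and b = s])
      show "1 \<le> s" using 3 by simp
      fix x assume "1 \<le> x" "x \<le> s"
      then show "\<exists>y. DERIV bump x :> y \<and> y \<le> 0"
        using bump_deriv[of x] \<beta> by (intro exI[of _ "\<beta> * (\<beta> + 1) * x powr (\<beta> - 1) * (1 - x)"]) (auto intro!: mult_nonneg_nonpos)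
    qed
    then show ?thesis using h1 by simp
  qed
qed

definition \<Psi> :: "nat \<Rightarrow> real \<Rightarrow> real" where
  "\<Psi> n s = (1 - bump s) + s powr \<beta> * (s - 1)\<^sup>2 * (1 + s ^ n)"

lemma \<Psi>_nonneg: "s > 0 \<Longrightarrow> \<Psi> n s \<ge> 0"
  unfolding \<Psi>_def using bump_le_1[of s] by (intro add_nonneg_nonneg mult_nonneg_nonneg) auto

text \<open>The integral of the constant 1 in \<Psi> is the mass, of which only an upper bound is
  known. That suffices: nonnegativity of \<Psi> bounds the integral below by 0, and in the upper
  bound all moments tend to 1 while their coefficients cancel the constant.\<close>

lemma integral_\<Psi>_tendsto:
  shows "t > 0 \<Longrightarrow> integrable (K t) (\<lambda>q. \<Psi> n (q / p))"
    and "((\<lambda>t. LINT q|K t. \<Psi> n (q / p)) \<longlongrightarrow> 0) (at_right 0)"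
proof -
  let ?m = "\<lambda>j q. (q / p) powr (\<beta> + real j)"
  have dec: "\<Psi> n (q / p) = 1 - (\<beta> + 1) * ?m 0 q + \<beta> * ?m 1 q + ?m 2 q - 2 * ?m 1 q + ?m 0 q
      + ?m (n + 2) q - 2 * ?m (n + 1) q + ?m n q" if "q > 0" for q
  proof -
    define s where "s = q / p"
    have s: "s > 0" using that p by (simp add: s_def)
    have "?m j q = s powr \<beta> * s ^ j" for j
      using s by (simp add: s_def[symmetric] powr_add powr_realpow)
    then show ?thesis
      unfolding \<Psi>_def bump_def s_def[symmetric] by (simp only:) (simp add: power2_eq_square power_add algebra_simps)
  qed
  have int: "integrable (K t) (\<lambda>q. \<Psi> n (q / p))" and
    val: "(LINT q|K t. \<Psi> n (q / p)) = measure (K t) UNIV - (\<beta> + 1) * I 0 t + \<beta> * I 1 t + I 2 t - 2 * I 1 t + I 0 t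
      + I (n + 2) t - 2 * I (n + 1) t + I n t" if t: "t > 0" for t
  proof -
    interpret finite_measure "K t" by (rule finite_K[OF t])
    note m = moment_nat[OF t]
    let ?f = "\<lambda>q. 1 - (\<beta> + 1) * ?m 0 q + \<beta> * ?m 1 q + ?m 2 q - 2 * ?m 1 q + ?m 0 q
      + ?m (n + 2) q - 2 * ?m (n + 1) q + ?m n q"
    have ae: "AE q in K t. ?f q = \<Psi> n (q / p)"
      using AE_radial_kernel by eventually_elim (simp only: dec)
    have f: "integrable (K t) ?f"
      by (intro Bochner_Integration.integrable_add Bochner_Integration.integrable_diff integrable_mult_right m) auto
    have [measurable]: "(\<lambda>q. \<Psi> n (q / p)) \<in> borel_measurable borel"
      unfolding \<Psi>_def bump_def by measurable
    show "integrable (K t) (\<lambda>q. \<Psi> n (q / p))"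
      by (rule integrable_cong_AE_imp[OF f _ ae]) measurable
    have "(LINT q|K t. \<Psi> n (q / p)) = (LINT q|K t. ?f q)"
      by (rule integral_cong_AE) (use ae in auto)
    also have "\<dots> = measure (K t) UNIV - (\<beta> + 1) * I 0 t + \<beta> * I 1 t + I 2 t - 2 * I 1 t + I 0 t
      + I (n + 2) t - 2 * I (n + 1) t + I n t"
      using m(1)
      by (simp only: Bochner_Integration.integral_add Bochner_Integration.integral_diff integral_mult_right_zero
          Bochner_Integration.integrable_add Bochner_Integration.integrable_diff integrable_mult_right
          integrable_const m(2) lebesgue_integral_const) simp
    finally show "(LINT q|K t. \<Psi> n (q / p)) = measure (K t) UNIV - (\<beta> + 1) * I 0 t + \<beta> * I 1 t + I 2 t - 2 * I 1 t + I 0 t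
      + I (n + 2) t - 2 * I (n + 1) t + I n t" .
  qed
  show "t > 0 \<Longrightarrow> integrable (K t) (\<lambda>q. \<Psi> n (q / p))" by (rule int)
  have pos: "\<forall>\<^sub>F t in at_right (0::real). t > 0"
    by (simp add: eventually_at_right_less)
  show "((\<lambda>t. LINT q|K t. \<Psi> n (q / p)) \<longlongrightarrow> 0) (at_right 0)"
  proof (rule tendsto_sandwich)
    show "\<forall>\<^sub>F t in at_right 0. 0 \<le> (LINT q|K t. \<Psi> n (q / p))"
      using pos
    proof eventually_elim
      case (elim t)
      have "AE q in K t. 0 \<le> \<Psi> n (q / p)"
        using AE_radial_kernel by eventually_elim (use p in \<open>auto intro!: \<Psi>_nonneg\<close>)
      then show ?case by (rule integral_nonneg_AE)
    qed
    show "\<forall>\<^sub>F t in at_right 0. (LINT q|K t. \<Psi> n (q / p)) \<le> 1 - (\<beta> + 1) * I 0 t + \<beta> * I 1 t + I 2 t - 2 * I 1 t + I 0 t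
      + I (n + 2) t - 2 * I (n + 1) t + I n t"
      using pos by eventually_elim (use val measure_K_le in auto)
    have "((\<lambda>t. 1 - (\<beta> + 1) * I 0 t + \<beta> * I 1 t + I 2 t - 2 * I 1 t + I 0 t
      + I (n + 2) t - 2 * I (n + 1) t + I n t) \<longlongrightarrow> 1 - (\<beta> + 1) * 1 + \<beta> * 1 + 1 - 2 * 1 + 1 + 1 - 2 * 1 + 1) (at_right 0)"
      by (intro tendsto_intros moment_poly_tendsto)
    then show "((\<lambda>t. 1 - (\<beta> + 1) * I 0 t + \<beta> * I 1 t + I 2 t - 2 * I 1 t + I 0 t
      + I (n + 2) t - 2 * I (n + 1) t + I n t) \<longlongrightarrow> 0) (at_right 0)" by simp
  qed simp
qed

text \<open>For \<beta> > 0 the second summand of \<Psi> vanishes as s tends to 0, so there the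
  bound comes from monotonicity of \<open>bump\<close>. For \<beta> = 0 \<open>bump\<close> is
  constantly 1 and (s - 1)^2 does the work; it also covers s \<ge> 1 + \<delta>.\<close>

lemma \<Psi>_lower_bound:
  assumes \<delta>: "0 < \<delta>" "\<delta> < 1"
  obtains e where "e > 0" "\<And>s. 0 < s \<Longrightarrow> s \<le> 1 - \<delta> \<Longrightarrow> e \<le> \<Psi> n s"
    "\<And>s. 1 + \<delta> \<le> s \<Longrightarrow> e * (s powr \<beta> * (1 + s ^ n)) \<le> \<Psi> n s"
proof -
  have up: "\<delta>\<^sup>2 * (s powr \<beta> * (1 + s ^ n)) \<le> \<Psi> n s" if "1 + \<delta> \<le> s" for s
  proof -
    have "\<delta>\<^sup>2 \<le> (s - 1)\<^sup>2" using that \<delta> by (intro power_mono) auto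
    then have "\<delta>\<^sup>2 * (s powr \<beta> * (1 + s ^ n)) \<le> (s - 1)\<^sup>2 * (s powr \<beta> * (1 + s ^ n))"
      using that \<delta> by (intro mult_right_mono) auto
    also have "\<dots> \<le> \<Psi> n s" using bump_le_1[of s] that \<delta> by (simp add: \<Psi>_def mult_ac)
    finally show ?thesis .
  qed
  show thesis
  proof (cases "\<beta> = 0")
    case True
    show thesis
    proof (rule that[of "\<delta>\<^sup>2"])
      fix s :: real assume s: "0 < s" "s \<le> 1 - \<delta>"
      have "\<delta>\<^sup>2 \<le> (1 - s)\<^sup>2" using s \<delta> by (intro power_mono) auto
      also have "\<dots> \<le> (s - 1)\<^sup>2 * (1 + s ^ n)"
        using s mult_left_mono[of 1 "1 + s ^ n" "(s - 1)\<^sup>2"] by (simp add: power2_commute)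
      also have "\<dots> \<le> \<Psi> n s" unfolding \<Psi>_def bump_def using True s by simp
      finally show "\<delta>\<^sup>2 \<le> \<Psi> n s" .
    qed (use up \<delta> in auto)
  next
    case False
    then have b: "\<beta> > 0" using \<beta> by simp
    define g where "g = 1 - bump (1 - \<delta>)"
    have "bump (1 - \<delta>) < bump 1" using \<delta> b by (intro bump_mono) auto
    then have g: "g > 0" by (simp add: g_def bump_def)
    show thesis
    proof (rule that[of "min g (\<delta>\<^sup>2)"])
      fix s assume s: "0 < s" "s \<le> 1 - \<delta>"
      then have "bump s \<le> bump (1 - \<delta>)" using bump_mono[of s "1 - \<delta>"] \<delta> b by (cases "s = 1 - \<delta>") auto
      moreover have "s powr \<beta> * (s - 1)\<^sup>2 * (1 + s ^ n) \<ge> 0" using s by auto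
      ultimately show "min g (\<delta>\<^sup>2) \<le> \<Psi> n s" by (simp add: \<Psi>_def g_def min_def)
    next
      fix s assume s: "1 + \<delta> \<le> s"
      have "min g (\<delta>\<^sup>2) * (s powr \<beta> * (1 + s ^ n)) \<le> \<delta>\<^sup>2 * (s powr \<beta> * (1 + s ^ n))"
        using s \<delta> by (intro mult_right_mono) auto
      then show "min g (\<delta>\<^sup>2) * (s powr \<beta> * (1 + s ^ n)) \<le> \<Psi> n s" using up[OF s] by simp
    qed (use g \<delta> in auto)
  qed
qed

lemma growth_le:
  assumes "q > 0"
  shows "(1 + q) ^ n \<le> (1 + p) ^ n * (1 + (q / p) ^ n)"
proof (cases "q \<le> p")
  case True
  then have "(1 + q) ^ n \<le> (1 + p) ^ n" using assms by (intro power_mono) auto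
  also have "\<dots> \<le> (1 + p) ^ n * (1 + (q / p) ^ n)" using assms p by simp
  finally show ?thesis .
next
  case False
  have "1 + q \<le> (1 + p) * (q / p)" using False p assms by (simp add: field_simps)
  then have "(1 + q) ^ n \<le> ((1 + p) * (q / p)) ^ n" using assms by (intro power_mono) auto
  also have "\<dots> = (1 + p) ^ n * (q / p) ^ n" by (rule power_mult_distrib)
  also have "\<dots> \<le> (1 + p) ^ n * (1 + (q / p) ^ n)" using p by (intro mult_left_mono) auto
  finally show ?thesis .
qed

lemma growth_const_nonneg:
  fixes F :: "real \<Rightarrow> complex"
  assumes "\<And>q. q > 0 \<Longrightarrow> norm (F q) \<le> B * (1 + q) ^ n"
  shows "B \<ge> 0"
proof (rule ccontr)
  assume "\<not> 0 \<le> B"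
  then have "B * (1 + 1) ^ n < 0" by (intro mult_neg_pos) auto
  then show False using order_trans[OF norm_ge_zero assms[of 1]] by simp
qed

lemma integrable_growth:
  fixes F :: "real \<Rightarrow> complex"
  assumes t: "t > 0" and [measurable]: "F \<in> borel_measurable borel" and F: "\<And>q. q > 0 \<Longrightarrow> norm (F q) \<le> B * (1 + q) ^ n"
  shows "integrable (K t) F"
proof -
  interpret finite_measure "K t" by (rule finite_K[OF t])
  have B: "B \<ge> 0" by (rule growth_const_nonneg[OF F])
  have "integrable (K t) (\<lambda>q. B * (1 + p) ^ n * (2 + (q / p) powr (\<beta> + real n)))"
    using moment_nat(1)[OF t, of n] by auto
  then show ?thesis
  proof (rule Bochner_Integration.integrable_bound)
    show "AE q in K t. norm (F q) \<le> norm (B * (1 + p) ^ n * (2 + (q / p) powr (\<beta> + real n)))"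
      using AE_radial_kernel
    proof eventually_elim
      case (elim q)
      have "(q / p) ^ n \<le> 1 + (q / p) powr (\<beta> + real n)"
      proof (cases "q / p \<le> 1")
        case True
        then have "(q / p) ^ n \<le> 1" using elim p by (intro power_le_one) auto
        then show ?thesis using powr_ge_zero[of "q / p" "\<beta> + real n"] by linarith
      next
        case False
        then have "(q / p) powr real n \<le> (q / p) powr (\<beta> + real n)" using \<beta> by (intro powr_mono) auto
        then show ?thesis using elim p by (simp add: powr_realpow)
      qed
      then have "(1 + p) ^ n * (1 + (q / p) ^ n) \<le> (1 + p) ^ n * (2 + (q / p) powr (\<beta> + real n))"
        using p by (intro mult_left_mono) auto
      then have "B * (1 + q) ^ n \<le> B * ((1 + p) ^ n * (2 + (q / p) powr (\<beta> + real n)))"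
        using growth_le[OF elim, of n] B by (intro mult_left_mono) auto
      then show ?case using F[OF elim] B p by (simp add: abs_mult mult.assoc)
    qed
  qed measurable
qed

text \<open>F is compared with F(p) (q / p)^\<beta>, whose integral is exactly F(p), because the
  integral of the constant F(p) is not known. The difference \<open>G\<close> vanishes at p and is
  dominated by \<epsilon> / 2 plus a multiple of \<Psi>.\<close>

lemma radial_kernel_limit:
  fixes F :: "real \<Rightarrow> complex"
  assumes F [measurable]: "F \<in> borel_measurable borel" and growth: "\<And>q. q > 0 \<Longrightarrow> norm (F q) \<le> B * (1 + q) ^ n"
    and cont: "isCont F p"
  shows "((\<lambda>t. LINT q|K t. F q) \<longlongrightarrow> F p) (at_right 0)"
proof (rule tendstoI)
  fix \<epsilon> :: real assume \<epsilon>: "\<epsilon> > 0"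
  define G where "G q = F q - F p * of_real ((q / p) powr \<beta>)" for q
  have Gm [measurable]: "G \<in> borel_measurable borel" unfolding G_def[abs_def] by measurable
  have "isCont G p" unfolding G_def[abs_def] using p
    by (intro continuous_intros cont) auto
  moreover have "G p = 0" using p by (simp add: G_def)
  ultimately obtain d where d: "d > 0" "\<And>q. \<bar>q - p\<bar> < d \<Longrightarrow> norm (G q) < \<epsilon> / 2"
    using \<epsilon> unfolding continuous_at_eps_delta dist_norm by (metis diff_zero half_gt_zero real_norm_def)
  \<comment> \<open>Converts the neighbourhood |q - p| < d to the relative variable s = q / p:
    \<delta> p \<le> d / 2, and \<delta> \<le> 1 / 2 keeps 1 - \<delta> positive.\<close>
  define \<delta> where "\<delta> = min (d / (2 * p)) (1 / 2)"
  have \<delta>: "0 < \<delta>" "\<delta> < 1" "\<delta> * p < d" using d p by (auto simp: \<delta>_def min_def field_simps)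
  obtain e where e: "e > 0" "\<And>s. 0 < s \<Longrightarrow> s \<le> 1 - \<delta> \<Longrightarrow> e \<le> \<Psi> n s"
    "\<And>s. 1 + \<delta> \<le> s \<Longrightarrow> e * (s powr \<beta> * (1 + s ^ n)) \<le> \<Psi> n s"
    using \<Psi>_lower_bound[OF \<delta>(1,2), of n] by blast
  have B: "B \<ge> 0" by (rule growth_const_nonneg[OF growth])
  \<comment> \<open>Chosen so that the norm of \<open>G\<close> is at most R for s \<le> 1 -
    \<delta> and at most R s^\<beta> (1 + s^n) for s \<ge> 1 + \<delta>; \<open>e\<close> then turns
    both into multiples of \<Psi>.\<close>
  define R where "R = B * (1 + p) ^ n * 2 + norm (F p)"
  have R: "R \<ge> 0" using B p by (simp add: R_def)
  have bound: "norm (G q) \<le> \<epsilon> / 2 + R / e * \<Psi> n (q / p)" if q: "q > 0" for q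
  proof -
    define s where "s = q / p"
    have s: "s > 0" using q p by (simp add: s_def)
    have psi: "R / e * \<Psi> n s \<ge> 0" using R e(1) \<Psi>_nonneg[OF s, of n] by (intro mult_nonneg_nonneg) auto
    have G1: "norm (G q) \<le> B * (1 + p) ^ n * (1 + s ^ n) + norm (F p) * s powr \<beta>"
    proof -
      have "norm (G q) \<le> norm (F q) + norm (F p) * s powr \<beta>"
        unfolding G_def s_def by (rule order_trans[OF norm_triangle_ineq4]) (simp add: norm_mult)
      also have "norm (F q) \<le> B * ((1 + p) ^ n * (1 + s ^ n))"
        using growth[OF q] growth_le[OF q, of n] B unfolding s_def by (meson mult_left_mono order_trans)
      finally show ?thesis by (simp add: mult.assoc)
    qed
    consider "\<bar>s - 1\<bar> < \<delta>" | "s \<le> 1 - \<delta>" | "1 + \<delta> \<le> s" by linarith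
    then show ?thesis
    proof cases
      case 1
      have "q - p = (s - 1) * p" using p by (simp add: s_def left_diff_distrib)
      then have "\<bar>q - p\<bar> = \<bar>s - 1\<bar> * p" using p by (simp add: abs_mult)
      also have "\<dots> < d" using 1 \<delta>(3) p mult_strict_right_mono[OF 1 p] by linarith
      finally show ?thesis using d(2)[of q] psi unfolding s_def[symmetric] by simp
    next
      case 2
      have "s powr \<beta> \<le> 1" "s ^ n \<le> 1" using s 2 \<delta> \<beta> by (auto intro!: powr_le1 power_le_one)
      then have "norm (G q) \<le> B * (1 + p) ^ n * 2 + norm (F p) * 1"
        using B p by (intro order_trans[OF G1] add_mono mult_left_mono) auto
      also have "\<dots> = R / e * e" using e(1) by (simp add: R_def)
      also have "\<dots> \<le> R / e * \<Psi> n s" using e(1) e(2)[OF s 2] R by (intro mult_left_mono) auto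
      finally show ?thesis using \<epsilon> unfolding s_def by simp
    next
      case 3
      have s1: "1 \<le> s powr \<beta>" using 3 \<delta> \<beta> by (intro ge_one_powr_ge_zero) auto
      have sn: "0 \<le> s ^ n" using s by simp
      have "B * (1 + p) ^ n * (1 + s ^ n) \<le> B * (1 + p) ^ n * 2 * (s powr \<beta> * (1 + s ^ n))"
      proof -
        have "1 * (1 + s ^ n) \<le> 2 * (s powr \<beta> * (1 + s ^ n))"
          using mult_right_mono[OF s1, of "1 + s ^ n"] sn by simp
        then show ?thesis using B p mult_left_mono[of "1 + s ^ n" "2 * (s powr \<beta> * (1 + s ^ n))" "B * (1 + p) ^ n"] by (simp add: mult_ac)
      qed
      moreover have "norm (F p) * s powr \<beta> \<le> norm (F p) * (s powr \<beta> * (1 + s ^ n))"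
        using sn by (intro mult_left_mono) (auto simp: mult_le_cancel_left1)
      ultimately have "norm (G q) \<le> R * (s powr \<beta> * (1 + s ^ n))"
        using G1 by (simp add: R_def algebra_simps)
      also have "\<dots> = R / e * (e * (s powr \<beta> * (1 + s ^ n)))" using e(1) by simp
      also have "\<dots> \<le> R / e * \<Psi> n s" using e(1) e(3)[OF 3] R by (intro mult_left_mono) auto
      finally show ?thesis using \<epsilon> unfolding s_def by simp
    qed
  qed
  have est: "norm ((LINT q|K t. F q) - F p) \<le> \<epsilon> / 2 + R / e * (LINT q|K t. \<Psi> n (q / p))" if t: "t > 0" for t
  proof -
    interpret finite_measure "K t" by (rule finite_K[OF t])
    have i1: "integrable (K t) F" by (rule integrable_growth[OF t F growth])
    have i2: "integrable (K t) (\<lambda>q. (q / p) powr \<beta>)" "(LINT q|K t. (q / p) powr \<beta>) = 1"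
      using moment_nat[OF t, of 0] by (simp_all add: moment_poly_0)
    have "F p = (LINT q|K t. F p * of_real ((q / p) powr \<beta>))"
      using i2 by simp
    then have "(LINT q|K t. F q) - F p = (LINT q|K t. G q)"
      unfolding G_def using i1 i2 by (subst Bochner_Integration.integral_diff) auto
    then have "norm ((LINT q|K t. F q) - F p) \<le> (LINT q|K t. norm (G q))"
      using integral_norm_bound[of "K t" G] by simp
    also have "\<dots> \<le> (LINT q|K t. \<epsilon> / 2 + R / e * \<Psi> n (q / p))"
    proof (rule integral_mono_AE)
      have "integrable (K t) G" unfolding G_def[abs_def] using i1 i2 by auto
      then show "integrable (K t) (\<lambda>q. norm (G q))" by (rule integrable_norm)
      show "integrable (K t) (\<lambda>q. \<epsilon> / 2 + R / e * \<Psi> n (q / p))"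
        using integral_\<Psi>_tendsto(1)[OF t, of n] by auto
      show "AE q in K t. norm (G q) \<le> \<epsilon> / 2 + R / e * \<Psi> n (q / p)"
        using AE_radial_kernel by eventually_elim (rule bound)
    qed
    also have "\<dots> = measure (K t) UNIV * (\<epsilon> / 2) + R / e * (LINT q|K t. \<Psi> n (q / p))"
      using integral_\<Psi>_tendsto(1)[OF t, of n] by simp
    also have "\<dots> \<le> 1 * (\<epsilon> / 2) + R / e * (LINT q|K t. \<Psi> n (q / p))"
      using \<epsilon> measure_K_le[OF t] by (intro add_right_mono mult_right_mono) auto
    finally show ?thesis by simp
  qed
  have "((\<lambda>t. \<epsilon> / 2 + R / e * (LINT q|K t. \<Psi> n (q / p))) \<longlongrightarrow> \<epsilon> / 2 + R / e * 0) (at_right 0)"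
    by (intro tendsto_intros integral_\<Psi>_tendsto)
  from order_tendstoD(2)[OF this, of \<epsilon>]
  have "\<forall>\<^sub>F t in at_right 0. \<epsilon> / 2 + R / e * (LINT q|K t. \<Psi> n (q / p)) < \<epsilon>" using \<epsilon> by simp
  moreover have "\<forall>\<^sub>F t in at_right (0::real). t > 0" by (simp add: eventually_at_right_less)
  ultimately show "\<forall>\<^sub>F t in at_right 0. dist (LINT q|K t. F q) (F p) < \<epsilon>"
  proof eventually_elim
    case (elim t)
    then show ?case using est[of t] by (simp add: dist_norm)
  qed
qed

text \<open>Outside the annulus q differs from p by a factor of at least 2, so the factor
  2^(-\<beta> / 2) is gained by inserting (q / p)^(-\<beta> / 2) below and (q / p)^(\<beta> / 2)
  above. The resulting moments of orders -\<beta> / 2 and n + \<beta> / 2 are at most 1 by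
  \<open>radial_kernel_moment_le_1\<close>; \<open>large\<close> states its conditions for
  them.\<close>

lemma radial_kernel_tail:
  fixes F :: "real \<Rightarrow> complex"
  assumes t: "t > 0" and F [measurable]: "F \<in> borel_measurable borel" and growth: "\<And>q. q > 0 \<Longrightarrow> norm (F q) \<le> B * (1 + q) ^ n"
    and near: "\<And>q. p / 2 \<le> q \<Longrightarrow> q \<le> 2 * p \<Longrightarrow> norm (F q) \<le> A"
    and large: "1 \<le> c + \<beta> / 2" "real n < \<beta> / 2"
  shows "norm (LINT q|K t. F q) \<le> A + 2 * (B * (1 + p) ^ n) * 2 powr (- \<beta> / 2)"
proof -
  interpret finite_measure "K t" by (rule finite_K[OF t])
  have B: "B \<ge> 0" by (rule growth_const_nonneg[OF growth])
  have A: "A \<ge> 0" using order_trans[OF norm_ge_zero near[of p]] p by simp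
  have b: "\<beta> > 0" using large(2) of_nat_0_le_iff[of n] by linarith
  define X where "X = B * (1 + p) ^ n * 2 powr (- \<beta> / 2)"
  have X: "X \<ge> 0" using B p by (simp add: X_def)
  have m: "(\<integral>\<^sup>+q. ennreal ((q / p) powr \<gamma>) \<partial>K t) \<le> 1" if "\<gamma> < \<beta>" "1 \<le> c + \<beta> + \<gamma>" for \<gamma>
    by (rule radial_kernel_moment_le_1[OF c \<beta> that p t])
  have m1: "(\<integral>\<^sup>+q. ennreal ((q / p) powr (- \<beta> / 2)) \<partial>K t) \<le> 1" using m[of "- \<beta> / 2"] b large by simp
  have m2: "(\<integral>\<^sup>+q. ennreal ((q / p) powr (real n + \<beta> / 2)) \<partial>K t) \<le> 1" using m[of "real n + \<beta> / 2"] b large by simp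
  have pt: "norm (F q) \<le> A + X * (q / p) powr (- \<beta> / 2) + X * (q / p) powr (real n + \<beta> / 2)" if q: "q > 0" for q
  proof -
    define s where "s = q / p"
    have s: "s > 0" using q p by (simp add: s_def)
    consider "p / 2 \<le> q \<and> q \<le> 2 * p" | "q < p / 2" | "2 * p < q" by linarith
    then show ?thesis
    proof cases
      case 1
      then have "norm (F q) \<le> A" using near by blast
      then show ?thesis using X by (simp add: add_increasing2)
    next
      case 2
      have "(1 + q) ^ n \<le> (1 + p) ^ n" using 2 q by (intro power_mono) auto
      then have F1: "norm (F q) \<le> B * (1 + p) ^ n" using growth[OF q] B by (meson mult_left_mono order_trans)
      have "2 * s \<le> 1" using 2 p by (simp add: s_def field_simps)
      then have "1 powr (- \<beta> / 2) \<le> (2 * s) powr (- \<beta> / 2)" using s b by (intro powr_mono2') auto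
      then have one: "1 \<le> 2 powr (- \<beta> / 2) * s powr (- \<beta> / 2)"
        unfolding powr_mult by simp
      have "B * (1 + p) ^ n * 1 \<le> B * (1 + p) ^ n * (2 powr (- \<beta> / 2) * s powr (- \<beta> / 2))"
        using B p by (intro mult_left_mono one) auto
      then have "norm (F q) \<le> X * s powr (- \<beta> / 2)" using F1 by (simp add: X_def mult.assoc)
      moreover have "0 \<le> X * s powr (real n + \<beta> / 2)" using X by simp
      ultimately show ?thesis using A unfolding s_def by linarith
    next
      case 3
      have "1 + q \<le> (1 + p) * s" using 3 p by (simp add: s_def field_simps)
      then have "(1 + q) ^ n \<le> ((1 + p) * s) ^ n" using q by (intro power_mono) auto
      then have "norm (F q) \<le> B * ((1 + p) * s) ^ n" using growth[OF q] B by (meson mult_left_mono order_trans)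
      also have "\<dots> = B * (1 + p) ^ n * s powr real n * 1" using s by (simp add: power_mult_distrib powr_realpow)
      also have "\<dots> \<le> B * (1 + p) ^ n * s powr real n * (2 powr (- \<beta> / 2) * s powr (\<beta> / 2))"
      proof (rule mult_left_mono)
        have "1 \<le> s / 2" using 3 p by (simp add: s_def field_simps)
        then have "1 powr (\<beta> / 2) \<le> (s / 2) powr (\<beta> / 2)" using b by (intro powr_mono2) auto
        also have "(s / 2) powr (\<beta> / 2) = s powr (\<beta> / 2) / 2 powr (\<beta> / 2)" by (rule powr_divide)
        also have "\<dots> = 2 powr (- \<beta> / 2) * s powr (\<beta> / 2)"
          using powr_minus_divide[of 2 "\<beta> / 2"] by simp
        finally show "1 \<le> 2 powr (- \<beta> / 2) * s powr (\<beta> / 2)" by simp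
      qed (use B p in auto)
      also have "\<dots> = X * s powr (real n + \<beta> / 2)"
        by (simp add: X_def powr_add mult_ac)
      finally have "norm (F q) \<le> X * s powr (real n + \<beta> / 2)" .
      moreover have "0 \<le> X * s powr (- \<beta> / 2)" using X by simp
      ultimately show ?thesis using A unfolding s_def by linarith
    qed
  qed
  have i: "integrable (K t) (\<lambda>q. (q / p) powr (- \<beta> / 2))" "integrable (K t) (\<lambda>q. (q / p) powr (real n + \<beta> / 2))"
    using m1 m2 by (auto intro!: integrableI_nonneg intro: order.strict_trans1)
  have v: "(LINT q|K t. (q / p) powr (- \<beta> / 2)) \<le> 1" "(LINT q|K t. (q / p) powr (real n + \<beta> / 2)) \<le> 1"
    using m1 m2 by (auto simp: integral_eq_nn_integral enn2real_leI)
  have "norm (LINT q|K t. F q) \<le> (LINT q|K t. norm (F q))" by (rule integral_norm_bound)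
  also have "\<dots> \<le> (LINT q|K t. A + X * (q / p) powr (- \<beta> / 2) + X * (q / p) powr (real n + \<beta> / 2))"
  proof (rule integral_mono_AE)
    show "integrable (K t) (\<lambda>q. norm (F q))"
      by (intro integrable_norm integrable_growth[OF t F growth])
    show "integrable (K t) (\<lambda>q. A + X * (q / p) powr (- \<beta> / 2) + X * (q / p) powr (real n + \<beta> / 2))"
      using i by auto
    show "AE q in K t. norm (F q) \<le> A + X * (q / p) powr (- \<beta> / 2) + X * (q / p) powr (real n + \<beta> / 2)"
      using AE_radial_kernel by eventually_elim (rule pt)
  qed
  also have "\<dots> = measure (K t) UNIV * A + X * (LINT q|K t. (q / p) powr (- \<beta> / 2)) + X * (LINT q|K t. (q / p) powr (real n + \<beta> / 2))"
    using i by simp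
  also have "\<dots> \<le> 1 * A + X * 1 + X * 1"
    using A X v measure_K_le[OF t] by (intro add_mono mult_right_mono mult_left_mono) auto
  finally show ?thesis by (simp add: X_def mult_ac)
qed

end

section \<open>Bounds for the Bessel series\<close>

text \<open>Restrict the Gamma integral to q > V and bound q^(x - 1) below by V^(x - 1). The free
  parameter V lets Gamma beat any prescribed exponential rate.\<close>

lemma Gamma_lower_bound:
  assumes "x \<ge> (1::real)" "V > 0"
  shows "V powr (x - 1) * exp (- V) \<le> Gamma x"
proof -
  have "ennreal (V powr (x - 1) * exp (- V))
     = ennreal (V powr (x - 1) * exp (- V)) * (\<integral>\<^sup>+q. ennreal (indicator {0<..} q * (q powr (1 - 1) * exp (- (1 * q)))) \<partial>lborel)"
    using nn_integral_Gamma[of 1 1] by simp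
  also have "\<dots> = (\<integral>\<^sup>+q. ennreal (V powr (x - 1) * exp (- V)) * ennreal (indicator {0<..} q * (q powr (1 - 1) * exp (- (1 * q)))) \<partial>lborel)"
    by (rule nn_integral_cmult[symmetric]) measurable
  also have "\<dots> \<le> (\<integral>\<^sup>+q. ennreal (indicator {0<..} (V + 1 * q) * ((V + 1 * q) powr (x - 1) * exp (- (1 * (V + 1 * q))))) \<partial>lborel)"
  proof (rule nn_integral_mono)
    fix q :: real
    show "ennreal (V powr (x - 1) * exp (- V)) * ennreal (indicator {0<..} q * (q powr (1 - 1) * exp (- (1 * q))))
      \<le> ennreal (indicator {0<..} (V + 1 * q) * ((V + 1 * q) powr (x - 1) * exp (- (1 * (V + 1 * q)))))"
    proof (cases "q > 0")
      case True
      have "V powr (x - 1) * (exp (- V) * exp (- q)) \<le> (V + q) powr (x - 1) * (exp (- V) * exp (- q))"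
        using assms True by (intro mult_right_mono powr_mono2) auto
      then show ?thesis
        using True assms by (simp add: ennreal_mult'[symmetric] exp_diff exp_minus field_simps)
    qed simp
  qed
  also have "\<dots> = (\<integral>\<^sup>+q. ennreal (indicator {0<..} q * (q powr (x - 1) * exp (- (1 * q)))) \<partial>lborel)"
    using nn_integral_real_affine[of "\<lambda>q. ennreal (indicator {0<..} q * (q powr (x - 1) * exp (- (1 * q))))" 1 V] by simp
  also have "\<dots> = ennreal (Gamma x)"
    using nn_integral_Gamma[of x 1] assms by simp
  finally show ?thesis
    using Gamma_real_pos[of x] assms by (simp add: ennreal_le_iff)
qed

lemma abs_bessel_series_le:
  assumes "c > 0" "\<bar>w\<bar> \<le> z"
  shows "\<bar>bessel_series c w\<bar> \<le> bessel_series c z"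
proof -
  have "norm (bessel_term c w j) \<le> bessel_term c z j" for j
  proof -
    have "Gamma (c + real j) > 0" using assms by (intro Gamma_real_pos) auto
    moreover have "\<bar>w\<bar> ^ j \<le> z ^ j" using assms by (intro power_mono) auto
    ultimately show ?thesis by (simp add: bessel_term_def abs_mult power_abs divide_right_mono)
  qed
  then have "norm (\<Sum>j. bessel_term c w j) \<le> (\<Sum>j. bessel_term c z j)"
    using bessel_sums[OF assms(1), of z] by (intro norm_suminf_le) (auto simp: sums_iff)
  then show ?thesis by (simp add: bessel_series_def)
qed

text \<open>Pochhammer symbols increase with their base, so the quotient of corresponding terms is
  largest at j = 0.\<close>

lemma bessel_series_shift_le:
  assumes "c > 0" "\<beta> \<ge> 0" "z \<ge> 0"
  shows "bessel_series (c + \<beta>) z \<le> Gamma c / Gamma (c + \<beta>) * bessel_series c z"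
proof (rule sums_le)
  show "bessel_term (c + \<beta>) z sums bessel_series (c + \<beta>) z" using assms by (intro bessel_sums) auto
  show "(\<lambda>j. Gamma c / Gamma (c + \<beta>) * bessel_term c z j) sums (Gamma c / Gamma (c + \<beta>) * bessel_series c z)"
    using assms by (intro sums_mult bessel_sums)
  fix j
  have G: "Gamma c > 0" "Gamma (c + \<beta>) > 0" using assms by (auto intro!: Gamma_real_pos)
  have P: "pochhammer c j > 0" using assms by (intro pochhammer_pos) auto
  have "pochhammer c j \<le> pochhammer (c + \<beta>) j"
    unfolding pochhammer_prod using assms by (intro prod_mono) auto
  then have "z ^ j / (fact j * (pochhammer (c + \<beta>) j * Gamma (c + \<beta>)))
     \<le> z ^ j / (fact j * (pochhammer c j * Gamma (c + \<beta>)))"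
    using assms G P by (intro divide_left_mono mult_left_mono mult_right_mono mult_pos_pos) auto
  then show "bessel_term (c + \<beta>) z j \<le> Gamma c / Gamma (c + \<beta>) * bessel_term c z j"
    using Gamma_add_nat[of "c + \<beta>" j] Gamma_add_nat[of c j] assms less_imp_neq[OF G(1)] by (simp add: bessel_term_def mult_ac)
qed

text \<open>The true growth is exponential in sqrt z. An arbitrarily small linear rate is the
  convenient form, since it is absorbed by a fraction of exp(-t q).\<close>

lemma bessel_series_subexponential:
  assumes c: "c > 0" and \<epsilon>: "\<epsilon> > 0"
  obtains M where "M \<ge> 0" "\<And>z. z \<ge> 0 \<Longrightarrow> bessel_series c z \<le> M * exp (\<epsilon> * z)"
proof
  define V where "V = 1 / \<epsilon>"
  have V: "V > 0" using \<epsilon> by (simp add: V_def)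
  \<comment> \<open>The first summand serves j = 0, where c may be below 1 and
    \<open>Gamma_lower_bound\<close> does not apply; the second comes from that bound with V = 1 /
    \<epsilon>.\<close>
  define M where "M = inverse (Gamma c) + exp V * V powr (1 - c)"
  have G: "Gamma c > 0" using c by (rule Gamma_real_pos)
  show M: "M \<ge> 0" using G by (simp add: M_def)
  have b: "inverse (Gamma (c + real j)) \<le> M * \<epsilon> ^ j" for j
  proof (cases "j = 0")
    case False
    have "V powr (c + real j - 1) * exp (- V) \<le> Gamma (c + real j)"
      using c False V by (intro Gamma_lower_bound) auto
    then have "inverse (Gamma (c + real j)) \<le> inverse (V powr (c + real j - 1) * exp (- V))"
      using V by (intro le_imp_inverse_le) auto
    also have "V powr (c + real j - 1) = V powr (c - 1) * V ^ j"
      using V by (simp add: powr_add[symmetric] powr_realpow[symmetric] algebra_simps)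
    also have "inverse (V powr (c - 1) * V ^ j * exp (- V)) = exp V * V powr (1 - c) * \<epsilon> ^ j"
    proof -
      have "V powr (1 - c) = inverse (V powr (c - 1))"
        by (subst powr_minus[symmetric]) simp
      then show ?thesis by (simp add: exp_minus V_def power_inverse inverse_mult_distrib divide_inverse mult_ac)
    qed
    also have "\<dots> \<le> M * \<epsilon> ^ j" using \<epsilon> G by (intro mult_right_mono) (auto simp: M_def)
    finally show ?thesis .
  qed (simp add: M_def)
  fix z :: real assume z: "z \<ge> 0"
  show "bessel_series c z \<le> M * exp (\<epsilon> * z)"
  proof (rule sums_le[OF _ bessel_sums[OF c] sums_mult[OF exp_converges]])
    fix j
    have "z ^ j / fact j * inverse (Gamma (c + real j)) \<le> z ^ j / fact j * (M * \<epsilon> ^ j)"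
      using z by (intro mult_left_mono b) auto
    then show "bessel_term c z j \<le> M * ((\<epsilon> * z) ^ j /\<^sub>R fact j)"
      by (simp add: bessel_term_def divide_inverse power_mult_distrib inverse_mult_distrib mult_ac)
  qed
qed

text \<open>The case \<open>m = 0\<close> is separate because \<open>z\<^sup>0 = 1\<close> also at \<open>z = 0\<close>, whereas \<open>0 powr 0 = 0\<close>.\<close>

definition radial_mode :: "real \<Rightarrow> real \<Rightarrow> nat \<Rightarrow> real \<Rightarrow> real \<Rightarrow> real" where
  "radial_mode b c m z w = (if m = 0 then 1 else z powr (b * real m / 2)) * bessel_series (c + b * real m) w"

lemma radial_mode_borel [measurable]:
  assumes [measurable]: "f \<in> borel_measurable M" "g \<in> borel_measurable M"
  shows "(\<lambda>x. radial_mode b c m (f x) (g x)) \<in> borel_measurable M"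
  unfolding radial_mode_def[abs_def] by measurable

text \<open>The Gamma function in the denominator has to beat z^(b m / 2) with a spare factor 2^m,
  uniformly in z. \<open>Gamma_lower_bound\<close> with V of the size of sqrt z does this at the
  price of exp(2 V), which is subexponential in z. The decay in m dominates the polynomial bound
  \<open>gegenbauer_bound\<close>.\<close>

lemma radial_mode_bound:
  assumes b: "b > 0" and c: "c > 0" "1 \<le> c + b" and \<epsilon>: "\<epsilon> > 0"
  obtains M where "M \<ge> 0" "\<And>m z w. \<bar>w\<bar> \<le> z \<Longrightarrow> \<bar>radial_mode b c m z w\<bar> \<le> M * exp (\<epsilon> * z) * (1 / 2) ^ m"
proof -
  obtain M where M: "M \<ge> 0" "\<And>z. z \<ge> 0 \<Longrightarrow> bessel_series c z \<le> M * exp (\<epsilon> / 2 * z)"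
    using bessel_series_subexponential[OF c(1), of "\<epsilon> / 2"] \<epsilon> by auto
  \<comment> \<open>With K^b = 2 and V \<ge> K sqrt z, the power V^(b m) is at least 2^m z^(b m /
    2).\<close>
  define K where "K = 2 powr (1 / b)"
  have K: "K > 0" "K powr (b * real m) = 2 ^ m" for m
    using b by (auto simp: K_def powr_powr powr_realpow)
  have G: "Gamma c > 0" using c by (intro Gamma_real_pos)
  \<comment> \<open>The constant left after completing the square: 2 K sqrt z \<le> (\<epsilon> / 2)
    z + 2 K^2 / \<epsilon>. The summand 2 covers the case V = 1.\<close>
  define E where "E = 2 + 2 * K\<^sup>2 / \<epsilon>"
  show thesis
  proof
    show "(1 + Gamma c) * M * exp E \<ge> 0" using M G by simp
    fix m :: nat and z w :: real
    assume w: "\<bar>w\<bar> \<le> z"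
    then have z: "z \<ge> 0" by linarith
    define V where "V = max 1 (K * sqrt z)"
    have V: "V \<ge> 1" by (simp add: V_def)
    have eV: "exp (2 * V) \<le> exp E * exp (\<epsilon> / 2 * z)"
    proof -
      have "0 \<le> (sqrt (\<epsilon> / 2) * sqrt z - K / sqrt (\<epsilon> / 2))\<^sup>2" by simp
      also have "\<dots> = \<epsilon> / 2 * z + 2 * K\<^sup>2 / \<epsilon> - 2 * (K * sqrt z)"
        using \<epsilon> z by (simp add: power2_diff power_mult_distrib power_divide real_sqrt_divide)
      finally have "2 * (K * sqrt z) \<le> \<epsilon> / 2 * z + 2 * K\<^sup>2 / \<epsilon>" by simp
      moreover have "2 * V \<le> 2 + 2 * (K * sqrt z)" using K z by (simp add: V_def max_def)
      ultimately show ?thesis by (simp add: E_def exp_add[symmetric])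
    qed
    have main: "(if m = 0 then 1 else z powr (b * real m / 2)) * (Gamma c / Gamma (c + b * real m)) \<le> (1 + Gamma c) * exp (2 * V) * (1 / 2) ^ m"
    proof (cases "m = 0")
      case True
      have "1 * 1 \<le> (1 + Gamma c) * exp (2 * V)" using G V by (intro mult_mono) auto
      then show ?thesis using True G by simp
    next
      case False
      have x: "1 \<le> c + b * real m" using False b c mult_left_mono[of 1 "real m" b] by linarith
      have "V powr (c + b * real m - 1) * exp (- V) \<le> Gamma (c + b * real m)"
        by (rule Gamma_lower_bound) (use x V in auto)
      then have "Gamma c / Gamma (c + b * real m) \<le> Gamma c / (V powr (c + b * real m - 1) * exp (- V))"
        using G V by (intro divide_left_mono) (auto intro!: mult_pos_pos Gamma_real_pos simp: less_le_trans[OF _ x])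
      also have "V powr (c + b * real m - 1) = V powr (b * real m) * V powr (c - 1)"
        by (simp add: powr_add[symmetric] algebra_simps)
      finally have 1: "Gamma c / Gamma (c + b * real m) \<le> Gamma c / (V powr (b * real m) * V powr (c - 1) * exp (- V))" .
      have 2: "2 ^ m * z powr (b * real m / 2) \<le> V powr (b * real m)"
      proof -
        have "2 ^ m * z powr (b * real m / 2) = (K * sqrt z) powr (b * real m)"
          using K z by (simp add: powr_mult powr_half_sqrt[symmetric] powr_powr)
        also have "\<dots> \<le> V powr (b * real m)" using K z b by (intro powr_mono2) (auto simp: V_def)
        finally show ?thesis .
      qed
      have 3: "1 / V powr (c - 1) \<le> exp V"
      proof -
        have "1 / V powr (c - 1) = V powr (1 - c)" by (simp add: powr_minus_divide[symmetric])
        also have "\<dots> \<le> V powr 1" using V c by (intro powr_mono) auto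
        also have "\<dots> \<le> exp V" using V exp_ge_add_one_self[of V] by (simp, linarith)
        finally show ?thesis .
      qed
      have "z powr (b * real m / 2) * (Gamma c / Gamma (c + b * real m))
        \<le> z powr (b * real m / 2) * (Gamma c / (V powr (b * real m) * V powr (c - 1) * exp (- V)))"
        by (intro mult_left_mono 1) auto
      also have "\<dots> = (2 ^ m * z powr (b * real m / 2)) / V powr (b * real m) * (1 / V powr (c - 1)) * exp V * Gamma c * (1 / 2) ^ m"
        by (simp add: exp_minus field_simps power_one_over)
      also have "\<dots> \<le> 1 * exp V * exp V * (1 + Gamma c) * (1 / 2) ^ m"
        using G V by (intro mult_mono 3 order_refl) (auto intro!: divide_le_eq_1_pos[THEN iffD2] 2)
      also have "\<dots> = (1 + Gamma c) * exp (2 * V) * (1 / 2) ^ m"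
        by (simp add: exp_double power2_eq_square)
      finally show ?thesis using False by simp
    qed
    have "\<bar>radial_mode b c m z w\<bar> \<le> (if m = 0 then 1 else z powr (b * real m / 2)) * bessel_series (c + b * real m) z"
      unfolding radial_mode_def abs_mult
      by (intro mult_mono abs_bessel_series_le) (use w b c in \<open>auto intro: add_pos_nonneg\<close>)
    also have "\<dots> \<le> (if m = 0 then 1 else z powr (b * real m / 2)) * (Gamma c / Gamma (c + b * real m) * bessel_series c z)"
      using b c z by (intro mult_left_mono bessel_series_shift_le) auto
    also have "\<dots> \<le> (1 + Gamma c) * exp (2 * V) * (1 / 2) ^ m * (M * exp (\<epsilon> / 2 * z))"
      unfolding mult.assoc[symmetric]
      using mult_mono[OF main M(2)[OF z]] bessel_series_nonneg[OF c(1) z] G by (simp add: mult.assoc)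
    also have "\<dots> \<le> (1 + Gamma c) * (exp E * exp (\<epsilon> / 2 * z)) * (1 / 2) ^ m * (M * exp (\<epsilon> / 2 * z))"
      using eV G M by (intro mult_right_mono mult_left_mono) auto
    also have "\<dots> = (1 + Gamma c) * M * exp E * exp (\<epsilon> * z) * (1 / 2) ^ m"
    proof -
      have "exp (\<epsilon> * z) = exp (\<epsilon> / 2 * z) * exp (\<epsilon> / 2 * z)" by (simp add: exp_add[symmetric])
      then show ?thesis by (simp only: mult_ac)
    qed
    finally show "\<bar>radial_mode b c m z w\<bar> \<le> (1 + Gamma c) * M * exp E * exp (\<epsilon> * z) * (1 / 2) ^ m" .
  qed
qed

section \<open>Weber's integral\<close>

lemma AE_gamma_radial: "AE q in gamma_radial c. q > 0"
  unfolding gamma_radial_def by (subst AE_density) (auto simp: indicator_def intro!: AE_I2)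

lemma gamma_radial_moment:
  assumes c: "c > 0" and s: "s > 0"
  shows "has_bochner_integral (gamma_radial c) (\<lambda>q. q ^ k * exp (- (s * q))) (Gamma (c + real k) / (Gamma c * s powr (c + real k)))"
proof (rule has_bochner_integral_nn_integral)
  have G: "Gamma c > 0" "Gamma (c + real k) > 0" using c by (auto intro!: Gamma_real_pos)
  show "AE q in gamma_radial c. 0 \<le> q ^ k * exp (- (s * q))"
    using AE_gamma_radial by eventually_elim simp
  show "0 \<le> Gamma (c + real k) / (Gamma c * s powr (c + real k))" using G by simp
  have "(\<integral>\<^sup>+q. ennreal (q ^ k * exp (- (s * q))) \<partial>gamma_radial c)
    = (\<integral>\<^sup>+q. ennreal (indicator {0<..} q * q powr (c - 1) / Gamma c) * ennreal (q ^ k * exp (- (s * q))) \<partial>lborel)"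
    unfolding gamma_radial_def by (rule nn_integral_density) measurable
  also have "\<dots> = (\<integral>\<^sup>+q. ennreal (1 / Gamma c) * ennreal (indicator {0<..} q * (q powr (c + real k - 1) * exp (- (s * q)))) \<partial>lborel)"
  proof (rule nn_integral_cong)
    fix q :: real
    show "ennreal (indicator {0<..} q * q powr (c - 1) / Gamma c) * ennreal (q ^ k * exp (- (s * q)))
      = ennreal (1 / Gamma c) * ennreal (indicator {0<..} q * (q powr (c + real k - 1) * exp (- (s * q))))"
    proof (cases "q > 0")
      case True
      then have "q powr (c + real k - 1) = q powr (c - 1) * q ^ k"
        by (simp add: powr_add[symmetric] powr_realpow[symmetric] algebra_simps)
      then show ?thesis using True G by (simp add: ennreal_mult'[symmetric] mult_ac)
    qed simp
  qed
  also have "\<dots> = ennreal (1 / Gamma c) * ennreal (Gamma (c + real k) / s powr (c + real k))"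
    using c s by (subst nn_integral_cmult) (auto simp: nn_integral_Gamma)
  also have "\<dots> = ennreal (Gamma (c + real k) / (Gamma c * s powr (c + real k)))"
    using G by (subst ennreal_mult'[symmetric]) auto
  finally show "(\<integral>\<^sup>+q. ennreal (q ^ k * exp (- (s * q))) \<partial>gamma_radial c)
      = ennreal (Gamma (c + real k) / (Gamma c * s powr (c + real k)))" .
qed measurable

lemma bessel_series_scaled_bound:
  assumes "c > 0" "\<epsilon> > 0"
  obtains M where "M \<ge> 0" "\<And>q n. q \<ge> 0 \<Longrightarrow> (\<Sum>j<n. \<bar>bessel_term c (P * q) j\<bar>) \<le> M * exp (\<epsilon> * q)"
    "\<And>q. q \<ge> 0 \<Longrightarrow> \<bar>bessel_series c (P * q)\<bar> \<le> M * exp (\<epsilon> * q)"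
proof -
  \<comment> \<open>The rate is divided by |P| + 1 so that P = 0 is included.\<close>
  obtain M where M: "M \<ge> 0" "\<And>z. z \<ge> 0 \<Longrightarrow> bessel_series c z \<le> M * exp (\<epsilon> / (\<bar>P\<bar> + 1) * z)"
    using bessel_series_subexponential[OF assms(1), of "\<epsilon> / (\<bar>P\<bar> + 1)"] assms by (metis abs_add_one_gt_zero add.commute divide_pos_pos)
  have b: "bessel_series c (\<bar>P\<bar> * q) \<le> M * exp (\<epsilon> * q)" if q: "q \<ge> 0" for q
  proof -
    have "\<epsilon> / (\<bar>P\<bar> + 1) * (\<bar>P\<bar> * q) = \<epsilon> * q * (\<bar>P\<bar> / (\<bar>P\<bar> + 1))" by simp
    also have "\<dots> \<le> \<epsilon> * q * 1" using assms q by (intro mult_left_mono) auto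
    finally have "M * exp (\<epsilon> / (\<bar>P\<bar> + 1) * (\<bar>P\<bar> * q)) \<le> M * exp (\<epsilon> * q)"
      using M(1) by (intro mult_left_mono) auto
    then show ?thesis using M(2)[of "\<bar>P\<bar> * q"] q by simp
  qed
  show thesis
  proof
    show "M \<ge> 0" by (rule M)
    fix q :: real assume q: "q \<ge> 0"
    show "\<bar>bessel_series c (P * q)\<bar> \<le> M * exp (\<epsilon> * q)"
      using abs_bessel_series_le[OF assms(1), of "P * q" "\<bar>P\<bar> * q"] b[OF q] q by (simp add: abs_mult)
    fix n
    have "\<bar>bessel_term c (P * q) j\<bar> = bessel_term c (\<bar>P\<bar> * q) j" for j
      using q Gamma_real_pos[of "c + real j"] assms by (simp add: bessel_term_def abs_mult power_abs)
    then have "(\<Sum>j<n. \<bar>bessel_term c (P * q) j\<bar>) = (\<Sum>j<n. bessel_term c (\<bar>P\<bar> * q) j)" by simp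
    also have "\<dots> \<le> bessel_series c (\<bar>P\<bar> * q)"
      unfolding bessel_series_def
      using bessel_sums[OF assms(1), of "\<bar>P\<bar> * q"] bessel_term_nonneg[OF assms(1)] q
      by (intro sum_le_suminf) (auto simp: sums_iff)
    finally show "(\<Sum>j<n. \<bar>bessel_term c (P * q) j\<bar>) \<le> M * exp (\<epsilon> * q)" using b[OF q] by linarith
  qed
qed

lemma bessel_laplace:
  assumes c: "c > 0" and t: "t > 0"
  shows "(LINT q|gamma_radial c. q ^ k * exp (- (t * q)) * bessel_series c (P * q)) =
    exp (P / t) / (Gamma c * t powr (c + real k)) * (\<Sum>i\<le>k. real (k choose i) * (P / t) ^ i * pochhammer (c + real i) (k - i))"
proof -
  have G: "Gamma c > 0" "Gamma (c + real j) > 0" for j using c by (auto intro!: Gamma_real_pos)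
  define f where "f j q = q ^ k * exp (- (t * q)) * bessel_term c (P * q) j" for j q
  obtain M where M: "M \<ge> 0" "\<And>q n. q \<ge> 0 \<Longrightarrow> (\<Sum>j<n. \<bar>bessel_term c (P * q) j\<bar>) \<le> M * exp (t / 2 * q)"
    using bessel_series_scaled_bound[OF c, of "t / 2" P] t by (metis half_gt_zero)
  have 1: "(\<lambda>j. integral\<^sup>L (gamma_radial c) (f j)) sums (LINT q|gamma_radial c. q ^ k * exp (- (t * q)) * bessel_series c (P * q))"
  proof (rule sums_integral_dominated(1))
    show "integrable (gamma_radial c) (\<lambda>q. M * (q ^ k * exp (- (t / 2 * q))))"
      using gamma_radial_moment[OF c, of "t / 2" k] t by (intro integrable_mult_right) (auto simp: has_bochner_integral_iff)
    show "AE q in gamma_radial c. (\<lambda>m. f m q) sums (q ^ k * exp (- (t * q)) * bessel_series c (P * q))"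
      unfolding f_def by (intro AE_I2 sums_mult bessel_sums c)
    show "AE q in gamma_radial c. \<forall>n. (\<Sum>m<n. norm (f m q)) \<le> M * (q ^ k * exp (- (t / 2 * q)))"
      using AE_gamma_radial
    proof eventually_elim
      case (elim q)
      have "(\<Sum>m<n. norm (f m q)) \<le> M * (q ^ k * exp (- (t / 2 * q)))" for n
      proof -
        have "(\<Sum>m<n. norm (f m q)) = q ^ k * exp (- (t * q)) * (\<Sum>j<n. \<bar>bessel_term c (P * q) j\<bar>)"
          using elim by (simp add: f_def abs_mult sum_distrib_left)
        also have "\<dots> \<le> q ^ k * exp (- (t * q)) * (M * exp (t / 2 * q))"
          using elim by (intro mult_left_mono M) auto
        also have "\<dots> = M * (q ^ k * (exp (- (t * q)) * exp (t / 2 * q)))" by simp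
        also have "exp (- (t * q)) * exp (t / 2 * q) = exp (- (t / 2 * q))" by (simp add: exp_add[symmetric])
        finally show ?thesis .
      qed
      then show ?case by blast
    qed
  qed (unfold f_def bessel_term_def, measurable)
  have 2: "integral\<^sup>L (gamma_radial c) (f j) = 1 / (Gamma c * t powr (c + real k)) * ((P / t) ^ j / fact j * pochhammer (c + real j) k)" for j
  proof -
    have "f j = (\<lambda>q. P ^ j / (fact j * Gamma (c + real j)) * (q ^ (k + j) * exp (- (t * q))))"
      by (auto simp: f_def bessel_term_def power_mult_distrib power_add)
    then have "integral\<^sup>L (gamma_radial c) (f j) = P ^ j / (fact j * Gamma (c + real j)) * (Gamma (c + real (k + j)) / (Gamma c * t powr (c + real (k + j))))"
      using has_bochner_integral_integral_eq[OF gamma_radial_moment[OF c t, of "k + j"]] by simp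
    also have "Gamma (c + real (k + j)) = pochhammer (c + real j) k * Gamma (c + real j)"
      using Gamma_add_nat[of "c + real j" k] c by (simp add: add_ac)
    also have "t powr (c + real (k + j)) = t powr (c + real k) * t ^ j"
      using t by (simp add: powr_add powr_realpow)
    finally show ?thesis using less_imp_neq[OF G(1)] less_imp_neq[OF G(2)[of j]] by (simp add: power_divide)
  qed
  have "(\<lambda>j. integral\<^sup>L (gamma_radial c) (f j)) sums
    (1 / (Gamma c * t powr (c + real k)) * (exp (P / t) * (\<Sum>i\<le>k. real (k choose i) * (P / t) ^ i * pochhammer (c + real i) (k - i))))"
    unfolding 2 by (intro sums_mult poisson_pochhammer_sums)
  from sums_unique2[OF 1 this] show ?thesis by simp
qed

text \<open>Only the second Bessel factor is expanded. After \<open>bessel_laplace\<close> its k-th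
  term is, up to a common constant, the k-th term of the Cauchy product of the Bessel series at P Q
  / t^2 and the exponential series of Q / t.\<close>

lemma weber_integral:
  assumes c: "c > 0" and t: "t > 0"
  shows "(LINT q|gamma_radial c. exp (- (t * q)) * (bessel_series c (P * q) * bessel_series c (Q * q))) =
    exp ((P + Q) / t) / (Gamma c * t powr c) * bessel_series c (P * Q / t\<^sup>2)"
proof -
  have G: "Gamma c > 0" "Gamma (c + real j) > 0" for j using c by (auto intro!: Gamma_real_pos)
  define f where "f k q = exp (- (t * q)) * (bessel_series c (P * q) * bessel_term c (Q * q) k)" for k q
  obtain M where M: "M \<ge> 0" "\<And>q n. q \<ge> 0 \<Longrightarrow> (\<Sum>j<n. \<bar>bessel_term c (Q * q) j\<bar>) \<le> M * exp (t / 4 * q)"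
    using bessel_series_scaled_bound[OF c, of "t / 4" Q] t by (metis zero_less_divide_iff zero_less_numeral)
  obtain M' where M': "M' \<ge> 0" "\<And>q. q \<ge> 0 \<Longrightarrow> \<bar>bessel_series c (P * q)\<bar> \<le> M' * exp (t / 4 * q)"
    using bessel_series_scaled_bound[OF c, of "t / 4" P] t by (metis zero_less_divide_iff zero_less_numeral)
  have 1: "(\<lambda>k. integral\<^sup>L (gamma_radial c) (f k)) sums (LINT q|gamma_radial c. exp (- (t * q)) * (bessel_series c (P * q) * bessel_series c (Q * q)))"
  proof (rule sums_integral_dominated(1))
    show "integrable (gamma_radial c) (\<lambda>q. (M' * M) * (q ^ 0 * exp (- (t / 2 * q))))"
      using gamma_radial_moment[OF c, of "t / 2" 0] t by (intro integrable_mult_right) (simp add: has_bochner_integral_iff)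
    show "AE q in gamma_radial c. (\<lambda>m. f m q) sums (exp (- (t * q)) * (bessel_series c (P * q) * bessel_series c (Q * q)))"
      unfolding f_def by (intro AE_I2 sums_mult bessel_sums c)
    show "AE q in gamma_radial c. \<forall>n. (\<Sum>m<n. norm (f m q)) \<le> (M' * M) * (q ^ 0 * exp (- (t / 2 * q)))"
      using AE_gamma_radial
    proof eventually_elim
      case (elim q)
      have "(\<Sum>m<n. norm (f m q)) \<le> (M' * M) * (q ^ 0 * exp (- (t / 2 * q)))" for n
      proof -
        have "(\<Sum>m<n. norm (f m q)) = exp (- (t * q)) * (\<bar>bessel_series c (P * q)\<bar> * (\<Sum>j<n. \<bar>bessel_term c (Q * q) j\<bar>))"
          by (simp add: f_def abs_mult sum_distrib_left)
        also have "\<dots> \<le> exp (- (t * q)) * ((M' * exp (t / 4 * q)) * (M * exp (t / 4 * q)))"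
          using elim M' by (intro mult_left_mono mult_mono M) (auto intro: sum_nonneg)
        also have "\<dots> = (M' * M) * (exp (- (t * q)) * exp (t / 4 * q) * exp (t / 4 * q))" by simp
        also have "exp (- (t * q)) * exp (t / 4 * q) * exp (t / 4 * q) = q ^ 0 * exp (- (t / 2 * q))"
          by (simp add: exp_add[symmetric])
        finally show ?thesis .
      qed
      then show ?case by blast
    qed
  qed (unfold f_def bessel_term_def, measurable)
  have 2: "integral\<^sup>L (gamma_radial c) (f k) = exp (P / t) / (Gamma c * t powr c) *
     (\<Sum>i\<le>k. bessel_term c (P * Q / t\<^sup>2) i * ((Q / t) ^ (k - i) /\<^sub>R fact (k - i)))" for k
  proof -
    have "f k = (\<lambda>q. Q ^ k / (fact k * Gamma (c + real k)) * (q ^ k * exp (- (t * q)) * bessel_series c (P * q)))"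
      by (auto simp: f_def bessel_term_def power_mult_distrib)
    then have "integral\<^sup>L (gamma_radial c) (f k) = Q ^ k / (fact k * Gamma (c + real k)) *
        (exp (P / t) / (Gamma c * t powr (c + real k)) * (\<Sum>i\<le>k. real (k choose i) * (P / t) ^ i * pochhammer (c + real i) (k - i)))"
      using bessel_laplace[OF c t, of k P] by simp
    also have "t powr (c + real k) = t powr c * t ^ k" using t by (simp add: powr_add powr_realpow)
    also have "Q ^ k / (fact k * Gamma (c + real k)) *
        (exp (P / t) / (Gamma c * (t powr c * t ^ k)) * (\<Sum>i\<le>k. real (k choose i) * (P / t) ^ i * pochhammer (c + real i) (k - i)))
      = exp (P / t) / (Gamma c * t powr c) * (\<Sum>i\<le>k. Q ^ k / (fact k * Gamma (c + real k) * t ^ k) * (real (k choose i) * (P / t) ^ i * pochhammer (c + real i) (k - i)))"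
      by (simp add: sum_distrib_left mult_ac)
    also have "(\<Sum>i\<le>k. Q ^ k / (fact k * Gamma (c + real k) * t ^ k) * (real (k choose i) * (P / t) ^ i * pochhammer (c + real i) (k - i)))
      = (\<Sum>i\<le>k. bessel_term c (P * Q / t\<^sup>2) i * ((Q / t) ^ (k - i) /\<^sub>R fact (k - i)))"
    proof (intro sum.cong refl)
      fix i assume "i \<in> {..k}"
      then obtain l where k: "k = i + l" by (auto simp: le_iff_add)
      have ch: "real (k choose i) = fact k / (fact i * fact l)"
        unfolding k by (subst binomial_fact) auto
      have Gk: "Gamma (c + real k) = pochhammer (c + real i) l * Gamma (c + real i)"
        using Gamma_add_nat[of "c + real i" l] c by (simp add: k add_ac)
      have nz: "pochhammer (c + real i) l \<noteq> 0" "Gamma (c + real i) \<noteq> 0" "t \<noteq> 0"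
        using pochhammer_pos[of "c + real i" l] less_imp_neq[OF G(2)[of i]] c t by auto
      have kl: "k - i = l" by (simp add: k)
      show "Q ^ k / (fact k * Gamma (c + real k) * t ^ k) * (real (k choose i) * (P / t) ^ i * pochhammer (c + real i) (k - i))
        = bessel_term c (P * Q / t\<^sup>2) i * ((Q / t) ^ (k - i) /\<^sub>R fact (k - i))"
        unfolding ch Gk kl bessel_term_def using nz
        by (simp add: k power_add power_divide power_mult_distrib divide_inverse inverse_mult_distrib power_inverse power2_eq_square mult_ac)
    qed
    finally show ?thesis .
  qed
  have "(\<lambda>k. \<Sum>i\<le>k. bessel_term c (P * Q / t\<^sup>2) i * ((Q / t) ^ (k - i) /\<^sub>R fact (k - i))) sums
     (bessel_series c (P * Q / t\<^sup>2) * exp (Q / t))"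
    unfolding bessel_series_def exp_def
    by (intro Cauchy_product_sums summable_norm_bessel summable_norm_exp c)
  then have "(\<lambda>k. integral\<^sup>L (gamma_radial c) (f k)) sums (exp (P / t) / (Gamma c * t powr c) * (bessel_series c (P * Q / t\<^sup>2) * exp (Q / t)))"
    unfolding 2 by (intro sums_mult)
  from sums_unique2[OF 1 this] show ?thesis by (simp add: add_divide_distrib exp_add mult_ac)
qed

lemma integral_gamma_radial_shift:
  fixes f :: "real \<Rightarrow> real"
  assumes c: "c > 0" and \<beta>: "\<beta> \<ge> 0" and [measurable]: "f \<in> borel_measurable borel"
  shows "(LINT q|gamma_radial c. q powr \<beta> * f q) = Gamma (c + \<beta>) / Gamma c * (LINT q|gamma_radial (c + \<beta>). f q)"
proof -
  have G: "Gamma c > 0" "Gamma (c + \<beta>) > 0" using c \<beta> by (auto intro!: Gamma_real_pos)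
  have "(LINT q|gamma_radial c. q powr \<beta> * f q) = (LINT q|lborel. (indicator {0<..} q * q powr (c - 1) / Gamma c) *\<^sub>R (q powr \<beta> * f q))"
    unfolding gamma_radial_def by (rule integral_density) (use G in auto)
  also have "\<dots> = (LINT q|lborel. Gamma (c + \<beta>) / Gamma c * ((indicator {0<..} q * q powr (c + \<beta> - 1) / Gamma (c + \<beta>)) *\<^sub>R f q))"
  proof (rule Bochner_Integration.integral_cong[OF refl])
    fix q :: real
    show "(indicator {0<..} q * q powr (c - 1) / Gamma c) *\<^sub>R (q powr \<beta> * f q)
      = Gamma (c + \<beta>) / Gamma c * ((indicator {0<..} q * q powr (c + \<beta> - 1) / Gamma (c + \<beta>)) *\<^sub>R f q)"
    proof (cases "q > 0")
      case True
      have "q powr (c + \<beta> - 1) = q powr (c - 1) * q powr \<beta>"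
        by (simp add: powr_add[symmetric] algebra_simps)
      then show ?thesis using G True by simp
    qed simp
  qed
  also have "\<dots> = Gamma (c + \<beta>) / Gamma c * (LINT q|lborel. (indicator {0<..} q * q powr (c + \<beta> - 1) / Gamma (c + \<beta>)) *\<^sub>R f q)"
    by (rule integral_mult_right_zero)
  also have "(LINT q|lborel. (indicator {0<..} q * q powr (c + \<beta> - 1) / Gamma (c + \<beta>)) *\<^sub>R f q) = (LINT q|gamma_radial (c + \<beta>). f q)"
    unfolding gamma_radial_def by (rule integral_density[symmetric]) (use G in auto)
  finally show ?thesis .
qed

text \<open>Weber's integral at -P and -Q: two oscillating factors become a nonnegative series at P
  Q / t^2 with a decaying exponential. For m > 0 the power q^(b m), half of it from each mode, is
  absorbed by raising the parameter of the measure from c to c + b m.\<close>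

lemma integral_radial_mode_product:
  assumes b: "b > 0" and c: "c > 0" and t: "t > 0" and P: "P \<ge> 0" and Q: "Q \<ge> 0"
  shows "(LINT q|gamma_radial c. exp (- (t * q)) * (radial_mode b c m (P * q) (- (P * q)) * radial_mode b c m (Q * q) (- (Q * q))))
    = exp (- ((P + Q) / t)) / (Gamma c * t powr c) * radial_mode b c m (P * Q / t\<^sup>2) (P * Q / t\<^sup>2)"
proof (cases "m = 0")
  case True
  moreover have "(- P + - Q) / t = - ((P + Q) / t)" by (simp add: divide_simps)
  ultimately show ?thesis using weber_integral[OF c t, of "- P" "- Q"] by (simp add: radial_mode_def)
next
  case False
  define \<beta> where "\<beta> = b * real m"
  have \<beta>: "\<beta> > 0" using False b by (simp add: \<beta>_def)
  have G: "Gamma c > 0" "Gamma (c + \<beta>) > 0" using c \<beta> by (auto intro!: Gamma_real_pos)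
  let ?f = "\<lambda>q. exp (- (t * q)) * (bessel_series (c + \<beta>) (- P * q) * bessel_series (c + \<beta>) (- Q * q))"
  have "(LINT q|gamma_radial c. exp (- (t * q)) * (radial_mode b c m (P * q) (- (P * q)) * radial_mode b c m (Q * q) (- (Q * q))))
    = (LINT q|gamma_radial c. (P * Q) powr (\<beta> / 2) * (q powr \<beta> * ?f q))"
  proof (rule integral_cong_AE)
    show "AE q in gamma_radial c. exp (- (t * q)) * (radial_mode b c m (P * q) (- (P * q)) * radial_mode b c m (Q * q) (- (Q * q)))
      = (P * Q) powr (\<beta> / 2) * (q powr \<beta> * ?f q)"
      using AE_gamma_radial
    proof eventually_elim
      case (elim q)
      have "(P * q) powr (\<beta> / 2) * (Q * q) powr (\<beta> / 2) = (P * Q) powr (\<beta> / 2) * (q powr (\<beta> / 2) * q powr (\<beta> / 2))"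
        using elim P Q by (simp add: powr_mult)
      also have "q powr (\<beta> / 2) * q powr (\<beta> / 2) = q powr \<beta>" by (simp add: powr_add[symmetric])
      finally show ?case using False by (simp add: radial_mode_def \<beta>_def)
    qed
  qed measurable
  also have "\<dots> = (P * Q) powr (\<beta> / 2) * (Gamma (c + \<beta>) / Gamma c * (LINT q|gamma_radial (c + \<beta>). ?f q))"
    using \<beta> c by (simp only: integral_mult_right_zero) (subst integral_gamma_radial_shift, auto)
  also have "(LINT q|gamma_radial (c + \<beta>). ?f q) = exp ((- P + - Q) / t) / (Gamma (c + \<beta>) * t powr (c + \<beta>)) * bessel_series (c + \<beta>) (- P * - Q / t\<^sup>2)"
    using weber_integral[of "c + \<beta>" t "- P" "- Q"] c \<beta> t by simp
  also have "(- P + - Q) / t = - ((P + Q) / t)" by (simp add: divide_simps)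
  also have "(P * Q) powr (\<beta> / 2) * (Gamma (c + \<beta>) / Gamma c * (exp (- ((P + Q) / t)) / (Gamma (c + \<beta>) * t powr (c + \<beta>)) * bessel_series (c + \<beta>) (- P * - Q / t\<^sup>2)))
    = exp (- ((P + Q) / t)) / (Gamma c * t powr c) * radial_mode b c m (P * Q / t\<^sup>2) (P * Q / t\<^sup>2)"
  proof -
    have "(P * Q / t\<^sup>2) powr (\<beta> / 2) = (P * Q) powr (\<beta> / 2) / t powr \<beta>"
      using P Q t by (simp add: powr_divide powr_powr flip: powr_numeral)
    then show ?thesis using False G by (simp add: radial_mode_def \<beta>_def[symmetric] powr_add mult_ac)
  qed
  finally show ?thesis .
qed

lemma integrable_gamma_radial_growth:
  assumes c: "c > 0" and s: "s > 0"
  shows "integrable (gamma_radial c) (\<lambda>q. (1 + q) ^ n * exp (- (s * q)))"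
proof -
  have "(1 + q) ^ n * exp (- (s * q)) = (\<Sum>k\<le>n. real (n choose k) * (q ^ k * exp (- (s * q))))" for q
    using binomial_ring[of q 1 n] by (simp add: add.commute sum_distrib_right mult.assoc)
  then show ?thesis
    using gamma_radial_moment[OF c s] by (auto simp: has_bochner_integral_iff)
qed

section \<open>The heat kernel and the heat flow\<close>

context deformed
begin

abbreviation b :: real where "b \<equiv> 2 / a"

abbreviation c :: real where "c \<equiv> (real N + a - 2) / a"

lemma b_pos: "b > 0" and c_pos: "c > 0" and c_ge: "1 \<le> c + b" and c_eq: "b * \<nu> + 1 = c"
  using a_pos a_gt' N_pos by (simp_all add: \<nu>_def field_simps)

text \<open>The variable z is the product of the two radial coordinates. In the definition of B_a
  one has w / 2 = -i v with v^2 = z, so the phase is that of (-i)^(b m), and (w / 2)^2 = -z explains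
  the negative argument.\<close>

definition kernel_term :: "real \<Rightarrow> nat \<Rightarrow> complex" where
  "kernel_term z m = cis (- (b * real m * pi / 2)) * of_real (radial_mode b c m z (- z))"

definition kernel_series :: "real \<Rightarrow> real \<Rightarrow> complex" where
  "kernel_series z \<tau> = (\<Sum>m. kernel_term z m * of_real (C m \<tau>))"

lemma deformed_B_expansion:
  fixes \<omega> \<eta> :: "real ^ 'n"
  assumes "r \<ge> 0" "s \<ge> 0" "norm \<omega> = 1" "norm \<eta> = 1"
  shows "deformed_B a (r *\<^sub>R \<omega>) (s *\<^sub>R \<eta>) = of_real (Gamma c) * kernel_series (r powr a / a * (s powr a / a)) (\<omega> \<bullet> \<eta>)"
proof -
  define z where "z = r powr a / a * (s powr a / a)"
  define v where "v = (r * s) powr (a / 2) / a"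
  define w where "w = complex_of_real (2 * (r * s) powr (a / 2)) / (of_real a * \<i>)"
  have v: "v \<ge> 0" using a_pos by (simp add: v_def)
  have "((r * s) powr (a / 2))\<^sup>2 = (r * s) powr a"
    by (simp add: power2_eq_square flip: powr_add)
  then have "((r * s) powr (a / 2))\<^sup>2 = r powr a * s powr a"
    using assms by (simp add: powr_mult)
  then have vz: "v\<^sup>2 = z"
    using a_pos by (simp add: v_def z_def power_divide power2_eq_square)
  have w: "w / 2 = - \<i> * of_real v"
    using a_pos by (simp add: w_def v_def field_simps)
  have I: "normalized_I_Bessel (b * (real m + \<nu>)) w = of_real (bessel_series (c + b * real m) (- z))" for m
  proof -
    have "(w / 2) ^ (2 * j) * of_real (rGamma (b * (real m + \<nu>) + real j + 1)) / fact j
      = complex_of_real (bessel_term (c + b * real m) (- z) j)" for j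
    proof -
      have "(w / 2)\<^sup>2 = of_real (- z)" unfolding w by (simp add: power_mult_distrib flip: vz)
      then have "(w / 2) ^ (2 * j) = of_real ((- z) ^ j)" by (simp only: power_mult of_real_power)
      moreover have "b * (real m + \<nu>) + real j + 1 = c + b * real m + real j"
        unfolding c_eq[symmetric] by (simp add: algebra_simps add_divide_distrib)
      ultimately show ?thesis
        by (simp only: bessel_term_def rGamma_inverse_Gamma divide_inverse) (simp add: inverse_mult_distrib mult_ac)
    qed
    then have "normalized_I_Bessel (b * (real m + \<nu>)) w = (\<Sum>j. complex_of_real (bessel_term (c + b * real m) (- z) j))"
      by (simp add: normalized_I_Bessel_def)
    also have "\<dots> = of_real (bessel_series (c + b * real m) (- z))"
      using b_pos c_pos by (intro sums_unique[symmetric] sums_of_real bessel_sums add_pos_nonneg) auto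
    finally show ?thesis .
  qed
  \<comment> \<open>For v > 0 the principal argument of w / 2 is -pi / 2. For v = 0 both sides are 0
    in positive degree and 1 in degree 0.\<close>
  have P: "principal_power (w / 2) (b * real m) = cis (- (b * real m * pi / 2)) * of_real (if m = 0 then 1 else z powr (b * real m / 2))" for m
  proof (cases "m = 0 \<or> v = 0")
    case True
    then show ?thesis using a_pos vz by (auto simp: principal_power_def w)
  next
    case False
    with v have v: "v > 0" by simp
    have "Arg (w / 2) = - (pi / 2)"
    proof (rule cis_Arg_unique)
      show "sgn (w / 2) = cis (- (pi / 2))"
        unfolding w using v by (simp add: sgn_div_norm norm_mult scaleR_conv_of_real complex_eq_iff power2_eq_square)
      show "- (pi / 2) \<le> pi" using pi_gt_zero by linarith
    qed auto
    moreover have "norm (w / 2) = v" unfolding w using v by (simp add: norm_mult)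
    moreover have "z powr (b * real m / 2) = v powr (b * real m)"
    proof -
      have "z = v powr 2" using v vz by simp
      then show ?thesis by (simp add: powr_powr)
    qed
    ultimately show ?thesis using False a_pos by (simp add: principal_power_def mult_ac)
  qed
  have DIM: "(real DIM(real ^ 'n) - 2) / 2 = \<nu>" by (simp add: \<nu>_def N_def)
  have "deformed_B a (r *\<^sub>R \<omega>) (s *\<^sub>R \<eta>) = script_I b \<nu> w (\<omega> \<bullet> \<eta>)"
    using deformed_B_polar[OF a_pos assms] unfolding DIM w_def .
  also have "\<dots> = of_real (Gamma c) * kernel_series z (\<omega> \<bullet> \<eta>)"
    unfolding script_I_def c_eq I P kernel_series_def kernel_term_def radial_mode_def of_real_mult mult.assoc ..
  finally show ?thesis by (simp only: z_def)
qed

section \<open>Zonal series and their convolution\<close>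

lemma summable_D_half: "summable (\<lambda>m. D m * (1 / 2) ^ m)"
  by (rule summable_gegenbauer_bound) simp

lemma D_nonneg: "D m \<ge> 0"
  by (rule less_imp_le[OF gegenbauer_bound_pos])

lemma mode_scaled_bound:
  assumes "P \<ge> 0" "\<epsilon> > 0"
  obtains M where "M \<ge> 0"
    "\<And>q m w. q \<ge> 0 \<Longrightarrow> \<bar>w\<bar> \<le> P * q \<Longrightarrow> \<bar>radial_mode b c m (P * q) w\<bar> \<le> M * exp (\<epsilon> * q) * (1 / 2) ^ m"
proof -
  have "\<epsilon> / (P + 1) > 0" using assms by simp
  from radial_mode_bound[OF b_pos c_pos c_ge this]
  obtain M where M: "M \<ge> 0"
    "\<And>m z w. \<bar>w\<bar> \<le> z \<Longrightarrow> \<bar>radial_mode b c m z w\<bar> \<le> M * exp (\<epsilon> / (P + 1) * z) * (1 / 2) ^ m" by metis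
  show thesis
  proof
    fix q w :: real and m :: nat assume q: "q \<ge> 0" and w: "\<bar>w\<bar> \<le> P * q"
    have "\<epsilon> / (P + 1) * (P * q) = \<epsilon> * q * (P / (P + 1))" by simp
    also have "\<dots> \<le> \<epsilon> * q * 1" using assms q by (intro mult_left_mono) auto
    finally have "M * exp (\<epsilon> / (P + 1) * (P * q)) * (1 / 2) ^ m \<le> M * exp (\<epsilon> * q) * (1 / 2) ^ m"
      using M(1) by (intro mult_right_mono mult_left_mono) auto
    then show "\<bar>radial_mode b c m (P * q) w\<bar> \<le> M * exp (\<epsilon> * q) * (1 / 2) ^ m"
      using M(2)[OF w] order_trans by blast
  qed (rule M)
qed

lemma norm_kernel_term: "norm (kernel_term z m) = \<bar>radial_mode b c m z (- z)\<bar>"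
  by (simp add: kernel_term_def norm_mult)

lemma zonal_series_bound:
  assumes "summable (\<lambda>m. norm (\<alpha> m) * D m)" "\<bar>\<tau>\<bar> \<le> 1"
  shows "(\<lambda>m. \<alpha> m * complex_of_real (C m \<tau>)) sums (\<Sum>m. \<alpha> m * of_real (C m \<tau>))"
    "norm (\<Sum>m. \<alpha> m * complex_of_real (C m \<tau>)) \<le> (\<Sum>m. norm (\<alpha> m) * D m)"
    "(\<Sum>m<n. norm (\<alpha> m * complex_of_real (C m \<tau>))) \<le> (\<Sum>m. norm (\<alpha> m) * D m)"
proof -
  have b: "norm (\<alpha> m * complex_of_real (C m \<tau>)) \<le> norm (\<alpha> m) * D m" for m
    unfolding norm_mult norm_of_real by (intro mult_left_mono C_bound assms(2)) auto
  then show "(\<lambda>m. \<alpha> m * complex_of_real (C m \<tau>)) sums (\<Sum>m. \<alpha> m * of_real (C m \<tau>))"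
    by (intro summable_sums summable_comparison_test'[OF assms(1), of 0])
  show "norm (\<Sum>m. \<alpha> m * complex_of_real (C m \<tau>)) \<le> (\<Sum>m. norm (\<alpha> m) * D m)"
    by (rule norm_suminf_le[OF b assms(1)])
  show "(\<Sum>m<n. norm (\<alpha> m * complex_of_real (C m \<tau>))) \<le> (\<Sum>m. norm (\<alpha> m) * D m)"
    by (rule sum_norm_le_suminf[OF assms(1) b])
qed

text \<open>By the reproducing property convolution multiplies the coefficients. The two series
  leave the integral one at a time: first the one about y, with a single polynomial about \<omega>
  as the other factor, then the one about \<omega>.\<close>

lemma zonal_convolution:
  fixes \<omega> y :: "real ^ 'n"
  assumes \<omega>: "norm \<omega> = 1" and y: "norm y = 1"
    and \<alpha>: "summable (\<lambda>m. norm (\<alpha> m) * D m)" and \<beta>: "summable (\<lambda>m. norm (\<beta> m) * D m)"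
  shows "(\<lambda>m. \<alpha> m * \<beta> m * complex_of_real (C m (\<omega> \<bullet> y))) sums
    (LINT \<eta>|\<sigma>. (\<Sum>m. \<alpha> m * of_real (C m (\<omega> \<bullet> \<eta>))) * (\<Sum>m. \<beta> m * of_real (C m (y \<bullet> \<eta>))))"
proof -
  define F where "F \<eta> = (\<Sum>m. \<alpha> m * complex_of_real (C m (\<omega> \<bullet> \<eta>)))" for \<eta>
  define G where "G \<eta> = (\<Sum>m. \<beta> m * complex_of_real (C m (y \<bullet> \<eta>)))" for \<eta>
  have [measurable]: "F \<in> borel_measurable borel" "G \<in> borel_measurable borel"
    unfolding F_def[abs_def] G_def[abs_def] by measurable
  have in\<omega>: "\<bar>\<omega> \<bullet> \<eta>\<bar> \<le> 1" and iny: "\<bar>y \<bullet> \<eta>\<bar> \<le> 1" if "norm \<eta> = 1" for \<eta>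
    using inner_le[OF _ that] \<omega> y by auto
  define SB where "SB = (\<Sum>m. norm (\<beta> m) * D m)"
  have SB: "norm (G \<eta>) \<le> SB" if "norm \<eta> = 1" for \<eta>
    unfolding G_def SB_def by (rule zonal_series_bound(2)[OF \<beta> iny[OF that]])
  have 1: "(LINT \<eta>|\<sigma>. of_real (C m (\<omega> \<bullet> \<eta>)) * G \<eta>) = \<beta> m * complex_of_real (C m (\<omega> \<bullet> y))" for m
  proof -
    define f where "f l \<eta> = complex_of_real (C m (\<omega> \<bullet> \<eta>)) * (\<beta> l * of_real (C l (y \<bullet> \<eta>)))" for l \<eta>
    have s: "(\<lambda>l. integral\<^sup>L \<sigma> (f l)) sums (LINT \<eta>|\<sigma>. of_real (C m (\<omega> \<bullet> \<eta>)) * G \<eta>)"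
    proof (rule sums_integral_dominated(1))
      show "integrable \<sigma> (\<lambda>_. D m * SB)" by simp
      show "AE \<eta> in \<sigma>. (\<lambda>l. f l \<eta>) sums (of_real (C m (\<omega> \<bullet> \<eta>)) * G \<eta>)"
        using AE_\<sigma> by eventually_elim (unfold f_def G_def, intro sums_mult zonal_series_bound(1)[OF \<beta>] iny)
      show "AE \<eta> in \<sigma>. \<forall>n. (\<Sum>l<n. norm (f l \<eta>)) \<le> D m * SB"
        using AE_\<sigma>
      proof eventually_elim
        case (elim \<eta>)
        have "(\<Sum>l<n. norm (f l \<eta>)) \<le> D m * SB" for n
        proof -
          have "(\<Sum>l<n. norm (f l \<eta>)) = \<bar>C m (\<omega> \<bullet> \<eta>)\<bar> * (\<Sum>l<n. norm (\<beta> l * complex_of_real (C l (y \<bullet> \<eta>))))"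
            unfolding f_def by (simp add: norm_mult sum_distrib_left)
          also have "\<dots> \<le> D m * SB" unfolding SB_def
            by (intro mult_mono C_bound in\<omega>[OF elim] zonal_series_bound(3)[OF \<beta> iny[OF elim]] D_nonneg sum_nonneg) auto
          finally show ?thesis .
        qed
        then show ?case by blast
      qed
    qed (unfold f_def, measurable)
    have "integral\<^sup>L \<sigma> (f l) = (if l = m then \<beta> m * complex_of_real (C m (\<omega> \<bullet> y)) else 0)" for l
    proof -
      have "integral\<^sup>L \<sigma> (f l) = (LINT \<eta>|\<sigma>. \<beta> l * complex_of_real (C m (\<omega> \<bullet> \<eta>) * C l (y \<bullet> \<eta>)))"
        unfolding f_def of_real_mult by (simp only: mult_ac)
      also have "\<dots> = \<beta> l * complex_of_real (LINT \<eta>|\<sigma>. C m (\<omega> \<bullet> \<eta>) * C l (y \<bullet> \<eta>))"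
        by (simp only: integral_mult_right_zero integral_complex_of_real)
      finally show ?thesis unfolding gegenbauer_reproducing[OF \<omega> y] by auto
    qed
    with s have "(\<lambda>l. if l = m then \<beta> m * complex_of_real (C m (\<omega> \<bullet> y)) else 0) sums (LINT \<eta>|\<sigma>. of_real (C m (\<omega> \<bullet> \<eta>)) * G \<eta>)"
      by (simp only:)
    from sums_unique2[OF this sums_single[of m "\<lambda>_. \<beta> m * complex_of_real (C m (\<omega> \<bullet> y))"]] show ?thesis .
  qed
  define f where "f m \<eta> = \<alpha> m * complex_of_real (C m (\<omega> \<bullet> \<eta>)) * G \<eta>" for m \<eta>
  have s: "(\<lambda>m. integral\<^sup>L \<sigma> (f m)) sums (LINT \<eta>|\<sigma>. F \<eta> * G \<eta>)"
  proof (rule sums_integral_dominated(1))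
    show "integrable \<sigma> (\<lambda>_. (\<Sum>m. norm (\<alpha> m) * D m) * SB)" by simp
    show "AE \<eta> in \<sigma>. (\<lambda>m. f m \<eta>) sums (F \<eta> * G \<eta>)"
      using AE_\<sigma> by eventually_elim (unfold f_def F_def, intro sums_mult2 zonal_series_bound(1)[OF \<alpha>] in\<omega>)
    show "AE \<eta> in \<sigma>. \<forall>n. (\<Sum>m<n. norm (f m \<eta>)) \<le> (\<Sum>m. norm (\<alpha> m) * D m) * SB"
      using AE_\<sigma>
    proof eventually_elim
      case (elim \<eta>)
      have "(\<Sum>m<n. norm (f m \<eta>)) \<le> (\<Sum>m. norm (\<alpha> m) * D m) * SB" for n
      proof -
        have "(\<Sum>m<n. norm (f m \<eta>)) = (\<Sum>m<n. norm (\<alpha> m * complex_of_real (C m (\<omega> \<bullet> \<eta>)))) * norm (G \<eta>)"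
          unfolding f_def norm_mult[of _ "G \<eta>"] by (simp only: sum_distrib_right)
        also have "\<dots> \<le> (\<Sum>m. norm (\<alpha> m) * D m) * SB"
          by (intro mult_mono SB[OF elim] zonal_series_bound(3)[OF \<alpha> in\<omega>[OF elim]] suminf_nonneg \<alpha> mult_nonneg_nonneg D_nonneg norm_ge_zero)
        finally show ?thesis .
      qed
      then show ?case by blast
    qed
  qed (unfold f_def, measurable)
  have "integral\<^sup>L \<sigma> (f m) = \<alpha> m * \<beta> m * complex_of_real (C m (\<omega> \<bullet> y))" for m
  proof -
    have "integral\<^sup>L \<sigma> (f m) = (LINT \<eta>|\<sigma>. \<alpha> m * (of_real (C m (\<omega> \<bullet> \<eta>)) * G \<eta>))"
      unfolding f_def mult.assoc ..
    then show ?thesis by (simp only: integral_mult_right_zero 1 mult.assoc)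
  qed
  with s show ?thesis unfolding F_def G_def by (simp only:)
qed

lemma cnj_borel [measurable]: "cnj \<in> borel_measurable borel"
  by (intro borel_measurable_continuous_onI continuous_intros)

lemma sigma_finite_pair: "pair_sigma_finite (gamma_radial c) \<sigma>"
  by (intro pair_sigma_finite.intro sigma_finite_gamma_radial c_pos finite_measure.axioms(1)) (rule S.finite_measure_axioms)

lemma deformed_const_nonneg: "deformed_const TYPE(real ^ 'n) a \<ge> 0"
  unfolding deformed_const_def by (intro inverse_nonnegative_iff_nonnegative[THEN iffD2] Bochner_Integration.integral_nonneg) auto

text \<open>Carries the Lebesgue integrals of the definitions to the product measure. The radial
  majorant \<open>g\<close> justifies Fubini, as the spherical factor has mass 1.\<close>

lemma polar_integral:
  fixes \<Phi> :: "real \<Rightarrow> real ^ 'n \<Rightarrow> complex"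
  assumes \<Phi> [measurable]: "case_prod \<Phi> \<in> borel_measurable (borel \<Otimes>\<^sub>M borel)"
    and f: "\<And>r \<eta>. r > 0 \<Longrightarrow> norm \<eta> = 1 \<Longrightarrow> f (r *\<^sub>R \<eta>) = \<Phi> (r powr a / a) \<eta>"
    and g: "integrable (gamma_radial c) g" "\<And>q \<eta>. q > 0 \<Longrightarrow> norm \<eta> = 1 \<Longrightarrow> norm (\<Phi> q \<eta>) \<le> g q"
  shows "of_real (deformed_const TYPE(real ^ 'n) a) * (LINT x|lborel. f x / of_real (norm x powr (2 - a)))
    = (LINT q|gamma_radial c. LINT \<eta>|\<sigma>. \<Phi> q \<eta>)"
proof -
  interpret pair_sigma_finite "gamma_radial c" \<sigma> by (rule sigma_finite_pair)
  let ?d = "deformed_const TYPE(real ^ 'n) a" and ?h = "\<lambda>x :: real ^ 'n. (norm x powr a / a, sgn x)"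
  have "of_real ?d * (LINT x|lborel. f x / of_real (norm x powr (2 - a)))
    = (LINT x|lborel. of_real ?d * (f x / of_real (norm x powr (2 - a))))"
    by (rule integral_mult_right_zero[symmetric])
  also have "\<dots> = (LINT x|lborel. (?d * norm x powr (a - 2)) *\<^sub>R case_prod \<Phi> (?h x))"
  proof (rule Bochner_Integration.integral_cong[OF refl])
    fix x :: "real ^ 'n"
    show "of_real ?d * (f x / of_real (norm x powr (2 - a))) = (?d * norm x powr (a - 2)) *\<^sub>R case_prod \<Phi> (?h x)"
    \<comment> \<open>At the origin both sides are 0, because 0 \<open>powr\<close> s is 0 and so is
      any quotient by 0.\<close>
    proof (cases "x = 0")
      case False
      have "f x = \<Phi> (norm x powr a / a) (sgn x)"
        using f[of "norm x" "sgn x"] False by (simp add: norm_sgn sgn_div_norm)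
      moreover have "norm x powr (a - 2) = 1 / norm x powr (2 - a)"
        by (simp add: powr_minus_divide[symmetric])
      ultimately show ?thesis by (simp add: scaleR_conv_of_real)
    qed simp
  qed
  also have "\<dots> = (LINT x|polar_measure a. case_prod \<Phi> (?h x))"
    unfolding polar_measure_def by (rule integral_density[symmetric]) (use deformed_const_nonneg in auto)
  also have "\<dots> = (LINT z|distr (polar_measure a) (borel \<Otimes>\<^sub>M borel) ?h. case_prod \<Phi> z)"
    by (rule integral_distr[symmetric]) (auto simp: polar_measure_def)
  also have "distr (polar_measure a) (borel \<Otimes>\<^sub>M borel) ?h = gamma_radial c \<Otimes>\<^sub>M \<sigma>"
    using polar_coordinates[OF a_pos a_gt_DIM] by (simp add: \<sigma>_def N_def)
  also have "(LINT z|(gamma_radial c \<Otimes>\<^sub>M \<sigma>). case_prod \<Phi> z) = (LINT q|gamma_radial c. LINT \<eta>|\<sigma>. case_prod \<Phi> (q, \<eta>))"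
  proof (rule integral_fst'[symmetric], rule Fubini_integrable)
    show "case_prod \<Phi> \<in> borel_measurable (gamma_radial c \<Otimes>\<^sub>M \<sigma>)" by measurable
    have m: "(\<lambda>\<eta>. \<Phi> q \<eta>) \<in> borel_measurable borel" for q by measurable
    show "AE q in gamma_radial c. integrable \<sigma> (\<lambda>\<eta>. case_prod \<Phi> (q, \<eta>))"
      using AE_gamma_radial
    proof eventually_elim
      case (elim q)
      show ?case using integrable_\<sigma>[OF m g(2)[OF elim]] by simp
    qed
    show "integrable (gamma_radial c) (\<lambda>q. LINT \<eta>|\<sigma>. norm (case_prod \<Phi> (q, \<eta>)))"
    proof (rule Bochner_Integration.integrable_bound[OF g(1)])
      show "AE q in gamma_radial c. norm (LINT \<eta>|\<sigma>. norm (case_prod \<Phi> (q, \<eta>))) \<le> norm (g q)"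
        using AE_gamma_radial
      proof eventually_elim
        case (elim q)
        have "norm (LINT \<eta>|\<sigma>. norm (\<Phi> q \<eta>)) \<le> g q"
          by (rule integral_\<sigma>_bound) (use m g(2)[OF elim] in auto)
        then show ?case by simp
      qed
    qed measurable
  qed
  finally show ?thesis by simp
qed

lemma kernel_term_summable:
  assumes "z \<ge> 0"
  shows "summable (\<lambda>m. norm (kernel_term z m) * D m)"
proof -
  obtain M where M: "M \<ge> 0"
    "\<And>q m w. q \<ge> 0 \<Longrightarrow> \<bar>w\<bar> \<le> z * q \<Longrightarrow> \<bar>radial_mode b c m (z * q) w\<bar> \<le> M * exp (1 * q) * (1 / 2) ^ m"
    using mode_scaled_bound[OF assms, of 1] by auto
  show ?thesis
  proof (rule summable_comparison_test'[of _ 0])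
    show "summable (\<lambda>m. M * exp 1 * (D m * (1 / 2) ^ m))" by (intro summable_mult summable_D_half)
    fix m
    have "\<bar>radial_mode b c m z (- z)\<bar> \<le> M * exp 1 * (1 / 2) ^ m" using M(2)[of 1 "- z" m] assms by simp
    then have "\<bar>radial_mode b c m z (- z)\<bar> * D m \<le> M * exp 1 * (1 / 2) ^ m * D m"
      by (intro mult_right_mono D_nonneg)
    then show "norm (norm (kernel_term z m) * D m) \<le> M * exp 1 * (D m * (1 / 2) ^ m)"
      using D_nonneg[of m] by (simp add: norm_kernel_term abs_mult mult_ac)
  qed
qed

lemma cnj_kernel_series:
  assumes "z \<ge> 0" "\<bar>\<tau>\<bar> \<le> 1"
  shows "cnj (kernel_series z \<tau>) = (\<Sum>m. cnj (kernel_term z m) * of_real (C m \<tau>))"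
proof -
  have "(\<lambda>m. kernel_term z m * of_real (C m \<tau>)) sums kernel_series z \<tau>"
    unfolding kernel_series_def by (rule zonal_series_bound(1)[OF kernel_term_summable[OF assms(1)] assms(2)])
  then have "(\<lambda>m. cnj (kernel_term z m * of_real (C m \<tau>))) sums cnj (kernel_series z \<tau>)"
    by (simp only: sums_cnj)
  then show ?thesis by (simp add: sums_iff)
qed

lemma norm_kernel_series_scaled:
  assumes P: "P \<ge> 0" and \<epsilon>: "\<epsilon> > 0"
  obtains M where "M \<ge> 0" "\<And>q \<tau>. q \<ge> 0 \<Longrightarrow> \<bar>\<tau>\<bar> \<le> 1 \<Longrightarrow> norm (kernel_series (P * q) \<tau>) \<le> M * exp (\<epsilon> * q)"
proof -
  obtain M where M: "M \<ge> 0"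
    "\<And>q m w. q \<ge> 0 \<Longrightarrow> \<bar>w\<bar> \<le> P * q \<Longrightarrow> \<bar>radial_mode b c m (P * q) w\<bar> \<le> M * exp (\<epsilon> * q) * (1 / 2) ^ m"
    using mode_scaled_bound[OF P \<epsilon>] by blast
  define S where "S = (\<Sum>m. D m * (1 / 2) ^ m)"
  have S: "S \<ge> 0" unfolding S_def by (intro suminf_nonneg summable_D_half mult_nonneg_nonneg D_nonneg) auto
  show thesis
  proof
    show "M * S \<ge> 0" using M S by simp
    fix q \<tau> :: real assume q: "q \<ge> 0" and \<tau>: "\<bar>\<tau>\<bar> \<le> 1"
    have "norm (kernel_series (P * q) \<tau>) \<le> (\<Sum>m. norm (kernel_term (P * q) m) * D m)"
      unfolding kernel_series_def using P q by (intro zonal_series_bound(2) kernel_term_summable \<tau>) auto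
    also have "\<dots> \<le> (\<Sum>m. M * exp (\<epsilon> * q) * (D m * (1 / 2) ^ m))"
    proof (rule suminf_le)
      show "norm (kernel_term (P * q) m) * D m \<le> M * exp (\<epsilon> * q) * (D m * (1 / 2) ^ m)" for m
        using mult_right_mono[OF M(2)[OF q, of "- (P * q)" m] D_nonneg[of m]] P q
        by (simp add: norm_kernel_term mult_ac)
    qed (use P q in \<open>auto intro!: kernel_term_summable summable_mult summable_D_half\<close>)
    also have "\<dots> = M * S * exp (\<epsilon> * q)" unfolding S_def by (subst suminf_mult[OF summable_D_half]) simp
    finally show "norm (kernel_series (P * q) \<tau>) \<le> M * S * exp (\<epsilon> * q)" .
  qed
qed

lemma kernel_series_borel [measurable]:
  assumes [measurable]: "f \<in> borel_measurable M" "g \<in> borel_measurable M"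
  shows "(\<lambda>x. kernel_series (f x) (g x)) \<in> borel_measurable M"
  unfolding kernel_series_def kernel_term_def by measurable

text \<open>The outcome of Weber's integral, up to powers of \<Gamma>(c). Unlike
  \<open>radial_density\<close> it carries no measure weight and has the right value at p = 0, which
  the flow at the origin requires.\<close>

definition heat_mode :: "real \<Rightarrow> real \<Rightarrow> nat \<Rightarrow> real \<Rightarrow> real" where
  "heat_mode p t m q = exp (- ((p + q) / t)) / t powr c * radial_mode b c m (p * q / t\<^sup>2) (p * q / t\<^sup>2)"

text \<open>In polar coordinates for \<xi> the sphere integral is a zonal convolution, which leaves
  a single sum over m, and the radial integral is
  \<open>integral_radial_mode_product\<close>.\<close>

lemma heat_kernel_sums:
  fixes \<omega> \<omega>' :: "real ^ 'n"
  assumes t: "t > 0" and \<omega>: "norm \<omega> = 1" "norm \<omega>' = 1" and r: "r \<ge> 0" "r' \<ge> 0"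
  defines "p \<equiv> r powr a / a" and "p' \<equiv> r' powr a / a"
  shows "(\<lambda>m. of_real (Gamma c * heat_mode p t m p' * C m (\<omega> \<bullet> \<omega>'))) sums deformed_heat_kernel a (r *\<^sub>R \<omega>) (r' *\<^sub>R \<omega>') t"
proof -
  have G: "Gamma c > 0" using c_pos by (rule Gamma_real_pos)
  have p: "p \<ge> 0" "p' \<ge> 0" using a_pos by (auto simp: p_def p'_def)
  define \<Phi> where "\<Phi> q \<eta> = cnj (kernel_series (p * q) (\<omega> \<bullet> \<eta>)) * kernel_series (p' * q) (\<omega>' \<bullet> \<eta>) * of_real (exp (- (t * q)))" for q and \<eta> :: "real ^ 'n"
  have in\<omega>: "\<bar>\<omega> \<bullet> \<eta>\<bar> \<le> 1" "\<bar>\<omega>' \<bullet> \<eta>\<bar> \<le> 1" if "norm \<eta> = 1" for \<eta>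
    using inner_le[OF _ that] \<omega> by auto
  \<comment> \<open>The rate t / 4 for each of the two factors leaves exp(-t q / 2) of the weight
    exp(-t q).\<close>
  obtain M where M: "M \<ge> 0" "\<And>q \<tau>. q \<ge> 0 \<Longrightarrow> \<bar>\<tau>\<bar> \<le> 1 \<Longrightarrow> norm (kernel_series (p * q) \<tau>) \<le> M * exp (t / 4 * q)"
    using norm_kernel_series_scaled[OF p(1), of "t / 4"] t by (metis zero_less_divide_iff zero_less_numeral)
  obtain M' where M': "M' \<ge> 0" "\<And>q \<tau>. q \<ge> 0 \<Longrightarrow> \<bar>\<tau>\<bar> \<le> 1 \<Longrightarrow> norm (kernel_series (p' * q) \<tau>) \<le> M' * exp (t / 4 * q)"
    using norm_kernel_series_scaled[OF p(2), of "t / 4"] t by (metis zero_less_divide_iff zero_less_numeral)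
  have ex: "exp (t / 4 * q) * exp (t / 4 * q) * exp (- (t * q)) = q ^ 0 * exp (- (t / 2 * q))" for q
    by (simp flip: exp_add)
  have int: "integrable (gamma_radial c) (\<lambda>q. K * (q ^ 0 * exp (- (t / 2 * q))))" for K
    using gamma_radial_moment[OF c_pos, of "t / 2" 0] t by (intro integrable_mult_right) (simp add: has_bochner_integral_iff)
  \<comment> \<open>The constants \<Gamma>(c) of \<open>deformed_B_expansion\<close> are split off,
    so that the integrand is a product of two kernel series.\<close>
  have "deformed_heat_kernel a (r *\<^sub>R \<omega>) (r' *\<^sub>R \<omega>') t = of_real (deformed_const TYPE(real ^ 'n) a) *
     (LINT \<xi>|lborel. of_real (Gamma c) ^ 2 * (cnj (deformed_B a (r *\<^sub>R \<omega>) \<xi> / of_real (Gamma c)) * (deformed_B a (r' *\<^sub>R \<omega>') \<xi> / of_real (Gamma c))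
        * of_real (exp (- (t / a) * norm \<xi> powr a)) / of_real (norm \<xi> powr (2 - a))))"
    unfolding deformed_heat_kernel_def using G by (simp add: power2_eq_square)
  also have "\<dots> = of_real (Gamma c) ^ 2 * (of_real (deformed_const TYPE(real ^ 'n) a) *
     (LINT \<xi>|lborel. (cnj (deformed_B a (r *\<^sub>R \<omega>) \<xi> / of_real (Gamma c)) * (deformed_B a (r' *\<^sub>R \<omega>') \<xi> / of_real (Gamma c))
        * of_real (exp (- (t / a) * norm \<xi> powr a))) / of_real (norm \<xi> powr (2 - a))))"
    by (simp only: integral_mult_right_zero mult.left_commute)
  also have "of_real (deformed_const TYPE(real ^ 'n) a) *
     (LINT \<xi>|lborel. (cnj (deformed_B a (r *\<^sub>R \<omega>) \<xi> / of_real (Gamma c)) * (deformed_B a (r' *\<^sub>R \<omega>') \<xi> / of_real (Gamma c))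
        * of_real (exp (- (t / a) * norm \<xi> powr a))) / of_real (norm \<xi> powr (2 - a)))
     = (LINT q|gamma_radial c. LINT \<eta>|\<sigma>. \<Phi> q \<eta>)"
  proof (rule polar_integral)
    show "case_prod \<Phi> \<in> borel_measurable (borel \<Otimes>\<^sub>M borel)"
      unfolding \<Phi>_def case_prod_beta' by measurable
    show "integrable (gamma_radial c) (\<lambda>q. (M * M') * (q ^ 0 * exp (- (t / 2 * q))))" by (rule int)
    fix s :: real and \<eta> :: "real ^ 'n" assume s: "s > 0" and \<eta>: "norm \<eta> = 1"
    show "cnj (deformed_B a (r *\<^sub>R \<omega>) (s *\<^sub>R \<eta>) / of_real (Gamma c)) * (deformed_B a (r' *\<^sub>R \<omega>') (s *\<^sub>R \<eta>) / of_real (Gamma c))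
        * of_real (exp (- (t / a) * norm (s *\<^sub>R \<eta>) powr a)) = \<Phi> (s powr a / a) \<eta>"
      using G s \<eta> deformed_B_expansion[OF r(1) less_imp_le[OF s] \<omega>(1) \<eta>] deformed_B_expansion[OF r(2) less_imp_le[OF s] \<omega>(2) \<eta>]
      by (simp add: \<Phi>_def p_def p'_def)
    have "norm (\<Phi> s \<eta>) \<le> (M * exp (t / 4 * s)) * (M' * exp (t / 4 * s)) * exp (- (t * s))"
      unfolding \<Phi>_def norm_mult complex_mod_cnj using M(1) M'(1) s
      by (intro mult_mono M(2) M'(2) in\<omega>[OF \<eta>]) auto
    then show "norm (\<Phi> s \<eta>) \<le> (M * M') * (s ^ 0 * exp (- (t / 2 * s)))"
      unfolding ex[symmetric] by (simp only: mult_ac)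
  qed
  finally have h: "deformed_heat_kernel a (r *\<^sub>R \<omega>) (r' *\<^sub>R \<omega>') t = of_real (Gamma c) ^ 2 * (LINT q|gamma_radial c. LINT \<eta>|\<sigma>. \<Phi> q \<eta>)" .
  have "(\<lambda>m. of_real (Gamma c * heat_mode p t m p' * C m (\<omega> \<bullet> \<omega>'))) sums (of_real (Gamma c) ^ 2 * (LINT q|gamma_radial c. LINT \<eta>|\<sigma>. \<Phi> q \<eta>))"
  proof -
    define e where "e m q = exp (- (t * q)) * (radial_mode b c m (p * q) (- (p * q)) * radial_mode b c m (p' * q) (- (p' * q)))" for m q
    define f where "f m q = complex_of_real (e m q * C m (\<omega> \<bullet> \<omega>'))" for m q
    have [measurable]: "e m \<in> borel_measurable borel" for m unfolding e_def[abs_def] by measurable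
    obtain L where L: "L \<ge> 0" "\<And>q m w. q \<ge> 0 \<Longrightarrow> \<bar>w\<bar> \<le> p * q \<Longrightarrow> \<bar>radial_mode b c m (p * q) w\<bar> \<le> L * exp (t / 4 * q) * (1 / 2) ^ m"
      using mode_scaled_bound[OF p(1), of "t / 4"] t by (metis zero_less_divide_iff zero_less_numeral)
    obtain L' where L': "L' \<ge> 0" "\<And>q m w. q \<ge> 0 \<Longrightarrow> \<bar>w\<bar> \<le> p' * q \<Longrightarrow> \<bar>radial_mode b c m (p' * q) w\<bar> \<le> L' * exp (t / 4 * q) * (1 / 2) ^ m"
      using mode_scaled_bound[OF p(2), of "t / 4"] t by (metis zero_less_divide_iff zero_less_numeral)
    define S where "S = (\<Sum>m. D m * (1 / 2) ^ m)"
    have 1: "(\<lambda>m. integral\<^sup>L (gamma_radial c) (f m)) sums (LINT q|gamma_radial c. LINT \<eta>|\<sigma>. \<Phi> q \<eta>)"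
    proof (rule sums_integral_dominated(1))
      show "integrable (gamma_radial c) (\<lambda>q. (L * L' * S) * (q ^ 0 * exp (- (t / 2 * q))))" by (rule int)
      show "AE q in gamma_radial c. (\<lambda>m. f m q) sums (LINT \<eta>|\<sigma>. \<Phi> q \<eta>)"
        using AE_gamma_radial
      proof eventually_elim
        case (elim q)
        have pq: "p * q \<ge> 0" "p' * q \<ge> 0" using p elim by auto
        have "(\<lambda>m. cnj (kernel_term (p * q) m) * kernel_term (p' * q) m * complex_of_real (C m (\<omega> \<bullet> \<omega>'))) sums
          (LINT \<eta>|\<sigma>. (\<Sum>m. cnj (kernel_term (p * q) m) * of_real (C m (\<omega> \<bullet> \<eta>))) * (\<Sum>m. kernel_term (p' * q) m * of_real (C m (\<omega>' \<bullet> \<eta>))))"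
          using kernel_term_summable[OF pq(1)] kernel_term_summable[OF pq(2)]
          by (intro zonal_convolution \<omega>) auto
        also have "(LINT \<eta>|\<sigma>. (\<Sum>m. cnj (kernel_term (p * q) m) * of_real (C m (\<omega> \<bullet> \<eta>))) * (\<Sum>m. kernel_term (p' * q) m * of_real (C m (\<omega>' \<bullet> \<eta>))))
          = (LINT \<eta>|\<sigma>. cnj (kernel_series (p * q) (\<omega> \<bullet> \<eta>)) * kernel_series (p' * q) (\<omega>' \<bullet> \<eta>))"
        proof (rule integral_cong_AE)
          show "AE \<eta> in \<sigma>. (\<Sum>m. cnj (kernel_term (p * q) m) * of_real (C m (\<omega> \<bullet> \<eta>))) * (\<Sum>m. kernel_term (p' * q) m * of_real (C m (\<omega>' \<bullet> \<eta>)))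
            = cnj (kernel_series (p * q) (\<omega> \<bullet> \<eta>)) * kernel_series (p' * q) (\<omega>' \<bullet> \<eta>)"
            using AE_\<sigma> by eventually_elim (simp only: cnj_kernel_series[OF pq(1) in\<omega>(1)], unfold kernel_series_def, rule refl)
        qed measurable
        finally have "(\<lambda>m. cnj (kernel_term (p * q) m) * kernel_term (p' * q) m * complex_of_real (C m (\<omega> \<bullet> \<omega>')) * of_real (exp (- (t * q)))) sums
          ((LINT \<eta>|\<sigma>. cnj (kernel_series (p * q) (\<omega> \<bullet> \<eta>)) * kernel_series (p' * q) (\<omega>' \<bullet> \<eta>)) * of_real (exp (- (t * q))))"
          by (rule sums_mult2)
        moreover have "(LINT \<eta>|\<sigma>. \<Phi> q \<eta>) = (LINT \<eta>|\<sigma>. cnj (kernel_series (p * q) (\<omega> \<bullet> \<eta>)) * kernel_series (p' * q) (\<omega>' \<bullet> \<eta>)) * of_real (exp (- (t * q)))"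
          unfolding \<Phi>_def by (rule integral_mult_left_zero)
        moreover have "cnj (kernel_term (p * q) m) * kernel_term (p' * q) m * complex_of_real (C m (\<omega> \<bullet> \<omega>')) * of_real (exp (- (t * q))) = f m q" for m
        proof -
          \<comment> \<open>The conjugation in the definition of the heat kernel makes the phases
            cancel; all coefficients of the heat kernel are real.\<close>
          have "cnj (cis s) * cis s = 1" for s by (simp add: cis_cnj cis_mult)
          then have "cnj (cis s * of_real x) * (cis s * of_real y) * of_real z * of_real w = complex_of_real (w * (x * y) * z)" for s x y z w
            by (simp add: mult_ac)
          then show ?thesis unfolding kernel_term_def f_def e_def .
        qed
        ultimately show ?case by (simp only:)
      qed
      show "AE q in gamma_radial c. \<forall>n. (\<Sum>m<n. norm (f m q)) \<le> (L * L' * S) * (q ^ 0 * exp (- (t / 2 * q)))"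
        using AE_gamma_radial
      proof eventually_elim
        case (elim q)
        let ?E = "L * L' * (q ^ 0 * exp (- (t / 2 * q)))"
        have E: "?E \<ge> 0" using L L' by simp
        have nf: "norm (f m q) \<le> ?E * (D m * (1 / 2) ^ m)" for m
        proof -
          have "norm (f m q) = exp (- (t * q)) * (\<bar>radial_mode b c m (p * q) (- (p * q))\<bar> * \<bar>radial_mode b c m (p' * q) (- (p' * q))\<bar>) * \<bar>C m (\<omega> \<bullet> \<omega>')\<bar>"
            unfolding f_def e_def norm_of_real by (simp add: abs_mult)
          also have "\<dots> \<le> exp (- (t * q)) * ((L * exp (t / 4 * q) * (1 / 2) ^ m) * (L' * exp (t / 4 * q) * (1 / 2) ^ m)) * D m"
            using elim p L(1) L'(1) by (intro mult_mono L(2) L'(2) C_bound in\<omega>(1) \<omega> order_refl) (auto intro!: mult_nonneg_nonneg)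
          also have "\<dots> = L * L' * (exp (t / 4 * q) * exp (t / 4 * q) * exp (- (t * q))) * (D m * (1 / 2) ^ m) * (1 / 2) ^ m"
            by (simp only: mult_ac)
          also have "\<dots> \<le> ?E * (D m * (1 / 2) ^ m) * 1"
            unfolding ex using E D_nonneg[of m] by (intro mult_left_mono) (auto intro!: power_le_one mult_nonneg_nonneg simp: L L')
          finally show ?thesis by simp
        qed
        have "(\<Sum>m<n. norm (f m q)) \<le> (\<Sum>m. ?E * (D m * (1 / 2) ^ m))" for n
          by (rule sum_norm_le_suminf[OF summable_mult[OF summable_D_half] nf])
        also have "(\<Sum>m. ?E * (D m * (1 / 2) ^ m)) = (L * L' * S) * (q ^ 0 * exp (- (t / 2 * q)))"
          unfolding S_def suminf_mult[OF summable_D_half] by (simp only: mult_ac)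
        finally show ?case by blast
      qed
      have [measurable]: "case_prod \<Phi> \<in> borel_measurable (borel \<Otimes>\<^sub>M \<sigma>)"
        unfolding \<Phi>_def case_prod_beta' by measurable
      show "(\<lambda>q. LINT \<eta>|\<sigma>. \<Phi> q \<eta>) \<in> borel_measurable (gamma_radial c)"
        by measurable
    qed (unfold f_def, measurable)
    have "integral\<^sup>L (gamma_radial c) (f m) = of_real (1 / Gamma c * heat_mode p t m p' * C m (\<omega> \<bullet> \<omega>'))" for m
    proof -
      have "integral\<^sup>L (gamma_radial c) (f m) = of_real ((LINT q|gamma_radial c. e m q) * C m (\<omega> \<bullet> \<omega>'))"
        unfolding f_def by (simp only: integral_complex_of_real integral_mult_left_zero)
      also have "(LINT q|gamma_radial c. e m q) = 1 / Gamma c * heat_mode p t m p'"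
        unfolding e_def integral_radial_mode_product[OF b_pos c_pos t p] heat_mode_def by simp
      finally show ?thesis .
    qed
    with sums_mult[OF 1, of "of_real (Gamma c) ^ 2"] have "(\<lambda>m. of_real (Gamma c) ^ 2 * of_real (1 / Gamma c * heat_mode p t m p' * C m (\<omega> \<bullet> \<omega>'))) sums
       (of_real (Gamma c) ^ 2 * (LINT q|gamma_radial c. LINT \<eta>|\<sigma>. \<Phi> q \<eta>))"
      by (simp only:)
    moreover have "of_real (Gamma c) ^ 2 * of_real (1 / Gamma c * h * k) = complex_of_real (Gamma c * h * k)" for h k
      using G by (simp add: power2_eq_square)
    ultimately show ?thesis by (simp only:)
  qed
  then show ?thesis by (simp only: h)
qed

section \<open>The heat flow as a series of radial integrals\<close>

definition zonal_profile :: "(real ^ 'n \<Rightarrow> complex) \<Rightarrow> real ^ 'n \<Rightarrow> nat \<Rightarrow> real \<Rightarrow> complex" where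
  "zonal_profile u \<omega> m q = zonal_coeff u \<omega> m ((a * q) powr (1 / a))"

lemma zonal_profile_borel [measurable]:
  assumes [measurable]: "u \<in> borel_measurable borel"
  shows "zonal_profile u \<omega> m \<in> borel_measurable borel"
  unfolding zonal_profile_def[abs_def] zonal_coeff_def by measurable

text \<open>The radius (a q)^(1 / a) is at most a polynomial in q once the exponent 1 / a is rounded
  up to an integer.\<close>

lemma growth_polar:
  fixes u :: "real ^ 'n \<Rightarrow> complex"
  assumes "polynomial_growth u"
  obtains B n where "B \<ge> 0" "\<And>q \<eta>. q > 0 \<Longrightarrow> norm \<eta> = 1 \<Longrightarrow> norm (u ((a * q) powr (1 / a) *\<^sub>R \<eta>)) \<le> B * (1 + q) ^ n"
proof -
  obtain B0 k where u: "\<And>y. norm (u y) \<le> B0 * (1 + norm y) ^ k"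
    using assms unfolding polynomial_growth_def by blast
  have B0: "B0 \<ge> 0" using order_trans[OF norm_ge_zero u[of 0]] by simp
  obtain n0 :: nat where n0: "1 / a \<le> real n0" using real_arch_simple by blast
  show thesis
  proof
    show "B0 * (2 * (1 + a) ^ n0) ^ k \<ge> 0" using B0 a_pos by simp
    fix q :: real and \<eta> :: "real ^ 'n" assume q: "q > 0" and \<eta>: "norm \<eta> = 1"
    have aq: "a * q > 0" using q a_pos by simp
    have "(a * q) powr (1 / a) \<le> (1 + a * q) powr (1 / a)" using aq a_pos by (intro powr_mono2) auto
    also have "\<dots> \<le> (1 + a * q) powr real n0" using aq n0 by (intro powr_mono) auto
    also have "\<dots> = (1 + a * q) ^ n0" using aq by (intro powr_realpow) auto
    also have "\<dots> \<le> ((1 + a) * (1 + q)) ^ n0" using q a_pos by (intro power_mono) (auto simp: algebra_simps)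
    finally have 1: "(a * q) powr (1 / a) \<le> ((1 + a) * (1 + q)) ^ n0" .
    have "1 * 1 \<le> (1 + a) * (1 + q)" using q a_pos by (intro mult_mono) auto
    then have "1 \<le> ((1 + a) * (1 + q)) ^ n0" by (intro one_le_power) simp
    with 1 have 2: "1 + (a * q) powr (1 / a) \<le> 2 * (1 + a) ^ n0 * (1 + q) ^ n0"
      by (simp add: power_mult_distrib)
    have "norm (u ((a * q) powr (1 / a) *\<^sub>R \<eta>)) \<le> B0 * (1 + (a * q) powr (1 / a)) ^ k"
      using u[of "(a * q) powr (1 / a) *\<^sub>R \<eta>"] \<eta> by simp
    also have "\<dots> \<le> B0 * (2 * (1 + a) ^ n0 * (1 + q) ^ n0) ^ k"
      by (intro mult_left_mono power_mono 2 B0) auto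
    also have "\<dots> = B0 * (2 * (1 + a) ^ n0) ^ k * (1 + q) ^ (n0 * k)"
      by (simp only: power_mult_distrib power_mult mult.assoc)
    finally show "norm (u ((a * q) powr (1 / a) *\<^sub>R \<eta>)) \<le> B0 * (2 * (1 + a) ^ n0) ^ k * (1 + q) ^ (n0 * k)" .
  qed
qed

lemma zonal_series_integral:
  fixes \<omega> :: "real ^ 'n"
  assumes \<omega>: "norm \<omega> = 1" and \<alpha>: "summable (\<lambda>m. norm (\<alpha> m) * D m)"
    and u [measurable]: "u \<in> borel_measurable borel" and B: "\<And>\<eta>. norm \<eta> = 1 \<Longrightarrow> norm (u (r *\<^sub>R \<eta>)) \<le> B"
  shows "(\<lambda>m. \<alpha> m * zonal_coeff u \<omega> m r) sums (LINT \<eta>|\<sigma>. (\<Sum>m. \<alpha> m * of_real (C m (\<omega> \<bullet> \<eta>))) * u (r *\<^sub>R \<eta>))"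
proof -
  define f where "f m \<eta> = \<alpha> m * complex_of_real (C m (\<omega> \<bullet> \<eta>)) * u (r *\<^sub>R \<eta>)" for m \<eta>
  have in\<omega>: "\<bar>\<omega> \<bullet> \<eta>\<bar> \<le> 1" if "norm \<eta> = 1" for \<eta>
    using inner_le[OF _ that] \<omega> by auto
  have "(\<lambda>m. integral\<^sup>L \<sigma> (f m)) sums (LINT \<eta>|\<sigma>. (\<Sum>m. \<alpha> m * of_real (C m (\<omega> \<bullet> \<eta>))) * u (r *\<^sub>R \<eta>))"
  proof (rule sums_integral_dominated(1))
    show "integrable \<sigma> (\<lambda>_. (\<Sum>m. norm (\<alpha> m) * D m) * B)" by simp
    show "AE \<eta> in \<sigma>. (\<lambda>m. f m \<eta>) sums ((\<Sum>m. \<alpha> m * of_real (C m (\<omega> \<bullet> \<eta>))) * u (r *\<^sub>R \<eta>))"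
      using AE_\<sigma> by eventually_elim (unfold f_def, intro sums_mult2 zonal_series_bound(1)[OF \<alpha>] in\<omega>)
    show "AE \<eta> in \<sigma>. \<forall>n. (\<Sum>m<n. norm (f m \<eta>)) \<le> (\<Sum>m. norm (\<alpha> m) * D m) * B"
      using AE_\<sigma>
    proof eventually_elim
      case (elim \<eta>)
      have "(\<Sum>m<n. norm (f m \<eta>)) \<le> (\<Sum>m. norm (\<alpha> m) * D m) * B" for n
      proof -
        have "(\<Sum>m<n. norm (f m \<eta>)) = (\<Sum>m<n. norm (\<alpha> m * complex_of_real (C m (\<omega> \<bullet> \<eta>)))) * norm (u (r *\<^sub>R \<eta>))"
          unfolding f_def norm_mult[of _ "u (r *\<^sub>R \<eta>)"] by (simp only: sum_distrib_right)
        also have "\<dots> \<le> (\<Sum>m. norm (\<alpha> m) * D m) * B"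
          by (intro mult_mono B[OF elim] zonal_series_bound(3)[OF \<alpha> in\<omega>[OF elim]] suminf_nonneg \<alpha> mult_nonneg_nonneg D_nonneg norm_ge_zero)
        finally show ?thesis .
      qed
      then show ?case by blast
    qed
  qed (unfold f_def, measurable)
  moreover have "integral\<^sup>L \<sigma> (f m) = \<alpha> m * zonal_coeff u \<omega> m r" for m
  proof -
    have "integral\<^sup>L \<sigma> (f m) = (LINT \<eta>|\<sigma>. \<alpha> m * (u (r *\<^sub>R \<eta>) * of_real (C m (\<omega> \<bullet> \<eta>))))"
      unfolding f_def by (simp only: mult_ac)
    then show ?thesis by (simp only: integral_mult_right_zero zonal_coeff_def)
  qed
  ultimately show ?thesis by (simp only:)
qed

lemma heat_mode_borel [measurable]: "heat_mode p t m \<in> borel_measurable borel"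
  unfolding heat_mode_def[abs_def] by measurable

text \<open>The growth of the modes is kept below half of the rate 1 / t of the exponential factor,
  so that the other half absorbs the polynomial growth of \<open>u\<close>.\<close>

lemma heat_mode_bound:
  assumes p: "p \<ge> 0" and t: "t > 0"
  obtains L where "L \<ge> 0" "\<And>q m. q \<ge> 0 \<Longrightarrow> \<bar>heat_mode p t m q\<bar> \<le> L * exp (- (1 / (2 * t) * q)) * (1 / 2) ^ m"
proof -
  have "p / t\<^sup>2 \<ge> 0" "1 / (2 * t) > 0" using p t by auto
  then obtain M where M: "M \<ge> 0"
    "\<And>q m w. q \<ge> 0 \<Longrightarrow> \<bar>w\<bar> \<le> p / t\<^sup>2 * q \<Longrightarrow> \<bar>radial_mode b c m (p / t\<^sup>2 * q) w\<bar> \<le> M * exp (1 / (2 * t) * q) * (1 / 2) ^ m"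
    using mode_scaled_bound by blast
  show thesis
  proof
    show "M / t powr c \<ge> 0" using M by simp
    fix q :: real and m :: nat assume q: "q \<ge> 0"
    have "\<bar>heat_mode p t m q\<bar> = exp (- ((p + q) / t)) / t powr c * \<bar>radial_mode b c m (p / t\<^sup>2 * q) (p / t\<^sup>2 * q)\<bar>"
      by (simp add: heat_mode_def abs_mult)
    also have "\<dots> \<le> exp (- (q / t)) / t powr c * (M * exp (1 / (2 * t) * q) * (1 / 2) ^ m)"
      using M q p t by (intro mult_mono divide_right_mono) (auto simp: divide_right_mono)
    also have "\<dots> = M / t powr c * (exp (- (q / t)) * exp (1 / (2 * t) * q)) * (1 / 2) ^ m" by simp
    also have "exp (- (q / t)) * exp (1 / (2 * t) * q) = exp (- (1 / (2 * t) * q))"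
      using t by (simp add: field_simps flip: exp_add)
    finally show "\<bar>heat_mode p t m q\<bar> \<le> M / t powr c * exp (- (1 / (2 * t) * q)) * (1 / 2) ^ m" .
  qed
qed

text \<open>The series of the heat kernel is exchanged first with the sphere integral, which turns
  \<open>u\<close> into its zonal coefficients, and then with the radial integral.\<close>

lemma heat_flow_sums:
  fixes \<omega> :: "real ^ 'n"
  assumes t: "t > 0" and \<omega>: "norm \<omega> = 1" and r: "r \<ge> 0" and u [measurable]: "u \<in> borel_measurable borel"
    and B: "B \<ge> 0" "\<And>q \<eta>. q > 0 \<Longrightarrow> norm \<eta> = 1 \<Longrightarrow> norm (u ((a * q) powr (1 / a) *\<^sub>R \<eta>)) \<le> B * (1 + q) ^ n"
  defines "p \<equiv> r powr a / a"
  shows "(\<lambda>m. LINT q|gamma_radial c. of_real (Gamma c * heat_mode p t m q) * zonal_profile u \<omega> m q)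
    sums deformed_heat_flow a u t (r *\<^sub>R \<omega>)"
proof -
  have G: "Gamma c > 0" using c_pos by (rule Gamma_real_pos)
  have p: "p \<ge> 0" using a_pos by (auto simp: p_def)
  obtain L where L: "L \<ge> 0" "\<And>q m. q \<ge> 0 \<Longrightarrow> \<bar>heat_mode p t m q\<bar> \<le> L * exp (- (1 / (2 * t) * q)) * (1 / 2) ^ m"
    using heat_mode_bound[OF p t] by blast
  define S where "S = (\<Sum>m. D m * (1 / 2) ^ m)"
  have sumH: "summable (\<lambda>m. norm (complex_of_real (Gamma c * heat_mode p t m q)) * D m)"
    and SH: "(\<Sum>m. norm (complex_of_real (Gamma c * heat_mode p t m q)) * D m) \<le> Gamma c * L * S * exp (- (1 / (2 * t) * q))"
    if q: "q > 0" for q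
  proof -
    have le: "norm (complex_of_real (Gamma c * heat_mode p t m q)) * D m \<le> Gamma c * L * exp (- (1 / (2 * t) * q)) * (D m * (1 / 2) ^ m)" for m
    proof -
      have "norm (complex_of_real (Gamma c * heat_mode p t m q)) * D m = Gamma c * \<bar>heat_mode p t m q\<bar> * D m"
        using G unfolding norm_of_real by (simp add: abs_mult)
      also have "\<dots> \<le> Gamma c * (L * exp (- (1 / (2 * t) * q)) * (1 / 2) ^ m) * D m"
        using G q by (intro mult_right_mono mult_left_mono L(2) D_nonneg) auto
      finally show ?thesis by (simp only: mult_ac)
    qed
    have s: "summable (\<lambda>m. Gamma c * L * exp (- (1 / (2 * t) * q)) * (D m * (1 / 2) ^ m))"
      by (intro summable_mult summable_D_half)
    show 1: "summable (\<lambda>m. norm (complex_of_real (Gamma c * heat_mode p t m q)) * D m)"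
    proof (rule summable_comparison_test'[OF s, of 0])
      fix m
      show "norm (norm (complex_of_real (Gamma c * heat_mode p t m q)) * D m) \<le> Gamma c * L * exp (- (1 / (2 * t) * q)) * (D m * (1 / 2) ^ m)"
        using le[of m] D_nonneg[of m] unfolding real_norm_def by (subst abs_of_nonneg) (auto intro!: mult_nonneg_nonneg)
    qed
    have "(\<Sum>m. norm (complex_of_real (Gamma c * heat_mode p t m q)) * D m) \<le> (\<Sum>m. Gamma c * L * exp (- (1 / (2 * t) * q)) * (D m * (1 / 2) ^ m))"
      by (rule suminf_le[OF le 1 s])
    also have "\<dots> = Gamma c * L * S * exp (- (1 / (2 * t) * q))"
      unfolding S_def suminf_mult[OF summable_D_half] by (simp only: mult_ac)
    finally show "(\<Sum>m. norm (complex_of_real (Gamma c * heat_mode p t m q)) * D m) \<le> Gamma c * L * S * exp (- (1 / (2 * t) * q))" .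
  qed
  define H where "H q \<tau> = (\<Sum>m. complex_of_real (Gamma c * heat_mode p t m q) * of_real (C m \<tau>))" for q \<tau>
  define \<Phi> where "\<Phi> q \<eta> = H q (\<omega> \<bullet> \<eta>) * u ((a * q) powr (1 / a) *\<^sub>R \<eta>)" for q and \<eta> :: "real ^ 'n"
  have in\<omega>: "\<bar>\<omega> \<bullet> \<eta>\<bar> \<le> 1" if "norm \<eta> = 1" for \<eta>
    using inner_le[OF _ that] \<omega> by auto
  define g where "g q = Gamma c * L * S * B * ((1 + q) ^ n * exp (- (1 / (2 * t) * q)))" for q
  have int: "integrable (gamma_radial c) g"
    unfolding g_def using t by (intro integrable_mult_right integrable_gamma_radial_growth c_pos) auto
  have ge: "Gamma c * L * S * exp (- (1 / (2 * t) * q)) * (B * (1 + q) ^ n) = g q" for q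
    unfolding g_def by (simp only: mult_ac)
  have [measurable]: "case_prod \<Phi> \<in> borel_measurable (borel \<Otimes>\<^sub>M borel)"
    unfolding \<Phi>_def H_def case_prod_beta' by measurable
  have flow: "deformed_heat_flow a u t (r *\<^sub>R \<omega>) = (LINT q|gamma_radial c. LINT \<eta>|\<sigma>. \<Phi> q \<eta>)"
    unfolding deformed_heat_flow_def
  proof (rule polar_integral[OF _ _ int])
    fix s :: real and \<eta> :: "real ^ 'n" assume s: "s > 0" and \<eta>: "norm \<eta> = 1"
    have "(a * (s powr a / a)) powr (1 / a) = s" using s a_pos by (simp add: powr_powr)
    moreover have "deformed_heat_kernel a (r *\<^sub>R \<omega>) (s *\<^sub>R \<eta>) t = H (s powr a / a) (\<omega> \<bullet> \<eta>)"
      using heat_kernel_sums[OF t \<omega> \<eta> r less_imp_le[OF s]] unfolding H_def p_def of_real_mult by (rule sums_unique)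
    ultimately show "deformed_heat_kernel a (r *\<^sub>R \<omega>) (s *\<^sub>R \<eta>) t * u (s *\<^sub>R \<eta>) = \<Phi> (s powr a / a) \<eta>"
      by (simp add: \<Phi>_def)
    have "norm (H s (\<omega> \<bullet> \<eta>)) \<le> Gamma c * L * S * exp (- (1 / (2 * t) * s))"
      unfolding H_def using zonal_series_bound(2)[OF sumH[OF s] in\<omega>[OF \<eta>]] SH[OF s] by (rule order_trans)
    then show "norm (\<Phi> s \<eta>) \<le> g s"
      unfolding \<Phi>_def norm_mult ge[symmetric] using B(2)[OF s \<eta>] order_trans[OF norm_ge_zero] by (intro mult_mono) auto
  qed measurable
  define f where "f m q = of_real (Gamma c * heat_mode p t m q) * zonal_profile u \<omega> m q" for m q
  have "(\<lambda>m. integral\<^sup>L (gamma_radial c) (f m)) sums (LINT q|gamma_radial c. LINT \<eta>|\<sigma>. \<Phi> q \<eta>)"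
  proof (rule sums_integral_dominated(1)[OF _ int])
    show "AE q in gamma_radial c. (\<lambda>m. f m q) sums (LINT \<eta>|\<sigma>. \<Phi> q \<eta>)"
      using AE_gamma_radial
    proof eventually_elim
      case (elim q)
      show ?case unfolding f_def \<Phi>_def H_def zonal_profile_def
        by (rule zonal_series_integral[OF \<omega> sumH[OF elim] u B(2)[OF elim]])
    qed
    show "AE q in gamma_radial c. \<forall>n. (\<Sum>m<n. norm (f m q)) \<le> g q"
      using AE_gamma_radial
    proof eventually_elim
      case (elim q)
      have "norm (f m q) \<le> B * (1 + q) ^ n * (norm (complex_of_real (Gamma c * heat_mode p t m q)) * D m)" for m
      proof -
        have "norm (f m q) = norm (complex_of_real (Gamma c * heat_mode p t m q)) * norm (zonal_profile u \<omega> m q)"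
          unfolding f_def norm_mult ..
        also have "\<dots> \<le> norm (complex_of_real (Gamma c * heat_mode p t m q)) * (B * (1 + q) ^ n * D m)"
          unfolding zonal_profile_def using \<omega> by (intro mult_left_mono zonal_coeff_bound u B(2)[OF elim]) auto
        finally show ?thesis by (simp only: mult_ac)
      qed
      then have "(\<Sum>m<k. norm (f m q)) \<le> (\<Sum>m. B * (1 + q) ^ n * (norm (complex_of_real (Gamma c * heat_mode p t m q)) * D m))" for k
        by (rule sum_norm_le_suminf[OF summable_mult[OF sumH[OF elim]]])
      also have "(\<Sum>m. B * (1 + q) ^ n * (norm (complex_of_real (Gamma c * heat_mode p t m q)) * D m))
         = B * (1 + q) ^ n * (\<Sum>m. norm (complex_of_real (Gamma c * heat_mode p t m q)) * D m)"
        by (rule suminf_mult[OF sumH[OF elim]])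
      also have "\<dots> \<le> B * (1 + q) ^ n * (Gamma c * L * S * exp (- (1 / (2 * t) * q)))"
        using B(1) elim by (intro mult_left_mono SH) auto
      also have "\<dots> = g q" unfolding ge[symmetric] by (rule mult.commute)
      finally show ?case by blast
    qed
    have [measurable]: "case_prod \<Phi> \<in> borel_measurable (borel \<Otimes>\<^sub>M \<sigma>)" by measurable
    show "(\<lambda>q. LINT \<eta>|\<sigma>. \<Phi> q \<eta>) \<in> borel_measurable (gamma_radial c)" by measurable
  qed (unfold f_def, measurable)
  then show ?thesis unfolding f_def flow .
qed

section \<open>Passage to the limit\<close>

lemma isCont_zonal_coeff:
  assumes u: "continuous_on UNIV u" and \<omega>: "norm \<omega> \<le> 1"
  shows "isCont (zonal_coeff u \<omega> m) r"
  unfolding continuous_at_sequentially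
proof (intro allI impI)
  fix x :: "nat \<Rightarrow> real" assume x: "x \<longlonglongrightarrow> r"
  have [measurable]: "u \<in> borel_measurable borel" by (rule borel_measurable_continuous_onI[OF u])
  obtain K where K: "\<And>n. \<bar>x n\<bar> \<le> K" using convergent_imp_Bseq[OF convergentI[OF x]] by (auto simp: Bseq_def)
  have "bounded (u ` cball 0 K)"
    by (intro compact_imp_bounded compact_continuous_image continuous_on_subset[OF u]) auto
  then obtain B where "\<forall>z\<in>u ` cball 0 K. norm z \<le> B"
    unfolding bounded_iff by blast
  then have B: "norm (u y) \<le> B" if "norm y \<le> K" for y using that by simp
  show "(zonal_coeff u \<omega> m \<circ> x) \<longlonglongrightarrow> zonal_coeff u \<omega> m r"
    unfolding zonal_coeff_def comp_def
  proof (rule integral_dominated_convergence)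
    show "integrable \<sigma> (\<lambda>_. B * D m)" by simp
    have "(\<lambda>n. u (x n *\<^sub>R \<eta>)) \<longlonglongrightarrow> u (r *\<^sub>R \<eta>)" for \<eta>
      using u by (intro isCont_tendsto_compose[of _ u] tendsto_intros x) (simp add: continuous_on_eq_continuous_at)
    then show "AE \<eta> in \<sigma>. (\<lambda>n. u (x n *\<^sub>R \<eta>) * of_real (C m (\<omega> \<bullet> \<eta>))) \<longlonglongrightarrow> u (r *\<^sub>R \<eta>) * of_real (C m (\<omega> \<bullet> \<eta>))"
      by (intro AE_I2 tendsto_mult_right)
    show "AE \<eta> in \<sigma>. norm (u (x n *\<^sub>R \<eta>) * of_real (C m (\<omega> \<bullet> \<eta>))) \<le> B * D m" for n
      using AE_\<sigma>
    proof eventually_elim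
      case (elim \<eta>)
      show ?case unfolding norm_mult norm_of_real
        using order_trans[OF norm_ge_zero B[of "x n *\<^sub>R \<eta>"]]
        by (intro mult_mono B C_bound inner_le \<omega> elim) (use K elim in auto)
    qed
  qed measurable
qed

text \<open>For p > 0 the base of the power in \<open>radial_mode\<close> is positive, so its case
  distinction at m = 0 disappears; since b m / 2 = m / a, the weight q^(c - 1) completes
  \<open>heat_mode\<close> to \<open>radial_density\<close> with \<beta> = m / a.\<close>

lemma integral_heat_mode_eq_radial_kernel:
  assumes p: "p > 0" and t: "t > 0" and [measurable]: "F \<in> borel_measurable borel"
  shows "(LINT q|gamma_radial c. of_real (Gamma c * heat_mode p t m q) * F q) = (LINT q|radial_kernel c (real m / a) p t. (F q :: complex))"
proof -
  have G: "Gamma c > 0" using c_pos by (rule Gamma_real_pos)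
  have bm: "b * real m / 2 = real m / a" "b * real m = 2 * (real m / a)" by simp_all
  have cm: "c + 2 * (real m / a) > 0" using c_pos a_pos by (intro add_pos_nonneg) auto
  have "(LINT q|gamma_radial c. of_real (Gamma c * heat_mode p t m q) * F q)
    = (LINT q|lborel. (indicator {0<..} q * q powr (c - 1) / Gamma c) *\<^sub>R (of_real (Gamma c * heat_mode p t m q) * F q))"
    unfolding gamma_radial_def by (rule integral_density) (use G in auto)
  also have "\<dots> = (LINT q|lborel. radial_density c (real m / a) p t q *\<^sub>R F q)"
  proof (rule Bochner_Integration.integral_cong[OF refl])
    fix q :: real
    show "(indicator {0<..} q * q powr (c - 1) / Gamma c) *\<^sub>R (of_real (Gamma c * heat_mode p t m q) * F q)
       = radial_density c (real m / a) p t q *\<^sub>R F q"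
    proof (cases "q > 0")
      case True
      have "(q / t) powr (real m / a + c - 1) = (q / t) powr (real m / a) * (q powr (c - 1) / t powr (c - 1))"
        using True t by (simp add: powr_divide powr_add[symmetric] algebra_simps)
      moreover have "t powr (c - 1) = t powr c / t" using t by (simp add: powr_diff)
      moreover have "(p / t) powr (real m / a) * (q / t) powr (real m / a) = (p * q / t\<^sup>2) powr (real m / a)"
        using True t p by (simp add: powr_mult[symmetric] power2_eq_square)
      moreover have "(p * q / t\<^sup>2) powr (real m / a) = (if m = 0 then 1 else (p * q / t\<^sup>2) powr (real m / a))"
        using True t p by simp
      ultimately have "q powr (c - 1) * heat_mode p t m q = radial_density c (real m / a) p t q"
        using True t p unfolding heat_mode_def radial_mode_def radial_density_def bm by (simp add: mult_ac)
      then have e: "indicator {0<..} q * q powr (c - 1) / Gamma c * (Gamma c * heat_mode p t m q) = radial_density c (real m / a) p t q"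
        using True G by simp
      show ?thesis
        unfolding scaleR_conv_of_real mult.assoc[symmetric] of_real_mult[symmetric] e[unfolded mult.assoc[symmetric]] ..
    qed (simp add: radial_density_def)
  qed
  also have "\<dots> = (LINT q|radial_kernel c (real m / a) p t. F q)"
    unfolding radial_kernel_def
  proof (rule integral_density[symmetric])
    have "radial_density c (real m / a) p t q \<ge> 0" for q
    proof (cases "q > 0")
      case True
      have "bessel_series (c + 2 * (real m / a)) (p * q / t\<^sup>2) \<ge> 0"
        using True p by (intro bessel_series_nonneg cm) simp
      then show ?thesis unfolding radial_density_def using t by (intro mult_nonneg_nonneg) auto
    qed (simp add: radial_density_def)
    then show "AE q in lborel. 0 \<le> radial_density c (real m / a) p t q" by simp
  qed measurable
  finally show ?thesis .
qed

lemma radial_locale: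
  assumes "p > 0"
  shows "radial c (real m / a) p"
proof
  show "c > 0" by (rule c_pos)
  show "real m / a \<ge> 0" using a_pos by simp
  show "real m / a = 0 \<or> 1 \<le> c + real m / a"
  proof (cases "m = 0")
    case False
    then have "real N + real m \<ge> 2" using N_pos by linarith
    then show ?thesis using a_pos by (simp add: field_simps)
  qed simp
qed (rule assms)

lemma heat_flow_tendsto_off_origin:
  fixes \<omega> :: "real ^ 'n"
  assumes \<omega>: "norm \<omega> = 1" and r: "r > 0" and u: "continuous_on UNIV u" "polynomial_growth u" "Cinfinity_on u (UNIV - {0})"
  shows "((\<lambda>t. deformed_heat_flow a u t (r *\<^sub>R \<omega>)) \<longlongrightarrow> u (r *\<^sub>R \<omega>)) (at_right 0)"
proof -
  define p where "p = r powr a / a"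
  have p: "p > 0" using r a_pos by (simp add: p_def)
  have pr: "(a * p) powr (1 / a) = r" using r a_pos by (simp add: p_def powr_powr)
  have [measurable]: "u \<in> borel_measurable borel" by (rule borel_measurable_continuous_onI[OF u(1)])
  obtain B n where B: "B \<ge> 0" "\<And>q \<eta>. q > 0 \<Longrightarrow> norm \<eta> = 1 \<Longrightarrow> norm (u ((a * q) powr (1 / a) *\<^sub>R \<eta>)) \<le> B * (1 + q) ^ n"
    using growth_polar[OF u(2)] by blast
  have growth: "norm (zonal_profile u \<omega> m q) \<le> B * D m * (1 + q) ^ n" if "q > 0" for m q
  proof -
    have "norm (zonal_profile u \<omega> m q) \<le> B * (1 + q) ^ n * D m"
      unfolding zonal_profile_def using \<omega> by (intro zonal_coeff_bound B(2)[OF that]) auto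
    then show ?thesis by (simp only: mult_ac)
  qed
  define f where "f m t = (LINT q|radial_kernel c (real m / a) p t. zonal_profile u \<omega> m q)" for m t
  have "(a * (p / 2)) powr (1 / a) > 0" using p a_pos by simp
  \<comment> \<open>The bounds on the radius are those of the annulus p / 2 \<le> q \<le> 2 p under
    q = r^a / a.\<close>
  then obtain A where A: "A \<ge> 0" "\<And>m r. m \<ge> 2 \<Longrightarrow> (a * (p / 2)) powr (1 / a) \<le> r \<Longrightarrow> r \<le> (a * (2 * p)) powr (1 / a) \<Longrightarrow>
      norm (zonal_coeff u \<omega> m r) \<le> A * D m / real m ^ (2 * (N + 2))"
    by (rule zonal_coeff_decay[OF \<omega> u(3), where K = "N + 2" and ?r2.0 = "(a * (2 * p)) powr (1 / a)"]) (rule that)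
  \<comment> \<open>The first summand bounds the annulus, the second the tails: for \<beta> = m / a
    the factor 2^(-\<beta> / 2) is geometric in m with ratio 2^(-1 / (2 a)).\<close>
  define M where "M m = A * D m / real m ^ (2 * (N + 2)) + 2 * (B * (1 + p) ^ n) * (D m * (2 powr (- (1 / (2 * a)))) ^ m)" for m
  \<comment> \<open>From k0 on, n < \<beta> / 2 holds with \<beta> = m / a, as
    \<open>radial_kernel_tail\<close> demands, and m > 2 as the decay estimate demands; m > 2 also
    gives 1 \<le> c + \<beta> / 2.\<close>
  obtain k0 :: nat where k0: "2 * a * real n + 2 < real k0" using reals_Archimedean2 by blast
  have "((\<lambda>t. \<Sum>m. f m t) \<longlongrightarrow> (\<Sum>m. zonal_profile u \<omega> m p)) (at_right 0)"
  proof (rule tannery_eventually)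
    fix m
    interpret radial c "real m / a" p by (rule radial_locale[OF p])
    show "(f m \<longlongrightarrow> zonal_profile u \<omega> m p) (at_right 0)"
      unfolding f_def
    proof (rule radial_kernel_limit[OF _ growth])
      have "isCont (\<lambda>q. (a * q) powr (1 / a)) p"
        using p a_pos by (intro continuous_intros) auto
      then show "isCont (zonal_profile u \<omega> m) p"
        unfolding zonal_profile_def[abs_def]
        by (rule isCont_o2) (rule isCont_zonal_coeff[OF u(1)], simp add: \<omega>)
    qed measurable
  next
    show "\<forall>\<^sub>F t in at_right 0. \<forall>m\<ge>k0. norm (f m t) \<le> M m"
      using eventually_at_right_less
    proof eventually_elim
      case (elim t)
      show ?case
      proof (intro allI impI)
        fix m assume "m \<ge> k0"
        then have m: "2 * a * real n + 2 < real m" using k0 by linarith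
        then have m2: "real m > 2" using a_pos by (smt (verit) mult_nonneg_nonneg of_nat_0_le_iff)
        interpret radial c "real m / a" p by (rule radial_locale[OF p])
        have "norm (f m t) \<le> A * D m / real m ^ (2 * (N + 2)) + 2 * (B * D m * (1 + p) ^ n) * 2 powr (- (real m / a) / 2)"
          unfolding f_def
        proof (rule radial_kernel_tail[OF elim _ growth])
          fix q assume q: "p / 2 \<le> q" "q \<le> 2 * p"
          have "(a * (p / 2)) powr (1 / a) \<le> (a * q) powr (1 / a)" "(a * q) powr (1 / a) \<le> (a * (2 * p)) powr (1 / a)"
            using q p a_pos by (auto intro!: powr_mono2 mult_left_mono)
          then show "norm (zonal_profile u \<omega> m q) \<le> A * D m / real m ^ (2 * (N + 2))"
            unfolding zonal_profile_def using m2 by (intro A(2)) auto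
        next
          have "real N + real m / 2 \<ge> 2" using m2 N_pos by linarith
          then show "1 \<le> c + real m / a / 2" using a_pos by (simp add: field_simps)
          show "real n < real m / a / 2" using m a_pos by (simp add: field_simps)
        qed measurable
        also have "2 powr (- (real m / a) / 2) = (2 powr (- (1 / (2 * a)))) ^ m"
          by (simp add: powr_powr mult.commute flip: powr_realpow)
        finally show "norm (f m t) \<le> M m" unfolding M_def by (simp only: mult_ac)
      qed
    qed
    show "summable M"
      unfolding M_def
    proof (intro summable_add summable_mult summable_gegenbauer_bound_decay summable_gegenbauer_bound)
      have "2 powr (- (1 / (2 * a))) < (2::real) powr 0" using a_pos by (intro powr_less_mono) auto
      then show "\<bar>2 powr (- (1 / (2 * a)))\<bar> < (1::real)" by simp
    qed
  qed simp
  moreover have "(\<Sum>m. zonal_profile u \<omega> m p) = u (r *\<^sub>R \<omega>)"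
    using zonal_coeff_sums[OF \<omega> u(3) r] by (simp add: zonal_profile_def pr sums_iff)
  moreover have "\<forall>\<^sub>F t in at_right 0. (\<Sum>m. f m t) = deformed_heat_flow a u t (r *\<^sub>R \<omega>)"
    using eventually_at_right_less
  proof eventually_elim
    case (elim t)
    have "(\<lambda>m. f m t) sums deformed_heat_flow a u t (r *\<^sub>R \<omega>)"
      using heat_flow_sums[OF elim \<omega> less_imp_le[OF r] _ B] unfolding f_def p_def[symmetric]
      by (subst integral_heat_mode_eq_radial_kernel[OF p elim, symmetric]) auto
    then show ?case by (simp add: sums_iff)
  qed
  ultimately show ?thesis using Lim_transform_eventually by metis
qed

text \<open>The unit vector is auxiliary, with 0 = 0 \<omega>: since C_0 = 1, the profile of degree
  0 is the spherical mean of \<open>u\<close>.\<close>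

lemma heat_flow_at_origin:
  fixes \<omega> :: "real ^ 'n"
  assumes t: "t > 0" and \<omega>: "norm \<omega> = 1" and u [measurable]: "u \<in> borel_measurable borel"
    and B: "B \<ge> 0" "\<And>q \<eta>. q > 0 \<Longrightarrow> norm \<eta> = 1 \<Longrightarrow> norm (u ((a * q) powr (1 / a) *\<^sub>R \<eta>)) \<le> B * (1 + q) ^ n"
  shows "deformed_heat_flow a u t 0 = (LINT q|gamma_radial c. of_real (exp (- (1 / t * q)) / t powr c) * zonal_profile u \<omega> 0 q)"
proof -
  have G: "Gamma c > 0" using c_pos by (rule Gamma_real_pos)
  have b0: "bessel_series c 0 = 1 / Gamma c"
  proof -
    have "bessel_term c 0 = (\<lambda>j. if j = 0 then 1 / Gamma c else 0)" by (auto simp: bessel_term_def)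
    then have "bessel_term c 0 sums (1 / Gamma c)" using sums_single[of 0 "\<lambda>_. 1 / Gamma c"] by (simp only: eq_commute)
    then show ?thesis by (rule sums_unique2[OF bessel_sums[OF c_pos]])
  qed
  have h: "Gamma c * heat_mode 0 t m q = (if m = 0 then exp (- (1 / t * q)) / t powr c else 0)" for m q
    using G a_pos b0 by (simp add: heat_mode_def radial_mode_def)
  have "(\<lambda>m. LINT q|gamma_radial c. of_real (Gamma c * heat_mode 0 t m q) * zonal_profile u \<omega> m q) sums deformed_heat_flow a u t 0"
  proof -
    have z: "(0::real) powr a / a = 0" "0 *\<^sub>R \<omega> = 0" by simp_all
    show ?thesis by (rule heat_flow_sums[OF t \<omega> order_refl u B, unfolded z])
  qed
  moreover have "(\<lambda>m. LINT q|gamma_radial c. of_real (Gamma c * heat_mode 0 t m q) * zonal_profile u \<omega> m q)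
     = (\<lambda>m. if m = 0 then (LINT q|gamma_radial c. of_real (exp (- (1 / t * q)) / t powr c) * zonal_profile u \<omega> m q) else 0)"
    (is "?l = ?r")
  proof
    fix m show "?l m = ?r m" unfolding h by (cases "m = 0") (simp_all only: refl if_True if_False of_real_0 mult_zero_left integral_zero)
  qed
  ultimately have "(\<lambda>m. if m = 0 then (LINT q|gamma_radial c. of_real (exp (- (1 / t * q)) / t powr c) * zonal_profile u \<omega> m q) else 0)
     sums deformed_heat_flow a u t 0" by (simp only:)
  from sums_unique2[OF this sums_single[of 0 "\<lambda>m. LINT q|gamma_radial c. of_real (exp (- (1 / t * q)) / t powr c) * zonal_profile u \<omega> m q"]]
  show ?thesis .
qed

text \<open>The density exp(-q / t) / t^c against \<open>gamma_radial\<close> is a Gamma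
  distribution of scale t. Its k-th moment is a constant times t^k, so it concentrates at 0.\<close>

lemma heat_flow_tendsto_origin:
  fixes u :: "real ^ 'n \<Rightarrow> complex"
  assumes u: "continuous_on UNIV u" "polynomial_growth u"
  shows "((\<lambda>t. deformed_heat_flow a u t 0) \<longlongrightarrow> u 0) (at_right 0)"
proof (rule tendstoI)
  fix \<epsilon> :: real assume \<epsilon>: "\<epsilon> > 0"
  have G: "Gamma c > 0" using c_pos by (rule Gamma_real_pos)
  obtain \<omega> :: "real ^ 'n" where \<omega>: "norm \<omega> = 1" using vector_choose_size[of 1] by auto
  have [measurable]: "u \<in> borel_measurable borel" by (rule borel_measurable_continuous_onI[OF u(1)])
  obtain B n where B: "B \<ge> 0" "\<And>q \<eta>. q > 0 \<Longrightarrow> norm \<eta> = 1 \<Longrightarrow> norm (u ((a * q) powr (1 / a) *\<^sub>R \<eta>)) \<le> B * (1 + q) ^ n"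
    using growth_polar[OF u(2)] by blast
  define F where "F = zonal_profile u \<omega> 0"
  have [measurable]: "F \<in> borel_measurable borel" unfolding F_def by measurable
  have D0: "D 0 = 2" by (simp add: gegenbauer_bound_def)
  have F_growth: "norm (F q) \<le> 2 * B * (1 + q) ^ n" if "q > 0" for q
  proof -
    have "norm (zonal_profile u \<omega> 0 q) \<le> B * (1 + q) ^ n * D 0"
      unfolding zonal_profile_def using \<omega> by (intro zonal_coeff_bound B(2)[OF that]) auto
    then show ?thesis by (simp add: D0 F_def mult_ac)
  qed
  have z0: "zonal_coeff u \<omega> 0 0 = u 0" by (simp add: zonal_coeff_def C_0 measure_\<sigma>)
  have "isCont (zonal_coeff u \<omega> 0) 0" using isCont_zonal_coeff[OF u(1)] \<omega> by simp
  then obtain d where d: "d > 0" "\<And>r. \<bar>r\<bar> < d \<Longrightarrow> norm (zonal_coeff u \<omega> 0 r - u 0) < \<epsilon> / 2"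
    using \<epsilon> unfolding continuous_at_eps_delta dist_norm z0 by (metis diff_zero half_gt_zero real_norm_def)
  define \<delta> where "\<delta> = d powr a / a"
  have \<delta>: "\<delta> > 0" using d a_pos by (simp add: \<delta>_def)
  \<comment> \<open>For q \<ge> \<delta> the factor q / \<delta> \<ge> 1 is inserted; the additional
    power of q makes the bound integrate to a quantity of order t.\<close>
  define K where "K = (2 * B + norm (u 0)) / \<delta>"
  have K: "K \<ge> 0" using B \<delta> by (simp add: K_def)
  have bound: "norm (F q - u 0) \<le> \<epsilon> / 2 + K * (q * (1 + q) ^ n)" if q: "q > 0" for q
  proof (cases "q < \<delta>")
    case True
    have "(a * q) powr (1 / a) < (a * \<delta>) powr (1 / a)" using True q a_pos by (intro powr_less_mono2) auto
    also have "(a * \<delta>) powr (1 / a) = d" using d a_pos by (simp add: \<delta>_def powr_powr)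
    finally have "norm (F q - u 0) < \<epsilon> / 2" unfolding F_def zonal_profile_def by (intro d) simp
    moreover have "K * (q * (1 + q) ^ n) \<ge> 0" using K q by simp
    ultimately show ?thesis by linarith
  next
    case False
    have q1: "(1 + q) ^ n \<ge> 1" using q by (intro one_le_power) auto
    have "norm (F q - u 0) \<le> 2 * B * (1 + q) ^ n + norm (u 0) * 1"
      using norm_triangle_ineq4[of "F q" "u 0"] F_growth[OF q] by simp
    also have "\<dots> \<le> 2 * B * (1 + q) ^ n + norm (u 0) * (1 + q) ^ n" using q1 by (intro add_left_mono mult_left_mono) auto
    also have "\<dots> = (2 * B + norm (u 0)) * (1 + q) ^ n * 1" by (simp add: algebra_simps)
    also have "\<dots> \<le> (2 * B + norm (u 0)) * (1 + q) ^ n * (q / \<delta>)"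
      using False \<delta> B q by (intro mult_left_mono) auto
    also have "\<dots> = K * (q * (1 + q) ^ n)" by (simp add: K_def)
    finally show ?thesis using \<epsilon> by linarith
  qed
  \<comment> \<open>The mean of q (1 + q)^n under this Gamma distribution, by the binomial theorem;
    every exponent of t is positive.\<close>
  define W where "W t = (\<Sum>k\<le>n. real (n choose k) * (Gamma (c + real (Suc k)) / Gamma c * t ^ Suc k))" for t
  have W: "(W \<longlongrightarrow> 0) (at_right 0)"
  proof -
    have "(W \<longlongrightarrow> (\<Sum>k\<le>n. real (n choose k) * (Gamma (c + real (Suc k)) / Gamma c * 0 ^ Suc k))) (at_right 0)"
      unfolding W_def by (intro tendsto_intros)
    then show ?thesis by simp
  qed
  have est: "norm (deformed_heat_flow a u t 0 - u 0) \<le> \<epsilon> / 2 + K * W t" if t: "t > 0" for t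
  proof -
    define w where "w q = exp (- (1 / t * q)) / t powr c" for q
    have w0: "w q \<ge> 0" for q by (simp add: w_def)
    have [measurable]: "w \<in> borel_measurable borel" unfolding w_def[abs_def] by measurable
    have mom: "has_bochner_integral (gamma_radial c) (\<lambda>q. q ^ k * w q) (Gamma (c + real k) / Gamma c * t ^ k)" for k
    proof -
      have "has_bochner_integral (gamma_radial c) (\<lambda>q. q ^ k * exp (- (1 / t * q)) / t powr c) (Gamma (c + real k) / (Gamma c * (1 / t) powr (c + real k)) / t powr c)"
        using gamma_radial_moment[OF c_pos, of "1 / t" k] t by (intro has_bochner_integral_divide_zero) auto
      moreover have "Gamma (c + real k) / (Gamma c * (1 / t) powr (c + real k)) / t powr c = Gamma (c + real k) / Gamma c * t ^ k"
        using t by (simp add: powr_divide powr_add powr_realpow)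
      ultimately show ?thesis by (simp add: w_def)
    qed
    have wi: "integrable (gamma_radial c) w" and w1: "integral\<^sup>L (gamma_radial c) w = 1"
      using mom[of 0] G by (auto simp: has_bochner_integral_iff)
    have expand: "w q * (q * (1 + q) ^ n) = (\<Sum>k\<le>n. real (n choose k) * (q ^ Suc k * w q))" for q
      using binomial_ring[of q 1 n] by (simp add: add.commute sum_distrib_left mult_ac)
    have "has_bochner_integral (gamma_radial c) (\<lambda>q. \<Sum>k\<le>n. real (n choose k) * (q ^ Suc k * w q)) (W t)"
      unfolding W_def by (intro has_bochner_integral_sum has_bochner_integral_mult_right mom)
    then have qi: "integrable (gamma_radial c) (\<lambda>q. w q * (q * (1 + q) ^ n))" and q1: "(LINT q|gamma_radial c. w q * (q * (1 + q) ^ n)) = W t"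
      unfolding expand[symmetric] by (auto simp: has_bochner_integral_iff)
    have di: "integrable (gamma_radial c) (\<lambda>q. \<epsilon> / 2 * w q + K * (w q * (q * (1 + q) ^ n)))"
      using wi qi by simp
    have db: "AE q in gamma_radial c. norm (of_real (w q) * (F q - u 0)) \<le> \<epsilon> / 2 * w q + K * (w q * (q * (1 + q) ^ n))"
      using AE_gamma_radial
    proof eventually_elim
      case (elim q)
      have "norm (of_real (w q) * (F q - u 0)) \<le> w q * (\<epsilon> / 2 + K * (q * (1 + q) ^ n))"
        unfolding norm_mult norm_of_real using w0[of q] bound[OF elim] by (simp add: mult_left_mono)
      then show ?case by (simp add: algebra_simps)
    qed
    have fi: "integrable (gamma_radial c) (\<lambda>q. of_real (w q) * (F q - u 0))"
    proof (rule Bochner_Integration.integrable_bound[OF di])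
      show "AE q in gamma_radial c. norm (of_real (w q) * (F q - u 0)) \<le> norm (\<epsilon> / 2 * w q + K * (w q * (q * (1 + q) ^ n)))"
        using db by eventually_elim (unfold real_norm_def, linarith)
    qed measurable
    have ci: "integrable (gamma_radial c) (\<lambda>q. of_real (w q) * u 0)"
      using wi by simp
    have "deformed_heat_flow a u t 0 = (LINT q|gamma_radial c. of_real (w q) * F q)"
      unfolding w_def F_def by (rule heat_flow_at_origin[OF t \<omega> _ B]) auto
    also have "\<dots> = (LINT q|gamma_radial c. of_real (w q) * (F q - u 0) + of_real (w q) * u 0)"
      by (simp add: algebra_simps)
    also have "\<dots> = (LINT q|gamma_radial c. of_real (w q) * (F q - u 0)) + (LINT q|gamma_radial c. of_real (w q) * u 0)"
      by (rule Bochner_Integration.integral_add[OF fi ci])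
    also have "(LINT q|gamma_radial c. of_real (w q) * u 0) = u 0"
      by (simp only: integral_mult_left_zero integral_complex_of_real w1) simp
    finally have "norm (deformed_heat_flow a u t 0 - u 0) = norm (LINT q|gamma_radial c. of_real (w q) * (F q - u 0))" by simp
    also have "\<dots> \<le> (LINT q|gamma_radial c. norm (of_real (w q) * (F q - u 0)))"
      by (rule integral_norm_bound)
    also have "\<dots> \<le> (LINT q|gamma_radial c. \<epsilon> / 2 * w q + K * (w q * (q * (1 + q) ^ n)))"
      by (rule integral_mono_AE[OF integrable_norm[OF fi] di db])
    also have "\<dots> = \<epsilon> / 2 + K * W t"
      using wi qi by (simp only: Bochner_Integration.integral_add integrable_mult_right integral_mult_right_zero w1 q1 mult_1_right)
    finally show ?thesis .
  qed
  have "((\<lambda>t. \<epsilon> / 2 + K * W t) \<longlongrightarrow> \<epsilon> / 2 + K * 0) (at_right 0)"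
    by (intro tendsto_intros W)
  then have "\<forall>\<^sub>F t in at_right 0. \<epsilon> / 2 + K * W t < \<epsilon>"
    by (rule order_tendstoD(2)) (use \<epsilon> in simp)
  then show "\<forall>\<^sub>F t in at_right 0. dist (deformed_heat_flow a u t 0) (u 0) < \<epsilon>"
    using eventually_at_right_less
  proof eventually_elim
    case (elim t)
    then show ?case using est[of t] by (simp add: dist_norm)
  qed
qed

end

theorem theorem4p18:
  fixes a :: real and u :: "real ^ 'n \<Rightarrow> complex" and x :: "real ^ 'n"
  assumes "a > max 0 (2 - real CARD('n))"
    and "Cinfinity_on u (UNIV - {0})"
    and "continuous_on UNIV u"
    and "polynomial_growth u"
  shows "((\<lambda>t. deformed_heat_flow a u t x) \<longlongrightarrow> u x) (at_right 0)"
proof -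
  interpret deformed a "CARD('n)" "(real CARD('n) - 2) / 2" "sphere_measure a :: (real ^ 'n) measure"
    by unfold_locales (use assms(1) in auto)
  show ?thesis
  proof (cases "x = 0")
    case True
    then show ?thesis using heat_flow_tendsto_origin[OF assms(3,4)] by simp
  next
    case False
    then show ?thesis
      using heat_flow_tendsto_off_origin[of "sgn x" "norm x", OF _ _ assms(3,4,2)] by (simp add: norm_sgn sgn_div_norm)
  qed
qed

end
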